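(* Let $\Omega=\{(x+iy,\,t+i\xi)\in\mathbb{C}^2:\xi>b(x)\}$, where $b$ is a real polynomial of even degree with positive leading coefficient. Then the Szegő kernel of $\Omega$ extends smoothly to $(\overline{\Omega}\times\overline{\Omega})\setminus\Delta$ if and only if $b$ is convex.
   Context: Tube domains $\Omega$ of this form are considered for $b$ satisfying $\lim_{|x|\to\infty}b(x)/|x|=\infty$ (so $b$ is non-constant). $\Delta=\{(z,w)\in\partial\Omega\times\partial\Omega:z=w\}$ is the diagonal of the boundary. $\mathcal{H}^2(\Omega)$ is the space of holomorphic $F$ on $\Omega$ with $\sup_{\varepsilon>0}\int_{\mathbb{R}^3}|F(x+iy,t+ib(x)+i\varepsilon)|^2\,dx\,dy\,dt<\infty$, identified (via boundary values) with a closed subspace of $L^2(\partial\Omega)$, where $\partial\Omega$ is identified with $\mathbb{R}^3$ (Lebesgue measure) by $(x,y,t)\mapsto(x+iy,t+ib(x))$. The Szegő kernel $S(z,w)=\sum_j\phi_j(z)\overline{\phi_j(w)}$, with $\{\phi_j\}$ an orthonormal basis of $\mathcal{H}^2(\Omega)$, is the reproducing kernel of this space; it is smooth on $\Omega\times\Omega$. For these domains it is given on $\Omega\times\Omega$ by $$S(z,w)=c\int_0^\infty\!\!\int_{-\infty}^\infty\tau\,e^{\eta\tau[z_1+\bar w_1]+i\tau[z_2-\bar w_2]}[N(\eta,\tau)]^{-1}\,d\eta\,d\tau,\qquad N(\eta,\tau)=\int_{-\infty}^\infty e^{2\tau[\eta\lambda-b(\lambda)]}\,d\lambda,$$ with $c$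 an absolute constant. *)

theory Defs
  imports "HOL-Analysis.Analysis" "HOL-Computational_Algebra.Polynomial"
begin

definition tube_domain :: "real poly \<Rightarrow> (complex \<times> complex) set" where
  "tube_domain b = {(z, w). poly b (Re z) < Im w}"

definition boundary_diagonal :: "real poly \<Rightarrow> ((complex \<times> complex) \<times> (complex \<times> complex)) set" where
  "boundary_diagonal b =
     {(z, w). z \<in> frontier (tube_domain b) \<and> w \<in> frontier (tube_domain b) \<and> z = w}"

(* Holomorphy in two variables as complex Frechet differentiability: the real derivative exists
   and is complex linear. *)
definition holomorphic2_on ::
    "(complex \<times> complex \<Rightarrow> complex) \<Rightarrow> (complex \<times> complex) set \<Rightarrow> bool" where
  "holomorphic2_on F U \<longleftrightarrow>
     (\<forall>p\<in>U. \<exists>A B. (F has_derivative (\<lambda>(u, v). A * u + B * v)) (at p))"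

(* For \<epsilon> = 0 this is the identification of R^3 with the boundary of the domain. *)
definition shifted_boundary_point ::
    "real poly \<Rightarrow> real \<Rightarrow> real \<times> real \<times> real \<Rightarrow> complex \<times> complex" where
  "shifted_boundary_point b \<epsilon> = (\<lambda>(x, y, t). (Complex x y, Complex t (poly b x + \<epsilon>)))"

(* Elements are total functions, but only their values on the domain matter. *)
definition hardy_space :: "real poly \<Rightarrow> (complex \<times> complex \<Rightarrow> complex) set" where
  "hardy_space b = {F. holomorphic2_on F (tube_domain b) \<and>
     (SUP \<epsilon>\<in>{0<..}. \<integral>\<^sup>+ p. ennreal ((norm (F (shifted_boundary_point b \<epsilon> p)))\<^sup>2) \<partial>lborel) < \<infinity>}"

(* Boundary values are limits in L^2(R^3) as \<epsilon> decreases to 0; they are determined up to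
   null sets. *)
definition has_boundary_value ::
    "real poly \<Rightarrow> (complex \<times> complex \<Rightarrow> complex) \<Rightarrow> (real \<times> real \<times> real \<Rightarrow> complex) \<Rightarrow> bool" where
  "has_boundary_value b F f \<longleftrightarrow>
     f \<in> borel_measurable lborel \<and>
     (\<integral>\<^sup>+ p. ennreal ((norm (f p))\<^sup>2) \<partial>lborel) < \<infinity> \<and>
     ((\<lambda>\<epsilon>. \<integral>\<^sup>+ p. ennreal ((norm (F (shifted_boundary_point b \<epsilon> p) - f p))\<^sup>2) \<partial>lborel)
        \<longlongrightarrow> 0) (at_right 0)"

definition boundary_value ::
    "real poly \<Rightarrow> (complex \<times> complex \<Rightarrow> complex) \<Rightarrow> real \<times> real \<times> real \<Rightarrow> complex" where
  "boundary_value b F = (SOME f. has_boundary_value b F f)"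

definition hardy_inner ::
    "real poly \<Rightarrow> (complex \<times> complex \<Rightarrow> complex) \<Rightarrow> (complex \<times> complex \<Rightarrow> complex) \<Rightarrow> complex" where
  "hardy_inner b F G = (\<integral>p. boundary_value b F p * cnj (boundary_value b G p) \<partial>lborel)"

(* An orthonormal basis of a Hilbert space: an orthonormal set with trivial orthogonal complement.
   Orthonormality forces distinct elements of B to differ on the domain itself, so the irrelevant
   values outside it cause no repetitions. *)
definition hardy_orthonormal_basis ::
    "real poly \<Rightarrow> (complex \<times> complex \<Rightarrow> complex) set \<Rightarrow> bool" where
  "hardy_orthonormal_basis b B \<longleftrightarrow>
     B \<subseteq> hardy_space b \<and>
     (\<forall>\<phi>\<in>B. \<forall>\<psi>\<in>B. hardy_inner b \<phi> \<psi> = (if \<phi> = \<psi> then 1 else 0)) \<and>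
     (\<forall>F\<in>hardy_space b. (\<forall>\<phi>\<in>B. hardy_inner b F \<phi> = 0) \<longrightarrow> (\<forall>p\<in>tube_domain b. F p = 0))"

(* The sum is independent of the choice of the orthonormal basis. *)
definition szego_kernel :: "real poly \<Rightarrow> complex \<times> complex \<Rightarrow> complex \<times> complex \<Rightarrow> complex" where
  "szego_kernel b z w =
     (\<Sum>\<^sub>\<infinity>\<phi>\<in>(SOME B. hardy_orthonormal_basis b B). \<phi> z * cnj (\<phi> w))"

fun iterated_derivative ::
    "'a list \<Rightarrow> ('a::euclidean_space \<Rightarrow> 'b::real_normed_vector) \<Rightarrow> 'a \<Rightarrow> 'b" where
  "iterated_derivative [] f = f"
| "iterated_derivative (v # vs) f = (\<lambda>x. frechet_derivative (iterated_derivative vs f) (at x) v)"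

definition smooth_on :: "'a::euclidean_space set \<Rightarrow> ('a \<Rightarrow> 'b::real_normed_vector) \<Rightarrow> bool" where
  "smooth_on U f \<longleftrightarrow>
     (\<forall>vs. set vs \<subseteq> Basis \<longrightarrow> (\<forall>x\<in>U. iterated_derivative vs f differentiable at x))"

(* Smoothness up to part of the boundary, for U open and U \<subseteq> A \<subseteq> closure U: f is smooth on U
   and its partial derivatives of all orders (including f itself) extend continuously to A. *)
definition extends_smoothly ::
    "'a::euclidean_space set \<Rightarrow> 'a set \<Rightarrow> ('a \<Rightarrow> 'b::real_normed_vector) \<Rightarrow> bool" where
  "extends_smoothly U A f \<longleftrightarrow>
     smooth_on U f \<and>
     (\<forall>vs. set vs \<subseteq> Basis \<longrightarrow>
        (\<exists>g. continuous_on A g \<and> (\<forall>x\<in>U. g x = iterated_derivative vs f x)))"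

end

theory Submission
 imports Defs "HOL-Probability.Probability" "HOL-Complex_Analysis.Complex_Analysis"
begin

text \<open>
 With \<open>a = \<eta> \<tau>\<close> in place of \<open>\<eta>\<close>, let \<open>N(a, \<tau>)\<close> be the integral of \<open>exp (2 (a \<lambda> - \<tau> b(\<lambda>)))\<close> over \<open>\<lambda>\<close>. It is finite exactly
 for \<open>\<tau> > 0\<close>.

 The kernel is first written as a Laplace transform. By Plancherel in \<open>(y, t)\<close> on each slice \<open>x = const\<close>, followed by
 integration in \<open>x\<close>, the transform \<open>Lap\<close> maps the space \<open>L\<^sup>2(N da d\<tau>)\<close> into the Hardy space and preserves the inner product
 up to the factor \<open>4 \<pi>\<^sup>2\<close> (\<open>Lap_in_hardy_space\<close>, \<open>hardy_inner_Lap\<close>). It is onto by a Paley-Wiener argument: after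
 damping, a Hardy space function is integrable on every slice, and moving the plane of integration shows that its Fourier transforms on the
 slices are exponential multiples of one single function (\<open>Paley_Wiener\<close>). In \<open>L\<^sup>2(N da d\<tau>)\<close>
 point evaluation is the inner product with an exponential divided by \<open>N\<close>. Expanding this element in any orthonormal basis gives
 \<open>S(z, w) = (1 / 4\<pi>\<^sup>2) \<integral>\<integral> exp (a Z + i \<tau> W) / N(a, \<tau>) da d\<tau>\<close> with \<open>Z = z\<^sub>1 + cnj w\<^sub>1\<close> and \<open>W = z\<^sub>2 - cnj w\<^sub>2\<close> (\<open>szego_kernel_formula\<close>).

 If \<open>b\<close> is not convex, some line lies below the graph and touches it over two different points \<open>x\<^sub>1\<close> and \<open>x\<^sub>2\<close> (\<open>bitangent\<close>). Let
 \<open>z\<close> and \<open>w\<close> descend vertically to the boundary points over \<open>x\<^sub>1\<close> and \<open>x\<^sub>2\<close>. The integrand is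
 positive, and in the limit it is bounded below by a positive constant on an infinite strip of unit width along the slope of the line. So the kernel is unbounded near
 a boundary point off the diagonal, and not even the kernel itself extends continuously (\<open>convex_if_extends\<close>).

 If \<open>b\<close> is convex, put \<open>x = Re Z / 2\<close> and \<open>\<alpha> = a - \<tau> b'(x)\<close>. The integrand becomes an oscillating factor, damped by
 \<open>exp (- \<tau> (Im W - 2 b(x)))\<close>, divided by \<open>D(\<alpha>, \<tau>) = \<integral> exp (2 \<alpha> u - 2 \<tau> \<beta>(u)) du\<close>, where \<open>\<beta>\<close> is the excess of \<open>b\<close> over its
 tangent at \<open>x\<close>. A convex polynomial satisfies \<open>\<beta>(u) \<ge> c \<bar>u\<bar>\<^sup>m\<close> with \<open>m\<close> the degree and \<open>c\<close> independent of \<open>x\<close>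
 (\<open>excess_lower_bound\<close>). So the mass of \<open>D\<close> concentrates near \<open>u = 0\<close> as \<open>\<tau>\<close> grows, and \<open>1 / D\<close>
 extends holomorphically in \<open>\<alpha>\<close> or \<open>\<tau>\<close> to discs whose radius grows like a power of \<open>\<tau>\<close> (\<open>cweight_perturbation\<close>). By
 Cauchy's estimates \<open>K\<close>-fold differences of \<open>1 / D\<close> gain a power of \<open>\<tau>\<close> that grows with \<open>K\<close>
 (\<open>amplitude_difference_bound\<close>). A difference under the integral sign multiplies the integral by \<open>1 - exp (i h \<phi>)\<close>, where
 \<open>\<phi>\<close> is the phase in the direction of the difference. Dividing by this factor extends the kernel, and in the same way each of its derivatives, to
 all boundary points where one of the two phases \<open>Im Z\<close> and \<open>W - 2 i b(x) + b'(x) Im Z\<close> does not vanish (\<open>Lap_symbol_extends\<close>).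
 By strict convexity both vanish only on the boundary diagonal (\<open>height_kernel_arg\<close>).
\<close>

abbreviation bm :: "('a::topological_space \<Rightarrow> 'b::topological_space) set" where
 "bm \<equiv> borel_measurable borel"

abbreviation L1 :: "('a::euclidean_space \<Rightarrow> 'b::{banach,second_countable_topology}) \<Rightarrow> bool" where
 "L1 \<equiv> integrable lborel"

abbreviation lebesgue_int :: "('a::euclidean_space \<Rightarrow> 'b::{banach,second_countable_topology}) \<Rightarrow> 'b" (binder "LI " 10) where
 "lebesgue_int f \<equiv> integral\<^sup>L lborel f"

abbreviation lebesgue_nn_int :: "('a::euclidean_space \<Rightarrow> ennreal) \<Rightarrow> ennreal" (binder "NI " 10) where
 "lebesgue_nn_int f \<equiv> integral\<^sup>N lborel f"

abbreviation nrm2 :: "'a::real_normed_vector \<Rightarrow> ennreal" where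
 "nrm2 z \<equiv> ennreal ((norm z)^2)"

abbreviation tilt :: "real \<Rightarrow> real \<Rightarrow> real \<times> real \<Rightarrow> complex" where
 "tilt x y q \<equiv> of_real (exp (fst q*x - snd q*y))"

abbreviation bdpt :: "real poly \<Rightarrow> real \<Rightarrow> real \<times> real \<times> real \<Rightarrow> complex \<times> complex" where
 "bdpt \<equiv> shifted_boundary_point"

abbreviation (input) seq_lim :: "(nat \<Rightarrow> 'a::topological_space) \<Rightarrow> 'a \<Rightarrow> bool" (infix "---->" 60) where
 "X ----> l \<equiv> X \<longlonglongrightarrow> l"

abbreviation wave :: "complex \<times> complex \<Rightarrow> real \<times> real \<Rightarrow> complex" where
 "wave P q \<equiv> exp (of_real (fst q)*fst P + \<i> * of_real (snd q) * snd P)"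

abbreviation cauchy :: "real \<times> real \<Rightarrow> real" where
 "cauchy q \<equiv> 1/(1 + (fst q)^2)*(1/(1 + (snd q)^2))"

abbreviation bracket :: "real \<Rightarrow> real \<Rightarrow> real" where
 "bracket a t \<equiv> 1 + \<bar>a\<bar>/ sqrt (1 + t)"

lemmas integrable_bound = Bochner_Integration.integrable_bound
lemmas LI_cong = Bochner_Integration.integral_cong[OF refl]

section \<open>Square integrable functions\<close>

definition L2 :: "'a measure => ('a => complex) => bool" where
 "L2 M f \<longleftrightarrow> f \<in> borel_measurable M \<and> integrable M (%x. (norm (f x))^2)"

definition nsq :: "'a measure => ('a => complex) => real" where
 "nsq M f = (\<integral>x. (norm (f x))^2 \<partial>M)"

lemma L2_measurable [measurable_dest]: "L2 M f ==> f \<in> borel_measurable M"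
 by (simp add: L2_def)

lemma L2_integrable: "L2 M f ==> integrable M (%x. (norm (f x))^2)"
 by (simp add: L2_def)

lemma nsq_nonneg [simp]: "0 <= nsq M f"
 by (simp add: nsq_def)

lemma L2_iff_nn:
 "L2 M f \<longleftrightarrow> f \<in> borel_measurable M \<and> (\<integral>\<^sup>+x. nrm2 (f x) \<partial>M) < \<infinity>"
 by (auto simp: L2_def integrable_iff_bounded)

lemma nn_nsq: "L2 M f ==> (\<integral>\<^sup>+x. nrm2 (f x) \<partial>M) = ennreal (nsq M f)"
 unfolding nsq_def L2_def by (subst nn_integral_eq_integral) auto

lemma L2_I_nn:
 assumes [measurable]: "f \<in> borel_measurable M" and "(\<integral>\<^sup>+x. nrm2 (f x) \<partial>M) <= ennreal C" "0 <= C"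
 shows "L2 M f" "nsq M f <= C"
proof -
 show "L2 M f" unfolding L2_iff_nn using assms by (auto simp: order.strict_trans1)
 from nn_nsq[OF this] assms show "nsq M f <= C" by simp
qed

lemma L2_bound:
 assumes "L2 M g" and [measurable]: "f \<in> borel_measurable M" and "AE x in M. norm (f x) <= C*norm (g x)"
 shows "L2 M f" "nsq M f <= C^2*nsq M g"
proof -
 have AE: "AE x in M. (norm (f x))^2 <= C^2*(norm (g x))^2"
  using assms(3) by eventually_elim (metis norm_ge_zero power_mono power_mult_distrib)
 have i: "integrable M (%x. C^2*(norm (g x))^2)" using assms(1) by (simp add: L2_def)
 show l: "L2 M f" unfolding L2_def
  by (intro conjI assms integrable_bound[OF i]) (use AE in auto)
 have "nsq M f <= (\<integral>x. C^2*(norm (g x))^2 \<partial>M)" unfolding nsq_def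
  using l i AE by (intro integral_mono_AE) (auto simp: L2_def)
 then show "nsq M f <= C^2*nsq M g" by (simp add: nsq_def)
qed

lemma norm_add_sq_le: "(norm (a + b :: complex))^2 <= 2*(norm a)^2 + 2*(norm b)^2"
proof -
 have "(norm (a+b))^2 <= (norm a + norm b)^2" by (simp add: norm_triangle_ineq power_mono)
 also have "... <= 2*(norm a)^2 + 2*(norm b)^2" using sum_squares_bound[of "norm a" "norm b"]
  by (simp add: power2_sum)
 finally show ?thesis .
qed

lemma L2_add:
 assumes f: "L2 M f" and g: "L2 M g"
 shows "L2 M (%x. f x + g x)" "nsq M (%x. f x + g x) <= 2*nsq M f + 2*nsq M g"
proof -
 note [measurable] = L2_measurable[OF f] L2_measurable[OF g]
 have i: "integrable M (%x. 2*(norm (f x))^2 + 2*(norm (g x))^2)"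
  using f g by (simp add: L2_def)
 show l: "L2 M (%x. f x + g x)" unfolding L2_def
  by (intro conjI integrable_bound[OF i]) (auto intro: order_trans[OF norm_add_sq_le])
 have "nsq M (%x. f x + g x) <= (\<integral>x. 2*(norm (f x))^2 + 2*(norm (g x))^2 \<partial>M)" unfolding nsq_def
  using l i by (intro integral_mono) (auto simp: L2_def norm_add_sq_le)
 then show "nsq M (%x. f x + g x) <= 2*nsq M f + 2*nsq M g"
  using f g by (simp add: nsq_def L2_def)
qed

lemma L2_cmult:
 assumes f: "L2 M f"
 shows "L2 M (%x. c*f x)" "nsq M (%x. c*f x) = (norm c)^2*nsq M f"
 using f by (auto simp: L2_def nsq_def norm_mult power_mult_distrib)

lemma L2_zero [simp]: "L2 M (%x. 0)" and nsq_zero [simp]: "nsq M (%x. 0) = 0"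
 by (auto simp: L2_def nsq_def)

lemma L2_diff:
 assumes f: "L2 M f" and g: "L2 M g"
 shows "L2 M (%x. f x - g x)" "nsq M (%x. f x - g x) <= 2*nsq M f + 2*nsq M g"
 using L2_add[OF f L2_cmult(1)[OF g, of "-1"]] L2_cmult(2)[OF g, of "-1"] by auto

lemma nsq_minus_commute: "nsq M (%x. f x - g x) = nsq M (%x. g x - f x)"
 by (simp add: nsq_def norm_minus_commute)

lemma L2_sum:
 "(!!i. i \<in> I ==> L2 M (f i)) ==> L2 M (%x. \<Sum>i\<in>I. f i x)"
 by (induction I rule: infinite_finite_induct) (auto intro: L2_add)

lemma borel_measurable_cnj [measurable (raw)]:
 assumes "f \<in> borel_measurable M" shows "(%x. cnj (f x)) \<in> borel_measurable M"
 using measurable_compose[OF assms, of cnj borel] borel_measurable_continuous_onI[of cnj]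
 by (auto intro: continuous_intros)

lemma L2_cnj: "L2 M f ==> L2 M (%x. cnj (f x))"
 by (auto simp: L2_def)

lemma L2_mult_integrable:
 assumes f: "L2 M f" and g: "L2 M g"
 shows "integrable M (%x. f x*g x)"
proof -
 note [measurable] = L2_measurable[OF f] L2_measurable[OF g]
 have i: "integrable M (%x. (norm (f x))^2 + (norm (g x))^2)"
  using f g by (simp add: L2_def)
 have *: "norm (f x)*norm (g x) <= (norm (f x))^2 + (norm (g x))^2" for x
 proof -
  have "0 <= norm (f x)*norm (g x)" by simp
  then show ?thesis using sum_squares_bound[of "norm (f x)" "norm (g x)"] by linarith
 qed
 show ?thesis
  by (rule integrable_bound[OF i]) (auto simp: norm_mult intro: order_trans[OF *])
qed

text \<open>Optimising the arithmetic-geometric mean inequality over the scale gives Cauchy-Schwarz.\<close>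

lemma L2_Cauchy_Schwarz:
 assumes f: "L2 M f" and g: "L2 M g"
 shows "(\<integral>x. norm (f x*g x) \<partial>M)^2 <= nsq M f*nsq M g"
proof -
 note [measurable] = L2_measurable[OF f] L2_measurable[OF g]
 define I where "I = (\<integral>x. norm (f x*g x) \<partial>M)"
 have I: "integrable M (%x. norm (f x*g x))" using L2_mult_integrable[OF f g] by simp
 have I0: "0 <= I" by (simp add: I_def)
 have q: "2*t*I <= t^2*nsq M f + nsq M g" for t
 proof -
  have "2*t*I = (\<integral>x. 2*t*norm (f x*g x) \<partial>M)" by (simp add: I_def)
  also have "... <= (\<integral>x. t^2*(norm (f x))^2 + (norm (g x))^2 \<partial>M)"
  proof (rule integral_mono)
   show "2*t*norm (f x*g x) <= t\<^sup>2*(cmod (f x))\<^sup>2 + (cmod (g x))\<^sup>2" for x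
    using zero_le_power2[of "t*norm (f x) - norm (g x)"] by (simp add: power2_diff norm_mult power_mult_distrib mult_ac)
  qed (use I f g in \<open>auto simp: L2_def\<close>)
  also have "... = t^2*nsq M f + nsq M g" using f g by (simp add: nsq_def L2_def)
  finally show ?thesis .
 qed
 show ?thesis
 proof (cases "nsq M f = 0")
  case True
  have "I <= 0"
  proof (rule ccontr)
   assume "\<not> I <= 0"
   then have "I \<noteq> 0" by simp
   then have "2*(nsq M g + 1) <= nsq M g" using q[of "(nsq M g + 1)/I"] True by simp
   then show False using nsq_nonneg[of M g] by (simp add: algebra_simps)
  qed
  then have "I = 0" using I0 by simp
  then show ?thesis unfolding I_def[symmetric] by (simp add: True)
 next
  case False
  then have pos: "nsq M f > 0" using nsq_nonneg[of M f] by linarith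
  have "2*(I/nsq M f)*I <= (I/nsq M f)^2*nsq M f + nsq M g" by (rule q)
  then have "2*I^2 <= I^2 + nsq M f*nsq M g"
   using pos by (simp add: field_simps power2_eq_square)
  then show ?thesis by (simp add: I_def)
 qed
qed

lemma L2_norm_integral_le:
 assumes f: "L2 M f" and g: "L2 M g"
 shows "norm (\<integral>x. f x*g x \<partial>M) <= sqrt (nsq M f*nsq M g)"
proof -
 have "norm (\<integral>x. f x*g x \<partial>M) <= (\<integral>x. norm (f x*g x) \<partial>M)" by simp
 also have "... <= sqrt (nsq M f*nsq M g)"
  using L2_Cauchy_Schwarz[OF f g] by (rule real_le_rsqrt)
 finally show ?thesis .
qed

lemma nsq_eq_0_iff:
 assumes "L2 M f" shows "nsq M f = 0 \<longleftrightarrow> (AE x in M. f x = 0)"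
 unfolding nsq_def using integral_nonneg_eq_0_iff_AE[OF L2_integrable[OF assms]] by simp

text \<open>Fatou's lemma for the squares, for limits that have a common norm bound but no dominating function.\<close>

lemma L2_Fatou:
 assumes L: "!!n. L2 M (f n)" and B: "!!n. nsq M (f n) <= C"
  and [measurable]: "g \<in> borel_measurable M" and lim: "AE x in M. (%n. f n x) ----> g x"
 shows "L2 M g" "nsq M g <= C"
proof -
 note [measurable] = L2_measurable[OF L]
 have "(\<integral>\<^sup>+x. nrm2 (g x) \<partial>M) = (\<integral>\<^sup>+x. liminf (%n. nrm2 (f n x)) \<partial>M)"
 proof (rule nn_integral_cong_AE)
  show "AE x in M. nrm2 (g x) = liminf (%n. nrm2 (f n x))"
   using lim
  proof eventually_elim
   case (elim x)
   then have "(%n. nrm2 (f n x)) ----> nrm2 (g x)"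
    by (intro tendsto_ennrealI tendsto_intros)
   then show ?case by (simp only: lim_imp_Liminf[OF trivial_limit_sequentially])
  qed
 qed
 also have "... <= liminf (%n. \<integral>\<^sup>+x. nrm2 (f n x) \<partial>M)"
  by (rule nn_integral_liminf) simp
 also have "... <= ennreal C"
  using B by (intro Liminf_le) (auto simp: nn_nsq[OF L] ennreal_leI)
 finally have le: "(\<integral>\<^sup>+x. nrm2 (g x) \<partial>M) <= ennreal C" .
 have "0 <= C" using B[of 0] nsq_nonneg[of M "f 0"] by linarith
 from L2_I_nn[OF assms(3) le this] show "L2 M g" "nsq M g <= C" by auto
qed

text \<open>A subsequence whose consecutive differences have squared norm at most \<open>8^-k\<close> converges almost
 everywhere, because \<open>|d| \<le> 2^-k + 2^k |d|\<^sup>2\<close> makes the telescoping series absolutely summable.\<close>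

lemma L2_AE_convergent:
 assumes L: "!!n. L2 M (f n)" and B: "!!n. nsq M (%x. f (Suc n) x - f n x) <= (1/8)^n"
 shows "AE x in M. convergent (%n. f n x)"
proof -
 note [measurable] = L2_measurable[OF L]
 define d where "d n x = f (Suc n) x - f n x" for n x
 have Ld: "L2 M (d n)" for n unfolding d_def by (intro L2_diff L)
 note [measurable] = L2_measurable[OF Ld]
 have "(\<integral>\<^sup>+x. (\<Sum>n. ennreal (2^n*(norm (d n x))^2)) \<partial>M) = (\<Sum>n. \<integral>\<^sup>+x. ennreal (2^n*(norm (d n x))^2) \<partial>M)"
  by (rule nn_integral_suminf) simp
 also have "... <= (\<Sum>n. ennreal ((1/4)^n))"
 proof (rule suminf_le)
  fix n
  have "(\<integral>\<^sup>+x. ennreal (2^n*(norm (d n x))^2) \<partial>M) = ennreal (2^n)*ennreal (nsq M (d n))"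
   by (subst nn_nsq[OF Ld, symmetric], subst nn_integral_cmult[symmetric]) (auto simp: ennreal_mult)
  also have "... <= ennreal (2^n)*ennreal ((1/8)^n)"
   using B[of n] unfolding d_def by (intro mult_left_mono ennreal_leI) auto
  also have "... = ennreal ((1/4)^n)" by (simp add: ennreal_mult[symmetric] power_mult_distrib[symmetric])
  finally show "(\<integral>\<^sup>+x. ennreal (2^n*(norm (d n x))^2) \<partial>M) <= ennreal ((1/4)^n)" .
 qed auto
 also have "... < \<infinity>" by (subst suminf_ennreal_eq[OF _ geometric_sums]) auto
 finally have "(\<integral>\<^sup>+x. (\<Sum>n. ennreal (2^n*(norm (d n x))^2)) \<partial>M) \<noteq> \<infinity>" by simp
 then have "AE x in M. (\<Sum>n. ennreal (2^n*(norm (d n x))^2)) \<noteq> \<infinity>"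
  by (rule nn_integral_PInf_AE[rotated]) measurable
 then show ?thesis
 proof eventually_elim
  case (elim x)
  have s1: "summable (%n. 2^n*(norm (d n x))^2)"
   by (rule summable_suminf_not_top) (use elim in auto)
  have s2: "summable (%n. (1/2::real)^n)" by (simp add: summable_geometric)
  have s: "summable (%n. d n x)"
  proof (rule summable_comparison_test[OF _ summable_add[OF s1 s2]], intro exI allI impI)
   fix n
   define y where "y = norm (d n x)"
   have "0 <= (2^n*y - 1)^2" by simp
   then have "2*(2^n*y) <= (2^n*y)^2 + 1" by (simp add: power2_diff)
   moreover have "0 <= 2^n*y" by (simp add: y_def)
   ultimately have "2^n*y <= (2^n*y)^2 + 1" by linarith
   then have "2^n*y <= 2^n*(2^n*y^2 + (1/2)^n)"
    by (simp add: power_mult_distrib algebra_simps power2_eq_square power_one_over)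
   then have "y <= 2^n*y^2 + (1/2)^n" by simp
   then show "norm (d n x) <= 2^n*(norm (d n x))^2 + (1/2)^n" by (simp add: y_def)
  qed
  have eq: "(%n. f n x) = (%n. f 0 x + (\<Sum>i<n. d i x))"
  proof
   show "f n x = f 0 x + (\<Sum>i<n. d i x)" for n by (induction n) (auto simp: d_def)
  qed
  have "convergent (%n. f 0 x + (\<Sum>i<n. d i x))"
   using s by (intro convergent_add convergent_const) (simp add: summable_iff_convergent)
  then show ?case by (subst eq)
 qed
qed

text \<open>A subsequence converges almost everywhere, and Fatou turns the Cauchy condition for the squared norms into convergence to that
 limit. The subsequence is exported because later limits are identified pointwise.\<close>

theorem Riesz_Fischer:
 assumes L: "!!n. L2 M (f n)"
  and C: "!!e. e > 0 ==> \<exists>N. \<forall>m\<ge>N. \<forall>n\<ge>N. nsq M (%x. f m x - f n x) <= e"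
 obtains g r where "L2 M g" "strict_mono r" "AE x in M. (%n. f (r n) x) ----> g x"
  "(%n. nsq M (%x. f n x - g x)) ----> 0"
proof -
 note [measurable] = L2_measurable[OF L]
 have "\<forall>k. \<exists>N. \<forall>m\<ge>N. \<forall>n\<ge>N. nsq M (%x. f m x - f n x) <= (1/8)^k" using C by simp
 then obtain N where N: "!!k m n. m >= N k ==> n >= N k ==> nsq M (%x. f m x - f n x) <= (1/8)^k"
  by metis
 define r where "r k = (\<Sum>i\<le>k. N i) + k" for k
 have r: "strict_mono r" unfolding strict_mono_Suc_iff by (simp add: r_def)
 have rN: "r k >= N k" for k using member_le_sum[of k "{..k}" N] by (auto simp: r_def)
 have "AE x in M. convergent (%n. f (r n) x)"
 proof (rule L2_AE_convergent)
  fix n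
  have "r (Suc n) >= N n" using rN[of n] r by (meson le_trans lessI less_imp_le strict_mono_less_eq)
  then show "nsq M (%x. f (r (Suc n)) x - f (r n) x) <= (1/8)^n" by (intro N rN)
 qed (rule L)
 define g where "g x = lim (%n. f (r n) x)" for x
 have g_meas [measurable]: "g \<in> borel_measurable M" unfolding g_def by measurable
 have lim: "AE x in M. (%n. f (r n) x) ----> g x"
  using \<open>AE x in M. convergent _\<close> by eventually_elim (simp add: g_def convergent_LIMSEQ_iff)
 have est: "\<exists>N. \<forall>m\<ge>N. L2 M (%x. f m x - g x) \<and> nsq M (%x. f m x - g x) <= e" if "e > 0" for e
 proof -
  from C[OF that] obtain N0 where N0: "!!m n. m >= N0 ==> n >= N0 ==> nsq M (%x. f m x - f n x) <= e" by blast
  have "L2 M (%x. f m x - g x) \<and> nsq M (%x. f m x - g x) <= e" if m: "m >= N0" for m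
  proof -
   have 1: "L2 M (%x. f m x - f (r (n + N0)) x)" for n by (intro L2_diff L)
   have 2: "nsq M (%x. f m x - f (r (n + N0)) x) <= e" for n
    using seq_suble[OF r, of "n+N0"] by (intro N0 m) linarith
   have 3: "AE x in M. (%n. f m x - f (r (n + N0)) x) ----> f m x - g x"
    using lim
   proof eventually_elim
    case (elim x)
    show ?case by (intro tendsto_diff tendsto_const LIMSEQ_ignore_initial_segment elim)
   qed
   show ?thesis using L2_Fatou[OF 1 2 _ 3] by auto
  qed
  then show ?thesis by blast
 qed
 obtain N1 where "L2 M (%x. f N1 x - g x)" using est[of 1] by auto
 from L2_diff(1)[OF L[of N1] this] have "L2 M g" by simp
 moreover have "(%n. nsq M (%x. f n x - g x)) ----> 0"
 proof (rule LIMSEQ_I)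
  fix e :: real assume "e > 0"
  then obtain N where "\<forall>m\<ge>N. nsq M (%x. f m x - g x) <= e/2" using est[of "e/2"] by auto
  then show "\<exists>N. \<forall>n\<ge>N. norm (nsq M (%x. f n x - g x) - 0) < e"
   using \<open>e > 0\<close> by (intro exI[of _ N]) force
 qed
 ultimately show ?thesis using that r lim by blast
qed

lemma L2_tendsto_inner:
 assumes f: "!!n. L2 M (f n)" and g: "L2 M g" and h: "L2 M h"
  and lim: "(%n. nsq M (%x. f n x - g x)) ----> 0"
 shows "(%n. \<integral>x. f n x*h x \<partial>M) ----> (\<integral>x. g x*h x \<partial>M)"
proof -
 have "(%n. (\<integral>x. f n x*h x \<partial>M) - (\<integral>x. g x*h x \<partial>M)) ----> 0"
 proof (rule Lim_null_comparison)
  have "(%n. sqrt (nsq M (%x. f n x - g x)*nsq M h)) ----> sqrt (0*nsq M h)"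
   by (intro tendsto_intros lim)
  then show "(%n. sqrt (nsq M (%x. f n x - g x)*nsq M h)) ----> 0" by simp
  show "\<forall>\<^sub>F n in sequentially. norm ((\<integral>x. f n x*h x \<partial>M) - (\<integral>x. g x*h x \<partial>M)) <= sqrt (nsq M (%x. f n x - g x)*nsq M h)"
  proof (rule always_eventually, rule allI)
   fix n
   have "(\<integral>x. f n x*h x \<partial>M) - (\<integral>x. g x*h x \<partial>M) = (\<integral>x. (f n x - g x)*h x \<partial>M)"
    by (subst Bochner_Integration.integral_diff[symmetric]) (auto intro!: L2_mult_integrable f g h simp: algebra_simps)
   then show "norm ((\<integral>x. f n x*h x \<partial>M) - (\<integral>x. g x*h x \<partial>M)) <= sqrt (nsq M (%x. f n x - g x)*nsq M h)"
    using L2_norm_integral_le[OF L2_diff(1)[OF f g] h] by metis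
  qed
 qed
 then show ?thesis by (rule LIM_zero_cancel)
qed

lemma L2_tendsto_nsq:
 assumes f: "!!n. L2 M (f n)" and g: "L2 M g"
  and lim: "(%n. nsq M (%x. f n x - g x)) ----> 0"
 shows "(%n. nsq M (f n)) ----> nsq M g"
proof -
 have e: "nsq M (f n) - nsq M g = nsq M (%x. f n x - g x) + 2 * Re (\<integral>x. (f n x - g x)*cnj (g x) \<partial>M)" for n
 proof -
  have i: "integrable M (%x. (f n x - g x)*cnj (g x))" by (intro L2_mult_integrable L2_diff f g L2_cnj)
  have "nsq M (f n) - nsq M g = (\<integral>x. (norm (f n x))^2 - (norm (g x))^2 \<partial>M)"
   using f g by (simp add: nsq_def L2_def)
  also have "... = (\<integral>x. (norm (f n x - g x))^2 + 2 * Re ((f n x - g x)*cnj (g x)) \<partial>M)"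
  proof (intro LI_cong)
   fix x
   have "(norm u)^2 - (norm v)^2 = (norm (u - v))^2 + 2 * Re ((u - v)*cnj v)" for u v
    unfolding cmod_power2 by (simp add: algebra_simps power2_eq_square)
   then show "(norm (f n x))^2 - (norm (g x))^2 = (norm (f n x - g x))^2 + 2 * Re ((f n x - g x)*cnj (g x))" .
  qed
  also have "... = nsq M (%x. f n x - g x) + 2 * Re (\<integral>x. (f n x - g x)*cnj (g x) \<partial>M)"
  proof -
   have 1: "integrable M (%x. (norm (f n x - g x))^2)" using L2_diff(1)[OF f g] by (simp add: L2_def)
   have 2: "integrable M (%x. 2 * Re ((f n x - g x)*cnj (g x)))" by (intro integrable_mult_right integrable_Re i)
   show ?thesis
    unfolding nsq_def Bochner_Integration.integral_add[OF 1 2] integral_mult_right_zero integral_Re[OF i] ..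
  qed
  finally show ?thesis .
 qed
 have "(%n. \<integral>x. (f n x - g x)*cnj (g x) \<partial>M) ----> (\<integral>x. 0*cnj (g x) \<partial>M)"
  by (rule L2_tendsto_inner) (auto intro: L2_diff f g L2_cnj lim)
 then have "(%n. nsq M (%x. f n x - g x) + 2 * Re (\<integral>x. (f n x - g x)*cnj (g x) \<partial>M)) ----> 0 + 2 * Re 0"
  by (intro tendsto_intros lim) simp
 then have "(%n. nsq M (f n) - nsq M g) ----> 0" unfolding e by simp
 then show ?thesis by (rule LIM_zero_cancel)
qed

lemma L2_polarization:
 assumes f: "L2 M f" and g: "L2 M g"
 shows "4*(\<integral>x. f x*cnj (g x) \<partial>M) = complex_of_real (nsq M (%x. f x + g x) - nsq M (%x. f x + (-1)*g x))
   + \<i>*complex_of_real (nsq M (%x. f x + \<i>*g x) - nsq M (%x. f x + (-\<i>)*g x))"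
proof -
 have l: "L2 M (%x. f x + c*g x)" for c by (intro L2_add f L2_cmult g)
 have i: "integrable M (%x. complex_of_real ((norm (f x + c*g x))^2))" for c
  using L2_integrable[OF l[of c]] by (rule integrable_of_real)
 have n: "complex_of_real (nsq M (%x. f x + c*g x)) = (\<integral>x. complex_of_real ((norm (f x + c*g x))^2) \<partial>M)" for c
  unfolding nsq_def by (rule integral_complex_of_real[symmetric])
 have p: "4*(u*cnj v) = (complex_of_real ((norm (u + 1 * v))^2) - complex_of_real ((norm (u + (-1) * v))^2))
   + \<i>*(complex_of_real ((norm (u + \<i> * v))^2) - complex_of_real ((norm (u + (-\<i>) * v))^2))" for u v :: complex
  unfolding cmod_power2 complex_eq_iff by (simp add: power2_eq_square algebra_simps)
 define A where "A c x = complex_of_real ((norm (f x + c*g x))^2)" for c x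
 have iA: "integrable M (A c)" for c unfolding A_def by (rule i)
 have nA: "complex_of_real (nsq M (%x. f x + c*g x)) = (\<integral>x. A c x \<partial>M)" for c unfolding A_def by (rule n)
 have "4*(\<integral>x. f x*cnj (g x) \<partial>M) = (\<integral>x. 4*(f x*cnj (g x)) \<partial>M)" by simp
 also have "... = (\<integral>x. (A 1 x - A (-1) x) + \<i>*(A \<i> x - A (-\<i>) x) \<partial>M)"
  unfolding p A_def ..
 also have "... = (\<integral>x. A 1 x - A (-1) x \<partial>M) + (\<integral>x. \<i>*(A \<i> x - A (-\<i>) x) \<partial>M)"
  by (intro Bochner_Integration.integral_add Bochner_Integration.integrable_diff integrable_mult_right iA)
 also have "(\<integral>x. A 1 x - A (-1) x \<partial>M) = (\<integral>x. A 1 x \<partial>M) - (\<integral>x. A (-1) x \<partial>M)"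
  by (intro Bochner_Integration.integral_diff iA)
 also have "(\<integral>x. \<i>*(A \<i> x - A (-\<i>) x) \<partial>M) = \<i>*((\<integral>x. A \<i> x \<partial>M) - (\<integral>x. A (-\<i>) x \<partial>M))"
  by (simp add: Bochner_Integration.integral_diff iA)
 finally have "4*(\<integral>x. f x*cnj (g x) \<partial>M) = ((\<integral>x. A 1 x \<partial>M) - (\<integral>x. A (-1) x \<partial>M)) + \<i>*((\<integral>x. A \<i> x \<partial>M) - (\<integral>x. A (-\<i>) x \<partial>M))" .
 then show ?thesis unfolding nA[symmetric] by simp
qed

text \<open>Dominated convergence with a dominating function that may depend on the point at which
 continuity is tested.\<close>

lemma continuous_on_integral_dominated:
 fixes F :: "'p::metric_space => 'a => 'b::{banach,second_countable_topology}"
 assumes meas: "!!p. p \<in> S ==> F p \<in> borel_measurable M"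
  and cont: "!!x. x \<in> space M ==> continuous_on S (%p. F p x)"
  and dom: "!!p0. p0 \<in> S ==> \<exists>U g. open U \<and> p0 \<in> U \<and> integrable M g \<and> (\<forall>p\<in>U\<inter>S. AE x in M. norm (F p x) <= g x)"
 shows "continuous_on S (%p. \<integral>x. F p x \<partial>M)"
 unfolding continuous_on_sequentially
proof (intro allI ballI impI)
 fix X p0 assume p0: "p0 \<in> S" and X: "(\<forall>n. X n \<in> S) \<and> X ----> p0"
 from dom[OF p0] obtain U g where U: "open U" "p0 \<in> U" "integrable M g"
  "!!p. p\<in>U\<inter>S ==> AE x in M. norm (F p x) <= g x" by blast
 from X U have "\<forall>\<^sub>F n in sequentially. X n \<in> U" by (auto simp: tendsto_def)
 then obtain n0 where n0: "!!n. n >= n0 ==> X n \<in> U" by (auto simp: eventually_sequentially)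
 have X': "(%n. X (n + n0)) ----> p0" using X by (intro LIMSEQ_ignore_initial_segment) auto
 have "(%n. \<integral>x. F (X (n + n0)) x \<partial>M) ----> (\<integral>x. F p0 x \<partial>M)"
 proof (rule integral_dominated_convergence[where w=g])
  show "AE x in M. (%n. F (X (n + n0)) x) ----> F p0 x"
  proof (rule AE_I2)
   fix x assume "x \<in> space M"
   from cont[OF this] show "(%n. F (X (n + n0)) x) ----> F p0 x"
    unfolding continuous_on_sequentially using X X' p0 by (auto simp: o_def)
  qed
 qed (use U X p0 n0 meas in auto)
 then show "((%p. \<integral>x. F p x \<partial>M) \<circ> X) ----> (\<integral>x. F p0 x \<partial>M)"
  unfolding o_def by (rule LIMSEQ_offset)
qed

text \<open>The remainder is compared with the exponential series shifted by two; it justifies all differentiations under the integral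
 sign.\<close>

lemma exp_quadratic_bound:
 fixes z :: complex
 shows "norm (exp z - 1 - z) <= (norm z)^2*exp (norm z)"
proof -
 have s: "(%n. z^(n+2) /\<^sub>R fact (n+2)) sums (exp z - (\<Sum>n<2. z^n /\<^sub>R fact n))"
  by (rule sums_split_initial_segment[OF exp_converges])
 have s': "(%n. (norm z)^n /\<^sub>R fact n) sums exp (norm z)" by (rule exp_converges)
 have le: "norm (z^(n+2) /\<^sub>R fact (n+2)) <= (norm z)^2*((norm z)^n /\<^sub>R fact n)" for n
 proof -
  have "inverse (fact (n+2) :: real) <= inverse (fact n)"
   by (intro le_imp_inverse_le fact_mono) auto
  then have "(norm z)^(n+2)*inverse (fact (n+2) :: real) <= (norm z)^(n+2)*inverse (fact n)"
   by (intro mult_left_mono) auto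
  then show ?thesis by (simp add: norm_power norm_mult power_add mult_ac power2_eq_square del: fact_Suc)
 qed
 have "norm (exp z - (\<Sum>n<2. z^n /\<^sub>R fact n)) <= (norm z)^2*exp (norm z)"
  using norm_suminf_le[of "%n. z^(n+2) /\<^sub>R fact (n+2)", OF le] s sums_mult[OF s', of "(norm z)^2"]
  by (simp only: sums_unique[symmetric] sums_summable)
 then show ?thesis by (simp add: numeral_2_eq_2 algebra_simps)
qed

section \<open>The Fourier transform on \<open>L\<^sup>1 \<inter> L\<^sup>2\<close> of a Euclidean space\<close>

lemma measurable_cis [measurable]: "cis \<in> bm"
 by (intro borel_measurable_continuous_onI) (simp add: cis_conv_exp continuous_intros)

definition ft :: "('a::euclidean_space => complex) => 'a => complex" where
 "ft h q = (LI p. h p*cis (p \<bullet> q))"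

lemma sets_borel_prod [measurable_cong]:
 "sets (borel :: ('a::second_countable_topology \<times> 'b::second_countable_topology) measure) = sets (borel \<Otimes>\<^sub>M borel)"
 by (simp only: borel_prod)

lemma measurable_lborel_pair:
 "measurable (lborel \<Otimes>\<^sub>M lborel :: ('a::euclidean_space \<times> 'b::euclidean_space) measure) N = measurable borel N"
 by (rule measurable_cong_sets) (simp_all only: lborel_prod sets_lborel)

lemma integrable_pair_mult:
 fixes f :: "'a::euclidean_space => complex" and g :: "'b::euclidean_space => complex"
 assumes f: "L1 f" and g: "L1 g"
 shows "integrable (lborel \<Otimes>\<^sub>M lborel) (%(x, y). f x*g y)"
proof (rule lborel_pair.Fubini_integrable)
 have [measurable]: "f \<in> bm" "g \<in> bm" using f g by auto
 show "(%(x, y). f x*g y) \<in> borel_measurable (lborel \<Otimes>\<^sub>M lborel)" by measurable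
 show "L1 (%x. LI y. norm (case (x, y) of (x, y) => f x*g y))"
  using f by (simp add: norm_mult)
 show "AE x in lborel. L1 (%y. case (x, y) of (x, y) => f x*g y)"
  using g by simp
qed

lemma integral_pair_mult:
 fixes f :: "'a::euclidean_space => complex" and g :: "'b::euclidean_space => complex"
 assumes f: "L1 f" and g: "L1 g"
 shows "(\<integral>(x, y). f x*g y \<partial>lborel) = (LI x. f x)*(LI y. g y)"
proof -
 have "(\<integral>(x, y). f x*g y \<partial>lborel) = (LI x. LI y. (case (x, y) of (x, y) => f x*g y))"
  unfolding lborel_prod[symmetric] by (rule lborel_pair.integral_fst'[symmetric, OF integrable_pair_mult[OF f g]])
 then show ?thesis by simp
qed

lemma lborel_shift:
 fixes f :: "'a::euclidean_space => 'b::{banach,second_countable_topology}"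
 assumes [measurable]: "f \<in> bm"
 shows "(LI p. f (p + s)) = (LI p. f p)"
  and "L1 (%p. f (p + s)) \<longleftrightarrow> L1 f"
proof -
 have "(\<integral>p. f p \<partial>distr lborel borel ((+) s)) = (LI p. f (s + p))"
  by (rule integral_distr) auto
 then show "(LI p. f (p + s)) = (LI p. f p)" by (simp add: lborel_distr_plus add.commute)
 have "integrable (distr lborel borel ((+) s)) f \<longleftrightarrow> L1 (%p. f (s + p))"
  by (rule integrable_distr_eq) auto
 then show "L1 (%p. f (p + s)) \<longleftrightarrow> L1 f" by (simp add: lborel_distr_plus add.commute)
qed

lemma lborel_scale:
 fixes f :: "'a::euclidean_space => 'b::{banach,second_countable_topology}"
 assumes [measurable]: "f \<in> bm" and c: "c > 0"
 shows "(LI p. f p) = c^DIM('a) *\<^sub>R (LI p. f (c *\<^sub>R p))"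
proof -
 have "(LI p. f p) = (\<integral>p. f p \<partial>density (distr lborel borel (%x. 0 + c *\<^sub>R x)) (%_. \<bar>c\<bar>^DIM('a)))"
  using c by (subst lborel_affine[of c 0]) auto
 also have "... = (\<integral>p. c^DIM('a) *\<^sub>R f p \<partial>distr lborel borel (%x. 0 + c *\<^sub>R x))"
  using c by (subst integral_density) (auto simp: ennreal_power)
 also have "... = c^DIM('a) *\<^sub>R (LI p. f (c *\<^sub>R p))"
  by (simp add: integral_distr)
 finally show ?thesis .
qed

subsection \<open>Gaussians\<close>

definition gauss :: "real \<times> real => complex" where
 "gauss p = of_real (exp (- (p \<bullet> p)/2))"

lemma measurable_gauss [measurable]: "gauss \<in> bm"
 unfolding gauss_def by measurable

lemma gauss_1d:
 "L1 (%x::real. complex_of_real (exp (- (x^2)/2)))"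
 "(LI x. complex_of_real (exp (- (x^2)/2))*cis (x*t)) = of_real (sqrt (2*pi)*exp (- (t^2)/2))"
proof -
 have d: "std_normal_density x = exp (- (x^2)/2)/sqrt (2*pi)" for x
  by (simp add: std_normal_density_def)
 have i: "L1 (%x. sqrt (2*pi) * std_normal_density x)"
  using integrable_normal_density[of 1 0] by (intro integrable_mult_right) simp
 then show "L1 (%x::real. complex_of_real (exp (- (x^2)/2)))"
  by (intro integrable_of_real) (simp add: d)
 have "of_real (exp (- (t^2)/2)) = (\<integral>x. iexp (t*x) \<partial>std_normal_distribution)"
  using char_std_normal_distribution by (simp add: char_def fun_eq_iff)
 also have "... = (LI x. std_normal_density x *\<^sub>R iexp (t*x))"
  by (subst integral_density) (auto simp: normal_density_nonneg)
 also have "... = (LI x. (1/sqrt (2*pi)) *\<^sub>R (complex_of_real (exp (- (x^2)/2))*cis (x*t)))"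
  by (intro LI_cong) (simp add: d cis_conv_exp scaleR_conv_of_real mult_ac)
 also have "... = (1/sqrt (2*pi)) *\<^sub>R (LI x. complex_of_real (exp (- (x^2)/2))*cis (x*t))"
  by simp
 finally show "(LI x. complex_of_real (exp (- (x^2)/2))*cis (x*t)) = of_real (sqrt (2*pi)*exp (- (t^2)/2))"
  by (simp add: scaleR_conv_of_real field_simps)
qed

lemma gauss_split: "gauss (x, y)*cis ((x, y) \<bullet> (s, t))
  = (complex_of_real (exp (- (x^2)/2))*cis (x * s))*(complex_of_real (exp (- (y^2)/2))*cis (y*t))"
 by (simp add: gauss_def exp_add[symmetric] cis_mult[symmetric] power2_eq_square add_divide_distrib diff_divide_distrib
   flip: of_real_mult)

lemma ft_gauss: "ft gauss q = 2*pi*gauss q" and integrable_gauss: "L1 gauss"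
proof -
 have i: "L1 (%x. complex_of_real (exp (- (x^2)/2))*cis (x*t))" for t
  by (rule integrable_bound[OF gauss_1d(1)]) (auto simp: norm_mult)
 obtain s t where q: "q = (s, t)" by force
 have "ft gauss q = (\<integral>(x, y). (complex_of_real (exp (- (x^2)/2))*cis (x * s))*(complex_of_real (exp (- (y^2)/2))*cis (y*t)) \<partial>lborel)"
  unfolding ft_def q by (intro LI_cong) (clarsimp simp: gauss_split simp del: inner_Pair)
 also have "... = of_real (sqrt (2*pi)*exp (- (s^2)/2)) * of_real (sqrt (2*pi)*exp (- (t^2)/2))"
  unfolding integral_pair_mult[OF i i] gauss_1d(2) ..
 also have "... = 2*pi*gauss q"
 proof -
  have 1: "exp (- (s^2)/2)*exp (- (t^2)/2) = exp (- (q \<bullet> q)/2)"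
   by (simp add: q exp_add[symmetric] power2_eq_square add_divide_distrib diff_divide_distrib)
  have "(sqrt (2*pi)*exp (- (s^2)/2))*(sqrt (2*pi)*exp (- (t^2)/2)) = 2*pi*(exp (- (s^2)/2)*exp (- (t^2)/2))"
   by simp
  then show ?thesis unfolding 1 gauss_def by (simp only: of_real_mult[symmetric])
 qed
 finally show "ft gauss q = 2*pi*gauss q" .
 have "L1 (%(x, y). complex_of_real (exp (- (x^2)/2))*complex_of_real (exp (- (y^2)/2)))"
  using integrable_pair_mult[OF gauss_1d(1) gauss_1d(1)] by (simp add: lborel_prod)
 then show "L1 gauss"
  by (rule back_subst[of "L1"])
   (auto simp: fun_eq_iff gauss_def power2_eq_square exp_add[symmetric] add_divide_distrib diff_divide_distrib
    simp flip: of_real_mult)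
qed

lemma integral_gauss: "(LI p. gauss p) = 2*pi"
 using ft_gauss[of 0] by (simp add: ft_def gauss_def)

lemma gauss_le_1: "norm (gauss p) <= 1"
 by (simp add: gauss_def)

lemma integrable_gauss_scaled:
 assumes "e > 0" shows "L1 (%q. gauss (e *\<^sub>R q))"
proof -
 have "integrable (density (distr lborel borel (%x. 0 + e *\<^sub>R x)) (%_. \<bar>e\<bar>^DIM(real\<times>real))) gauss"
  using integrable_gauss assms by (subst (asm) lborel_affine[of e 0]) auto
 then have "integrable (distr lborel borel (%x. 0 + e *\<^sub>R x)) (%p. e^DIM(real\<times>real) *\<^sub>R gauss p)"
  using assms by (subst (asm) integrable_density) (auto simp: ennreal_power)
 then have "L1 (%q. e^DIM(real\<times>real) *\<^sub>R gauss (e *\<^sub>R q))" by (subst (asm) integrable_distr_eq) auto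
 moreover define k where "k = e^DIM(real\<times>real)"
 ultimately have "L1 (%q. k *\<^sub>R gauss (e *\<^sub>R q))" by simp
 then have "L1 (%q. inverse k *\<^sub>R (k *\<^sub>R gauss (e *\<^sub>R q)))"
  by (rule integrable_scaleR_right)
 moreover have "k \<noteq> 0" using assms by (simp add: k_def)
 ultimately show ?thesis by simp
qed

definition shrink :: "nat => real" where "shrink n = inverse (real (Suc n))"

lemma shrink_pos [simp]: "0 < shrink n" and shrink_nonneg [simp]: "0 <= shrink n" and shrink_neq_0 [simp]: "shrink n \<noteq> 0"
 and shrink_le_1 [simp]: "shrink n <= 1"
 by (simp_all add: shrink_def field_simps)

lemma shrink_tendsto: "shrink ----> 0"
 unfolding shrink_def by (rule LIMSEQ_inverse_real_of_nat)

lemma shrink_antimono: "m <= n ==> shrink n <= shrink m"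
 by (simp add: shrink_def field_simps)

text \<open>Regularising with a dilated Gaussian in frequency is averaging against a shrinking Gaussian in
 position.\<close>

lemma ft_mult_gauss:
 fixes A :: "real \<times> real => complex"
 assumes A: "L1 A" and e: "e > 0"
 shows "(LI q. ft A q*gauss (e *\<^sub>R q)) = 2*pi*(LI v. A (e *\<^sub>R v)*gauss v)"
proof -
 have [measurable]: "A \<in> bm" using A by auto
 have int: "integrable (lborel \<Otimes>\<^sub>M lborel) (%(s, q). A s*cis (s \<bullet> q)*gauss (e *\<^sub>R q))"
  by (rule integrable_bound[OF integrable_pair_mult[OF A integrable_gauss_scaled[OF e]]])
    (auto simp: norm_mult)
 have g: "(LI q. cis (s \<bullet> q)*gauss (e *\<^sub>R q)) = 2*pi/e^2*gauss (s /\<^sub>R e)" for s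
 proof -
  have "2*pi*gauss (s /\<^sub>R e) = (LI p. gauss p*cis (p \<bullet> (s /\<^sub>R e)))"
   using ft_gauss[of "s /\<^sub>R e"] by (simp add: ft_def)
  also have "... = e^DIM(real \<times> real) *\<^sub>R (LI p. gauss (e *\<^sub>R p)*cis ((e *\<^sub>R p) \<bullet> (s /\<^sub>R e)))"
   by (rule lborel_scale[OF _ e]) measurable
  also have "(%p. gauss (e *\<^sub>R p)*cis ((e *\<^sub>R p) \<bullet> (s /\<^sub>R e))) = (%p. cis (s \<bullet> p)*gauss (e *\<^sub>R p))"
  proof
   fix p
   have "(e *\<^sub>R p) \<bullet> (s /\<^sub>R e) = s \<bullet> p" using e by (simp add: inner_commute)
   then show "gauss (e *\<^sub>R p)*cis ((e *\<^sub>R p) \<bullet> (s /\<^sub>R e)) = cis (s \<bullet> p)*gauss (e *\<^sub>R p)" by simp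
  qed
  finally show ?thesis using e by (simp add: scaleR_conv_of_real field_simps power2_eq_square)
 qed
 have "(LI q. ft A q*gauss (e *\<^sub>R q)) = (LI q. LI s. A s*cis (s \<bullet> q)*gauss (e *\<^sub>R q))"
  by (simp add: ft_def)
 also have "... = (LI s. LI q. A s*cis (s \<bullet> q)*gauss (e *\<^sub>R q))"
  by (rule lborel_pair.Fubini_integral[OF int])
 also have "... = (LI s. A s*(2*pi/e^2*gauss (s /\<^sub>R e)))"
  by (simp add: g mult.assoc)
 also have "... = e^DIM(real \<times> real) *\<^sub>R (LI v. A (e *\<^sub>R v)*(2*pi/e^2*gauss ((e *\<^sub>R v) /\<^sub>R e)))"
  by (rule lborel_scale[OF _ e]) measurable
 also have "... = e^2 *\<^sub>R (LI v. (2*pi/e^2)*(A (e *\<^sub>R v)*gauss v))"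
  using e by (simp add: mult_ac power2_eq_square)
 also have "... = 2*pi*(LI v. A (e *\<^sub>R v)*gauss v)"
  using e by (simp add: scaleR_conv_of_real)
 finally show ?thesis .
qed

text \<open>Rescaling moves the shrinking width into the argument of \<open>h\<close>, where boundedness and continuity at the point allow
 dominated convergence.\<close>

lemma gauss_approximate_identity:
 fixes A :: "real \<times> real => complex"
 assumes [measurable]: "A \<in> bm" and B: "!!s. norm (A s) <= B" and cont: "isCont A 0"
 shows "(%n. LI v. A (shrink n *\<^sub>R v)*gauss v) ----> 2*pi*A 0"
proof -
 have "(%n. LI v. A (shrink n *\<^sub>R v)*gauss v) ----> (LI v. A 0*gauss v)"
 proof (rule integral_dominated_convergence[where w="%v. B*norm (gauss v)"])
  show "L1 (%v. B*norm (gauss v))" using integrable_gauss by simp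
  show "AE v in lborel. (%n. A (shrink n *\<^sub>R v)*gauss v) ----> A 0*gauss v"
  proof (rule AE_I2)
   fix v :: "real \<times> real"
   have "(%n. shrink n *\<^sub>R v) ----> 0 *\<^sub>R v"
    by (intro tendsto_scaleR shrink_tendsto tendsto_const)
   then have "(%n. A (shrink n *\<^sub>R v)) ----> A 0"
    using cont by (intro isCont_tendsto_compose[of 0 A]) auto
   then show "(%n. A (shrink n *\<^sub>R v)*gauss v) ----> A 0*gauss v"
    by (intro tendsto_mult tendsto_const)
  qed
  show "AE v in lborel. norm (A (shrink n *\<^sub>R v)*gauss v) <= B*norm (gauss v)" for n
   by (auto simp: norm_mult intro!: mult_right_mono B)
 qed measurable
 then show ?thesis by (simp add: integral_gauss mult.commute)
qed

lemma gauss_scaled_tendsto_1: "(%n. gauss (shrink n *\<^sub>R q)) ----> 1"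
proof -
 have "isCont gauss 0" unfolding gauss_def by (intro continuous_intros) simp
 moreover have "(%n. shrink n *\<^sub>R q) ----> 0 *\<^sub>R q"
  by (intro tendsto_scaleR shrink_tendsto tendsto_const)
 ultimately have "(%n. gauss (shrink n *\<^sub>R q)) ----> gauss 0"
  by (intro isCont_tendsto_compose[of 0 gauss]) auto
 then show ?thesis by (simp add: gauss_def)
qed

lemma measurable_ft [measurable]:
 assumes [measurable]: "h \<in> bm"
 shows "ft h \<in> bm"
 unfolding ft_def by measurable

lemma ft_norm_le: "norm (ft h q) <= (LI p. norm (h p))"
proof -
 have "norm (ft h q) <= (LI p. norm (h p*cis (p \<bullet> q)))" unfolding ft_def by (rule integral_norm_bound)
 then show ?thesis by (simp add: norm_mult)
qed

text \<open>The transform is integrable, so the Gaussian regularisation in frequency may be removed by dominated convergence; in position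
 it converges by continuity.\<close>

theorem Fourier_inversion:
 fixes h :: "real \<times> real => complex"
 assumes h: "L1 h" and cont: "continuous_on UNIV h" and B: "!!p. norm (h p) <= B"
  and f: "L1 (ft h)"
 shows "ft (ft h) (-p) = 4*pi^2*h p"
proof -
 have [measurable]: "h \<in> bm" using h by auto
 define g where "g n q = gauss (shrink n *\<^sub>R q)" for n q
 define A where "A s = h (s + p)" for s
 have A: "L1 A" unfolding A_def using h by (simp add: lborel_shift)
 have [measurable]: "A \<in> bm" unfolding A_def by measurable
 have ftA: "ft A q = ft h q*cis (q \<bullet> (-p))" for q
 proof -
  have "ft A q = (LI s. h (s + p)*cis ((s + p) \<bullet> q)*cis (q \<bullet> (-p)))"
   unfolding ft_def A_def
   by (intro LI_cong) (simp add: cis_mult mult.assoc inner_add_left inner_add_right inner_commute)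
  also have "... = (LI s. h s*cis (s \<bullet> q)*cis (q \<bullet> (-p)))"
   by (rule lborel_shift(1)[where f="%s. h s*cis (s \<bullet> q)*cis (q \<bullet> (-p))"]) measurable
  finally show ?thesis by (simp add: ft_def)
 qed
 have cA: "isCont A 0" unfolding A_def
  by (intro continuous_on_interior[of UNIV] continuous_on_compose2[OF cont] continuous_intros) auto
 have "(%n. LI q. ft A q*g n q) ----> 2*pi*(2*pi*A 0)"
  unfolding g_def ft_mult_gauss[OF A shrink_pos]
  by (intro tendsto_mult tendsto_const gauss_approximate_identity[where B=B] cA) (auto simp: A_def B)
 moreover have "(%n. LI q. ft A q*g n q) ----> (LI q. ft A q)"
 proof (rule integral_dominated_convergence[where w="%q. norm (ft h q)"])
  show "AE q in lborel. (%n. ft A q*g n q) ----> ft A q"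
   using tendsto_mult[OF tendsto_const gauss_scaled_tendsto_1] by (auto simp: g_def)
  show "AE q in lborel. norm (ft A q*g n q) <= norm (ft h q)" for n
   unfolding g_def ftA by (intro AE_I2) (simp add: norm_mult mult_left_le gauss_le_1)
 qed (use f in \<open>auto simp: g_def\<close>)
 ultimately have "2*pi*(2*pi*A 0) = (LI q. ft A q)" by (rule LIMSEQ_unique)
 also have "... = ft (ft h) (-p)" unfolding ftA by (simp add: ft_def)
 finally show ?thesis by (simp add: A_def power2_eq_square mult.assoc)
qed

subsection \<open>Continuity of translations in the mean\<close>

definition translation_continuous :: "('a::euclidean_space => complex) => bool" where
 "translation_continuous h \<longleftrightarrow> L2 lborel h \<and> ((%s. nsq lborel (%p. h (p + s) - h p)) \<longlongrightarrow> 0) (at 0)"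

lemma L2_shift:
 fixes h :: "'a::euclidean_space => complex"
 assumes "L2 lborel h"
 shows "L2 lborel (%p. h (p + s))" "nsq lborel (%p. h (p + s)) = nsq lborel h"
proof -
 have [measurable]: "h \<in> bm" using assms by (auto simp: L2_def)
 show "L2 lborel (%p. h (p + s))" "nsq lborel (%p. h (p + s)) = nsq lborel h"
  using assms lborel_shift[of "%p. (norm (h p))^2" s] by (auto simp: L2_def nsq_def)
qed

lemma L2_indicator:
 fixes B :: "'a::euclidean_space set"
 assumes [measurable]: "B \<in> sets borel" and fin: "emeasure lborel B < \<infinity>"
 shows "L2 lborel (%p. complex_of_real (indicator B p))"
proof -
 have "(%x. (norm (complex_of_real (indicator B x)))^2) = (indicator B :: 'a => real)" by (auto simp: indicator_def)
 then show ?thesis using fin unfolding L2_def by simp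
qed

lemma nsq_cnj: "nsq M (%p. cnj (f p)) = nsq M f"
 by (simp add: nsq_def)

text \<open>The set \<open>U \<inter> (U - s)\<close> exhausts \<open>U\<close> as \<open>s\<close> tends to \<open>0\<close>, because
 \<open>U\<close> is open, and translation preserves the measure.\<close>

lemma translation_continuous_open:
 fixes U :: "'a::euclidean_space set"
 assumes U: "open U" and fin: "emeasure lborel U < \<infinity>"
 shows "translation_continuous (%p. of_real (indicator U p))"
proof -
 have [measurable]: "U \<in> sets borel" using U by simp
 have iU: "L1 (indicator U :: 'a => real)" using fin by simp
 have L: "L2 lborel (%p. complex_of_real (indicator U p))"
  by (rule L2_indicator[OF _ fin]) simp
 have sym: "nsq lborel (%p. complex_of_real (indicator U (p + s)) - of_real (indicator U p))
   = 2*(LI p. indicator U p*(1 - indicator U (p + s)))" for s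
 proof -
  have 1: "L1 (%p. indicator U p*(1 - indicator U (p + s)) :: real)"
   by (rule integrable_bound[OF iU]) (auto simp: indicator_def)
  have iS: "L1 (%p. indicator U (p + s) :: real)"
   using iU by (simp add: lborel_shift)
  have "nsq lborel (%p. complex_of_real (indicator U (p + s)) - of_real (indicator U p))
   = (LI p. 2*(indicator U p*(1 - indicator U (p + s))) + (indicator U (p + s) - indicator U p))"
   unfolding nsq_def by (intro LI_cong) (auto simp: indicator_def)
  also have "... = 2*(LI p. indicator U p*(1 - indicator U (p + s))) + ((LI p. indicator U (p + s)) - (LI p. indicator U p))"
   using 1 iS iU by (simp only: Bochner_Integration.integral_add Bochner_Integration.integral_diff integral_mult_right_zero integrable_mult_right Bochner_Integration.integrable_diff)
  also have "(LI p. indicator U (p + s)) = (\<integral>p. indicator U p \<partial>lborel :: real)"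
   by (rule lborel_shift) measurable
  finally show ?thesis by simp
 qed
 have "((%s. LI p. indicator U p*(1 - indicator U (p + s))) \<longlongrightarrow> (\<integral>p. 0 \<partial>(lborel :: 'a measure) :: real)) (at 0)"
  unfolding tendsto_at_iff_sequentially o_def
 proof (intro allI impI)
  fix X :: "nat => 'a" assume X: "\<forall>i. X i \<in> UNIV - {0}" "X ----> 0"
  show "(%n. LI p. indicator U p*(1 - indicator U (p + X n))) ----> (\<integral>p. 0 \<partial>(lborel :: 'a measure) :: real)"
  proof (rule integral_dominated_convergence[where w="indicator U"])
   show "AE p in lborel. (%n. indicator U p*(1 - indicator U (p + X n))) ----> (0::real)"
   proof (rule AE_I2)
    fix p
    show "(%n. indicator U p*(1 - indicator U (p + X n))) ----> (0::real)"
    proof (cases "p \<in> U")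
     case True
     have "(%n. p + X n) ----> p + 0" by (intro tendsto_intros X)
     then have "\<forall>\<^sub>F n in sequentially. p + X n \<in> U" using U True by (auto simp: tendsto_def)
     then have "\<forall>\<^sub>F n in sequentially. indicator U p*(1 - indicator U (p + X n)) = (0::real)"
      by eventually_elim auto
     then show ?thesis by (simp add: tendsto_eventually)
    qed auto
   qed
  qed (use iU in \<open>auto simp: indicator_def\<close>)
 qed
 then show ?thesis unfolding translation_continuous_def sym using L tendsto_mult[OF tendsto_const[of 2]] by fastforce
qed

text \<open>Translations are isometries, so an approximation error enters twice and uniformly in the shift.\<close>

lemma translation_continuous_approx:
 assumes L: "L2 lborel h"
  and ap: "!!e. e > 0 ==> \<exists>h'. translation_continuous h' \<and> nsq lborel (%p. h p - h' p) <= e"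
 shows "translation_continuous h"
 unfolding translation_continuous_def
proof (intro conjI L tendstoI)
 fix e :: real assume e: "e > 0"
 obtain h' where h': "translation_continuous h'" and le: "nsq lborel (%p. h p - h' p) <= e/16"
  using ap[of "e/16"] e by auto
 have L': "L2 lborel h'" and t: "((%s. nsq lborel (%p. h' (p + s) - h' p)) \<longlongrightarrow> 0) (at 0)"
  using h' by (auto simp: translation_continuous_def)
 from tendstoD[OF t, of "e/8"] e have "\<forall>\<^sub>F s in at 0. nsq lborel (%p. h' (p + s) - h' p) < e/8" by simp
 then show "\<forall>\<^sub>F s in at 0. dist (nsq lborel (%p. h (p + s) - h p)) 0 < e"
 proof eventually_elim
  case (elim s)
  define u where "u p = h p - h' p" for p
  have Lu: "L2 lborel u" unfolding u_def by (intro L2_diff L L')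
  have 1: "nsq lborel (%p. u (p + s) - u p) <= 4*(e/16)"
  proof -
   have "nsq lborel u <= e/16" using le by (simp add: u_def[abs_def])
   then show ?thesis using L2_diff(2)[OF L2_shift(1)[OF Lu] Lu, of s] L2_shift(2)[OF Lu, of s] by linarith
  qed
  have "nsq lborel (%p. (u (p + s) - u p) + (h' (p + s) - h' p)) <= 2*(4*(e/16)) + 2*(e/8)"
   using L2_add(2)[OF L2_diff(1)[OF L2_shift(1)[OF Lu] Lu] L2_diff(1)[OF L2_shift(1)[OF L'] L'], of s s] 1 elim e
   by linarith
  moreover have "(%p. (u (p + s) - u p) + (h' (p + s) - h' p)) = (%p. h (p + s) - h p)" by (auto simp: u_def)
  moreover have "nsq lborel (%p. (u (p + s) - u p) + (h' (p + s) - h' p)) < e"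
   using L2_add(2)[OF L2_diff(1)[OF L2_shift(1)[OF Lu] Lu] L2_diff(1)[OF L2_shift(1)[OF L'] L'], of s s] 1 elim e
   by linarith
  ultimately show ?case by (simp add: dist_real_def)
 qed
qed

lemma translation_continuous_add:
 assumes f: "translation_continuous f" and g: "translation_continuous g"
 shows "translation_continuous (%p. f p + g p)"
proof -
 have L: "L2 lborel f" "L2 lborel g" using f g by (auto simp: translation_continuous_def)
 have "((%s. 2*nsq lborel (%p. f (p + s) - f p) + 2*nsq lborel (%p. g (p + s) - g p)) \<longlongrightarrow> 2*0 + 2*0) (at 0)"
  using f g by (intro tendsto_intros) (auto simp: translation_continuous_def)
 moreover have "nsq lborel (%p. (f (p + s) + g (p + s)) - (f p + g p)) <= 2*nsq lborel (%p. f (p + s) - f p) + 2*nsq lborel (%p. g (p + s) - g p)" for s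
  using L2_add(2)[OF L2_diff(1)[OF L2_shift(1)[OF L(1)] L(1)] L2_diff(1)[OF L2_shift(1)[OF L(2)] L(2)], of s s]
  by (simp add: algebra_simps)
 ultimately have "((%s. nsq lborel (%p. (f (p + s) + g (p + s)) - (f p + g p))) \<longlongrightarrow> 0) (at 0)"
  by (intro tendsto_sandwich[OF _ _ tendsto_const, of 0 "%s. nsq lborel (%p. (f (p + s) + g (p + s)) - (f p + g p))" "at 0"
     "%s. 2*nsq lborel (%p. f (p + s) - f p) + 2*nsq lborel (%p. g (p + s) - g p)"])
    (auto intro!: always_eventually)
 then show ?thesis unfolding translation_continuous_def using L2_add(1)[OF L] by simp
qed

lemma translation_continuous_cmult:
 assumes f: "translation_continuous f" shows "translation_continuous (%p. c*f p)"
proof -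
 have L: "L2 lborel f" using f by (auto simp: translation_continuous_def)
 have "nsq lborel (%p. c*f (p + s) - c*f p) = (norm c)^2*nsq lborel (%p. f (p + s) - f p)" for s
  using L2_cmult(2)[OF L2_diff(1)[OF L2_shift(1)[OF L] L], of c s] by (simp add: algebra_simps)
 then show ?thesis using f L2_cmult(1)[OF L] tendsto_mult_right_zero[of _ "at 0" "(norm c)^2"]
  by (auto simp: translation_continuous_def)
qed

lemma translation_continuous_sum:
 "(!!i. i \<in> I ==> translation_continuous (f i)) ==> translation_continuous (%p. \<Sum>i\<in>I. f i p)"
proof (induction I rule: infinite_finite_induct)
 case (insert x F)
 then show ?case by (simp add: translation_continuous_add)
qed (auto simp: translation_continuous_def)

text \<open>Open sets of finite measure approximate Borel sets from outside, and simple functions approximate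
 in the mean.\<close>

theorem L2_translation_continuous:
 fixes h :: "'a::euclidean_space => complex"
 assumes L: "L2 lborel h" shows "translation_continuous h"
proof -
 have ind: "translation_continuous (%p. of_real (indicator B p))"
  if B [measurable]: "B \<in> sets borel" and fin: "emeasure lborel B < \<infinity>" for B :: "'a set"
 proof (rule translation_continuous_approx)
  have iB: "L1 (indicator B :: 'a => real)" using fin by simp
  show "L2 lborel (%p. complex_of_real (indicator B p))"
   by (rule L2_indicator[OF B fin])
  fix e :: real assume e: "e > 0"
  obtain U where U: "open U" "B \<subseteq> U" "emeasure lborel (U - B) < ennreal e"
   using outer_regular_lborel[OF B e] by auto
  have [measurable]: "U \<in> sets borel" using U by simp
  have "emeasure lborel U <= emeasure lborel B + emeasure lborel (U - B)"
   using U(2) by (subst plus_emeasure) (auto simp: Un_absorb1)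
  also have "... < \<infinity>" using fin order.strict_trans[OF U(3) ennreal_less_top] by (simp add: less_top[symmetric])
  finally have "translation_continuous (%p. of_real (indicator U p))" by (intro translation_continuous_open U)
  moreover have "nsq lborel (%p. complex_of_real (indicator B p) - of_real (indicator U p)) <= e"
  proof (rule L2_I_nn)
   have "(NI p. nrm2 (complex_of_real (indicator B p) - of_real (indicator U p))) = (NI p. indicator (U - B) p)"
    using U(2) by (intro nn_integral_cong) (auto simp: indicator_def)
   then show "(NI p. nrm2 (complex_of_real (indicator B p) - of_real (indicator U p))) <= ennreal e"
    using U(3) by simp
  qed (use e in auto)
  ultimately show "\<exists>h'. translation_continuous h' \<and> nsq lborel (%p. complex_of_real (indicator B p) - h' p) <= e" by blast
 qed
 have [measurable]: "h \<in> bm" using L by (auto simp: L2_def)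
 obtain s where s: "!!i. simple_function lborel (s i)" "!!p. (%i. s i p) ----> h p" "!!i p. norm (s i p) <= 2*norm (h p)"
 proof -
  obtain F where "\<forall>i. simple_function lborel (F i)" "\<forall>x\<in>space lborel. (%i. F i x) ----> h x"
   "\<forall>i. \<forall>x\<in>space lborel. dist (F i x) 0 <= 2*dist (h x) 0"
   using borel_measurable_implies_sequence_metric[of h lborel 0] by auto
  then show ?thesis using that[of F] by simp
 qed
 have [measurable]: "s i \<in> bm" for i using borel_measurable_simple_function[OF s(1)] by simp
 have Ls: "L2 lborel (s i)" for i by (rule L2_bound(1)[OF L, where C=2]) (auto simp: s)
 have ts: "translation_continuous (s i)" for i
 proof -
  have fr: "finite (range (s i))" using s(1)[of i] by (auto simp: simple_function_def)
  have eq: "s i = (%p. \<Sum>y\<in>range (s i) - {0}. y * of_real (indicator (s i -` {y}) p))"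
  proof
   fix p
   have "(\<Sum>y\<in>range (s i) - {0}. y * of_real (indicator (s i -` {y}) p)) = (\<Sum>y\<in>range (s i). if y = s i p then s i p else 0)"
    using fr by (intro sum.mono_neutral_cong_left) (auto simp: indicator_def)
   then show "s i p = (\<Sum>y\<in>range (s i) - {0}. y * of_real (indicator (s i -` {y}) p))" using fr by simp
  qed
  have "translation_continuous (%p. y * of_real (indicator (s i -` {y}) p))" if y: "y \<noteq> 0" for y
  proof (intro translation_continuous_cmult ind)
   show m: "s i -` {y} \<in> sets borel" using measurable_sets_borel[of "s i" borel "{y}"] by simp
   have "emeasure lborel (s i -` {y})*ennreal ((norm y)^2) = (NI p. ennreal ((norm y)^2)*indicator (s i -` {y}) p)"
    using m by (simp add: nn_integral_cmult mult.commute)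
   also have "... <= (NI p. nrm2 (s i p))"
    by (intro nn_integral_mono) (auto simp: indicator_def)
   also have "... < \<infinity>" using Ls[of i] by (simp add: L2_iff_nn)
   finally show "emeasure lborel (s i -` {y}) < \<infinity>"
    using y by (auto simp: ennreal_mult_less_top less_top ennreal_zero_less_mult_iff)
  qed
  then show ?thesis by (subst eq) (intro translation_continuous_sum, auto)
 qed
 have "(%i. nsq lborel (%p. h p - s i p)) ----> (\<integral>p. 0 \<partial>(lborel :: 'a measure))"
  unfolding nsq_def
 proof (rule integral_dominated_convergence[where w="%p. 9*(norm (h p))^2"])
  show "AE p in lborel. (%i. (norm (h p - s i p))^2) ----> 0"
  proof (rule AE_I2)
   fix p
   have "(%i. (norm (h p - s i p))^2) ----> (norm (h p - h p))^2" by (intro tendsto_intros s)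
   then show "(%i. (norm (h p - s i p))^2) ----> 0" by simp
  qed
  show "AE p in lborel. norm ((norm (h p - s i p))^2) <= 9*(norm (h p))^2" for i
  proof (rule AE_I2)
   fix p
   have "norm (h p - s i p) <= 3*norm (h p)" using norm_triangle_ineq4[of "h p" "s i p"] s(3)[of i p] by linarith
   then have "(norm (h p - s i p))^2 <= (3*norm (h p))^2" by (intro power_mono) auto
   then show "norm ((norm (h p - s i p))^2) <= 9*(norm (h p))^2" by (simp add: power_mult_distrib)
  qed
 qed (use L in \<open>auto simp: L2_def\<close>)
 then have lim: "(%i. nsq lborel (%p. h p - s i p)) ----> 0" by simp
 show ?thesis
 proof (rule translation_continuous_approx[OF L])
  fix e :: real assume "e > 0"
  from order_tendstoD(2)[OF lim this] obtain i where "nsq lborel (%p. h p - s i p) < e"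
   by (auto simp: eventually_sequentially)
  then show "\<exists>h'. translation_continuous h' \<and> nsq lborel (%p. h p - h' p) <= e" using ts[of i] by (intro exI[of _ "s i"]) auto
 qed
qed

subsection \<open>The Plancherel identity\<close>

text \<open>The squared modulus of the transform of \<open>h\<close> is the transform of the autocorrelation of \<open>h\<close>, which is
 continuous at the origin, where its value is the squared norm.\<close>

theorem Plancherel:
 fixes h :: "real \<times> real => complex"
 assumes h: "L1 h" and L: "L2 lborel h"
 shows "L2 lborel (ft h)" "nsq lborel (ft h) = 4*pi^2*nsq lborel h"
proof -
 have [measurable]: "h \<in> bm" using h by auto
 define A where "A s = (LI p. h (p + s)*cnj (h p))" for s
 have [measurable]: "A \<in> bm" unfolding A_def by measurable
 have hs: "L1 (%s. h (p + s))" for p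
  using h lborel_shift(2)[of h p] by (simp add: add.commute)
 have hs': "(LI s. norm (h (p + s))) = (LI s. norm (h s))" for p
  using lborel_shift(1)[of "%s. norm (h s)" p] by (simp add: add.commute)
 have int0: "integrable (lborel \<Otimes>\<^sub>M lborel) (%(p, s). h (p + s)*cnj (h p))"
 proof (rule lborel_pair.Fubini_integrable)
  show "L1 (%p. LI s. norm (case (p, s) of (p, s) => h (p + s)*cnj (h p)))"
   using h by (simp add: norm_mult hs')
  show "AE p in lborel. L1 (%s. case (p, s) of (p, s) => h (p + s)*cnj (h p))"
   using hs by simp
  show "(%(p, s). h (p + s)*cnj (h p)) \<in> borel_measurable (lborel \<Otimes>\<^sub>M lborel)" by measurable
 qed
 have iA: "L1 A"
  unfolding A_def by (rule lborel_pair.integrable_snd[OF int0])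
 have ftA: "ft A q = of_real ((norm (ft h q))^2)" for q
 proof -
  have int: "integrable (lborel \<Otimes>\<^sub>M lborel) (%(p, s). h (p + s)*cnj (h p)*cis (s \<bullet> q))"
   by (rule integrable_bound[OF int0]) (auto simp: norm_mult)
  have "ft A q = (LI s. LI p. h (p + s)*cnj (h p)*cis (s \<bullet> q))"
   by (simp add: ft_def A_def)
  also have "... = (LI p. LI s. h (p + s)*cnj (h p)*cis (s \<bullet> q))"
   by (rule lborel_pair.Fubini_integral[OF int])
  also have "... = (LI p. (cnj (h p)*cis (- (p \<bullet> q)))*ft h q)"
  proof (intro LI_cong)
   fix p :: "real \<times> real"
   have "(LI s. h (p + s)*cnj (h p)*cis (s \<bullet> q)) = (LI s. (cnj (h p)*cis (- (p \<bullet> q)))*(h (s + p)*cis ((s + p) \<bullet> q)))"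
   proof (intro LI_cong)
    fix s
    have "cis (s \<bullet> q) = cis (- (p \<bullet> q))*cis ((s + p) \<bullet> q)" by (simp add: cis_mult inner_add_left)
    then show "h (p + s)*cnj (h p)*cis (s \<bullet> q) = (cnj (h p)*cis (- (p \<bullet> q)))*(h (s + p)*cis ((s + p) \<bullet> q))"
     by (simp add: add.commute mult_ac)
   qed
   also have "... = (cnj (h p)*cis (- (p \<bullet> q)))*(LI s. h (s + p)*cis ((s + p) \<bullet> q))" by simp
   also have "(LI s. h (s + p)*cis ((s + p) \<bullet> q)) = ft h q"
    unfolding ft_def by (rule lborel_shift(1)[where f="%s. h s*cis (s \<bullet> q)"]) measurable
   finally show "(LI s. h (p + s)*cnj (h p)*cis (s \<bullet> q)) = (cnj (h p)*cis (- (p \<bullet> q)))*ft h q" .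
  qed
  also have "... = cnj (ft h q)*ft h q"
  proof -
   have "(LI p. cnj (h p)*cis (- (p \<bullet> q))) = cnj (ft h q)"
   proof -
    have "(LI p. cnj (h p)*cis (- (p \<bullet> q))) = (LI p. cnj (h p*cis (p \<bullet> q)))"
     by (intro LI_cong) (simp add: cis_cnj)
    also have "... = cnj (LI p. h p*cis (p \<bullet> q))"
    proof (rule integral_bounded_linear[OF bounded_linear_cnj])
     show "L1 (%p. h p*cis (p \<bullet> q))"
      by (rule integrable_bound[OF h]) (auto simp: norm_mult)
    qed
    finally show ?thesis unfolding ft_def .
   qed
   then show ?thesis by simp
  qed
  finally show ?thesis by (simp only: complex_norm_square mult.commute)
 qed
 have A0: "A 0 = of_real (nsq lborel h)"
  by (simp add: A_def nsq_def complex_norm_square flip: integral_complex_of_real of_real_power)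
 have Ab: "norm (A s) <= nsq lborel h" for s
  using L2_norm_integral_le[OF L2_shift(1)[OF L] L2_cnj[OF L], of s]
  by (simp add: A_def L2_shift(2)[OF L] nsq_cnj)
 have "isCont A 0"
  unfolding isCont_def
 proof (rule Lim_transform[OF tendsto_const Lim_null_comparison])
  have "((%s. sqrt (nsq lborel (%p. h (p + s) - h p)*nsq lborel h)) \<longlongrightarrow> sqrt (0*nsq lborel h)) (at 0)"
   using L2_translation_continuous[OF L] by (intro tendsto_intros) (auto simp: translation_continuous_def)
  then show "((%s. sqrt (nsq lborel (%p. h (p + s) - h p)*nsq lborel h)) \<longlongrightarrow> 0) (at 0)" by simp
  show "\<forall>\<^sub>F s in at 0. norm (A s - A 0) <= sqrt (nsq lborel (%p. h (p + s) - h p)*nsq lborel h)"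
  proof (rule always_eventually, rule allI)
   fix s
   have "A s - A 0 = (LI p. (h (p + s) - h p)*cnj (h p))"
    unfolding A_def
    by (subst Bochner_Integration.integral_diff[symmetric]) (auto intro!: L2_mult_integrable L2_shift L L2_cnj simp: algebra_simps)
   then show "norm (A s - A 0) <= sqrt (nsq lborel (%p. h (p + s) - h p)*nsq lborel h)"
    using L2_norm_integral_le[OF L2_diff(1)[OF L2_shift(1)[OF L] L] L2_cnj[OF L], of s] by (simp add: nsq_cnj)
  qed
 qed
 define g where "g n q = exp (- ((shrink n)^2*(q \<bullet> q))/2)" for n and q :: "real \<times> real"
 have g: "gauss (shrink n *\<^sub>R q) = of_real (g n q)" for n q
  by (simp add: gauss_def g_def power2_eq_square)
 have g0: "\<bar>g n q\<bar> = g n q" for n q by (simp add: g_def)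
 have ig: "L1 (%q. (norm (ft h q))^2*g n q)" for n
 proof -
  have "L1 (%q. g n q)"
   using integrable_norm[OF integrable_gauss_scaled[OF shrink_pos[of n]]]
   by (simp add: g g0)
  then have i: "L1 (%q. (LI p. norm (h p))^2*g n q)" by simp
  show ?thesis
   by (rule integrable_bound[OF i])
     (auto simp: g_def abs_mult intro!: mult_right_mono power_mono ft_norm_le)
 qed
 have "(%n. 2*pi*(LI v. A (shrink n *\<^sub>R v)*gauss v)) ----> 2*pi*(2*pi*A 0)"
  by (intro tendsto_mult tendsto_const gauss_approximate_identity[OF _ Ab \<open>isCont A 0\<close>]) measurable
 moreover have "2*pi*(LI v. A (shrink n *\<^sub>R v)*gauss v) = of_real (LI q. (norm (ft h q))^2*g n q)" for n
 proof -
  have "(LI q. ft A q*gauss (shrink n *\<^sub>R q)) = (LI q. complex_of_real ((norm (ft h q))^2*g n q))"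
   by (simp add: ftA g)
  also have "... = of_real (LI q. (norm (ft h q))^2*g n q)" by (rule integral_complex_of_real)
  finally show ?thesis unfolding ft_mult_gauss[OF iA shrink_pos] .
 qed
 ultimately have lim: "(%n. LI q. (norm (ft h q))^2*g n q) ----> 4*pi^2*nsq lborel h"
 proof -
  assume "(%n. 2*pi*(LI v. A (shrink n *\<^sub>R v)*gauss v)) ----> 2*pi*(2*pi*A 0)"
   "!!n. 2*pi*(LI v. A (shrink n *\<^sub>R v)*gauss v) = of_real (LI q. (norm (ft h q))^2*g n q)"
  then have "(%n. complex_of_real (LI q. (norm (ft h q))^2*g n q)) ----> 2*pi*(2*pi*A 0)" by simp
  also have "2*pi*(2*pi*A 0) = complex_of_real (4*pi^2*nsq lborel h)" by (simp add: A0 power2_eq_square)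
  finally show ?thesis by (simp only: tendsto_of_real_iff)
 qed
 have inc: "g n q <= g (Suc n) q" for n q
 proof -
  have "(shrink (Suc n))^2*(q \<bullet> q) <= (shrink n)^2*(q \<bullet> q)"
   by (intro mult_right_mono power_mono shrink_antimono) auto
  then show ?thesis by (simp add: g_def)
 qed
 have "(NI q. nrm2 (ft h q)) = (NI q. (SUP n. ennreal ((norm (ft h q))^2*g n q)))"
 proof (intro nn_integral_cong)
  fix q
  have "(%n. complex_of_real (g n q)) ----> of_real 1" using gauss_scaled_tendsto_1[of q] by (simp add: g)
  then have "(%n. g n q) ----> 1" by (simp only: tendsto_of_real_iff)
  then have "(%n. (norm (ft h q))^2*g n q) ----> (norm (ft h q))^2*1" by (intro tendsto_intros)
  then have "(%n. ennreal ((norm (ft h q))^2*g n q)) ----> nrm2 (ft h q)" by (intro tendsto_ennrealI) simp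
  moreover have "(%n. ennreal ((norm (ft h q))^2*g n q)) ----> (SUP n. ennreal ((norm (ft h q))^2*g n q))"
   by (intro LIMSEQ_SUP incseq_SucI ennreal_leI mult_left_mono inc) simp
  ultimately show "nrm2 (ft h q) = (SUP n. ennreal ((norm (ft h q))^2*g n q))" by (rule LIMSEQ_unique)
 qed
 also have "... = (SUP n. NI q. ennreal ((norm (ft h q))^2*g n q))"
 proof (rule nn_integral_monotone_convergence_SUP)
  show "incseq (%n q. ennreal ((norm (ft h q))^2*g n q))"
   by (intro incseq_SucI le_funI ennreal_leI mult_left_mono inc) simp
  show "(%q. ennreal ((norm (ft h q))^2*g n q)) \<in> borel_measurable lborel" for n
   unfolding g_def by measurable
 qed
 also have "... = (SUP n. ennreal (LI q. (norm (ft h q))^2*g n q))"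
  by (subst nn_integral_eq_integral[OF ig]) (auto simp: g_def)
 also have "... = ennreal (4*pi^2*nsq lborel h)"
 proof (rule LIMSEQ_unique[OF LIMSEQ_SUP])
  show "incseq (%n. ennreal (LI q. (norm (ft h q))^2*g n q))"
   by (intro incseq_SucI ennreal_leI integral_mono ig mult_left_mono inc) simp
  show "(%n. ennreal (LI q. (norm (ft h q))^2*g n q)) ----> ennreal (4*pi^2*nsq lborel h)"
   by (intro tendsto_ennrealI lim)
 qed
 finally have eq: "(NI q. nrm2 (ft h q)) = ennreal (4*pi^2*nsq lborel h)" .
 show Lf: "L2 lborel (ft h)" unfolding L2_iff_nn eq by simp
 show "nsq lborel (ft h) = 4*pi^2*nsq lborel h"
  using eq nn_nsq[OF Lf] by simp
qed

section \<open>Laplace transforms on tubes over open sets\<close>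

definition Lap :: "(real \<times> real => complex) => complex \<times> complex => complex" where
 "Lap g P = (LI q. wave P q*g q)"

definition lap_on :: "(real \<times> real) set => (real \<times> real => complex) => bool" where
 "lap_on U g \<longleftrightarrow> open U \<and> g \<in> bm \<and>
   (\<forall>(X, Y)\<in>U. L1 (%q. exp (fst q*X - snd q*Y)*norm (g q)))"

abbreviation tube_pt :: "complex \<times> complex => real \<times> real" where
 "tube_pt P \<equiv> (Re (fst P), Im (snd P))"

lemma lap_on_measurable: "lap_on U g ==> g \<in> bm"
 by (simp add: lap_on_def)

lemma lap_on_integrable:
 "lap_on U g ==> (X, Y) \<in> U ==> L1 (%q. exp (fst q*X - snd q*Y)*norm (g q))"
 by (auto simp: lap_on_def)

lemma Lap_kernel_measurable [measurable]:
 "(%q. exp (of_real (fst q)*Z + \<i> * of_real (snd q)*W) :: complex) \<in> bm"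
proof -
 have "continuous_on UNIV (%q::real\<times>real. exp (of_real (fst q)*Z + \<i> * of_real (snd q)*W) :: complex)"
  by (intro continuous_intros)
 then show ?thesis by (rule borel_measurable_continuous_onI)
qed

lemma norm_Lap_kernel:
 "norm (wave P q) = exp (fst q * Re (fst P) - snd q*Im (snd P))"
 by (simp add: norm_exp_eq_Re)

text \<open>The exponential weight at the centre of a small square, multiplied by the exponential of
 \<open>r (|a| + |\<tau>|)\<close>, is dominated by the sum of the weights at the corners. So integrability at all points of
 an open set absorbs every polynomial factor.\<close>

lemma lap_on_room:
 assumes L: "lap_on U g" and P: "(X, Y) \<in> U"
 obtains r where "r > 0"
  "L1 (%q. exp (fst q*X - snd q*Y)*exp (r*(\<bar>fst q\<bar> + \<bar>snd q\<bar>))*norm (g q))"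
proof -
 have [measurable]: "g \<in> bm" by (rule lap_on_measurable[OF L])
 obtain e where e: "e > 0" "ball (X, Y) e \<subseteq> U" using L P by (auto simp: lap_on_def open_contains_ball)
 define r where "r = e/2"
 have r: "r > 0" using e by (simp add: r_def)
 have corner: "(X + s, Y + t) \<in> U" if "\<bar>s\<bar> = r" "\<bar>t\<bar> = r" for s t
 proof -
  have "dist (X, Y) (X + s, Y + t) = sqrt (s^2 + t^2)" by (simp add: dist_Pair_Pair dist_real_def)
  also have "s^2 + t^2 = 2*r^2" using that by (metis mult_2 power2_abs)
  also have "sqrt (2*r^2) < e"
   by (rule real_sqrt_less_mono[of _ "e^2", simplified real_sqrt_abs abs_of_pos[OF e(1)]])
     (use e in \<open>simp add: r_def power2_eq_square\<close>)
  finally show ?thesis using e by auto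
 qed
 have i: "L1 (%q. exp (fst q*(X + s) - snd q*(Y + t))*norm (g q))"
  if "\<bar>s\<bar> = r" "\<bar>t\<bar> = r" for s t by (rule lap_on_integrable[OF L corner[OF that]])
 define G where "G q = exp (fst q*(X + r) - snd q*(Y + r))*norm (g q) + exp (fst q*(X + r) - snd q*(Y + - r))*norm (g q)
   + exp (fst q*(X + - r) - snd q*(Y + r))*norm (g q) + exp (fst q*(X + - r) - snd q*(Y + - r))*norm (g q)" for q
 have iG: "L1 G" unfolding G_def
  by (intro Bochner_Integration.integrable_add i) (use r in auto)
 have le: "exp (fst q*X - snd q*Y)*exp (r*(\<bar>fst q\<bar> + \<bar>snd q\<bar>))*norm (g q) <= G q" for q
 proof -
  define s where "s = (if fst q >= 0 then r else - r)"
  define t where "t = (if snd q >= 0 then - r else r)"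
  have eq: "fst q*X - snd q*Y + r*(\<bar>fst q\<bar> + \<bar>snd q\<bar>) = fst q*(X + s) - snd q*(Y + t)"
   by (auto simp: s_def t_def algebra_simps)
  have "exp (fst q*X - snd q*Y)*exp (r*(\<bar>fst q\<bar> + \<bar>snd q\<bar>))*norm (g q) = exp (fst q*(X + s) - snd q*(Y + t))*norm (g q)"
   unfolding exp_add[symmetric] eq ..
  also have "... <= G q" unfolding G_def s_def t_def by (auto intro!: add_nonneg_nonneg)
  finally show ?thesis .
 qed
 have "L1 (%q. exp (fst q*X - snd q*Y)*exp (r*(\<bar>fst q\<bar> + \<bar>snd q\<bar>))*norm (g q))"
  by (rule integrable_bound[OF iG]) (auto intro!: AE_I2 order_trans[OF le])
 then show ?thesis using that r by blast
qed

lemma lap_on_weight: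
 assumes L: "lap_on U g" and [measurable]: "w \<in> bm"
  and w: "!!q. norm (w q) <= \<bar>fst q\<bar> + \<bar>snd q\<bar>"
 shows "lap_on U (%q. w q*g q)"
proof -
 have [measurable]: "g \<in> bm" by (rule lap_on_measurable[OF L])
 have "L1 (%q. exp (fst q*X - snd q*Y)*norm (w q*g q))" if P: "(X, Y) \<in> U" for X Y
 proof -
  obtain r where r: "r > 0"
   "L1 (%q. exp (fst q*X - snd q*Y)*exp (r*(\<bar>fst q\<bar> + \<bar>snd q\<bar>))*norm (g q))"
   using lap_on_room[OF L P] .
  have i: "L1 (%q. inverse r*(exp (fst q*X - snd q*Y)*exp (r*(\<bar>fst q\<bar> + \<bar>snd q\<bar>))*norm (g q)))"
   using r(2) by (intro integrable_mult_right)
  show ?thesis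
  proof (rule integrable_bound[OF i])
   show "AE q in lborel. norm (exp (fst q*X - snd q*Y)*norm (w q*g q))
     <= norm (inverse r*(exp (fst q*X - snd q*Y)*exp (r*(\<bar>fst q\<bar> + \<bar>snd q\<bar>))*norm (g q)))"
   proof (rule AE_I2)
    fix q :: "real \<times> real"
    have "r*norm (w q) <= r*(\<bar>fst q\<bar> + \<bar>snd q\<bar>)" using w[of q] r by simp
    also have "... <= exp (r*(\<bar>fst q\<bar> + \<bar>snd q\<bar>))" using exp_ge_add_one_self[of "r*(\<bar>fst q\<bar> + \<bar>snd q\<bar>)"] by linarith
    finally have "norm (w q) <= inverse r*exp (r*(\<bar>fst q\<bar> + \<bar>snd q\<bar>))" using r by (simp add: field_simps)
    then have "exp (fst q*X - snd q*Y)*norm (g q)*norm (w q) <= exp (fst q*X - snd q*Y)*norm (g q)*(inverse r*exp (r*(\<bar>fst q\<bar> + \<bar>snd q\<bar>)))"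
     by (rule mult_left_mono) simp
    then show "norm (exp (fst q*X - snd q*Y)*norm (w q*g q))
     <= norm (inverse r*(exp (fst q*X - snd q*Y)*exp (r*(\<bar>fst q\<bar> + \<bar>snd q\<bar>))*norm (g q)))"
     using r by (simp add: norm_mult abs_mult mult_ac)
   qed
  qed measurable
 qed
 then show ?thesis using L by (auto simp: lap_on_def)
qed

lemma lap_on_fst: "lap_on U g ==> lap_on U (%q. of_real (fst q)*g q)"
 by (rule lap_on_weight) auto

lemma lap_on_snd: "lap_on U g ==> lap_on U (%q. \<i> * of_real (snd q)*g q)"
 by (rule lap_on_weight) (auto simp: norm_mult)

lemma Lap_integrable:
 assumes L: "lap_on U g" and P: "tube_pt P \<in> U"
 shows "L1 (%q. wave P q*g q)"
proof -
 have [measurable]: "g \<in> bm" by (rule lap_on_measurable[OF L])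
 have "L1 (%q. exp (fst q * Re (fst P) - snd q*Im (snd P))*norm (g q))"
  using L P by (auto simp: lap_on_def)
 then show ?thesis
  by (rule integrable_bound) (auto simp: norm_mult norm_Lap_kernel)
qed

text \<open>The remainder of the exponential is quadratic in the increment, and the room around the point absorbs the polynomial factors.\<close>

theorem Lap_has_derivative:
 assumes L: "lap_on U g" and P: "tube_pt P \<in> U"
 shows "(Lap g has_derivative (%(u, v). Lap (%q. of_real (fst q)*g q) P*u + Lap (%q. \<i> * of_real (snd q)*g q) P * v)) (at P)"
proof -
 have [measurable]: "g \<in> bm" by (rule lap_on_measurable[OF L])
 obtain r where r: "r > 0"
  "L1 (%q. exp (fst q * Re (fst P) - snd q*Im (snd P))*exp (r*(\<bar>fst q\<bar> + \<bar>snd q\<bar>))*norm (g q))"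
  using lap_on_room[OF L P] .
 obtain e where e: "e > 0" "ball (tube_pt P) e \<subseteq> U" using L P by (auto simp: lap_on_def open_contains_ball)
 define d where "d = min e (r/3)"
 have d: "d > 0" "d <= e" "d <= r/3" using e r by (auto simp: d_def)
 define E where "E q = wave P q" for q
 define l where "l q h = of_real (fst q)*fst h + \<i> * of_real (snd q) * snd h" for q and h :: "complex \<times> complex"
 define f' where "f' h = Lap (%q. of_real (fst q)*g q) P*fst h + Lap (%q. \<i> * of_real (snd q)*g q) P * snd h" for h
 define C where "C = (9/r^2)*(LI q. exp (fst q * Re (fst P) - snd q*Im (snd P))*exp (r*(\<bar>fst q\<bar> + \<bar>snd q\<bar>))*norm (g q))"
 have [measurable]: "E \<in> bm" unfolding E_def by measurable
 have [measurable]: "(%q. l q h) \<in> bm" for h unfolding l_def by measurable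
 have lb: "norm (l q h) <= norm h*(\<bar>fst q\<bar> + \<bar>snd q\<bar>)" for q h
 proof -
  have "norm (l q h) <= \<bar>fst q\<bar>*norm (fst h) + \<bar>snd q\<bar>*norm (snd h)"
   unfolding l_def by (rule order_trans[OF norm_triangle_ineq]) (simp add: norm_mult)
  also have "... <= \<bar>fst q\<bar>*norm h + \<bar>snd q\<bar>*norm h"
   by (intro add_mono mult_left_mono norm_fst_le norm_snd_le) (cases h; auto intro: norm_fst_le norm_snd_le)+
  finally show ?thesis by (simp add: algebra_simps)
 qed
 have f'_eq: "f' h = (LI q. E q*l q h*g q)" for h
 proof -
  have "f' h = (LI q. E q*(of_real (fst q)*g q))*fst h + (LI q. E q*(\<i> * of_real (snd q)*g q)) * snd h"
   by (simp add: f'_def Lap_def E_def)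
  also have "... = (LI q. E q*(of_real (fst q)*g q)*fst h) + (LI q. E q*(\<i> * of_real (snd q)*g q) * snd h)"
   by simp
  also have "... = (LI q. E q*(of_real (fst q)*g q)*fst h + E q*(\<i> * of_real (snd q)*g q) * snd h)"
   unfolding E_def
   by (intro Bochner_Integration.integral_add[symmetric] integrable_mult_left
     Lap_integrable[OF lap_on_fst[OF L] P] Lap_integrable[OF lap_on_snd[OF L] P])
  finally show ?thesis by (simp add: l_def algebra_simps)
 qed
 have est: "norm (Lap g (P + h) - Lap g P - f' h) <= C*(norm h)^2" if h: "norm h < d" for h
 proof -
  have Ph: "tube_pt (P + h) \<in> U"
  proof -
   have "norm (Re (fst h), Im (snd h)) <= norm h"
    by (cases h) (simp add: norm_Pair cmod_power2)
   moreover have "dist (tube_pt P) (tube_pt (P + h)) = norm (Re (fst h), Im (snd h))"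
    by (simp add: dist_norm norm_Pair)
   ultimately have "tube_pt (P + h) \<in> ball (tube_pt P) e" using h d by (simp add: mem_ball)
   then show ?thesis using e by blast
  qed
  have i1: "L1 (%q. E q*exp (l q h)*g q)"
   using Lap_integrable[OF L Ph] by (simp add: E_def l_def exp_add[symmetric] algebra_simps)
  have i2: "L1 (%q. E q*g q)" unfolding E_def by (rule Lap_integrable[OF L P])
  have i3: "L1 (%q. E q*l q h*g q)"
  proof -
   have "L1 (%q. E q*(of_real (fst q)*g q)*fst h + E q*(\<i> * of_real (snd q)*g q) * snd h)"
    unfolding E_def
    by (intro Bochner_Integration.integrable_add integrable_mult_left
     Lap_integrable[OF lap_on_fst[OF L] P] Lap_integrable[OF lap_on_snd[OF L] P])
   then show ?thesis by (simp add: l_def algebra_simps)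
  qed
  have "Lap g (P + h) - Lap g P - f' h = (LI q. E q*exp (l q h)*g q) - (LI q. E q*g q) - (LI q. E q*l q h*g q)"
   unfolding f'_eq by (simp add: Lap_def E_def l_def exp_add[symmetric] algebra_simps)
  also have "... = (LI q. E q*exp (l q h)*g q - E q*g q - E q*l q h*g q)"
   using i1 i2 i3 by simp
  finally have eq: "Lap g (P + h) - Lap g P - f' h = (LI q. E q*exp (l q h)*g q - E q*g q - E q*l q h*g q)" .
  have "norm (Lap g (P + h) - Lap g P - f' h)
   <= (LI q. (norm h)^2*(9/r^2)*(exp (fst q * Re (fst P) - snd q*Im (snd P))*exp (r*(\<bar>fst q\<bar> + \<bar>snd q\<bar>))*norm (g q)))"
   unfolding eq
  proof (rule order_trans[OF integral_norm_bound], rule integral_mono)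
   fix q :: "real \<times> real"
   define s where "s = \<bar>fst q\<bar> + \<bar>snd q\<bar>"
   have s0: "s >= 0" by (simp add: s_def)
   have "norm (exp (l q h) - 1 - l q h) <= (norm (l q h))^2*exp (norm (l q h))" by (rule exp_quadratic_bound)
   also have "... <= (norm h * s)^2*exp (r/3 * s)"
   proof -
    have "norm h * s <= r/3 * s" using h d s0 by (intro mult_right_mono) auto
    moreover have "norm (l q h) <= norm h * s" using lb[of q h] by (simp add: s_def)
    ultimately show ?thesis by (intro mult_mono power_mono) auto
   qed
   also have "... = (norm h)^2*(9/r^2)*((r/3 * s)^2*exp (r/3 * s))"
    using r by (simp add: power2_eq_square field_simps)
   also have "... <= (norm h)^2*(9/r^2)*((exp (r/3 * s))^2*exp (r/3 * s))"
   proof -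
    have "r/3 * s <= exp (r/3 * s)" using exp_ge_add_one_self[of "r/3 * s"] by linarith
    moreover have "0 <= r/3 * s" using r s0 by simp
    ultimately show ?thesis by (intro mult_left_mono mult_right_mono power_mono) auto
   qed
   also have "(exp (r/3 * s))^2*exp (r/3 * s) = exp (r * s)"
    by (simp add: power2_eq_square exp_add[symmetric])
   finally have b: "norm (exp (l q h) - 1 - l q h) <= (norm h)^2*(9/r^2)*exp (r * s)" .
   have "norm (E q*exp (l q h)*g q - E q*g q - E q*l q h*g q) = norm (exp (l q h) - 1 - l q h)*(norm (E q)*norm (g q))"
    by (simp add: norm_mult[symmetric] algebra_simps)
   also have "... <= ((norm h)^2*(9/r^2)*exp (r * s))*(norm (E q)*norm (g q))"
    by (intro mult_right_mono b) simp
   finally show "norm (E q*exp (l q h)*g q - E q*g q - E q*l q h*g q)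
    <= (norm h)^2*(9/r^2)*(exp (fst q * Re (fst P) - snd q*Im (snd P))*exp (r*(\<bar>fst q\<bar> + \<bar>snd q\<bar>))*norm (g q))"
    by (simp add: E_def norm_Lap_kernel s_def mult_ac)
  qed (use r i1 i2 i3 in auto)
  then show ?thesis unfolding C_def integral_mult_right_zero by (simp only: mult_ac)
 qed
 have "(Lap g has_derivative f') (at P)"
 proof (rule has_derivativeI_sandwich[OF d(1)])
  show "bounded_linear f'" unfolding f'_def
   by (intro bounded_linear_intros)
  show "norm (Lap g Q - Lap g P - f' (Q - P))/norm (Q - P) <= C*norm (Q - P)" if "Q \<noteq> P" "dist Q P < d" for Q
   using est[of "Q - P"] that by (simp add: dist_norm divide_le_eq power2_eq_square mult_ac)
  show "((%Q. C*norm (Q - P)) \<longlongrightarrow> 0) (at P)"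
   by (rule tendsto_eq_intros | simp)+
 qed
 then show ?thesis by (rule back_subst[of "%f. (Lap g has_derivative f) (at P)"]) (auto simp: f'_def)
qed

text \<open>On a slice the Laplace transform is the Fourier transform of an exponential multiple.\<close>

lemma Lap_slice:
 "Lap g (Complex x y, Complex t h) = ft (%q. tilt x h q*g q) (y, t)"
 unfolding Lap_def ft_def
 by (intro LI_cong)
   (simp add: exp_eq_polar algebra_simps case_prod_beta inner_prod_def)

section \<open>The weight\<close>

definition weight :: "real poly => real \<times> real => ennreal" where
 "weight b q = (NI l. ennreal (exp (2*(fst q*l - snd q*poly b l))))"

definition inv_weight :: "real poly => real \<times> real => real" where
 "inv_weight b q = (if snd q > 0 then 1/enn2real (weight b q) else 0)"

lemma measurable_poly [measurable]: "poly (b :: real poly) \<in> bm"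
 by (intro borel_measurable_continuous_onI continuous_intros)

lemma measurable_weight [measurable]: "weight b \<in> bm"
 unfolding weight_def by measurable

lemma measurable_inv_weight [measurable]: "inv_weight b \<in> bm"
 unfolding inv_weight_def by measurable

lemma inv_weight_nonneg [simp]: "0 <= inv_weight b q"
 by (simp add: inv_weight_def)

text \<open>The terms of lower degree are at most half of the leading term outside of a compact interval.\<close>

lemma poly_even_lower_bound:
 fixes b :: "real poly"
 assumes "even (degree b)" "0 < degree b" "0 < lead_coeff b"
 obtains C where "C >= 0" "!!x. poly b x >= lead_coeff b/2*x^degree b - C"
proof -
 define m where "m = degree b"
 define p where "p = b - monom (lead_coeff b/2) m"
 have cp: "coeff p m = lead_coeff b/2" by (simp add: p_def m_def)
 have dp: "degree p = m"
  using assms(3) cp by (intro antisym degree_le) (auto simp: p_def m_def coeff_eq_0 intro!: le_degree)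
 have lp: "lead_coeff p > 0" using assms dp cp by simp
 have pe: "poly p x = poly b x - lead_coeff b/2*x^m" for x by (simp add: p_def poly_monom)
 define p' where "p' = pcompose p [:0, -1:]"
 have "lead_coeff p' = lead_coeff p" using assms(1) dp unfolding p'_def by (subst lead_coeff_comp) (auto simp: m_def)
 then have lp': "lead_coeff p' > 0" using lp by simp
 obtain n1 where n1: "!!x. x >= n1 ==> poly p x >= lead_coeff p" using poly_pinfty_gt_lc[OF lp] by blast
 obtain n2 where n2: "!!x. x >= n2 ==> poly p' x >= lead_coeff p'" using poly_pinfty_gt_lc[OF lp'] by blast
 define K where "K = {min (-n2) n1 .. max (-n2) n1}"
 have "bounded (poly p ` K)"
  by (intro compact_imp_bounded compact_continuous_image continuous_intros) (simp add: K_def)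
 then obtain B where B: "!!x. x \<in> K ==> \<bar>poly p x\<bar> <= B" by (auto simp: bounded_iff)
 have "poly p x >= - max B 0" for x
 proof -
  consider "x >= n1" | "-x >= n2" | "x \<in> K" unfolding K_def by fastforce
  then show ?thesis
  proof cases
   case 1 then show ?thesis using n1[of x] lp by linarith
  next
   case 2 then show ?thesis using n2[of "-x"] lp' by (simp add: p'_def poly_pcompose)
  next
   case 3 then show ?thesis using B[of x] by linarith
  qed
 qed
 then have "poly b x >= lead_coeff b/2*x^degree b - max B 0" for x
  using pe[of x] unfolding m_def by (smt (verit))
 then show ?thesis by (intro that[of "max B 0"]) auto
qed

lemma poly_even_quadratic_bound:
 fixes b :: "real poly"
 assumes "even (degree b)" "0 < degree b" "0 < lead_coeff b"
 obtains c C where "c > 0" "!!x. poly b x >= c*x^2 - C"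
proof -
 obtain C where C: "!!x. poly b x >= lead_coeff b/2*x^degree b - C"
  using poly_even_lower_bound[OF assms] by blast
 obtain k where k: "degree b = 2*k" "k >= 1" using assms(1,2) by (auto elim!: evenE)
 have "x^degree b >= x^2 - 1" for x :: real
 proof (cases "x^2 >= 1")
  case True
  then have "(x^2)^1 <= (x^2)^k" using k by (intro power_increasing) auto
  then show ?thesis by (simp add: k power_mult)
 next
  case False
  moreover have "0 <= x^degree b" by (rule zero_le_even_power[OF assms(1)])
  ultimately show ?thesis by linarith
 qed
 then have k1: "lead_coeff b/2*x^degree b >= lead_coeff b/2*(x^2 - 1)" for x
  using assms(3) by (intro mult_left_mono) auto
 then have "poly b x >= (lead_coeff b/2)*x^2 - (C + lead_coeff b/2)" for x
  proof -
  have "lead_coeff b/2*(x^2 - 1) = lead_coeff b/2*x^2 - lead_coeff b/2" by (simp add: right_diff_distrib)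
  then show ?thesis using C[of x] k1[of x] by linarith
 qed
 then show ?thesis using that[of "lead_coeff b/2"] assms(3) by auto
qed

lemma poly_local_Lipschitz:
 fixes b :: "real poly"
 obtains L where "L >= 0" "!!x u. \<bar>x\<bar> <= R ==> \<bar>u\<bar> <= 1 ==> poly b (x + u) <= poly b x + L*\<bar>u\<bar>"
proof -
 define K where "K = {-(\<bar>R\<bar>+1)..\<bar>R\<bar>+1}"
 have "bounded (poly (pderiv b) ` K)"
  unfolding K_def by (intro compact_imp_bounded compact_continuous_image continuous_intros) simp
 then obtain B where B: "!!x. x \<in> K ==> \<bar>poly (pderiv b) x\<bar> <= B" unfolding bounded_iff by auto
 have "poly b (x + u) <= poly b x + max B 0*\<bar>u\<bar>" if "\<bar>x\<bar> <= R" "\<bar>u\<bar> <= 1" for x u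
 proof -
  have "norm (poly b (x + u) - poly b x) <= max B 0*norm (x + u - x)"
  proof (rule field_differentiable_bound[of K "poly b" "poly (pderiv b)"])
   show "(poly b has_field_derivative poly (pderiv b) z) (at z within K)" for z
    using poly_DERIV[of b z] by (rule has_field_derivative_at_within)
  qed (use that B in \<open>auto simp: max.coboundedI1 K_def\<close>)
  then show ?thesis by simp
 qed
 then show ?thesis using that[of "max B 0"] by simp
qed

text \<open>Near \<open>x\<close> the exponent changes by at most a constant over the length \<open>1 / (1 + t)\<close>, and half of
 such an interval, on the side given by the sign of \<open>a\<close>, contributes the gain in \<open>a\<close>.\<close>

lemma weight_lower_bound:
 fixes b :: "real poly"
 obtains C where "C > 0" "!!x a t. \<bar>x\<bar> <= R ==> t > 0 ==>
  weight b (a, t) >= ennreal (exp (2*a*x - 2*t*poly b x)*(exp (\<bar>a\<bar>/(1 + t))/(C*(1 + t))))"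
proof -
 obtain L where L: "L >= 0" "!!x u. \<bar>x\<bar> <= R ==> \<bar>u\<bar> <= 1 ==> poly b (x + u) <= poly b x + L*\<bar>u\<bar>"
  using poly_local_Lipschitz[of R b] by blast
 have "weight b (a, t) >= ennreal (exp (2*a*x - 2*t*poly b x)*(exp (\<bar>a\<bar>/(1 + t))/(2*exp (2*L)*(1 + t))))"
  if x: "\<bar>x\<bar> <= R" and t: "t > 0" for x a t
 proof -
  define h where "h = 1/(1 + t)"
  have h: "0 < h" "h <= 1" "t*h <= 1" using t by (auto simp: h_def field_simps)
  define I where "I = (if a >= 0 then {x + h/2..x + h} else {x - h..x - h/2})"
  have I: "I \<in> sets borel" "emeasure lborel I = ennreal (h/2)" using h by (auto simp: I_def)
  define c where "c = exp (2*a*x - 2*t*poly b x)*(exp (\<bar>a\<bar>*h)*exp (- 2*L))"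
  have "ennreal (exp (2*a*x - 2*t*poly b x)*(exp (\<bar>a\<bar>/(1 + t))/(2*exp (2*L)*(1 + t)))) = ennreal (c*(h/2))"
   by (simp add: c_def h_def exp_minus field_simps)
  also have "... = (NI l. ennreal c*indicator I l)"
  proof -
   have "c >= 0" by (simp add: c_def)
   then have "ennreal (c*(h/2)) = ennreal c*ennreal (h/2)" using h by (intro ennreal_mult) auto
   then show ?thesis using I by (simp only: nn_integral_cmult_indicator sets_lborel)
  qed
  also have "... <= weight b (a, t)"
   unfolding weight_def
  proof (rule nn_integral_mono)
   fix l
   show "ennreal c*indicator I l <= ennreal (exp (2*(fst (a, t)*l - snd (a, t)*poly b l)))"
   proof (cases "l \<in> I")
    case True
    define u where "u = l - x"
    have u: "\<bar>u\<bar> <= h" "a*u >= \<bar>a\<bar>*(h/2)"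
    proof -
     show "\<bar>u\<bar> <= h" using True h by (auto simp: I_def u_def split: if_splits)
     show "a*u >= \<bar>a\<bar>*(h/2)"
     proof (cases "a >= 0")
      case True
      have "h/2 <= u" using \<open>l \<in> I\<close> True by (simp add: I_def u_def)
      then have "a*(h/2) <= a*u" using True by (rule mult_left_mono)
      then show ?thesis using True by simp
     next
      case False
      then have "(-a)*(-u) >= (-a)*(h/2)" using \<open>l \<in> I\<close> by (intro mult_left_mono) (auto simp: I_def u_def)
      then show ?thesis using False by simp
     qed
    qed
    have "poly b l <= poly b x + L*\<bar>u\<bar>" using L(2)[of x u] x u h by (simp add: u_def)
    then have "t*poly b l <= t*(poly b x + L*\<bar>u\<bar>)" using t by (intro mult_left_mono) auto
    moreover have "t*(L*\<bar>u\<bar>) <= L"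
    proof -
     have "t*\<bar>u\<bar> <= 1" using u h t by (smt (verit) mult_left_mono)
     then have "L*(t*\<bar>u\<bar>) <= L*1" using L(1) by (intro mult_left_mono) auto
     then show ?thesis by (simp add: mult_ac)
    qed
    ultimately have "t*poly b l <= t*poly b x + L" by (simp add: distrib_left)
    moreover have "a*l = a*x + a*u" by (simp add: u_def algebra_simps)
    ultimately have "2*a*x - 2*t*poly b x + (\<bar>a\<bar>*h + - 2*L) <= 2*(a*l - t*poly b l)" using u(2) by (simp add: mult.assoc)
    then have "c <= exp (2*(a*l - t*poly b l))" unfolding c_def exp_add[symmetric] by simp
    then show ?thesis using True by (simp add: ennreal_leI)
   qed simp
  qed
  finally show ?thesis .
 qed
 then show ?thesis using that[of "2*exp (2*L)"] by simp
qed

lemma weight_pos: "weight b q > 0"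
proof -
 have "weight b q \<noteq> 0"
 proof
  assume "weight b q = 0"
  then have "AE l in (lborel :: real measure). ennreal (exp (2*(fst q*l - snd q*poly b l))) = 0"
   unfolding weight_def by (subst (asm) nn_integral_0_iff_AE) auto
  then have "AE l in (lborel :: real measure). False" by simp
  then show False by (simp add: eventually_False ae_filter_eq_bot_iff emeasure_lborel_UNIV)
 qed
 then show ?thesis by (simp add: zero_less_iff_neq_zero)
qed

lemma emeasure_lborel_half_line: "emeasure lborel {0::real..} = \<infinity>" "emeasure lborel {..0::real} = \<infinity>"
proof -
 have *: "emeasure lborel A = \<infinity>" if A: "!!n::nat. \<exists>B. B \<subseteq> A \<and> emeasure lborel B = ennreal n" and A': "A \<in> sets borel" for A :: "real set"
 proof (rule ccontr)
  assume "emeasure lborel A \<noteq> \<infinity>"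
  then have "emeasure lborel A < \<top>" by (simp add: less_top)
  then obtain n :: nat where n: "emeasure lborel A < of_nat n" using ennreal_Ex_less_of_nat by blast
  obtain B where B: "B \<subseteq> A" "emeasure lborel B = ennreal (Suc n)" using A[of "Suc n"] by auto
  then have "ennreal (Suc n) <= emeasure lborel A" using A' by (metis emeasure_mono sets_lborel)
  also have "... <= ennreal n" using less_imp_le[OF n] by (simp add: ennreal_of_nat_eq_real_of_nat)
  finally show False by (subst (asm) ennreal_le_iff) auto
 qed
 show "emeasure lborel {0::real..} = \<infinity>"
 proof (rule *)
  show "\<exists>B. B \<subseteq> {0::real..} \<and> emeasure lborel B = ennreal n" for n :: nat by (rule exI[of _ "{0..real n}"]) auto
 qed simp
 show "emeasure lborel {..0::real} = \<infinity>"
 proof (rule *)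
  show "\<exists>B. B \<subseteq> {..0::real} \<and> emeasure lborel B = ennreal n" for n :: nat by (rule exI[of _ "{-real n..0}"]) auto
 qed simp
qed

text \<open>All the integrals over \<open>(a, t)\<close> are controlled by a product of Cauchy densities.\<close>

lemma integrable_cauchy_product:
 "L1 (%q::real\<times>real. cauchy q)"
proof -
 have 1: "L1 (%x::real. complex_of_real (1/(1 + x^2)))"
  using integrable_inverse_1_plus_square by (intro integrable_of_real) (simp add: set_integrable_def divide_inverse)
 have "L1 (%(x::real, y::real). complex_of_real (1/(1 + x^2))*complex_of_real (1/(1 + y^2)))"
  using integrable_pair_mult[OF 1 1] by (simp add: lborel_prod)
 then have "L1 (%(x::real, y::real). complex_of_real (1/(1 + x^2)*(1/(1 + y^2))))"
  by simp
 then have "L1 (%q::real\<times>real. Re (case q of (x, y) => complex_of_real (1/(1 + x^2)*(1/(1 + y^2)))))"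
  by (rule integrable_Re)
 then show ?thesis by (simp add: case_prod_beta)
qed

lemma power_fact_le_exp:
 assumes "0 <= (x::real)" shows "x^n/fact n <= exp x"
proof -
 have "(%k. x^k /\<^sub>R fact k) sums exp x" by (rule exp_converges)
 then have "sum (%k. x^k /\<^sub>R fact k) {n} <= exp x"
  using assms by (intro sum_le_suminf[THEN order_trans]) (auto simp: sums_iff)
 then show ?thesis by (simp add: divide_inverse mult.commute)
qed

locale szego_poly =
 fixes b :: "real poly"
 assumes ev: "even (degree b)" and dp: "0 < degree b" and lc: "0 < lead_coeff b"
begin

lemma weight_finite:
 assumes t: "t > 0" shows "weight b (a, t) < \<infinity>"
proof -
 obtain c C where c: "c > 0" and C: "!!x. poly b x >= c*x^2 - C"
  using poly_even_quadratic_bound[OF ev dp lc] by blast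
 define M where "M = exp (2*t*C + a^2/(t*c))"
 have i: "L1 (%l. exp (- (l - 0)\<^sup>2/(2*(1/sqrt (2*(t*c)))\<^sup>2)))"
 proof -
  have "L1 (%l. sqrt (2*pi*(1/sqrt (2*(t*c)))\<^sup>2)*normal_density 0 (1/sqrt (2*(t*c))) l)"
   using c t by (intro integrable_mult_right integrable_normal_density) simp
  moreover have "sqrt (2*pi*(1/sqrt (2*(t*c)))\<^sup>2) \<noteq> 0" using c t by simp
  ultimately show ?thesis using c t unfolding normal_density_def by (simp add: field_simps)
 qed
 have "weight b (a, t) <= (NI l. ennreal (M*exp (- (l - 0)\<^sup>2/(2*(1/sqrt (2*(t*c)))\<^sup>2))))"
  unfolding weight_def
 proof (intro nn_integral_mono ennreal_leI)
  fix l
  have 1: "t*poly b l >= t*(c*l^2 - C)" using C[of l] t by (intro mult_left_mono) auto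
  have tc: "t*c > 0" using t c by simp
  have "0 <= (t*c*l - a)^2/(t*c)" using tc by simp
  also have "... = t*c*l^2 - 2*a*l + a^2/(t*c)"
   using t c by (simp add: power2_eq_square field_simps)
  finally have 2: "2*a*l <= t*c*l^2 + a^2/(t*c)" by simp
  have "2*(a*l - t*poly b l) <= 2*t*C + a^2/(t*c) - t*c*l^2" using 1 2 by (simp add: algebra_simps)
  also have "t*c*l^2 = (l - 0)\<^sup>2/(2*(1/sqrt (2*(t*c)))\<^sup>2)" using t c by (simp add: field_simps power2_eq_square)
  finally show "exp (2*(fst (a, t)*l - snd (a, t)*poly b l)) <= M*exp (- (l - 0)\<^sup>2/(2*(1/sqrt (2*(t*c)))\<^sup>2))"
   by (simp add: M_def exp_add[symmetric])
 qed
 also have "... = ennreal (LI l. M*exp (- (l - 0)\<^sup>2/(2*(1/sqrt (2*(t*c)))\<^sup>2)))"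
  by (rule nn_integral_eq_integral[OF integrable_mult_right[OF i]]) (simp add: M_def)
 also have "... < \<infinity>" by simp
 finally show ?thesis .
qed

text \<open>For \<open>t \<le> 0\<close> the integrand does not tend to zero on one of the two half lines.\<close>

lemma weight_infinite:
 assumes t: "t <= 0" shows "weight b (a, t) = \<infinity>"
proof -
 obtain C where C: "!!x. poly b x >= lead_coeff b/2*x^degree b - C"
  using poly_even_lower_bound[OF ev dp lc] by blast
 have pb: "poly b l >= - C" for l
 proof -
  have "0 <= l^degree b" by (rule zero_le_even_power[OF ev])
  then show ?thesis using C[of l] lc by (smt (verit) divide_nonneg_pos mult_nonneg_nonneg)
 qed
 define k where "k = exp (2*t*C)"
 have "\<infinity> = (\<integral>\<^sup>+l. ennreal k*indicator (if a >= 0 then {0..} else {..0}) l \<partial>(lborel :: real measure))"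
  by (subst nn_integral_cmult_indicator) (auto simp: k_def ennreal_mult_top emeasure_lborel_half_line)
 also have "... <= weight b (a, t)"
  unfolding weight_def
 proof (rule nn_integral_mono)
  fix l :: real
  show "ennreal k*indicator (if a >= 0 then {0..} else {..0}) l <= ennreal (exp (2*(fst (a, t)*l - snd (a, t)*poly b l)))"
  proof (cases "l \<in> (if a >= 0 then {0..} else {..0})")
   case True
   then have "0 <= a*l" by (auto split: if_splits intro: mult_nonpos_nonpos)
   moreover have "(-t)*poly b l >= (-t)*(-C)" using pb[of l] t by (intro mult_left_mono) auto
   ultimately have "2*t*C <= 2*(a*l - t*poly b l)" by simp
   then show ?thesis using True by (auto simp: k_def ennreal_leI)
  qed auto
 qed
 finally show ?thesis by (simp add: top_unique)
qed

lemma weight_inv_weight: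
 assumes "t > 0" shows "weight b (a, t)*ennreal (inv_weight b (a, t)) = 1" "inv_weight b (a, t) > 0"
proof -
 have p: "enn2real (weight b (a, t)) > 0" using weight_pos weight_finite[OF assms] by (simp add: enn2real_positive_iff)
 then show "inv_weight b (a, t) > 0" using assms by (simp add: inv_weight_def)
 have "weight b (a, t) = ennreal (enn2real (weight b (a, t)))" using weight_finite[OF assms] by simp
 then have "weight b (a, t)*ennreal (inv_weight b (a, t)) = ennreal (enn2real (weight b (a, t)))*ennreal (1/enn2real (weight b (a, t)))"
  using assms by (simp add: inv_weight_def)
 also have "... = 1" using p by (simp flip: ennreal_mult)
 finally show "weight b (a, t)*ennreal (inv_weight b (a, t)) = 1" .
qed

lemma inv_weight_bound:
 obtains C where "C > 0" "!!x a t. \<bar>x\<bar> <= R ==> t > 0 ==>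
  exp (2*a*x - 2*t*poly b x)*inv_weight b (a, t) <= C*(1 + t)*exp (- \<bar>a\<bar>/(1 + t))"
proof -
 obtain C where C: "C > 0" "!!x a t. \<bar>x\<bar> <= R ==> t > 0 ==>
  weight b (a, t) >= ennreal (exp (2*a*x - 2*t*poly b x)*(exp (\<bar>a\<bar>/(1 + t))/(C*(1 + t))))"
  using weight_lower_bound[of R b] by blast
 have "exp (2*a*x - 2*t*poly b x)*inv_weight b (a, t) <= C*(1 + t)*exp (- \<bar>a\<bar>/(1 + t))"
  if "\<bar>x\<bar> <= R" "t > 0" for x a t
 proof -
  define u where "u = exp (2*a*x - 2*t*poly b x)"
  have "ennreal (u*(exp (\<bar>a\<bar>/(1 + t))/(C*(1 + t))))*ennreal (inv_weight b (a, t)) <= weight b (a, t)*ennreal (inv_weight b (a, t))"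
   using C(2)[OF that, of a] unfolding u_def by (rule mult_right_mono) simp
  also have "... = 1" using that by (intro weight_inv_weight)
  finally have "u*(exp (\<bar>a\<bar>/(1 + t))/(C*(1 + t)))*inv_weight b (a, t) <= 1"
   using C(1) that by (simp flip: ennreal_mult add: u_def)
  define E where "E = exp (\<bar>a\<bar>/(1 + t))"
  define K where "K = C*(1 + t)"
  have EK: "E > 0" "K > 0" using C(1) that by (auto simp: E_def K_def)
  have "u*inv_weight b (a, t) = (u*(E/K)*inv_weight b (a, t))*(K/E)" using EK by (simp add: field_simps)
  also have "... <= 1*(K/E)"
   using EK \<open>u * (exp (\<bar>a\<bar> / (1 + t)) / (C * (1 + t))) * inv_weight b (a, t) \<le> 1\<close> unfolding E_def[symmetric] K_def[symmetric]
   by (intro mult_right_mono) auto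
  also have "... = K*exp (- \<bar>a\<bar>/(1 + t))" by (simp add: E_def exp_minus divide_inverse)
  finally show ?thesis by (simp add: u_def K_def)
 qed
 then show ?thesis using that C(1) by blast
qed

lemma exp_weight_bound:
 fixes d :: real
 assumes d: "d > 0"
 obtains C where "C >= 0" "!!a t :: real. t > 0 ==> (1 + t)*exp (- \<bar>a\<bar>/(1 + t))*exp (- d*t) <= C*(1/(1 + a^2)*(1/(1 + t^2)))"
proof -
 have "(1 + t)*exp (- \<bar>a\<bar>/(1 + t))*exp (- d*t) <= (240*exp d/d^5)*(1/(1 + a^2)*(1/(1 + t^2)))"
  if t: "t > 0" for a t :: real
 proof -
  define s where "s = 1 + t"
  have s: "s >= 1" using t by (simp add: s_def)
  have e1: "exp (- \<bar>a\<bar>/s) <= 2 * s^2/(1 + a^2)"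
  proof -
   have "1 + (\<bar>a\<bar>/s) + (\<bar>a\<bar>/s)^2/2 <= exp (\<bar>a\<bar>/s)" using s by (intro exp_lower_Taylor_quadratic) simp
   moreover have "0 <= \<bar>a\<bar>/s" using s by simp
   ultimately have "(1 + (a/s)^2)/2 <= exp (\<bar>a\<bar>/s)" by (simp add: power_divide)
   moreover have "(1 + a^2)/s^2 <= 1 + (a/s)^2"
    using s by (simp add: power_divide add_divide_distrib divide_le_eq)
   ultimately have "(1 + a^2)/(2 * s^2) <= exp (\<bar>a\<bar>/s)" by simp
   moreover have "(1 + a^2)/(2 * s^2) > 0" using s by (intro divide_pos_pos) (auto simp: add_pos_nonneg)
   ultimately have "inverse (exp (\<bar>a\<bar>/s)) <= inverse ((1 + a^2)/(2 * s^2))" by (intro le_imp_inverse_le)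
   then show ?thesis by (simp add: exp_minus)
  qed
  have e2: "s^5*exp (- d*t) <= 120*exp d/d^5"
  proof -
   have "(d * s)^5/fact 5 <= exp (d * s)" using d s by (intro power_fact_le_exp) auto
   then have "(d * s)^5 <= 120*exp (d * s)" by (simp add: fact_numeral)
   also have "exp (d * s) = exp d*exp (d*t)" by (simp add: s_def exp_add[symmetric] algebra_simps)
   finally have "d^5 * s^5 <= 120*exp d*exp (d*t)" by (simp add: power_mult_distrib)
   then have "d^5 * s^5*exp (- d*t) <= 120*exp d*exp (d*t)*exp (- d*t)" by (rule mult_right_mono) simp
   also have "... = 120*exp d" by (simp add: mult.assoc exp_add[symmetric])
   finally show ?thesis using d by (simp add: field_simps)
  qed
  have "1 + t^2 <= s^2" using t by (simp add: s_def power2_sum)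
  moreover have "1 + t^2 > 0" "s^2 > 0" using s by (auto intro: add_pos_nonneg)
  ultimately have e3: "1/s^2 <= 1/(1 + t^2)" by (intro divide_left_mono mult_pos_pos) auto
  have "s*exp (- \<bar>a\<bar>/s)*exp (- d*t) <= s*(2 * s^2/(1 + a^2))*exp (- d*t)"
   using s e1 by (intro mult_right_mono mult_left_mono) auto
  also have "... = (2/(1 + a^2))*(s^5*exp (- d*t))*(1/s^2)"
   using s by (simp add: field_simps eval_nat_numeral)
  also have "... <= (2/(1 + a^2))*(120*exp d/d^5)*(1/(1 + t^2))"
   using s d e2 e3 by (intro mult_mono mult_left_mono) (auto intro!: mult_nonneg_nonneg divide_nonneg_nonneg add_nonneg_nonneg)
  also have "... = (240*exp d/d^5)*(1/(1 + a^2)*(1/(1 + t^2)))" by simp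
  finally show ?thesis by (simp add: s_def)
 qed
 then show ?thesis using that[of "240*exp d/d^5"] d by auto
qed

text \<open>Above the graph there is exponential decay in \<open>t\<close>. Together with the decay in \<open>a\<close> at scale \<open>1 + t\<close> it gives a bound by a
 multiple of a product of Cauchy densities.\<close>

lemma inv_weight_integrable:
 assumes "h > poly b x"
 shows "L1 (%q. exp (2*fst q*x - 2 * snd q*h)*inv_weight b q)"
proof -
 define d where "d = 2*(h - poly b x)"
 have d: "d > 0" using assms by (simp add: d_def)
 obtain C where C0: "C > 0" "!!y a t. \<bar>y\<bar> <= \<bar>x\<bar> ==> t > 0 ==>
  exp (2*a*y - 2*t*poly b y)*inv_weight b (a, t) <= C*(1 + t)*exp (- \<bar>a\<bar>/(1 + t))"
  using inv_weight_bound[of "\<bar>x\<bar>"] by blast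
 note C = C0(1) C0(2)[OF order_refl]
 obtain D where D: "D >= 0" "!!a t. t > 0 ==> (1 + t)*exp (- \<bar>a\<bar>/(1 + t))*exp (- d*t) <= D*(1/(1 + a^2)*(1/(1 + t^2)))"
  using exp_weight_bound[OF d] by blast
 have i: "L1 (%q::real\<times>real. (C*D)*(cauchy q))"
  by (intro integrable_mult_right integrable_cauchy_product)
 show ?thesis
 proof (rule integrable_bound[OF i])
  show "AE q in lborel. norm (exp (2*fst q*x - 2 * snd q*h)*inv_weight b q)
    <= norm ((C*D)*(cauchy q))"
  proof (rule AE_I2)
   fix q :: "real \<times> real"
   obtain a t where q: "q = (a, t)" by force
   show "norm (exp (2*fst q*x - 2 * snd q*h)*inv_weight b q) <= norm ((C*D)*(cauchy q))"
   proof (cases "t > 0")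
    case True
    have "exp (2*a*x - 2*t*h)*inv_weight b q = exp (2*a*x - 2*t*poly b x)*inv_weight b (a, t)*exp (- d*t)"
     by (simp add: q d_def exp_add[symmetric] algebra_simps)
    also have "... <= C*(1 + t)*exp (- \<bar>a\<bar>/(1 + t))*exp (- d*t)"
     by (intro mult_right_mono C(2) True) simp
    also have "... <= C*(D*(1/(1 + a^2)*(1/(1 + t^2))))"
     using mult_left_mono[OF D(2)[OF True, of a], of C] C(1) by (simp add: mult_ac)
    finally show ?thesis using C(1) D(1) by (simp add: q abs_mult)
   qed (simp add: q inv_weight_def)
  qed
 qed measurable
qed

end

section \<open>Laplace transforms of weighted square integrable functions lie in the Hardy space\<close>

lemma shift_eq: "bdpt b e (x, y, t) = (Complex x y, Complex t (poly b x + e))"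
 by (simp add: shifted_boundary_point_def)

lemma ennreal_mult_norm_sq: "nrm2 (c*z :: complex) = ennreal ((norm c)^2)*ennreal ((norm z)^2)"
 by (simp add: norm_mult power_mult_distrib ennreal_mult)

lemma nn_norm_add_sq_le:
 assumes [measurable]: "f \<in> borel_measurable M" "g \<in> borel_measurable M"
 shows "(\<integral>\<^sup>+x. nrm2 (f x + g x :: complex) \<partial>M) <= 2*(\<integral>\<^sup>+x. nrm2 (f x) \<partial>M) + 2*(\<integral>\<^sup>+x. nrm2 (g x) \<partial>M)"
proof -
 have "(\<integral>\<^sup>+x. nrm2 (f x + g x) \<partial>M) <= (\<integral>\<^sup>+x. 2*nrm2 (f x) + 2*nrm2 (g x) \<partial>M)"
 proof (rule nn_integral_mono)
  fix x
  have "nrm2 (f x + g x) <= ennreal (2*(norm (f x))^2 + 2*(norm (g x))^2)"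
   by (intro ennreal_leI norm_add_sq_le)
  also have "... = 2*nrm2 (f x) + 2*nrm2 (g x)"
   by (simp add: ennreal_plus ennreal_mult)
  finally show "nrm2 (f x + g x) <= 2*nrm2 (f x) + 2*nrm2 (g x)" .
 qed
 also have "... = 2*(\<integral>\<^sup>+x. nrm2 (f x) \<partial>M) + 2*(\<integral>\<^sup>+x. nrm2 (g x) \<partial>M)"
  by (simp add: nn_integral_add nn_integral_cmult)
 finally show ?thesis .
qed

context szego_poly
begin

definition spec :: "(real \<times> real) measure" where
 "spec = density lborel (weight b)"

abbreviation base :: "(real \<times> real) set" where
 "base \<equiv> {(x, h). poly b x < h}"

lemma sets_spec [measurable_cong]: "sets spec = sets borel"
 by (simp add: spec_def)

lemma open_base: "open base"
proof -
 have "base = {p. poly b (fst p) < snd p}" by auto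
 then show ?thesis by (simp add: open_Collect_less continuous_intros)
qed

lemma open_tube_domain: "open (tube_domain b)"
proof -
 have "tube_domain b = {p. poly b (Re (fst p)) < Im (snd p)}" by (auto simp: tube_domain_def)
 then show ?thesis by (auto intro!: open_Collect_less continuous_intros)
qed

lemma tube_domain_base: "p \<in> tube_domain b \<longleftrightarrow> tube_pt p \<in> base"
 by (cases p) (simp add: tube_domain_def)

lemma shift_in_domain: "e > 0 ==> bdpt b e p \<in> tube_domain b"
 by (cases p) (simp add: shift_eq tube_domain_def)

lemma L2_spec_measurable: "L2 spec g ==> g \<in> bm"
 by (auto simp: L2_def measurable_cong_sets[OF sets_spec refl])

lemma nn_integral_spec:
 "f \<in> bm ==> (\<integral>\<^sup>+q. f q \<partial>spec) = (NI q. weight b q*f q)"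
 unfolding spec_def by (rule nn_integral_density) auto

lemma L2_spec_finite:
 assumes "L2 spec g" shows "(NI q. weight b q*nrm2 (g q)) = ennreal (nsq spec g)"
proof -
 have [measurable]: "g \<in> bm" by (rule L2_spec_measurable[OF assms])
 show ?thesis using nn_nsq[OF assms] by (subst nn_integral_spec[symmetric]) auto
qed

lemma AE_spec: "(AE q in spec. P q) \<longleftrightarrow> (AE q in lborel. P q)"
 unfolding spec_def by (subst AE_density) (auto simp: weight_pos)

text \<open>The weight is infinite where \<open>t \<le> 0\<close>, so finite norm forces the function to vanish there.\<close>

lemma L2_spec_support:
 assumes "L2 spec g" shows "AE q in lborel. snd q <= 0 \<longrightarrow> g q = 0"
proof -
 have [measurable]: "g \<in> bm" by (rule L2_spec_measurable[OF assms])
 have "AE q in lborel. weight b q*nrm2 (g q) \<noteq> \<infinity>"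
  using L2_spec_finite[OF assms] by (intro nn_integral_PInf_AE) auto
 then show ?thesis
 proof eventually_elim
  case (elim q)
  show ?case
  proof (intro impI, rule ccontr)
   assume "snd q <= 0" "g q \<noteq> 0"
   then show False using elim weight_infinite[of "snd q" "fst q"] by (simp add: ennreal_top_mult)
  qed
 qed
qed

text \<open>The arithmetic-geometric mean inequality splits the product into a part with the inverse weight and a part with the weight.\<close>

lemma L2_spec_lap_on:
 assumes "L2 spec g" shows "lap_on base g"
proof -
 have [measurable]: "g \<in> bm" by (rule L2_spec_measurable[OF assms])
 have "L1 (%q. exp (fst q*x - snd q*h)*norm (g q))" if h: "poly b x < h" for x h
 proof -
  define G where "G q = enn2real (weight b q*nrm2 (g q))" for q
  have iG: "L1 G"
  proof (rule integrableI_bounded)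
   show "G \<in> borel_measurable lborel" unfolding G_def by measurable
   have "(NI q. ennreal (norm (G q))) <= (NI q. weight b q*nrm2 (g q))"
   proof (rule nn_integral_mono)
    fix q
    have "ennreal (enn2real z) <= z" for z :: ennreal by (cases z rule: ennreal_cases) auto
    then show "ennreal (norm (G q)) <= weight b q*nrm2 (g q)" by (simp add: G_def)
   qed
   then show "(NI q. ennreal (norm (G q))) < \<infinity>"
    unfolding L2_spec_finite[OF assms] by (auto intro: le_less_trans)
  qed
  have i: "L1 (%q. exp (2*fst q*x - 2 * snd q*h)*inv_weight b q + G q)"
   by (intro Bochner_Integration.integrable_add inv_weight_integrable h iG)
  show ?thesis
  proof (rule integrable_bound[OF i])
   show "AE q in lborel. norm (exp (fst q*x - snd q*h)*norm (g q)) <= norm (exp (2*fst q*x - 2 * snd q*h)*inv_weight b q + G q)"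
    using L2_spec_support[OF assms]
   proof eventually_elim
    case (elim q)
    obtain a t where q: "q = (a, t)" by force
    show ?case
    proof (cases "t > 0")
     case False
     then show ?thesis using elim by (simp add: q)
    next
     case True
     define w where "w = enn2real (weight b q)"
     have w: "w > 0" using weight_pos weight_finite[OF True] by (simp add: q w_def enn2real_positive_iff)
     have Gw: "G q = w*(norm (g q))^2" by (simp add: G_def w_def enn2real_mult)
     have iw: "inv_weight b q = 1/w" using True by (simp add: inv_weight_def w_def q)
     define e where "e = exp (fst q*x - snd q*h)"
     have e2: "exp (2*fst q*x - 2 * snd q*h) = e^2" by (simp add: e_def exp_add[symmetric] power2_eq_square)
     have e0: "e > 0" by (simp add: e_def)
     have "0 <= (e - w*norm (g q))^2/w" using w by simp
     also have "(e - w*norm (g q))^2/w = e^2*(1/w) + w*(norm (g q))^2 - 2*(e*norm (g q))"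
      using w by (simp add: power2_eq_square field_simps)
     finally have "2*(e*norm (g q)) <= e^2*(1/w) + w*(norm (g q))^2" by simp
     moreover have "0 <= e*norm (g q)" using e0 by simp
     ultimately have "e*norm (g q) <= e^2*(1/w) + w*(norm (g q))^2" by linarith
     then show ?thesis using e0 unfolding e2 iw Gw e_def[symmetric] by (simp add: abs_mult)
    qed
   qed
  qed measurable
 qed
 then show ?thesis using open_base by (auto simp: lap_on_def)
qed

text \<open>Above the graph the exponential is bounded by a multiple of the square root of the weight, so each slice is controlled by the
 weighted norm.\<close>

lemma L2_spec_slice:
 assumes "L2 spec g" and h: "poly b x < h"
 shows "L1 (%q. tilt x h q*g q)"
  and "L2 lborel (%q. tilt x h q*g q)"
  and "\<exists>C>0. \<forall>g. L2 spec g \<longrightarrow> nsq lborel (%q. tilt x h q*g q) <= C*nsq spec g"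
proof -
 have [measurable]: "g \<in> bm" by (rule L2_spec_measurable[OF assms(1)])
 have "L1 (%q. exp (fst q*x - snd q*h)*norm (g q))"
  using L2_spec_lap_on[OF assms(1)] h by (auto simp: lap_on_def)
 then show "L1 (%q. tilt x h q*g q)"
  by (rule integrable_bound) (auto simp: norm_mult)
 define d where "d = 2*(h - poly b x)"
 have d: "d > 0" using h by (simp add: d_def)
 obtain C where C0: "C > 0" "!!y a t. \<bar>y\<bar> <= \<bar>x\<bar> ==> t > 0 ==>
  exp (2*a*y - 2*t*poly b y)*inv_weight b (a, t) <= C*(1 + t)*exp (- \<bar>a\<bar>/(1 + t))"
  using inv_weight_bound[of "\<bar>x\<bar>"] by blast
 note C = C0(1) C0(2)[OF order_refl]
 define K where "K = C*(1 + 1/d)"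
 have K: "K > 0" using C d by (simp add: K_def add_pos_pos)
 have le: "exp (2*a*x - 2*t*h)*inv_weight b (a, t) <= K" if t: "t > 0" for a t
 proof -
  have "exp (2*a*x - 2*t*h)*inv_weight b (a, t) = exp (2*a*x - 2*t*poly b x)*inv_weight b (a, t)*exp (- d*t)"
   by (simp add: d_def exp_add[symmetric] algebra_simps)
  also have "... <= C*(1 + t)*exp (- \<bar>a\<bar>/(1 + t))*exp (- d*t)"
   by (intro mult_right_mono C(2) t) simp
  also have "... <= C*(1 + t)*1*exp (- d*t)"
   using C(1) t by (intro mult_right_mono mult_left_mono) auto
  also have "... = C*((1 + t)*exp (- d*t))" by simp
  also have "(1 + t)*exp (- d*t) <= 1 + 1/d"
  proof -
   have "exp (- d*t) <= 1" using d t by simp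
   moreover have "t*exp (- d*t) <= 1/d"
   proof -
    have "d*t <= exp (d*t)" using exp_ge_add_one_self[of "d*t"] by linarith
    then show ?thesis using d by (simp add: exp_minus field_simps)
   qed
   moreover have "(1 + t)*exp (- d*t) = exp (- d*t) + t*exp (- d*t)" by (simp add: distrib_right)
   ultimately show ?thesis by linarith
  qed
  finally show ?thesis using C(1) by (simp add: K_def)
 qed
 have nn: "(NI q. nrm2 (tilt x h q*g q)) <= ennreal (K*nsq spec g)"
  if g: "L2 spec g" for g
 proof -
  have [measurable]: "g \<in> bm" by (rule L2_spec_measurable[OF g])
  have "(NI q. nrm2 (tilt x h q*g q)) <= (NI q. ennreal K*(weight b q*nrm2 (g q)))"
  proof (rule nn_integral_mono_AE)
   show "AE q in lborel. nrm2 (tilt x h q*g q) <= ennreal K*(weight b q*nrm2 (g q))"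
    using L2_spec_support[OF g]
   proof eventually_elim
    case (elim q)
    obtain a t where q: "q = (a, t)" by force
    show ?case
    proof (cases "t > 0")
     case False
     then show ?thesis using elim by (simp add: q)
    next
     case True
     have "nrm2 (tilt x h q*g q) = ennreal (exp (2*a*x - 2*t*h))*nrm2 (g q)"
     proof -
      have "(exp (a*x - t*h))^2 = exp (2*a*x - 2*t*h)" by (simp add: power2_eq_square exp_add[symmetric])
      then show ?thesis by (simp only: q ennreal_mult_norm_sq norm_of_real abs_exp_cancel fst_conv snd_conv)
     qed
     also have "ennreal (exp (2*a*x - 2*t*h)) = ennreal (exp (2*a*x - 2*t*h))*(weight b (a, t)*ennreal (inv_weight b (a, t)))"
      using weight_inv_weight[OF True] by simp
     also have "... = ennreal (exp (2*a*x - 2*t*h)*inv_weight b (a, t))*weight b (a, t)"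
      by (simp add: ennreal_mult mult_ac)
     also have "... <= ennreal K*weight b (a, t)"
      by (intro mult_right_mono ennreal_leI le True) simp
     finally show ?thesis by (simp add: q mult.assoc mult_right_mono)
    qed
   qed
  qed
  also have "... = ennreal K*ennreal (nsq spec g)"
   by (subst nn_integral_cmult) (auto simp: L2_spec_finite[OF g])
  finally show ?thesis using K by (simp add: ennreal_mult)
 qed
 have L: "L2 lborel (%q. tilt x h q*g q) \<and> nsq lborel (%q. tilt x h q*g q) <= K*nsq spec g"
  if g: "L2 spec g" for g
 proof -
  have [measurable]: "g \<in> bm" by (rule L2_spec_measurable[OF g])
  show ?thesis using L2_I_nn[OF _ nn[OF g]] K by auto
 qed
 show "L2 lborel (%q. tilt x h q*g q)" using L[OF assms(1)] by blast
 show "\<exists>C>0. \<forall>g. L2 spec g \<longrightarrow> nsq lborel (%q. tilt x h q*g q) <= C*nsq spec g"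
  using L K by blast
qed

lemma Lap_holomorphic:
 assumes "lap_on base g" shows "holomorphic2_on (Lap g) (tube_domain b)"
 unfolding holomorphic2_on_def
 by (intro ballI exI, rule Lap_has_derivative[OF assms]) (simp add: tube_domain_base)

lemma measurable_Lap_shift [measurable]:
 assumes [measurable]: "g \<in> bm"
 shows "(%p. Lap g (bdpt b e p)) \<in> bm"
proof -
 have "(%p. Lap g (bdpt b e p)) =
  (%p. LI q. of_real (exp (fst q*fst p - snd q*(poly b (fst p) + e)))*g q*cis (snd p \<bullet> q))"
  by (auto simp: shift_eq Lap_slice ft_def inner_commute)
 also have "... \<in> bm" by measurable
 finally show ?thesis .
qed

text \<open>Slicewise Plancherel in \<open>(y, t)\<close>, followed by integration over \<open>x\<close>, which produces the weight.\<close>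

lemma nn_shift_combination:
 assumes g: "L2 spec g" and ep: "ep > 0" "ep' > 0"
 shows "(NI p. nrm2 (c*Lap g (bdpt b ep p) + c'*Lap g (bdpt b ep' p)))
  = ennreal (4*pi^2)*(\<integral>\<^sup>+q. ennreal ((norm (c * of_real (exp (- snd q*ep)) + c' * of_real (exp (- snd q*ep'))))^2*(norm (g q))^2) \<partial>spec)"
proof -
 have [measurable]: "g \<in> bm" by (rule L2_spec_measurable[OF g])
 define m where "m q = c*complex_of_real (exp (- snd q*ep)) + c' * of_real (exp (- snd q*ep'))" for q :: "real \<times> real"
 have [measurable]: "m \<in> bm" unfolding m_def by measurable
 define h where "h x q = of_real (exp (fst q*x - snd q*poly b x))*m q*g q" for x q
 have h_eq: "h x q = c*(tilt x (poly b x + ep) q*g q) + c'*(tilt x (poly b x + ep') q*g q)" for x q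
 proof -
  have e: "exp (fst q*x - snd q*(poly b x + e)) = exp (fst q*x - snd q*poly b x)*exp (- snd q*e)" for e
   by (simp add: exp_add[symmetric] algebra_simps)
  show ?thesis unfolding h_def m_def e of_real_mult by (simp add: algebra_simps del: of_real_exp)
 qed
 have hint: "L1 (h x)" and hL2: "L2 lborel (h x)" for x
  unfolding h_eq using ep by (auto intro!: Bochner_Integration.integrable_add integrable_mult_right L2_add L2_cmult L2_spec_slice[OF g] simp del: of_real_exp)
 have fth: "c*Lap g (bdpt b ep (x, y, t)) + c'*Lap g (bdpt b ep' (x, y, t)) = ft (h x) (y, t)" for x y t
 proof -
  have i: "L1 (%q. tilt x (poly b x + e) q*g q*cis (q \<bullet> (y, t)))" if "e > 0" for e
   by (rule integrable_bound[OF integrable_norm[OF L2_spec_slice(1)[OF g, of x "poly b x + e"]]])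
     (use that in \<open>auto simp: norm_mult simp del: of_real_exp\<close>)
  have "ft (h x) (y, t) = (LI q. c*(tilt x (poly b x + ep) q*g q*cis (q \<bullet> (y, t)))
    + c'*(tilt x (poly b x + ep') q*g q*cis (q \<bullet> (y, t))))"
   unfolding ft_def h_eq by (intro LI_cong) (simp add: distrib_right mult.assoc del: of_real_exp)
  also have "... = c*ft (%q. tilt x (poly b x + ep) q*g q) (y, t)
    + c'*ft (%q. tilt x (poly b x + ep') q*g q) (y, t)"
   unfolding ft_def using i ep
   by (subst Bochner_Integration.integral_add) (auto intro!: integrable_mult_right simp del: of_real_exp)
  finally show ?thesis by (simp add: shift_eq Lap_slice)
 qed
 have "(NI p. nrm2 (c*Lap g (bdpt b ep p) + c'*Lap g (bdpt b ep' p)))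
  = (NI x. NI yt. nrm2 (c*Lap g (bdpt b ep (x, yt)) + c'*Lap g (bdpt b ep' (x, yt))))"
  unfolding lborel_prod[symmetric, where 'a=real and 'b="real\<times>real"]
  by (rule lborel.nn_integral_fst[symmetric]) simp
 also have "... = (NI x. NI yt. nrm2 (ft (h x) yt))"
  by (intro nn_integral_cong) (auto simp: fth split_paired_all)
 also have "... = (NI x. ennreal (4*pi^2)*(NI q. nrm2 (h x q)))"
  by (intro nn_integral_cong) (simp add: nn_nsq[OF Plancherel(1)[OF hint hL2]] Plancherel(2)[OF hint hL2] nn_nsq[OF hL2] ennreal_mult)
 also have "... = ennreal (4*pi^2)*(NI x. NI q. nrm2 (h x q))"
  unfolding h_def by (rule nn_integral_cmult) measurable
 also have "(NI x. NI q. nrm2 (h x q)) = (NI q. NI x. nrm2 (h x q))"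
  by (rule lborel_pair.Fubini'[symmetric]) (simp add: h_def split_beta')
 also have "... = (NI q. weight b q*ennreal ((norm (m q))^2*(norm (g q))^2))"
 proof (intro nn_integral_cong)
  fix q :: "real \<times> real"
  have "(NI x. nrm2 (h x q)) = (NI x. ennreal (exp (2*(fst q*x - snd q*poly b x)))*ennreal ((norm (m q))^2*(norm (g q))^2))"
   by (intro nn_integral_cong)
     (simp add: h_def norm_mult power_mult_distrib ennreal_mult[symmetric] power2_eq_square exp_add[symmetric] mult_ac del: of_real_exp)
  also have "... = weight b q*ennreal ((norm (m q))^2*(norm (g q))^2)"
   unfolding weight_def by (rule nn_integral_multc) measurable
  finally show "(NI x. nrm2 (h x q)) = weight b q*ennreal ((norm (m q))^2*(norm (g q))^2)" .
 qed
 also have "... = (\<integral>\<^sup>+q. ennreal ((norm (m q))^2*(norm (g q))^2) \<partial>spec)"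
  by (rule nn_integral_spec[symmetric]) measurable
 finally show ?thesis unfolding m_def .
qed

lemma Lap_in_hardy_space:
 assumes g: "L2 spec g" shows "Lap g \<in> hardy_space b"
proof -
 have [measurable]: "g \<in> bm" by (rule L2_spec_measurable[OF g])
 have "(NI p. nrm2 (Lap g (bdpt b e p))) <= ennreal (4*pi^2*nsq spec g)"
  if e: "e > 0" for e
 proof -
  have "(NI p. nrm2 (Lap g (bdpt b e p)))
   = ennreal (4*pi^2)*(\<integral>\<^sup>+q. ennreal ((norm (1*complex_of_real (exp (- snd q*e)) + 0 * of_real (exp (- snd q*e))))^2*(norm (g q))^2) \<partial>spec)"
   using nn_shift_combination[OF g e e, of 1 0] by simp
  also have "(\<integral>\<^sup>+q. ennreal ((norm (1*complex_of_real (exp (- snd q*e)) + 0 * of_real (exp (- snd q*e))))^2*(norm (g q))^2) \<partial>spec) <= (\<integral>\<^sup>+q. nrm2 (g q) \<partial>spec)"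
  proof (rule nn_integral_mono_AE)
   show "AE q in spec. ennreal ((norm (1*complex_of_real (exp (- snd q*e)) + 0 * of_real (exp (- snd q*e))))^2*(norm (g q))^2) <= nrm2 (g q)"
    unfolding AE_spec using L2_spec_support[OF g]
   proof eventually_elim
    case (elim q)
    show ?case
    proof (cases "snd q > 0")
     case True
     then have "exp (- snd q*e) <= 1" using e by simp
     then have "(exp (- snd q*e))^2 <= 1" by (simp add: power_le_one)
     then show ?thesis by (intro ennreal_leI) (simp add: mult_left_le_one_le del: of_real_exp)
    qed (use elim in auto)
   qed
  qed
  finally show ?thesis by (simp add: nn_nsq[OF g] ennreal_mult mult_left_mono)
 qed
 then have "(SUP e\<in>{0<..}. NI p. nrm2 (Lap g (bdpt b e p))) <= ennreal (4*pi^2*nsq spec g)"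
  by (intro SUP_least) auto
 then show ?thesis
  using Lap_holomorphic[OF L2_spec_lap_on[OF g]] by (auto simp: hardy_space_def intro: le_less_trans)
qed

lemma has_boundary_value_cong:
 assumes "!!p. p \<in> tube_domain b ==> F p = G p"
 shows "has_boundary_value b F f \<longleftrightarrow> has_boundary_value b G f"
proof -
 have "((%e. NI p. nrm2 (F (bdpt b e p) - f p)) \<longlongrightarrow> 0) (at_right 0)
  \<longleftrightarrow> ((%e. NI p. nrm2 (G (bdpt b e p) - f p)) \<longlongrightarrow> 0) (at_right 0)"
  by (intro tendsto_cong eventually_at_right_less[THEN eventually_mono]) (simp add: assms shift_in_domain)
 then show ?thesis by (simp add: has_boundary_value_def)
qed

text \<open>The slices at heights \<open>ep\<close> and \<open>ep'\<close> differ in norm by the weighted norm of the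
 difference of two damping factors. So they form a Cauchy family, and the limit inherits the norm.\<close>

theorem Lap_boundary_value:
 assumes g: "L2 spec g"
 obtains f where "has_boundary_value b (Lap g) f" "L2 lborel f" "nsq lborel f = 4*pi^2*nsq spec g"
proof -
 have [measurable]: "g \<in> bm" by (rule L2_spec_measurable[OF g])
 define F where "F ep p = Lap g (bdpt b ep p)" for ep p
 have F_meas [measurable]: "F ep \<in> bm" for ep unfolding F_def by measurable
 define w where "w ep = (\<integral>q. (1 - exp (- snd q*ep))^2*(norm (g q))^2 \<partial>spec)" for ep
 have sup: "AE q in spec. snd q <= 0 \<longrightarrow> g q = 0" unfolding AE_spec by (rule L2_spec_support[OF g])
 have ig: "integrable spec (%q. (norm (g q))^2)" by (rule L2_integrable[OF g])
 have dom: "AE q in spec. norm ((1 - exp (- snd q*ep))^2*(norm (g q))^2) <= (norm (g q))^2" if "ep > 0" for ep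
  using sup
 proof eventually_elim
  case (elim q)
  show ?case
  proof (cases "snd q > 0")
   case True
   then have "0 <= 1 - exp (- snd q*ep)" "1 - exp (- snd q*ep) <= 1" using that by auto
   then have "(1 - exp (- snd q*ep))^2 <= 1" by (simp add: power_le_one)
   then show ?thesis by (simp add: abs_mult mult_left_le_one_le)
  qed (use elim in auto)
 qed
 have iw: "integrable spec (%q. (1 - exp (- snd q*ep))^2*(norm (g q))^2)" if "ep > 0" for ep
  by (rule integrable_bound[OF ig]) (use dom[OF that] in auto)
 have w0: "w ep >= 0" for ep by (simp add: w_def)
 have w_lim: "(%n. w (X n)) ----> 0" if X: "!!n. X n > 0" "X ----> 0" for X
 proof -
  have "(%n. w (X n)) ----> (\<integral>q. 0 \<partial>spec)" unfolding w_def
  proof (rule integral_dominated_convergence[OF _ _ ig])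
   show "AE q in spec. (%n. (1 - exp (- snd q*X n))^2*(norm (g q))^2) ----> 0"
   proof (rule AE_I2)
    fix q :: "real \<times> real"
    have "(%n. (1 - exp (- snd q*X n))^2*(norm (g q))^2) ----> (1 - exp (- snd q*0))^2*(norm (g q))^2"
     by (intro tendsto_intros X)
    then show "(%n. (1 - exp (- snd q*X n))^2*(norm (g q))^2) ----> 0" by simp
   qed
  qed (use dom X in auto)
  then show ?thesis by simp
 qed
 have diff: "L2 lborel (%p. F ep p - F ep' p) \<and> nsq lborel (%p. F ep p - F ep' p) <= 4*pi^2*w e"
  if e: "0 < ep" "0 < ep'" "ep <= e" "ep' <= e" for ep ep' e
 proof -
  have "(NI p. nrm2 (F ep p - F ep' p))
   = ennreal (4*pi^2)*(\<integral>\<^sup>+q. ennreal ((norm (1*complex_of_real (exp (- snd q*ep)) + (-1) * of_real (exp (- snd q*ep'))))^2*(norm (g q))^2) \<partial>spec)"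
   using nn_shift_combination[OF g e(1,2), of 1 "-1"] by (simp add: F_def)
  also have "(\<integral>\<^sup>+q. ennreal ((norm (1*complex_of_real (exp (- snd q*ep)) + (-1) * of_real (exp (- snd q*ep'))))^2*(norm (g q))^2) \<partial>spec)
   <= (\<integral>\<^sup>+q. ennreal ((1 - exp (- snd q*e))^2*(norm (g q))^2) \<partial>spec)"
  proof (rule nn_integral_mono_AE)
   show "AE q in spec. ennreal ((norm (1*complex_of_real (exp (- snd q*ep)) + (-1) * of_real (exp (- snd q*ep'))))^2*(norm (g q))^2) <= ennreal ((1 - exp (- snd q*e))^2*(norm (g q))^2)"
    using sup
   proof eventually_elim
    case (elim q)
    show ?case
    proof (cases "snd q > 0")
     case True
     have *: "exp (- snd q*e) <= exp (- snd q*u)" "exp (- snd q*u) <= 1" if "0 < u" "u <= e" for u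
      using True that by auto
     have "norm (1*complex_of_real (exp (- snd q*ep)) + (-1) * of_real (exp (- snd q*ep'))) = \<bar>exp (- snd q*ep) - exp (- snd q*ep')\<bar>"
      by (simp flip: of_real_diff del: of_real_exp)
     also have "... <= 1 - exp (- snd q*e)" using *[of ep] *[of ep'] e by linarith
     finally show ?thesis by (intro ennreal_leI mult_right_mono power_mono) auto
    qed (use elim in auto)
   qed
  qed
  also have "... = ennreal (w e)" unfolding w_def using iw[of e] e by (intro nn_integral_eq_integral) auto
  finally have "(NI p. nrm2 (F ep p - F ep' p)) <= ennreal (4*pi^2*w e)"
   by (simp add: ennreal_mult mult_left_mono w0)
  from L2_I_nn[OF _ this] show ?thesis using w0 by auto
 qed
 have LF: "L2 lborel (F ep)" if "ep > 0" for ep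
 proof -
  have "Lap g \<in> hardy_space b" by (rule Lap_in_hardy_space[OF g])
  then have "(NI p. nrm2 (F ep p)) < \<infinity>"
   using that unfolding hardy_space_def F_def by (auto elim!: le_less_trans[rotated] intro!: SUP_upper)
  then show ?thesis by (simp add: L2_iff_nn)
 qed
 define e where "e n = inverse (real (Suc n))" for n
 have e: "e n > 0" "e ----> 0" for n unfolding e_def using LIMSEQ_inverse_real_of_nat by auto
 have e_mono: "m <= n ==> e n <= e m" for m n by (simp add: e_def field_simps)
 obtain f r where f: "L2 lborel f" and r: "strict_mono r" and AE: "AE p in lborel. (%n. F (e (r n)) p) ----> f p"
  and lim: "(%n. nsq lborel (%p. F (e n) p - f p)) ----> 0"
 proof (rule Riesz_Fischer[of lborel "%n. F (e n)"])
  show "L2 lborel (F (e n))" for n by (rule LF[OF e(1)])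
  fix u :: real assume "u > 0"
  then have "\<forall>\<^sub>F n in sequentially. w (e n) < u/(4*pi^2)" by (intro order_tendstoD(2)[OF w_lim[OF e]]) simp
  then obtain N where "w (e N) < u/(4*pi^2)" by (auto simp: eventually_sequentially)
  then have N: "4*pi^2*w (e N) <= u" by (simp add: field_simps)
  show "\<exists>N. \<forall>m\<ge>N. \<forall>n\<ge>N. nsq lborel (%p. F (e m) p - F (e n) p) <= u"
   using diff[OF e(1) e(1) e_mono e_mono] N by (meson order_trans)
 qed blast
 have fb: "L2 lborel (%p. F ep p - f p) \<and> nsq lborel (%p. F ep p - f p) <= 4*pi^2*w ep" if ep: "ep > 0" for ep
 proof -
  obtain N where "\<forall>n\<ge>N. e n < ep"
   using order_tendstoD(2)[OF e(2) ep] by (auto simp: eventually_sequentially)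
  then have N: "!!n. n >= N ==> e n <= ep" by (auto intro: less_imp_le)
  have rN: "e (r (n + N)) <= ep" for n using seq_suble[OF r, of "n + N"] by (intro N) linarith
  have AE': "AE p in lborel. (%n. F ep p - F (e (r (n + N))) p) ----> F ep p - f p"
   using AE
  proof eventually_elim
   case (elim p)
   show ?case by (intro tendsto_diff tendsto_const LIMSEQ_ignore_initial_segment[OF elim])
  qed
  have "(%p. F ep p - f p) \<in> borel_measurable lborel" using f by (auto simp: L2_def)
  from L2_Fatou[OF _ _ this AE'] diff[OF ep e(1) order_refl rN] show ?thesis by auto
 qed
 have bv: "has_boundary_value b (Lap g) f"
  unfolding has_boundary_value_def
 proof (intro conjI)
  show "f \<in> borel_measurable lborel" "(NI p. nrm2 (f p)) < \<infinity>"
   using f by (auto simp: L2_iff_nn)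
  show "((%ep. NI p. nrm2 (Lap g (bdpt b ep p) - f p)) \<longlongrightarrow> 0) (at_right 0)"
   unfolding tendsto_at_iff_sequentially o_def
  proof (intro allI impI)
   fix X :: "nat => real" assume X: "\<forall>i. X i \<in> {0<..} - {0}" "X ----> 0"
   have "(%n. ennreal (4*pi^2*w (X n))) ----> ennreal (4*pi^2*0)"
    using X by (intro tendsto_ennrealI tendsto_intros w_lim) auto
   then have l: "(%n. ennreal (4*pi^2*w (X n))) ----> 0" by simp
   show "(%n. NI p. nrm2 (Lap g (bdpt b (X n) p) - f p)) ----> 0"
   proof (rule tendsto_sandwich[OF _ _ tendsto_const l])
    show "\<forall>\<^sub>F n in sequentially. (NI p. nrm2 (Lap g (bdpt b (X n) p) - f p)) <= ennreal (4*pi^2*w (X n))"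
    proof (rule always_eventually, rule allI)
     fix n
     have "X n > 0" using X by auto
     from fb[OF this] have l: "L2 lborel (%p. F (X n) p - f p)" "nsq lborel (%p. F (X n) p - f p) <= 4*pi^2*w (X n)" by auto
     show "(NI p. nrm2 (Lap g (bdpt b (X n) p) - f p)) <= ennreal (4*pi^2*w (X n))"
      using nn_nsq[OF l(1)] l(2) by (simp add: F_def ennreal_leI)
    qed
   qed simp
  qed
 qed
 have "(%n. nsq lborel (F (e n))) ----> nsq lborel f"
  by (rule L2_tendsto_nsq[OF LF[OF e(1)] f lim])
 moreover have "(%n. nsq lborel (F (e n))) ----> 4*pi^2*nsq spec g"
 proof -
  have eq: "nsq lborel (F (e n)) = 4*pi^2*(\<integral>q. (exp (- snd q*e n))^2*(norm (g q))^2 \<partial>spec)" for n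
  proof -
   have dom1: "AE q in spec. norm ((exp (- snd q*e n))^2*(norm (g q))^2) <= (norm (g q))^2"
    using sup
   proof eventually_elim
    case (elim q)
    show ?case
    proof (cases "snd q > 0")
     case True
     then have "exp (- snd q*e n) <= 1" using e(1)[of n] by simp
     then have "(exp (- snd q*e n))^2 <= 1" by (simp add: power_le_one)
     then show ?thesis by (simp add: abs_mult mult_left_le_one_le)
    qed (use elim in auto)
   qed
   have i: "integrable spec (%q. (exp (- snd q*e n))^2*(norm (g q))^2)"
    by (rule integrable_bound[OF ig]) (use dom1 in auto)
   have "ennreal (nsq lborel (F (e n))) = ennreal (4*pi^2)*(\<integral>\<^sup>+q. ennreal ((norm (1*complex_of_real (exp (- snd q*e n)) + 0 * of_real (exp (- snd q*e n))))^2*(norm (g q))^2) \<partial>spec)"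
    using nn_shift_combination[OF g e(1) e(1), of 1 n 0 n] nn_nsq[OF LF[OF e(1)], of n] by (simp add: F_def)
   also have "... = ennreal (4*pi^2)*ennreal (\<integral>q. (exp (- snd q*e n))^2*(norm (g q))^2 \<partial>spec)"
    using i by (subst nn_integral_eq_integral[symmetric]) (auto simp del: of_real_exp)
   finally show ?thesis by (simp add: ennreal_mult[symmetric])
  qed
  have "(%n. \<integral>q. (exp (- snd q*e n))^2*(norm (g q))^2 \<partial>spec) ----> (\<integral>q. (norm (g q))^2 \<partial>spec)"
  proof (rule integral_dominated_convergence[OF _ _ ig])
   show "AE q in spec. (%n. (exp (- snd q*e n))^2*(norm (g q))^2) ----> (norm (g q))^2"
   proof (rule AE_I2)
    fix q :: "real \<times> real"
    have "(%n. (exp (- snd q*e n))^2*(norm (g q))^2) ----> (exp (- snd q*0))^2*(norm (g q))^2"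
     by (intro tendsto_intros e)
    then show "(%n. (exp (- snd q*e n))^2*(norm (g q))^2) ----> (norm (g q))^2" by simp
   qed
   show "AE q in spec. norm ((exp (- snd q*e n))^2*(norm (g q))^2) <= (norm (g q))^2" for n
    using sup
   proof eventually_elim
    case (elim q)
    show ?case
    proof (cases "snd q > 0")
     case True
     then have "exp (- snd q*e n) <= 1" using e(1)[of n] by simp
     then have "(exp (- snd q*e n))^2 <= 1" by (simp add: power_le_one)
     then show ?thesis by (simp add: abs_mult mult_left_le_one_le)
    qed (use elim in auto)
   qed
  qed measurable
  then show ?thesis unfolding eq nsq_def[of spec] by (intro tendsto_intros)
 qed
 ultimately have "nsq lborel f = 4*pi^2*nsq spec g" by (rule LIMSEQ_unique)
 with bv f that show ?thesis by blast
qed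

lemma has_boundary_value_add_cmult:
 assumes "L2 spec g" "L2 spec g'" and f: "has_boundary_value b (Lap g) f" and f': "has_boundary_value b (Lap g') f'"
 shows "has_boundary_value b (%p. Lap g p + c*Lap g' p) (%p. f p + c*f' p)"
proof -
 have [measurable]: "g \<in> bm" "g' \<in> bm" by (auto intro: L2_spec_measurable assms)
 have L: "L2 lborel f" "L2 lborel f'" using f f' by (auto simp: has_boundary_value_def L2_iff_nn)
 have [measurable]: "f \<in> bm" "f' \<in> bm" using L by (auto simp: L2_def)
 have "L2 lborel (%p. f p + c*f' p)" by (intro L2_add L2_cmult L)
 moreover have "((%e. NI p. nrm2 (Lap g (bdpt b e p) + c*Lap g' (bdpt b e p) - (f p + c*f' p))) \<longlongrightarrow> 0) (at_right 0)"
 proof (rule tendsto_sandwich[OF _ _ tendsto_const])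
  let ?I = "%e. NI p. nrm2 (Lap g (bdpt b e p) - f p)"
  let ?J = "%e. NI p. nrm2 (Lap g' (bdpt b e p) - f' p)"
  have "((%e. 2*?I e + 2*(ennreal ((norm c)^2)*?J e)) \<longlongrightarrow> 2*0 + 2*(ennreal ((norm c)^2)*0)) (at_right 0)"
   using f f' by (intro tendsto_add ennreal_tendsto_cmult) (auto simp: has_boundary_value_def)
  then show "((%e. 2*?I e + 2*(ennreal ((norm c)^2)*?J e)) \<longlongrightarrow> 0) (at_right 0)" by simp
  show "\<forall>\<^sub>F e in at_right 0. (NI p. nrm2 (Lap g (bdpt b e p) + c*Lap g' (bdpt b e p) - (f p + c*f' p))) <= 2*?I e + 2*(ennreal ((norm c)^2)*?J e)"
  proof (rule always_eventually, rule allI)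
   fix e
   have "(NI p. nrm2 (Lap g (bdpt b e p) + c*Lap g' (bdpt b e p) - (f p + c*f' p)))
    = (NI p. nrm2 ((Lap g (bdpt b e p) - f p) + c*(Lap g' (bdpt b e p) - f' p)))"
    by (simp add: algebra_simps)
   also have "... <= 2*?I e + 2*(NI p. nrm2 (c*(Lap g' (bdpt b e p) - f' p)))"
    by (rule nn_norm_add_sq_le) measurable
   also have "(NI p. nrm2 (c*(Lap g' (bdpt b e p) - f' p))) = ennreal ((norm c)^2)*?J e"
    unfolding ennreal_mult_norm_sq by (rule nn_integral_cmult) measurable
   finally show "(NI p. nrm2 (Lap g (bdpt b e p) + c*Lap g' (bdpt b e p) - (f p + c*f' p))) <= 2*?I e + 2*(ennreal ((norm c)^2)*?J e)" .
  qed
 qed simp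
 ultimately show ?thesis by (auto simp: has_boundary_value_def L2_iff_nn)
qed

lemma has_boundary_value_unique:
 assumes g: "L2 spec g" and f: "has_boundary_value b (Lap g) f" and f': "has_boundary_value b (Lap g) f'"
 shows "AE p in lborel. f p = f' p"
proof -
 have [measurable]: "g \<in> bm" by (auto intro: L2_spec_measurable assms)
 have L: "L2 lborel f" "L2 lborel f'" using f f' by (auto simp: has_boundary_value_def L2_iff_nn)
 have [measurable]: "f \<in> bm" "f' \<in> bm" using L by (auto simp: L2_def)
 let ?I = "%f e. NI p. nrm2 (Lap g (bdpt b e p) - f p)"
 have le: "(NI p. nrm2 (f p - f' p)) <= 2*?I f e + 2*?I f' e" for e
 proof -
  have "(NI p. nrm2 (f p - f' p)) = (NI p. nrm2 ((f p - Lap g (bdpt b e p)) + (Lap g (bdpt b e p) - f' p)))"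
   by simp
  also have "... <= 2*(NI p. nrm2 (f p - Lap g (bdpt b e p))) + 2*?I f' e"
   by (rule nn_norm_add_sq_le) measurable
  finally show ?thesis by (simp add: norm_minus_commute)
 qed
 have "((%e. 2*?I f e + 2*?I f' e) \<longlongrightarrow> 2*0 + 2*0) (at_right 0)"
  using f f' by (intro tendsto_add ennreal_tendsto_cmult) (auto simp: has_boundary_value_def)
 then have "(NI p. nrm2 (f p - f' p)) <= 2*0 + 2*0"
  by (rule tendsto_lowerbound) (auto intro!: always_eventually le)
 then have "nsq lborel (%p. f p - f' p) = 0"
  using nn_nsq[OF L2_diff(1)[OF L]] nsq_nonneg[of lborel "%p. f p - f' p"] by (simp add: ennreal_eq_0_iff)
 then show ?thesis using nsq_eq_0_iff[OF L2_diff(1)[OF L]] by simp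
qed

lemma nsq_boundary_value:
 assumes g: "L2 spec g" and f: "has_boundary_value b (Lap g) f"
 shows "nsq lborel f = 4*pi^2*nsq spec g"
proof -
 obtain f0 where f0: "has_boundary_value b (Lap g) f0" "L2 lborel f0" "nsq lborel f0 = 4*pi^2*nsq spec g"
  using Lap_boundary_value[OF g] .
 have "AE p in lborel. f p = f0 p" by (rule has_boundary_value_unique[OF g f f0(1)])
 then have "nsq lborel f = nsq lborel f0" unfolding nsq_def
  using f f0 by (intro integral_cong_AE) (auto simp: has_boundary_value_def L2_def)
 then show ?thesis using f0 by simp
qed

lemma Lap_add_cmult:
 assumes "lap_on U g" "lap_on U g'" "tube_pt P \<in> U"
 shows "Lap (%q. g q + c*g' q) P = Lap g P + c*Lap g' P"
proof -
 have "Lap (%q. g q + c*g' q) P = (LI q. wave P q*g q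
   + c*(wave P q*g' q))"
  unfolding Lap_def by (simp add: algebra_simps)
 also have "... = Lap g P + c*Lap g' P"
  unfolding Lap_def using Lap_integrable[OF assms(1,3)] Lap_integrable[OF assms(2,3)] by simp
 finally show ?thesis .
qed

text \<open>Norms of boundary values are known, and polarisation recovers the inner product.\<close>

theorem hardy_inner_Lap:
 assumes g: "L2 spec g" and g': "L2 spec g'"
  and F: "!!p. p \<in> tube_domain b ==> F p = Lap g p" and F': "!!p. p \<in> tube_domain b ==> F' p = Lap g' p"
 shows "hardy_inner b F F' = 4*pi^2*(\<integral>q. g q*cnj (g' q) \<partial>spec)"
proof -
 have bvF: "has_boundary_value b (Lap g) (boundary_value b F)"
 proof -
  obtain f where "has_boundary_value b (Lap g) f" using Lap_boundary_value[OF g] by blast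
  then have "has_boundary_value b F f" using has_boundary_value_cong[of F "Lap g", OF F] by blast
  then have "has_boundary_value b F (boundary_value b F)" unfolding boundary_value_def by (rule someI[of "has_boundary_value b F"])
  then show ?thesis using has_boundary_value_cong[of F "Lap g", OF F] by blast
 qed
 have bvF': "has_boundary_value b (Lap g') (boundary_value b F')"
 proof -
  obtain f where "has_boundary_value b (Lap g') f" using Lap_boundary_value[OF g'] by blast
  then have "has_boundary_value b F' f" using has_boundary_value_cong[of F' "Lap g'", OF F'] by blast
  then have "has_boundary_value b F' (boundary_value b F')" unfolding boundary_value_def by (rule someI[of "has_boundary_value b F'"])
  then show ?thesis using has_boundary_value_cong[of F' "Lap g'", OF F'] by blast
 qed
 define f f' where "f = boundary_value b F" and "f' = boundary_value b F'"
 have L: "L2 lborel f" "L2 lborel f'" using bvF bvF' by (auto simp: f_def f'_def has_boundary_value_def L2_iff_nn)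
 have n: "nsq lborel (%p. f p + c*f' p) = 4*pi^2*nsq spec (%q. g q + c*g' q)" for c
 proof (rule nsq_boundary_value)
  show "L2 spec (%q. g q + c*g' q)" by (intro L2_add L2_cmult g g')
  have "has_boundary_value b (%p. Lap g p + c*Lap g' p) (%p. f p + c*f' p)"
   unfolding f_def f'_def by (rule has_boundary_value_add_cmult[OF g g' bvF bvF'])
  then show "has_boundary_value b (Lap (%q. g q + c*g' q)) (%p. f p + c*f' p)"
   by (rule has_boundary_value_cong[THEN iffD1, rotated])
     (auto simp: Lap_add_cmult[OF L2_spec_lap_on[OF g] L2_spec_lap_on[OF g']] tube_domain_base)
 qed
 have "4*hardy_inner b F F' = 4*(LI p. f p*cnj (f' p))"
  by (simp add: hardy_inner_def f_def f'_def)
 also have "... = 4*pi^2*(4*(\<integral>q. g q*cnj (g' q) \<partial>spec))"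
  unfolding L2_polarization[OF L] L2_polarization[OF g g']
  using n[of 1] n[of "-1"] n[of \<i>] n[of "-\<i>"] by (simp add: algebra_simps)
 finally show ?thesis by simp
qed

end

section \<open>Rectangular contours\<close>

lemma borel_measurable_Complex [measurable (raw)]:
 assumes "f \<in> borel_measurable M" "g \<in> borel_measurable M"
 shows "(%x. Complex (f x) (g x)) \<in> borel_measurable M"
 unfolding Complex_eq using assms by measurable

lemma contour_integral_linepath_same_Im:
 assumes "x1 < x2"
 shows "contour_integral (linepath (Complex x1 y) (Complex x2 y)) f = integral {x1..x2} (%u. f (Complex u y))"
proof -
 have i: "Complex (- y) u = \<i>*Complex u y" for u by (simp add: complex_eq_iff)
 define g where "g w = f (- \<i>*w)" for w
 have "contour_integral (linepath (Complex (-y) x1) (Complex (-y) x2)) g = \<i>*integral {x1..x2} (%u. g (Complex (-y) u))"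
  using assms by (intro contour_integral_linepath_same_Re) auto
 also have "contour_integral (linepath (Complex (-y) x1) (Complex (-y) x2)) g
   = \<i>*contour_integral (linepath (Complex x1 y) (Complex x2 y)) f"
 proof -
  have l: "linepath (Complex (-y) x1) (Complex (-y) x2) t = \<i>*linepath (Complex x1 y) (Complex x2 y) t" for t
   unfolding i linepath_def by (simp add: scaleR_conv_of_real algebra_simps)
  have A: "contour_integral (linepath z z') h = (z' - z)*integral {0..1} (%t. h (linepath z z' t))" for z z' h
   by (simp add: contour_integral_integral)
  have gl: "g (linepath (Complex (-y) x1) (Complex (-y) x2) t) = f (linepath (Complex x1 y) (Complex x2 y) t)" for t
   unfolding l g_def by (simp add: mult.assoc[symmetric])
  show ?thesis unfolding A gl by (simp add: i right_diff_distrib mult.assoc)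
 qed
 finally show ?thesis by (simp add: g_def i mult.assoc[symmetric])
qed

lemma contour_integral_rectpath:
 assumes cont: "continuous_on (path_image (rectpath (Complex x1 y1) (Complex x2 y2))) g" and x: "x1 < x2" and y: "y1 < y2"
 shows "contour_integral (rectpath (Complex x1 y1) (Complex x2 y2)) g =
  integral {x1..x2} (%u. g (Complex u y1)) + \<i>*integral {y1..y2} (%v. g (Complex x2 v))
  - integral {x1..x2} (%u. g (Complex u y2)) - \<i>*integral {y1..y2} (%v. g (Complex x1 v))"
proof -
 let ?a1 = "Complex x1 y1" and ?a2 = "Complex x2 y1" and ?a3 = "Complex x2 y2" and ?a4 = "Complex x1 y2"
 have rp: "rectpath ?a1 ?a3 = linepath ?a1 ?a2 +++ linepath ?a2 ?a3 +++ linepath ?a3 ?a4 +++ linepath ?a4 ?a1"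
  by (simp add: rectpath_def Let_def)
 have pi: "path_image (rectpath ?a1 ?a3) = closed_segment ?a1 ?a2 \<union> (closed_segment ?a2 ?a3 \<union> (closed_segment ?a3 ?a4 \<union> closed_segment ?a4 ?a1))"
  unfolding rp by (simp add: path_image_join)
 have c: "g contour_integrable_on linepath ?a1 ?a2" "g contour_integrable_on linepath ?a2 ?a3"
  "g contour_integrable_on linepath ?a3 ?a4" "g contour_integrable_on linepath ?a4 ?a1"
  by (auto intro!: contour_integrable_continuous_linepath continuous_on_subset[OF cont] simp: pi)
 have "contour_integral (rectpath ?a1 ?a3) g = contour_integral (linepath ?a1 ?a2) g + contour_integral (linepath ?a2 ?a3) g
  + contour_integral (linepath ?a3 ?a4) g + contour_integral (linepath ?a4 ?a1) g"
  unfolding rp using c by (simp add: contour_integrable_join)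
 also have "contour_integral (linepath ?a3 ?a4) g = - contour_integral (linepath ?a4 ?a3) g"
  using cont by (intro contour_integral_reverse_linepath) (auto intro: continuous_on_subset simp: pi closed_segment_commute)
 also have "contour_integral (linepath ?a4 ?a1) g = - contour_integral (linepath ?a1 ?a4) g"
  using cont by (intro contour_integral_reverse_linepath) (auto intro: continuous_on_subset simp: pi closed_segment_commute)
 also have "contour_integral (linepath ?a1 ?a2) g = integral {x1..x2} (%u. g (Complex u y1))"
  using x by (intro contour_integral_linepath_same_Im) auto
 also have "contour_integral (linepath ?a4 ?a3) g = integral {x1..x2} (%u. g (Complex u y2))"
  using x by (intro contour_integral_linepath_same_Im) auto
 also have "contour_integral (linepath ?a2 ?a3) g = \<i>*integral {y1..y2} (%v. g (Complex x2 v))"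
  using y by (intro contour_integral_linepath_same_Re) auto
 also have "contour_integral (linepath ?a1 ?a4) g = \<i>*integral {y1..y2} (%v. g (Complex x1 v))"
  using y by (intro contour_integral_linepath_same_Re) auto
 finally show ?thesis by (simp add: algebra_simps)
qed

text \<open>Cauchy-Schwarz against the constant \<open>1\<close>, stated for nonnegative extended integrals since these are integrated
 again below.\<close>

lemma interval_integral_sq_le:
 fixes f :: "real => complex"
 assumes f: "continuous_on {a..b} f" and ab: "a <= b"
 shows "nrm2 (integral {a..b} f) <= ennreal (b - a)*(NI x. indicator {a..b} x*nrm2 (f x))"
proof -
 define g where "g x = indicator {a..b} x *\<^sub>R f x" for x
 define h where "h x = complex_of_real (indicator {a..b} x)" for x
 have si: "set_integrable lborel {a..b} f" by (rule borel_integrable_atLeastAtMost'[OF f])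
 have [measurable]: "g \<in> bm" using si unfolding g_def set_integrable_def by auto
 have "set_integrable lborel {a..b} (%x. (norm (f x))^2)"
  by (rule borel_integrable_atLeastAtMost') (intro continuous_intros f)
 then have i2: "L1 (%x. (norm (g x))^2)"
  unfolding set_integrable_def by (rule back_subst[of "L1"]) (auto simp: g_def indicator_def fun_eq_iff)
 have Lg: "L2 lborel g" using i2 by (simp add: L2_def)
 have Lh: "L2 lborel h" unfolding h_def by (rule L2_indicator) (use ab in auto)
 have nh: "nsq lborel h = b - a"
 proof -
  have "nsq lborel h = (LI x. indicator {a..b} x)" unfolding nsq_def h_def
   by (intro Bochner_Integration.integral_cong) (auto simp: indicator_def)
  then show ?thesis using ab by simp
 qed
 have "integral {a..b} f = (LI x. g x)"
  using set_borel_integral_eq_integral(2)[OF si] by (simp add: set_lebesgue_integral_def g_def)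
 also have "... = (LI x. g x*h x)" by (intro Bochner_Integration.integral_cong) (auto simp: g_def h_def indicator_def)
 finally have "norm (integral {a..b} f) <= sqrt (nsq lborel g*nsq lborel h)" using L2_norm_integral_le[OF Lg Lh] by simp
 then have "(norm (integral {a..b} f))^2 <= (sqrt (nsq lborel g*nsq lborel h))^2" by (intro power_mono) auto
 then have "(norm (integral {a..b} f))^2 <= (b - a)*nsq lborel g" using ab by (simp add: nh mult.commute)
 then have "nrm2 (integral {a..b} f) <= ennreal (b - a)*ennreal (nsq lborel g)"
  using ab by (simp add: ennreal_mult[symmetric] ennreal_leI)
 also have "ennreal (nsq lborel g) = (NI x. indicator {a..b} x*nrm2 (f x))"
  unfolding nn_nsq[OF Lg, symmetric] by (intro nn_integral_cong) (auto simp: g_def indicator_def)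
 finally show ?thesis .
qed

text \<open>Cauchy's formula on the boundaries of concentric squares, averaged over the side length. Squares
 sweep out area with unit Jacobian.\<close>

lemma mean_value_square:
 fixes f :: "complex => complex"
 assumes f: "f holomorphic_on S" "open S" and [measurable]: "f \<in> bm" and R: "R > 0"
  and sub: "!!u v. \<bar>u - x\<bar> <= 2 * R ==> \<bar>v - y\<bar> <= 2 * R ==> Complex u v \<in> S"
 shows "nrm2 (f (Complex x y)) <= ennreal (4/R^2) *
  (NI u. NI v. indicator {x-2*R..x+2*R} u*(indicator {y-2*R..y+2*R} v * nrm2 (f (Complex u v))))"
proof -
 define p where "p = Complex x y"
 define I where "I = (NI u. NI v. indicator {x-2*R..x+2*R} u*(indicator {y-2*R..y+2*R} v * nrm2 (f (Complex u v))))"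
 define H where "H u v = nrm2 (f (Complex u v))" for u v
 have [measurable]: "case_prod H \<in> borel_measurable (borel \<Otimes>\<^sub>M borel)" unfolding H_def by measurable
 have Hc[measurable]: "(%u. H u v) \<in> bm" "(%v. H u v) \<in> bm" for u v unfolding H_def by measurable
 define NB where "NB v = (NI u. indicator {x-2*R..x+2*R} u*H u v)" for v
 define NL where "NL u = (NI v. indicator {y-2*R..y+2*R} v * H u v)" for u
 have [measurable]: "NB \<in> bm" "NL \<in> bm" unfolding NB_def NL_def by measurable
 have I1: "I = (NI u. indicator {x-2*R..x+2*R} u*NL u)"
  unfolding I_def NL_def H_def by (intro nn_integral_cong) (simp add: nn_integral_cmult)
 have I2: "I = (NI v. indicator {y-2*R..y+2*R} v * NB v)"
 proof -
  have "I = (NI v. NI u. indicator {x-2*R..x+2*R} u*(indicator {y-2*R..y+2*R} v * H u v))"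
   unfolding I_def H_def[symmetric] by (rule lborel_pair.Fubini'[symmetric]) measurable
  also have "... = (NI v. indicator {y-2*R..y+2*R} v * NB v)"
   unfolding NB_def by (intro nn_integral_cong) (simp add: nn_integral_cmult[symmetric] mult_ac)
  finally show ?thesis .
 qed
 have cont: "continuous_on S f" by (rule holomorphic_on_imp_continuous_on[OF f(1)])
 have key: "nrm2 (f p) <= ennreal (1/R)*(NB (y - r) + NL (x + r) + NB (y + r) + NL (x - r))"
  if r: "R <= r" "r <= 2 * R" for r
 proof -
  have r0: "r > 0" using r R by linarith
  define C where "C = {z. \<bar>Re z - x\<bar> <= 2 * R \<and> \<bar>Im z - y\<bar> <= 2 * R}"
  have CS: "C \<subseteq> S"
  proof
   fix z assume "z \<in> C"
   then show "z \<in> S" using sub[of "Re z" "Im z"] by (simp add: C_def)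
  qed
  have Cbox: "C = cbox (Complex (x - 2*R) (y - 2*R)) (Complex (x + 2*R) (y + 2*R))"
   by (auto simp: C_def in_cbox_complex_iff)
  have conv: "convex C" unfolding Cbox by (rule convex_box)
  have pint: "p \<in> interior C" unfolding Cbox interior_cbox using R by (simp add: p_def in_box_complex_iff)
  let ?ga = "rectpath (Complex (x - r) (y - r)) (Complex (x + r) (y + r))"
  have img: "path_image ?ga \<subseteq> cbox (Complex (x - r) (y - r)) (Complex (x + r) (y + r)) - {p}"
   using path_image_rectpath_cbox_minus_box[of "Complex (x - r) (y - r)" "Complex (x + r) (y + r)"] r0
   by (auto simp: p_def in_box_complex_iff)
  also have "... \<subseteq> C - {p}" using r by (auto simp: C_def in_cbox_complex_iff)
  finally have imgC: "path_image ?ga \<subseteq> C - {p}" .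
  have wn: "winding_number ?ga p = 1" using r0 by (intro winding_number_rectpath) (simp add: p_def in_box_complex_iff)
  define g where "g z = f z/(z - p)" for z
  have "(g has_contour_integral (2*pi*\<i>*winding_number ?ga p*f p)) ?ga"
   unfolding g_def
   by (rule Cauchy_integral_formula_convex_simple[OF conv holomorphic_on_subset[OF f(1) CS] pint _ imgC]) auto
  then have ci: "contour_integral ?ga g = 2*pi*\<i>*f p" unfolding wn by (simp add: contour_integral_unique)
  have cg: "continuous_on (C - {p}) g" unfolding g_def
   by (intro continuous_intros continuous_on_subset[OF cont]) (use CS in auto)
  define B where "B = integral {x - r..x + r} (%u. g (Complex u (y - r)))"
  define T where "T = integral {x - r..x + r} (%u. g (Complex u (y + r)))"
  define L where "L = integral {y - r..y + r} (%v. g (Complex (x - r) v))"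
  define Q where "Q = integral {y - r..y + r} (%v. g (Complex (x + r) v))"
  have eq: "2*pi*\<i>*f p = B + \<i>*Q - T - \<i>*L"
   unfolding ci[symmetric] B_def T_def L_def Q_def
   by (rule contour_integral_rectpath[OF continuous_on_subset[OF cg imgC]]) (use r0 in auto)
  have cC: "continuous_on A (%u. Complex u c)" "continuous_on A (%v. Complex c v)" for A c
   unfolding Complex_eq by (intro continuous_intros)+
  have gb: "(norm (g z))^2 <= (norm (f z))^2/r^2" if "norm (z - p) >= r" for z
  proof -
   have "norm (g z) <= norm (f z)/r" unfolding g_def norm_divide using that r0 by (intro divide_left_mono mult_pos_pos) auto
   then have "(norm (g z))^2 <= (norm (f z)/r)^2" by (intro power_mono) auto
   then show ?thesis by (simp add: power_divide)
  qed
  have seg: "nrm2 (integral {w - r..w + r} (%u. g (k u)))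
    <= ennreal (2/r)*(NI u. indicator {w-2*R..w+2*R} u*nrm2 (f (k u)))"
   if cont: "continuous_on {w - r..w + r} (%u. g (k u))" and far: "!!u. norm (k u - p) >= r"
    and m: "(%u. f (k u)) \<in> bm" for k w
  proof -
   define h where "h u = f (k u)" for u
   have [measurable]: "h \<in> bm" using m by (simp add: h_def[abs_def])
   let ?J = "NI u. indicator {w-2*R..w+2*R} u*nrm2 (h u)"
   have "nrm2 (integral {w - r..w + r} (%u. g (k u)))
    <= ennreal (w + r - (w - r))*(NI u. indicator {w - r..w + r} u*nrm2 (g (k u)))"
    using cont by (rule interval_integral_sq_le) (use r0 in auto)
   also have "(NI u. indicator {w - r..w + r} u*nrm2 (g (k u)))
    <= (NI u. ennreal (1/r^2)*(indicator {w-2*R..w+2*R} u*nrm2 (h u)))"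
   proof (rule nn_integral_mono)
    fix u
    have "nrm2 (g (k u)) <= ennreal (1/r^2)*nrm2 (h u)"
     using gb[OF far, of u] by (simp add: h_def ennreal_mult[symmetric] ennreal_leI)
    then show "indicator {w - r..w + r} u*nrm2 (g (k u)) <= ennreal (1/r^2)*(indicator {w-2*R..w+2*R} u*nrm2 (h u))"
     using r by (auto simp: indicator_def)
   qed
   also have "... = ennreal (1/r^2)*?J" by (rule nn_integral_cmult) measurable
   also have "ennreal (w + r - (w - r))*(ennreal (1/r^2)*?J) = ennreal (2/r)*?J"
    unfolding mult.assoc[symmetric] using r0 by (subst ennreal_mult[symmetric]) (auto simp: power2_eq_square)
   finally show ?thesis by (simp add: mult_left_mono h_def)
  qed
  have hor: "nrm2 (integral {x - r..x + r} (%u. g (Complex u c))) <= ennreal (2/r)*NB c" if c: "\<bar>c - y\<bar> = r" for c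
   unfolding NB_def H_def
  proof (rule seg)
   show "norm (Complex u c - p) >= r" for u using abs_Im_le_cmod[of "Complex u c - p"] c by (simp add: p_def)
   show "continuous_on {x - r..x + r} (%u. g (Complex u c))"
    by (rule continuous_on_compose2[OF cg cC(1)]) (use r c r0 in \<open>auto simp: C_def p_def\<close>)
  qed measurable
  have ver: "nrm2 (integral {y - r..y + r} (%v. g (Complex c v))) <= ennreal (2/r)*NL c" if c: "\<bar>c - x\<bar> = r" for c
   unfolding NL_def H_def
  proof (rule seg)
   show "norm (Complex c v - p) >= r" for v using abs_Re_le_cmod[of "Complex c v - p"] c by (simp add: p_def)
   show "continuous_on {y - r..y + r} (%v. g (Complex c v))"
    by (rule continuous_on_compose2[OF cg cC(2)]) (use r c r0 in \<open>auto simp: C_def p_def\<close>)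
  qed measurable
  have four: "(norm (B + \<i>*Q - T - \<i>*L))^2 <= 4*((norm B)^2 + (norm Q)^2 + (norm T)^2 + (norm L)^2)"
  proof -
   have "(norm ((B + \<i>*Q) + (- T + - \<i>*L)))^2 <= 2*(norm (B + \<i>*Q))^2 + 2*(norm (- T + - \<i>*L))^2"
    by (rule norm_add_sq_le)
   also have "... <= 2*(2*(norm B)^2 + 2*(norm (\<i>*Q))^2) + 2*(2*(norm (- T))^2 + 2*(norm (- \<i>*L))^2)"
    by (intro add_mono mult_left_mono norm_add_sq_le) auto
   finally show ?thesis by (simp add: norm_mult algebra_simps)
  qed
  have "(norm (2*pi*\<i>*f p))^2 = 4*pi^2*(norm (f p))^2" by (simp add: norm_mult power_mult_distrib)
  then have "pi^2*(norm (f p))^2 <= (norm B)^2 + (norm Q)^2 + (norm T)^2 + (norm L)^2" using four eq by simp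
  moreover have "2*(norm (f p))^2 <= pi^2*(norm (f p))^2"
  proof (rule mult_right_mono)
   have "2*2 <= pi*pi" using pi_ge_two by (intro mult_mono) auto
   then show "2 <= pi^2" by (simp add: power2_eq_square)
  qed simp
  ultimately have "2*(norm (f p))^2 <= (norm B)^2 + (norm Q)^2 + (norm T)^2 + (norm L)^2" by linarith
  then have "ennreal (2*(norm (f p))^2) <= ennreal ((norm B)^2) + ennreal ((norm Q)^2) + ennreal ((norm T)^2) + ennreal ((norm L)^2)"
   by (simp add: ennreal_plus[symmetric] ennreal_leI del: ennreal_plus)
  also have "... <= ennreal (2/r)*NB (y - r) + ennreal (2/r)*NL (x + r) + ennreal (2/r)*NB (y + r) + ennreal (2/r)*NL (x - r)"
   unfolding B_def Q_def T_def L_def using r0 by (intro add_mono hor ver) auto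
  also have "... = ennreal (2/r)*(NB (y - r) + NL (x + r) + NB (y + r) + NL (x - r))" by (simp add: distrib_left)
  also have "... <= ennreal (2/R)*(NB (y - r) + NL (x + r) + NB (y + r) + NL (x - r))"
   using r R by (intro mult_right_mono ennreal_leI divide_left_mono) auto
  finally have "ennreal (1/2)*ennreal (2*(norm (f p))^2) <= ennreal (1/2)*(ennreal (2/R)*(NB (y - r) + NL (x + r) + NB (y + r) + NL (x - r)))"
   by (rule mult_left_mono) simp
  moreover have "ennreal (1/2)*ennreal (2*(norm (f p))^2) = nrm2 (f p)" by (subst ennreal_mult[symmetric]) auto
  moreover have "ennreal (1/2)*(ennreal (2/R)*W) = ennreal (1/R)*W" for W
  proof -
   have "ennreal (1/2)*ennreal (2/R) = ennreal (1/R)" using R by (subst ennreal_mult[symmetric]) auto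
   then show ?thesis by (simp add: mult.assoc[symmetric])
  qed
  ultimately show ?thesis by simp
 qed
 have sw: "(NI r. indicator {R..2*R} r*NB (y - r)) <= I" "(NI r. indicator {R..2*R} r*NB (y + r)) <= I"
  "(NI r. indicator {R..2*R} r*NL (x - r)) <= I" "(NI r. indicator {R..2*R} r*NL (x + r)) <= I"
 proof -
  have aff: "(NI v. h v) = (NI r. h (t + s*r))" if "h \<in> bm" "\<bar>s\<bar> = 1" for h :: "real => ennreal" and s t :: real
   using nn_integral_real_affine[OF that(1), of s t] that(2) by auto
  show "(NI r. indicator {R..2*R} r*NB (y - r)) <= I"
   unfolding I2 by (subst aff[where s="-1" and t=y and h="%v. indicator {y-2*R..y+2*R} v * NB v"])
    (use R in \<open>auto intro!: nn_integral_mono mult_right_mono simp: indicator_def\<close>)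
  show "(NI r. indicator {R..2*R} r*NB (y + r)) <= I"
   unfolding I2 by (subst aff[where s=1 and t=y and h="%v. indicator {y-2*R..y+2*R} v * NB v"])
    (use R in \<open>auto intro!: nn_integral_mono mult_right_mono simp: indicator_def\<close>)
  show "(NI r. indicator {R..2*R} r*NL (x - r)) <= I"
   unfolding I1 by (subst aff[where s="-1" and t=x and h="%v. indicator {x-2*R..x+2*R} v * NL v"])
    (use R in \<open>auto intro!: nn_integral_mono mult_right_mono simp: indicator_def\<close>)
  show "(NI r. indicator {R..2*R} r*NL (x + r)) <= I"
   unfolding I1 by (subst aff[where s=1 and t=x and h="%v. indicator {x-2*R..x+2*R} v * NL v"])
    (use R in \<open>auto intro!: nn_integral_mono mult_right_mono simp: indicator_def\<close>)
 qed
 have "nrm2 (f p)*ennreal R = (NI r. nrm2 (f p)*indicator {R..2*R} r)"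
  using R by (simp add: nn_integral_cmult_indicator)
 also have "... <= (NI r. ennreal (1/R)*(indicator {R..2*R} r*NB (y - r) + indicator {R..2*R} r*NL (x + r)
   + indicator {R..2*R} r*NB (y + r) + indicator {R..2*R} r*NL (x - r)))"
  by (intro nn_integral_mono) (use key in \<open>auto simp: indicator_def\<close>)
 also have "... = ennreal (1/R)*((NI r. indicator {R..2*R} r*NB (y - r)) + (NI r. indicator {R..2*R} r*NL (x + r))
   + (NI r. indicator {R..2*R} r*NB (y + r)) + (NI r. indicator {R..2*R} r*NL (x - r)))"
  by (simp add: nn_integral_cmult nn_integral_add)
 also have "... <= ennreal (1/R)*(I + I + I + I)"
  by (intro mult_left_mono add_mono sw) simp
 finally have "ennreal (1/R)*(nrm2 (f p)*ennreal R) <= ennreal (1/R)*(ennreal (1/R)*(I + I + I + I))"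
  by (rule mult_left_mono) simp
 moreover have "ennreal (1/R)*(nrm2 (f p)*ennreal R) = nrm2 (f p)"
 proof -
  have "ennreal (1/R)*(nrm2 (f p)*ennreal R) = nrm2 (f p)*(ennreal (1/R)*ennreal R)" by (simp add: mult_ac)
  also have "ennreal (1/R)*ennreal R = 1" using R by (subst ennreal_mult[symmetric]) auto
  finally show ?thesis by simp
 qed
 moreover have "ennreal (1/R)*(ennreal (1/R)*(I + I + I + I)) = ennreal (4/R^2)*I"
 proof -
  have "I + I + I + I = ennreal 4*I"     proof -
   have "ennreal 4 = 1 + 1 + 1 + 1" by simp
   then show ?thesis by (simp only: distrib_right mult_1)
  qed
  moreover have "ennreal (1/R)*(ennreal (1/R)*ennreal 4) = ennreal (4/R^2)"
   using R by (simp add: ennreal_mult[symmetric] power2_eq_square del: ennreal_numeral)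
  ultimately show ?thesis by (simp add: mult.assoc[symmetric] del: ennreal_numeral)
 qed
 ultimately show ?thesis by (simp add: I_def p_def)
qed

text \<open>The vertical sides of tall rectangles carry the two integrals, and the horizontal sides vanish in the limit by the quadratic
 decay.\<close>

lemma vertical_line_shift:
 fixes f :: "complex => complex"
 assumes f: "f holomorphic_on {z. x1 <= Re z \<and> Re z <= x2}" and x: "x1 < x2"
  and B: "!!x y. x1 <= x ==> x <= x2 ==> norm (f (Complex x y)) <= C/(1 + y^2)"
 shows "(LI y. f (Complex x1 y)) = (LI y. f (Complex x2 y))"
proof -
 let ?S = "{z. x1 <= Re z \<and> Re z <= x2}"
 have C0: "C >= 0" using B[of x1 0] x by (auto intro: order_trans[OF norm_ge_zero])
 have cont: "continuous_on ?S f" by (rule holomorphic_on_imp_continuous_on[OF f])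
 have cC: "continuous_on A (%u. Complex u c)" "continuous_on A (%v. Complex c v)" for A c
  unfolding Complex_eq by (intro continuous_intros)+
 have conv: "convex ?S"
 proof -
  have "?S = {z. x1 <= Re z} \<inter> {z. Re z <= x2}" by auto
  then show ?thesis by (simp add: convex_Int convex_halfspace_Re_ge convex_halfspace_Re_le)
 qed
 have cv: "continuous_on UNIV (%v. f (Complex x v))" if "x1 <= x" "x <= x2" for x
  by (rule continuous_on_compose2[OF cont cC(2)]) (use that in auto)
 have ib: "L1 (%y::real. C/(1 + y^2))"
  using integrable_mult_right[OF integrable_inverse_1_plus_square[unfolded set_integrable_def], of C]
  by (simp add: divide_inverse)
 have lim: "(%n. integral {- real (Suc n)..real (Suc n)} (%v. f (Complex x v))) ----> (LI y. f (Complex x y))"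
  if xx: "x1 <= x" "x <= x2" for x
 proof -
  have m[measurable]: "(%v. f (Complex x v)) \<in> bm" by (rule borel_measurable_continuous_onI[OF cv[OF xx]])
  have "(%n. LI y. indicator {- real (Suc n)..real (Suc n)} y *\<^sub>R f (Complex x y)) ----> (LI y. f (Complex x y))"
  proof (rule integral_dominated_convergence[OF _ _ ib])
   show "AE y in lborel. (%n. indicator {- real (Suc n)..real (Suc n)} y *\<^sub>R f (Complex x y)) ----> f (Complex x y)"
   proof (rule AE_I2)
    fix y :: real
    obtain N :: nat where N: "\<bar>y\<bar> <= N" using real_arch_simple by blast
    have "\<forall>\<^sub>F n in sequentially. indicator {- real (Suc n)..real (Suc n)} y *\<^sub>R f (Complex x y) = f (Complex x y)"
     unfolding eventually_sequentially by (rule exI[of _ N]) (use N in \<open>auto simp: indicator_def\<close>)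
    then show "(%n. indicator {- real (Suc n)..real (Suc n)} y *\<^sub>R f (Complex x y)) ----> f (Complex x y)"
     by (rule tendsto_eventually)
   qed
   show "AE y in lborel. norm (indicator {- real (Suc n)..real (Suc n)} y *\<^sub>R f (Complex x y)) <= C/(1 + y^2)" for n
    using B[OF xx] C0 by (intro AE_I2) (auto simp: indicator_def)
  qed measurable
  moreover have "(LI y. indicator {- real (Suc n)..real (Suc n)} y *\<^sub>R f (Complex x y)) = integral {- real (Suc n)..real (Suc n)} (%v. f (Complex x v))" for n
   using set_borel_integral_eq_integral(2)[OF borel_integrable_atLeastAtMost'[OF continuous_on_subset[OF cv[OF xx]]]]
   by (simp add: set_lebesgue_integral_def)
  ultimately show ?thesis by simp
 qed
 have hor: "(%n. integral {x1..x2} (%u. f (Complex u (s*real (Suc n))))) ----> 0" if s: "\<bar>s\<bar> = 1" for s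
 proof (rule Lim_null_comparison)
  show "\<forall>\<^sub>F n in sequentially. norm (integral {x1..x2} (%u. f (Complex u (s*real (Suc n))))) <= C*(x2 - x1)*inverse (real (Suc n))"
  proof (rule always_eventually, rule allI)
   fix n
   have s2: "(s*real (Suc n))^2 = (real (Suc n))^2" using s by (metis mult_1 power2_abs power_mult_distrib power_one)
   have "norm (integral {x1..x2} (%u. f (Complex u (s*real (Suc n))))) <= (C*inverse (real (Suc n)))*(x2 - x1)"
   proof (rule integral_bound)
    show "continuous_on {x1..x2} (%u. f (Complex u (s*real (Suc n))))"
     by (rule continuous_on_compose2[OF cont cC(1)]) auto
    fix u assume u: "u \<in> {x1..x2}"
    have "norm (f (Complex u (s*real (Suc n)))) <= C/(1 + (real (Suc n))^2)" using B[of u "s*real (Suc n)"] u s2 by simp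
    also have "... <= C/real (Suc n)"
     using C0 by (intro divide_left_mono) (auto simp: power2_eq_square algebra_simps intro!: mult_pos_pos add_pos_nonneg)
    finally show "norm (f (Complex u (s*real (Suc n)))) <= C*inverse (real (Suc n))" by (simp add: divide_inverse)
   qed (use x in auto)
   then show "norm (integral {x1..x2} (%u. f (Complex u (s*real (Suc n))))) <= C*(x2 - x1)*inverse (real (Suc n))" by (simp add: mult_ac)
  qed
  show "(%n. C*(x2 - x1)*inverse (real (Suc n))) ----> 0"
   by (intro tendsto_mult_right_zero LIMSEQ_inverse_real_of_nat)
 qed
 have z: "integral {x1..x2} (%u. f (Complex u ((-1)*real (Suc n)))) + \<i>*integral {- real (Suc n)..real (Suc n)} (%v. f (Complex x2 v))
  - integral {x1..x2} (%u. f (Complex u (1*real (Suc n)))) - \<i>*integral {- real (Suc n)..real (Suc n)} (%v. f (Complex x1 v)) = 0" for n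
 proof -
  let ?g = "rectpath (Complex x1 (- real (Suc n))) (Complex x2 (real (Suc n)))"
  have img: "path_image ?g \<subseteq> ?S"
   using path_image_rectpath_subset_cbox[of "Complex x1 (- real (Suc n))" "Complex x2 (real (Suc n))"] x
   by (auto simp: in_cbox_complex_iff)
  have "(f has_contour_integral 0) ?g"
   by (rule Cauchy_theorem_convex_simple[OF f conv _ img]) auto
  then have "contour_integral ?g f = 0" by (rule contour_integral_unique)
  then show ?thesis
   by (subst (asm) contour_integral_rectpath[OF continuous_on_subset[OF cont img] x]) auto
 qed
 have "(%n. integral {x1..x2} (%u. f (Complex u ((-1)*real (Suc n)))) + \<i>*integral {- real (Suc n)..real (Suc n)} (%v. f (Complex x2 v))
  - integral {x1..x2} (%u. f (Complex u (1*real (Suc n)))) - \<i>*integral {- real (Suc n)..real (Suc n)} (%v. f (Complex x1 v)))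
  ----> 0 + \<i>*(LI y. f (Complex x2 y)) - 0 - \<i>*(LI y. f (Complex x1 y))"
  by (intro tendsto_intros hor lim) (use x in auto)
 then have "0 = 0 + \<i>*(LI y. f (Complex x2 y)) - 0 - \<i>*(LI y. f (Complex x1 y))"
  unfolding z by (simp add: LIMSEQ_const_iff)
 then show ?thesis by simp
qed

section \<open>Hardy space functions are Laplace transforms\<close>

lemma holomorphic2_on_slices:
 assumes F: "holomorphic2_on F U"
 shows "(%z. F (z, w)) holomorphic_on {z. (z, w) \<in> U}" "(%w. F (z, w)) holomorphic_on {w. (z, w) \<in> U}"
proof -
 have d: "\<exists>A B. (F has_derivative (%(u, v). A*u + B * v)) (at p)" if "p \<in> U" for p
  using F that by (auto simp: holomorphic2_on_def)
 show "(%z. F (z, w)) holomorphic_on {z. (z, w) \<in> U}"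
 proof (rule holomorphic_onI)
  fix z assume "z \<in> {z. (z, w) \<in> U}"
  then obtain A B where AB: "(F has_derivative (%(u, v). A*u + B * v)) (at (z, w))" using d by blast
  have "((%z. (z, w)) has_derivative (%u. (u, 0))) (at z)" by (auto intro!: derivative_eq_intros)
  from has_derivative_compose[OF this AB] have "((%z. F (z, w)) has_field_derivative A) (at z)"
   by (simp add: has_field_derivative_def)
  then show "(%z. F (z, w)) field_differentiable (at z within {z. (z, w) \<in> U})"
   using field_differentiable_at_within field_differentiable_def by blast
 qed
 show "(%w. F (z, w)) holomorphic_on {w. (z, w) \<in> U}"
 proof (rule holomorphic_onI)
  fix w assume "w \<in> {w. (z, w) \<in> U}"
  then obtain A B where AB: "(F has_derivative (%(u, v). A*u + B * v)) (at (z, w))" using d by blast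
  have "((%w. (z, w)) has_derivative (%v. (0, v))) (at w)" by (auto intro!: derivative_eq_intros)
  from has_derivative_compose[OF this AB] have "((%w. F (z, w)) has_field_derivative B) (at w)"
   by (simp add: has_field_derivative_def)
  then show "(%w. F (z, w)) field_differentiable (at w within {w. (z, w) \<in> U})"
   using field_differentiable_at_within field_differentiable_def by blast
 qed
qed

lemma holomorphic2_on_continuous:
 assumes F: "holomorphic2_on F U" shows "continuous_on U F"
 using F unfolding holomorphic2_on_def
 by (intro continuous_at_imp_continuous_on ballI) (metis has_derivative_continuous)

lemma lborel_reflect:
 fixes f :: "'a::euclidean_space => 'b::{banach,second_countable_topology}"
 assumes [measurable]: "f \<in> bm"
 shows "(LI p. f (- p)) = (LI p. f p)"
  and "L1 (%p. f (- p)) \<longleftrightarrow> L1 f"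
proof -
 have d: "lborel = distr lborel borel (%x::'a. - x)"
  using lborel_affine[of "-1" "0::'a"] by (simp add: density_1)
 show "(LI p. f (- p)) = (LI p. f p)"
  by (subst (2) d, subst integral_distr) auto
 show "L1 (%p. f (- p)) \<longleftrightarrow> L1 f"
  by (subst (2) d, subst integrable_distr_eq) auto
qed

text \<open>The set where two continuous functions differ is open, so it is empty when it is null.\<close>

lemma continuous_AE_eq:
 fixes f g :: "'a::euclidean_space => 'b::t2_space"
 assumes f: "continuous_on UNIV f" and g: "continuous_on UNIV g" and eq: "AE x in lborel. f x = g x"
 shows "f x = g x"
proof (rule ccontr)
 assume ne: "f x \<noteq> g x"
 have "closed {x. f x = g x}" by (rule closed_Collect_eq[OF f g])
 moreover have "{x. f x \<noteq> g x} = - {x. f x = g x}" by auto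
 ultimately have op: "open {x. f x \<noteq> g x}" using open_Compl by metis
 then have "{x. f x \<noteq> g x} \<in> null_sets lborel"
  using eq AE_iff_null_sets[of "{x. f x \<noteq> g x}" lborel] by (simp add: borel_open)
 then have "negligible {x. f x \<noteq> g x}" by (simp add: null_sets_completionI negligible_iff_null_sets)
 with op ne show False using open_not_negligible by blast
qed

definition cauchy2 :: "real \<times> real => real" where
 "cauchy2 q = cauchy q"

lemma inverse_1_plus_square_le: "1/(1 + (x::real)^2) <= 1" "0 <= 1/(1 + (x::real)^2)"
proof -
 have "0 < 1 + x^2" by (simp add: add_pos_nonneg)
 then show "1/(1 + x^2) <= 1" "0 <= 1/(1 + x^2)" by (simp_all add: divide_le_eq)
qed

lemma cauchy2_nonneg [simp]: "0 <= cauchy2 q" and cauchy2_le_1: "cauchy2 q <= 1"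
 unfolding cauchy2_def by (intro mult_le_one mult_nonneg_nonneg inverse_1_plus_square_le)+

lemma cauchy2_le: "cauchy2 (y, t) <= 1/(1 + y^2)" "cauchy2 (y, t) <= 1/(1 + t^2)"
 using mult_left_mono[OF inverse_1_plus_square_le(1)[of t] inverse_1_plus_square_le(2)[of y]]
  mult_right_mono[OF inverse_1_plus_square_le(1)[of y] inverse_1_plus_square_le(2)[of t]]
 unfolding cauchy2_def by (simp_all only: fst_conv snd_conv mult_1 mult_1_right)

lemma integrable_cauchy2: "L1 cauchy2"
 unfolding cauchy2_def[abs_def] by (rule integrable_cauchy_product)

text \<open>Global measurability is no restriction, since the values outside of the domain may be replaced by \<open>0\<close>. The
 constants of the quadratic lower bound of \<open>b\<close> are fixed because they enter the damping factor.\<close>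

locale hardy_function = szego_poly +
 fixes F :: "complex \<times> complex => complex" and M c C :: real
 assumes F_meas [measurable]: "F \<in> bm"
  and F_holo: "holomorphic2_on F (tube_domain b)"
  and F_bound: "!!e. e > 0 ==> (NI p. nrm2 (F (bdpt b e p))) <= ennreal M"
  and M0: "M >= 0"
  and c0: "c > 0" and quad: "!!x. poly b x >= c*x^2 - C"
begin

lemma F_cont: "continuous_on (tube_domain b) F"
 by (rule holomorphic2_on_continuous[OF F_holo])

lemma Complex_in_domain: "(Complex x y, Complex t h) \<in> tube_domain b \<longleftrightarrow> poly b x < h"
 by (simp add: tube_domain_def)

text \<open>The mean value inequality in both variables bounds the function at a point by its mass over a box,
 which meets only a bounded range of heights \<open>ep\<close>.\<close>

lemma locally_bounded:
 assumes K: "compact K" "K \<subseteq> base"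
 obtains B where "B >= 0" "!!x \<xi> y t. (x, \<xi>) \<in> K ==> norm (F (Complex x y, Complex t \<xi>)) <= B"
proof -
 obtain e where e: "e > 0" "(\<Union>p\<in>K. ball p e) \<subseteq> base"
  using compact_subset_open_imp_ball_epsilon_subset[OF K(1) open_base K(2)] by blast
 define R where "R = e/8"
 have R: "R > 0" using e by (simp add: R_def)
 have box: "poly b u < v" if "(x, \<xi>) \<in> K" "\<bar>u - x\<bar> <= 2 * R" "\<bar>v - \<xi>\<bar> <= 2 * R" for x \<xi> u v
 proof -
  have "dist (x, \<xi>) (u, v) <= \<bar>u - x\<bar> + \<bar>v - \<xi>\<bar>"
   unfolding dist_Pair_Pair dist_real_def by (rule order_trans[OF sqrt_sum_squares_le_sum_abs]) (simp add: abs_minus_commute)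
  also have "... < e" using that e(1) by (simp add: R_def)
  finally have "(u, v) \<in> (\<Union>p\<in>K. ball p e)" using that(1) by auto
  then have "(u, v) \<in> base" using e(2) by (rule subsetD[rotated])
  then show ?thesis by simp
 qed
 obtain X where X: "!!p. p \<in> K ==> norm p <= X" using compact_imp_bounded[OF K(1)] by (auto simp: bounded_iff)
 define E where "E = max 1 (X + 2 * R + C)"
 have E0: "E > 0" by (simp add: E_def)
 define D where "D = (4/R^2)*((4/R^2)*(E*M))"
 have D0: "D >= 0" using E0 M0 by (simp add: D_def)
 have "norm (F (Complex x y, Complex t \<xi>)) <= sqrt D" if p: "(x, \<xi>) \<in> K" for x \<xi> y t
 proof -
  let ?iu = "%u. indicator {x-2*R..x+2*R} u :: ennreal" and ?iv = "%v. indicator {y-2*R..y+2*R} v :: ennreal"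
  let ?is = "%s. indicator {t-2*R..t+2*R} s :: ennreal" and ?ir = "%r. indicator {\<xi>-2*R..\<xi>+2*R} r :: ennreal"
  define h where "h u v s r = nrm2 (F (Complex u v, Complex s r))" for u v s r
  have [measurable]: "(%z. F (z, w)) \<in> bm" "(%z. F (w, z)) \<in> bm" for w
   by measurable
  have "h x y t \<xi> <= ennreal (4/R^2)*(NI u. NI v. ?iu u*(?iv v * h u v t \<xi>))"
   unfolding h_def
   by (rule mean_value_square[OF holomorphic2_on_slices(1)[OF F_holo, of "Complex t \<xi>"]])
     (use R in \<open>auto simp: Complex_in_domain intro!: open_vimage[OF open_tube_domain, unfolded vimage_def] continuous_intros box[OF p]\<close>)
  also have "... <= ennreal (4/R^2)*(NI u. NI v. ennreal (4/R^2)*(NI s. NI ep. indicator {0<..E} ep*nrm2 (F (bdpt b ep (u, v, s)))))"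
  proof (intro mult_left_mono nn_integral_mono)
   fix u v
   show "?iu u*(?iv v * h u v t \<xi>) <= ennreal (4/R^2)*(NI s. NI ep. indicator {0<..E} ep*nrm2 (F (bdpt b ep (u, v, s))))"
   proof (cases "\<bar>u - x\<bar> <= 2 * R")
    case True
    have "?iu u*(?iv v * h u v t \<xi>) <= h u v t \<xi>" by (auto simp: indicator_def)
    also have "... <= ennreal (4/R^2)*(NI s. NI r. ?is s*(?ir r*h u v s r))"
     unfolding h_def
     by (rule mean_value_square[OF holomorphic2_on_slices(2)[OF F_holo, of "Complex u v"]])
       (use R True in \<open>auto simp: Complex_in_domain intro!: open_vimage[OF open_tube_domain, unfolded vimage_def] continuous_intros box[OF p]\<close>)
    also have "... <= ennreal (4/R^2)*(NI s. NI ep. indicator {0<..E} ep*nrm2 (F (bdpt b ep (u, v, s))))"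
    proof (rule mult_left_mono, rule nn_integral_mono)
     fix s
     have "(NI r. ?is s*(?ir r*h u v s r)) <= (NI r. ?ir r*h u v s r)"
      by (intro nn_integral_mono) (auto simp: indicator_def)
     also have "... = (NI ep. ?ir (poly b u + 1*ep)*h u v s (poly b u + 1*ep))"
      by (subst nn_integral_real_affine[where c=1 and t="poly b u"]) (auto simp: h_def)
     also have "... <= (NI ep. indicator {0<..E} ep*nrm2 (F (bdpt b ep (u, v, s))))"
     proof (rule nn_integral_mono)
      fix ep :: real
      show "?ir (poly b u + 1*ep)*h u v s (poly b u + 1*ep) <= indicator {0<..E} ep*nrm2 (F (bdpt b ep (u, v, s)))"
      proof (cases "poly b u + ep \<in> {\<xi>-2*R..\<xi>+2*R}")
       case True
       then have "\<bar>(poly b u + ep) - \<xi>\<bar> <= 2 * R" by auto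
       from box[OF p \<open>\<bar>u - x\<bar> \<le> 2 * R\<close> this] have "ep > 0" by simp
       moreover have "ep <= E"
       proof -
        have "\<bar>\<xi>\<bar> <= norm (x, \<xi>)" using norm_snd_le[of \<xi> x] by simp
        then have "\<xi> <= X" using X[OF p] by linarith
        moreover have "poly b u >= - C" using quad[of u] c0 by (smt (verit) mult_nonneg_nonneg zero_le_power2)
        ultimately show ?thesis using True by (auto simp: E_def)
       qed
       ultimately show ?thesis by (auto simp: h_def shift_eq indicator_def)
      next
       case False
       then show ?thesis by simp
      qed
     qed
     finally show "(NI r. ?is s*(?ir r*h u v s r)) <= (NI ep. indicator {0<..E} ep*nrm2 (F (bdpt b ep (u, v, s))))" .
    qed simp
    finally show ?thesis .
   next
    case False
    then have "u \<notin> {x-2*R..x+2*R}" by auto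
    then show ?thesis by simp
   qed
  qed simp
  also have "(NI u. NI v. ennreal (4/R^2)*(NI s. NI ep. indicator {0<..E} ep*nrm2 (F (bdpt b ep (u, v, s)))))
   = ennreal (4/R^2)*(NI q. NI ep. indicator {0<..E} ep*nrm2 (F (bdpt b ep q)))"
  proof -
   define k where "k q = (NI ep. indicator {0<..E} ep*nrm2 (F (bdpt b ep q)))" for q
   have [measurable]: "k \<in> bm"
    unfolding k_def shifted_boundary_point_def case_prod_beta by measurable
   have "(NI q. k q) = (NI u. NI w. k (u, w))"
    unfolding lborel_prod[symmetric, where 'a=real and 'b="real\<times>real"]
    by (rule lborel.nn_integral_fst[symmetric]) simp
   also have "... = (NI u. NI v. NI s. k (u, v, s))"
    unfolding lborel_prod[symmetric, where 'a=real and 'b=real]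
    by (intro nn_integral_cong lborel.nn_integral_fst[symmetric]) simp
   finally show ?thesis unfolding k_def[symmetric]
    by (simp add: nn_integral_cmult)
  qed
  also have "(NI q. NI ep. indicator {0<..E} ep*nrm2 (F (bdpt b ep q)))
   = (NI ep. NI q. indicator {0<..E} ep*nrm2 (F (bdpt b ep q)))"
   by (rule lborel_pair.Fubini'[symmetric]) (simp add: shifted_boundary_point_def case_prod_beta)
  also have "... <= (NI ep. ennreal M*indicator {0<..E} ep)"
  proof (rule nn_integral_mono)
   fix ep :: real
   show "(NI q. indicator {0<..E} ep*nrm2 (F (bdpt b ep q))) <= ennreal M*indicator {0<..E} ep"
    using F_bound[of ep] by (cases "ep \<in> {0<..E}") auto
  qed
  also have "... = ennreal (E*M)" using E0 M0 by (simp add: nn_integral_cmult_indicator ennreal_mult mult.commute)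
  finally have "h x y t \<xi> <= ennreal (4/R^2)*(ennreal (4/R^2)*ennreal (E*M))" by (simp add: mult_left_mono)
  also have "... = ennreal D" using E0 M0 by (simp add: D_def ennreal_mult[symmetric])
  finally have "(norm (F (Complex x y, Complex t \<xi>)))^2 <= D" using D0 by (simp add: h_def)
  then show ?thesis by (rule real_le_rsqrt)
 qed
 then show ?thesis using that[of "sqrt D"] D0 by simp
qed

subsection \<open>Decay factors\<close>

text \<open>The real part of \<open>C - i z\<^sub>2 - c z\<^sub>1\<^sup>2\<close> is at least \<open>c (Im z\<^sub>1)\<^sup>2\<close> on the domain because \<open>b\<close> grows at least
 quadratically. Adding \<open>1\<close> to a positive multiple gives a denominator without zeros, whose inverse is bounded by \<open>1\<close> and decays in the
 directions of the tube.\<close>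

definition den :: "real => complex \<times> complex => complex" where
 "den d P = 1 + of_real d*(of_real C - \<i> * snd P - of_real c*(fst P)^2)"

definition Fd :: "real => complex \<times> complex => complex" where
 "Fd d P = F P*inverse (den d P^3)"

lemma den_parts:
 "Re (den d (Complex x y, Complex t h)) = 1 + d*(C + h - c*x^2 + c*y^2)"
 "Im (den d (Complex x y, Complex t h)) = d*(- t - 2*c*x*y)"
 by (simp_all add: den_def power2_eq_square algebra_simps)

lemma den_Re_ge:
 assumes "0 <= d" "poly b x < h" shows "Re (den d (Complex x y, Complex t h)) >= 1 + d*(c*y^2)"
proof -
 have "c*y^2 <= C + h - c*x^2 + c*y^2" using quad[of x] assms(2) by linarith
 then have "d*(c*y^2) <= d*(C + h - c*x^2 + c*y^2)" using assms(1) by (rule mult_left_mono)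
 then show ?thesis unfolding den_parts by simp
qed

lemma den_norm_ge_1:
 assumes "0 <= d" "P \<in> tube_domain b" shows "norm (den d P) >= 1"
proof -
 obtain x y t h where P: "P = (Complex x y, Complex t h)" by (metis complex.exhaust surj_pair)
 have "1 <= Re (den d P)" using den_Re_ge[of d x h y t] assms c0 unfolding P Complex_in_domain
  by (smt (verit) mult_nonneg_nonneg zero_le_power2)
 also have "... <= norm (den d P)" by (rule complex_Re_le_cmod)
 finally show ?thesis .
qed

text \<open>The real part of the denominator grows like \<open>y\<^sup>2\<close> and its imaginary part like \<open>t\<close> up to a
 multiple of \<open>x y\<close>. Three factors suffice for a product of Cauchy densities.\<close>

lemma den_decay:
 assumes de: "de > 0" and X: "X >= 0"
 obtains K where "K >= 0" "!!x v y t. poly b x < v ==> \<bar>x\<bar> <= X ==> norm (inverse (den de (Complex x y, Complex t v)^3)) <= K*cauchy2 (y, t)"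
proof -
 define k1 where "k1 = 1 + 1/(de*c)"
 define k2 where "k2 = 1 + 2/de^2 + 8*c^2*X^2*k1"
 have k: "k1 >= 1" "k2 >= 0" using de c0 by (auto simp: k1_def k2_def)
 have "norm (inverse (den de (Complex x y, Complex t v)^3)) <= (k1*k2)*cauchy2 (y, t)" if h: "poly b x < v" "\<bar>x\<bar> <= X" for x v y t
 proof -
  define d where "d = norm (den de (Complex x y, Complex t v))"
  have d1: "d >= 1" unfolding d_def using de h by (intro den_norm_ge_1) (auto simp: Complex_in_domain)
  have dRe: "1 + de*(c*y^2) <= d" unfolding d_def using den_Re_ge[of de x v y t] de h complex_Re_le_cmod order_trans by (meson less_imp_le)
  have dIm: "\<bar>de*(- t - 2*c*x*y)\<bar> <= d" using abs_Im_le_cmod[of "den de (Complex x y, Complex t v)"] by (simp only: d_def den_parts(2))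
  have y2: "1 + y^2 <= k1*d"
  proof -
   have dc: "de*c > 0" using de c0 by simp
   have "de*c*y^2 <= d" using dRe by (simp add: mult.assoc)
   then have "y^2 <= d/(de*c)" using dc by (simp add: pos_le_divide_eq mult.commute)
   then show ?thesis using d1 by (simp add: k1_def distrib_right)
  qed
  have "1 + t^2 <= k2*d^2"
  proof -
   have "\<bar>de\<bar>*\<bar>t + 2*c*x*y\<bar> <= d"
   proof -
    have "de*(- t - 2*c*x*y) = - (de*(t + 2*c*x*y))" by (simp add: algebra_simps)
    then show ?thesis using dIm by (simp add: abs_mult)
   qed
   then have "\<bar>t + 2*c*x*y\<bar> <= d/de" using de by (simp add: pos_le_divide_eq mult.commute)
   then have "\<bar>t + 2*c*x*y\<bar>^2 <= (d/de)^2" by (intro power_mono) auto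
   then have A: "(t + 2*c*x*y)^2 <= d^2/de^2" by (simp add: power_divide)
   have "x^2 <= X^2" using h(2) by (metis abs_le_square_iff abs_of_nonneg X)
   moreover have "y^2 <= k1*d" using y2 by simp
   moreover have "k1*d <= k1*d^2" using d1 k by (simp add: power2_eq_square)
   ultimately have "x^2*y^2 <= X^2*(k1*d^2)" by (intro mult_mono) auto
   then have B: "8*c^2*(x^2*y^2) <= 8*c^2*(X^2*(k1*d^2))" by (intro mult_left_mono) auto
   have "0 <= (t + 4*c*x*y)^2" by simp
   then have "t^2 <= 2*(t + 2*c*x*y)^2 + 8*c^2*(x^2*y^2)"
    by (simp add: power2_eq_square algebra_simps)
   also have "... <= 2*(d^2/de^2) + 8*c^2*(X^2*(k1*d^2))" using A B by simp
   finally have "1 + t^2 <= d^2 + 2*(d^2/de^2) + 8*c^2*(X^2*(k1*d^2))" using d1 one_le_power[OF d1, of 2] by linarith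
   then show ?thesis by (simp add: k2_def algebra_simps)
  qed
  then have "(1 + y^2)*(1 + t^2) <= (k1*d)*(k2*d^2)" using y2 k d1 by (intro mult_mono) auto
  then have le: "(1 + y^2)*(1 + t^2) <= (k1*k2)*d^3" by (simp add: power2_eq_square power3_eq_cube mult_ac)
  have pos: "(1 + y^2)*(1 + t^2) > 0" by (intro mult_pos_pos add_pos_nonneg) auto
  have d3: "d^3 > 0" using d1 by simp
  have "1/d^3 <= (k1*k2)/((1 + y^2)*(1 + t^2))" using le pos d3 by (simp add: field_simps)
  then show ?thesis by (simp add: d_def norm_inverse norm_power cauchy2_def divide_inverse mult_ac)
 qed
 then show ?thesis using that[of "k1*k2"] k by auto
qed

lemma den_nonzero: "0 <= d ==> P \<in> tube_domain b ==> den d P \<noteq> 0"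
 using den_norm_ge_1[of d P] by auto

lemma Fd_norm_le: "0 <= d ==> P \<in> tube_domain b ==> norm (Fd d P) <= norm (F P)"
proof -
 assume a: "0 <= d" "P \<in> tube_domain b"
 have "norm (inverse (den d P^3)) <= 1"
  using one_le_power[OF den_norm_ge_1[OF a], of 3] by (simp add: norm_inverse norm_power inverse_le_1_iff)
 then show ?thesis unfolding Fd_def norm_mult by (intro mult_right_le_one_le) auto
qed

lemma den_continuous: "continuous_on A (den d)"
 unfolding den_def by (intro continuous_intros)

lemma Fd_measurable [measurable]: "Fd d \<in> bm"
proof -
 have [measurable]: "den d \<in> bm" by (rule borel_measurable_continuous_onI[OF den_continuous])
 show ?thesis unfolding Fd_def by measurable
qed

lemma Fd_continuous: "0 <= d ==> continuous_on (tube_domain b) (Fd d)"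
 unfolding Fd_def by (intro continuous_intros F_cont den_continuous) (simp add: den_nonzero)

definition slice :: "real => real => real => real \<times> real => complex" where
 "slice d x h p = Fd d (Complex x (fst p), Complex (snd p) h)"

lemma slice_continuous:
 assumes "0 <= d" "poly b x < h" shows "continuous_on UNIV (slice d x h)"
 unfolding slice_def
 by (rule continuous_on_compose2[OF Fd_continuous[OF assms(1)]])
   (use assms in \<open>auto simp: Complex_eq Complex_in_domain[unfolded Complex_eq] intro!: continuous_intros\<close>)

lemma slice_decay:
 assumes d: "d > 0" and K: "compact K" "K \<subseteq> base"
 obtains A where "A >= 0" "!!x h p. (x, h) \<in> K ==> norm (slice d x h p) <= A*cauchy2 p"
proof -
 obtain B where B: "B >= 0" "!!x h y t. (x, h) \<in> K ==> norm (F (Complex x y, Complex t h)) <= B"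
  using locally_bounded[OF K] by blast
 obtain X where X: "!!p. p \<in> K ==> norm p <= X" using compact_imp_bounded[OF K(1)] by (auto simp: bounded_iff)
 obtain k where k: "k >= 0" "!!x h y t. poly b x < h ==> \<bar>x\<bar> <= \<bar>X\<bar> ==> norm (inverse (den d (Complex x y, Complex t h)^3)) <= k*cauchy2 (y, t)"
  using den_decay[OF d, of "\<bar>X\<bar>"] by auto
 have "norm (slice d x h p) <= (B*k)*cauchy2 p" if "(x, h) \<in> K" for x h p
 proof -
  have "\<bar>x\<bar> <= \<bar>X\<bar>" using X[OF that] norm_fst_le[of x h] by simp
  moreover have "poly b x < h" using K that by auto
  ultimately have "norm (inverse (den d (Complex x (fst p), Complex (snd p) h)^3)) <= k*cauchy2 p"
   using k(2)[of x h "fst p" "snd p"] by simp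
  then have "norm (slice d x h p) <= B*(k*cauchy2 p)"
   unfolding slice_def Fd_def norm_mult using that B by (intro mult_mono) auto
  then show ?thesis by (simp add: mult.assoc)
 qed
 then show ?thesis using that[of "B*k"] B k by auto
qed

lemma slice_nice:
 assumes d: "d > 0" and h: "poly b x < h"
 shows "L1 (slice d x h)" "L2 lborel (slice d x h)" "\<exists>B. \<forall>p. norm (slice d x h p) <= B"
proof -
 have "compact {(x, h)}" "{(x, h)} \<subseteq> base" using h by auto
 from slice_decay[OF d this] obtain A where A0: "A >= 0" "!!x' h' p. (x', h') \<in> {(x, h)} ==> norm (slice d x' h' p) <= A*cauchy2 p"
  by blast
 have A: "A >= 0" "norm (slice d x h p) <= A*cauchy2 p" for p using A0(1) A0(2)[of x h p] by auto
 have [measurable]: "slice d x h \<in> bm"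
  by (rule borel_measurable_continuous_onI[OF slice_continuous]) (use d h in auto)
 have bd: "norm (slice d x h p) <= A" for p
  using A(2)[of p] mult_left_mono[OF cauchy2_le_1[of p] A(1)] by simp
 then show "\<exists>B. \<forall>p. norm (slice d x h p) <= B" by blast
 have i: "L1 (%p. A*cauchy2 p)" by (intro integrable_mult_right integrable_cauchy2)
 show int: "L1 (slice d x h)"
  by (rule integrable_bound[OF i]) (use A in \<open>auto intro!: AE_I2\<close>)
 have i2: "L1 (%p. A*norm (slice d x h p))" using int by simp
 show "L2 lborel (slice d x h)" unfolding L2_def
  by (intro conjI integrable_bound[OF i2])
    (use bd A in \<open>auto intro!: AE_I2 mult_right_mono simp: power2_eq_square abs_mult\<close>)
qed

text \<open>The transform of a slice, multiplied by the inverse exponential of its base point, is an integral of a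
 function holomorphic in both variables over a plane, and the planes are homotopic.\<close>

definition twisted :: "real => real \<times> real => complex \<times> complex => complex" where
 "twisted d q P = Fd d P*exp (- (of_real (fst q)*fst P + \<i> * of_real (snd q) * snd P))"

definition spec_at :: "real => real => real => real \<times> real => complex" where
 "spec_at d x h q = of_real (exp (- (fst q*x - snd q*h)))*ft (slice d x h) (- q)"

lemma twisted_norm:
 "norm (twisted d q (Complex x y, Complex t h)) = norm (slice d x h (y, t))*exp (- (fst q*x - snd q*h))"
 by (simp add: twisted_def slice_def norm_mult norm_exp_eq_Re algebra_simps)

lemma twisted_slice:
 "twisted d q (Complex x (fst p), Complex (snd p) h) = of_real (exp (- (fst q*x - snd q*h)))*(slice d x h p*cis (p \<bullet> (- q)))"
 by (simp add: twisted_def slice_def exp_eq_polar inner_prod_def algebra_simps)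

lemma spec_at_eq: "spec_at d x h q = (LI p. twisted d q (Complex x (fst p), Complex (snd p) h))"
 unfolding twisted_slice spec_at_def ft_def by simp

lemma twisted_bound:
 assumes d: "d > 0" and K: "compact K" "K \<subseteq> base"
 obtains A where "A >= 0" "!!x h y t. (x, h) \<in> K ==> norm (twisted d q (Complex x y, Complex t h)) <= A*cauchy2 (y, t)"
proof -
 obtain A where A: "A >= 0" "!!x h p. (x, h) \<in> K ==> norm (slice d x h p) <= A*cauchy2 p" using slice_decay[OF d K] by blast
 have "compact ((%p. exp (- (fst q*fst p - snd q * snd p))) ` K)"
  by (intro compact_continuous_image K continuous_intros)
 then obtain B where B: "!!p. p \<in> K ==> exp (- (fst q*fst p - snd q * snd p)) <= B"
  using compact_imp_bounded by (fastforce simp: bounded_iff)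
 have "norm (twisted d q (Complex x y, Complex t h)) <= (A*\<bar>B\<bar>)*cauchy2 (y, t)" if "(x, h) \<in> K" for x h y t
 proof -
  have "norm (twisted d q (Complex x y, Complex t h)) <= (A*cauchy2 (y, t))*\<bar>B\<bar>"
   unfolding twisted_norm using A that B[OF that] by (intro mult_mono) auto
  then show ?thesis by (simp add: mult_ac)
 qed
 then show ?thesis using that[of "A*\<bar>B\<bar>"] A by auto
qed

lemma twisted_integrable:
 assumes d: "d > 0" and h: "poly b x < h"
 shows "integrable (lborel \<Otimes>\<^sub>M lborel) (%(y, t). twisted d q (Complex x y, Complex t h))"
proof -
 have "L1 (%p. of_real (exp (- (fst q*x - snd q*h)))*(slice d x h p*cis (p \<bullet> (- q))))"
 proof (rule integrable_mult_right, rule integrable_bound[OF slice_nice(1)[OF d h]])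
  have [measurable]: "slice d x h \<in> bm" using slice_nice(1)[OF d h] by auto
  show "(%p. slice d x h p*cis (p \<bullet> (- q))) \<in> borel_measurable lborel" by measurable
 qed (auto simp: norm_mult)
 then show ?thesis unfolding twisted_slice[symmetric] by (simp add: lborel_prod case_prod_unfold)
qed

lemma Fd_holomorphic:
 assumes "0 <= d"
 shows "(%z. Fd d (z, w)) holomorphic_on {z. (z, w) \<in> tube_domain b}" "(%w. Fd d (z, w)) holomorphic_on {w. (z, w) \<in> tube_domain b}"
 unfolding Fd_def
 by (intro holomorphic_intros holomorphic2_on_slices[OF F_holo];
   use den_nonzero[OF assms] in \<open>auto simp: den_def intro!: holomorphic_intros\<close>)+

lemma spec_at_shift_x:
 assumes d: "d > 0" and x: "x1 < x2" and h: "!!x. x1 <= x ==> x <= x2 ==> poly b x < h"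
 shows "spec_at d x1 h q = spec_at d x2 h q"
proof -
 have K: "compact ({x1..x2} \<times> {h})" "{x1..x2} \<times> {h} \<subseteq> base" using h by (auto intro: compact_Times)
 obtain A where A: "A >= 0" "!!x h' y t. (x, h') \<in> {x1..x2} \<times> {h} ==> norm (twisted d q (Complex x y, Complex t h')) <= A*cauchy2 (y, t)"
  using twisted_bound[OF d K] by blast
 have sh: "(LI y. twisted d q (Complex x1 y, Complex t h)) = (LI y. twisted d q (Complex x2 y, Complex t h))" for t
 proof (rule vertical_line_shift[OF _ x, where C=A])
  show "(%z. twisted d q (z, Complex t h)) holomorphic_on {z. x1 <= Re z \<and> Re z <= x2}"
   unfolding twisted_def
   by (intro holomorphic_intros holomorphic_on_subset[OF Fd_holomorphic(1)]) (use d h in \<open>auto simp: tube_domain_def\<close>)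
  show "norm (twisted d q (Complex x y, Complex t h)) <= A/(1 + y^2)" if "x1 <= x" "x <= x2" for x y
   using A(2)[of x h y t] mult_left_mono[OF cauchy2_le(1)[of y t] A(1)] that by simp
 qed
 have e: "spec_at d x h q = (LI t. LI y. twisted d q (Complex x y, Complex t h))" if "poly b x < h" for x
  using lborel_pair.integral_snd[OF twisted_integrable[OF d that, of q]]
  unfolding spec_at_eq lborel_prod by (simp add: case_prod_unfold)
 show ?thesis using e[OF h[of x1]] e[OF h[of x2]] x sh by simp
qed

lemma spec_at_shift_xi:
 assumes d: "d > 0" and v: "poly b x < v1" "v1 < v2"
 shows "spec_at d x v1 q = spec_at d x v2 q"
proof -
 have K: "compact ({x} \<times> {v1..v2})" "{x} \<times> {v1..v2} \<subseteq> base" using v by (auto intro: compact_Times)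
 obtain A where A: "A >= 0" "!!x' v y t. (x', v) \<in> {x} \<times> {v1..v2} ==> norm (twisted d q (Complex x' y, Complex t v)) <= A*cauchy2 (y, t)"
  using twisted_bound[OF d K] by blast
 have rot: "\<i>*Complex v s = Complex (- s) v" for v s by (simp add: complex_eq_iff)
 have sh: "(LI t. twisted d q (Complex x y, Complex t v1)) = (LI t. twisted d q (Complex x y, Complex t v2))" for y
 proof -
  define h where "h ze = twisted d q (Complex x y, \<i>*ze)" for ze
  have "(LI s. h (Complex v1 s)) = (LI s. h (Complex v2 s))"
  proof (rule vertical_line_shift[OF _ v(2), where C=A])
   have "(%w. Fd d (Complex x y, w)) holomorphic_on {w. (Complex x y, w) \<in> tube_domain b}"
    using d by (intro Fd_holomorphic) simp
   then have "((%w. Fd d (Complex x y, w)) \<circ> (%ze. \<i>*ze)) holomorphic_on {z. v1 <= Re z \<and> Re z <= v2}"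
    by (rule holomorphic_on_compose_gen[rotated]) (use v in \<open>auto simp: tube_domain_def intro!: holomorphic_intros\<close>)
   then show "h holomorphic_on {z. v1 <= Re z \<and> Re z <= v2}"
    unfolding h_def twisted_def o_def by (intro holomorphic_intros) auto
   show "norm (h (Complex v s)) <= A/(1 + s^2)" if "v1 <= v" "v <= v2" for v s
    using A(2)[of x v y "-s"] mult_left_mono[OF cauchy2_le(2)[of y "-s"] A(1)] that by (simp add: h_def rot)
  qed
  then have "(LI s. twisted d q (Complex x y, Complex (- s) v1)) = (LI s. twisted d q (Complex x y, Complex (- s) v2))"
   by (simp add: h_def rot)
  moreover have "(LI s. twisted d q (Complex x y, Complex (- s) v)) = (LI t. twisted d q (Complex x y, Complex t v))" for v
  proof (rule lborel_reflect(1)[where f="%t. twisted d q (Complex x y, Complex t v)"])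
   have "(%P. exp (- (of_real (fst q)*fst P + \<i> * of_real (snd q) * snd P))) \<in> borel_measurable (borel :: (complex \<times> complex) measure)"
    by (intro borel_measurable_continuous_onI continuous_intros)
   then have [measurable]: "twisted d q \<in> bm" unfolding twisted_def by measurable
   show "(%t. twisted d q (Complex x y, Complex t v)) \<in> bm" by measurable
  qed
  ultimately show ?thesis by simp
 qed
 have e: "spec_at d x v q = (LI y. LI t. twisted d q (Complex x y, Complex t v))" if "poly b x < v" for v
  using lborel_pair.integral_fst'[OF twisted_integrable[OF d that, of q]]
  unfolding spec_at_eq lborel_prod by (simp add: case_prod_unfold)
 show ?thesis using e[OF v(1)] e[of v2] v sh by simp
qed

text \<open>Two base points of the domain are joined by moving up, sideways above the maximum of \<open>b\<close> on the interval, and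
 down again.\<close>

lemma spec_at_const:
 assumes d: "d > 0" and h: "poly b x < h" "poly b x' < h'"
 shows "spec_at d x h q = spec_at d x' h' q"
proof -
 have main: "spec_at d x h q = spec_at d x' h' q" if xx: "x <= x'" and h: "poly b x < h" "poly b x' < h'" for x h x' h'
 proof -
  have "compact (poly b ` {x..x'})" by (intro compact_continuous_image continuous_intros) simp
  then obtain B where B: "!!u. u \<in> {x..x'} ==> \<bar>poly b u\<bar> <= B" using compact_imp_bounded by (fastforce simp: bounded_iff)
  define \<Xi> where "\<Xi> = max (max h h') B + 1"
  have 1: "spec_at d x h q = spec_at d x \<Xi> q" by (rule spec_at_shift_xi[OF d h(1)]) (simp add: \<Xi>_def)
  have 2: "spec_at d x' h' q = spec_at d x' \<Xi> q" by (rule spec_at_shift_xi[OF d h(2)]) (simp add: \<Xi>_def)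
  have "spec_at d x \<Xi> q = spec_at d x' \<Xi> q"
  proof (cases "x = x'")
   case False
   have "poly b u < \<Xi>" if "x <= u" "u <= x'" for u using B[of u] that by (simp add: \<Xi>_def)
   then show ?thesis using False xx by (intro spec_at_shift_x[OF d]) auto
  qed simp
  then show ?thesis using 1 2 by simp
 qed
 show ?thesis
 proof (cases "x <= x'")
  case True then show ?thesis using main h by blast
 next
  case False then show ?thesis using main[of x' x h' h] h by simp
 qed
qed

text \<open>The base point is immaterial by \<open>spec_at_const\<close>.\<close>

definition spectrum :: "real => real \<times> real => complex" where
 "spectrum d q = spec_at d 0 (poly b 0 + 1) q/(4*pi^2)"

lemma ft_slice:
 assumes d: "d > 0" and h: "poly b x < h"
 shows "ft (slice d x h) (- q) = 4*pi^2*(tilt x h q * spectrum d q)"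
proof -
 have "spec_at d x h q = 4*pi^2 * spectrum d q"
  using spec_at_const[OF d h, of 0 "poly b 0 + 1" q] by (simp add: spectrum_def)
 then have "tilt x h q * spec_at d x h q = 4*pi^2*(tilt x h q * spectrum d q)"
  by simp
 moreover have "tilt x h q * spec_at d x h q = ft (slice d x h) (- q)"
 proof -
  have "tilt x h q * of_real (exp (- (fst q*x - snd q*h))) = 1"
   unfolding of_real_mult[symmetric] exp_add[symmetric] by simp
  then show ?thesis unfolding spec_at_def by (simp only: mult.assoc[symmetric] mult_1)
 qed
 ultimately show ?thesis by simp
qed

lemma spectrum_measurable: "d > 0 ==> spectrum d \<in> bm"
proof -
 assume d: "d > 0"
 have [measurable]: "slice d 0 (poly b 0 + 1) \<in> bm" using slice_nice(1)[OF d, of 0 "poly b 0 + 1"] by auto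
 show ?thesis unfolding spectrum_def spec_at_def by measurable
qed

lemma spectrum_slice:
 assumes d: "d > 0" and h: "poly b x < h"
 shows "L2 lborel (%q. tilt x h q * spectrum d q)"
  and "4*pi^2*nsq lborel (%q. tilt x h q * spectrum d q) = nsq lborel (slice d x h)"
proof -
 have [measurable]: "spectrum d \<in> bm" using d by (rule spectrum_measurable)
 have [measurable]: "slice d x h \<in> bm" using slice_nice(1)[OF d h] by auto
 define u where "u q = tilt x h q * spectrum d q" for q
 have [measurable]: "u \<in> bm" unfolding u_def by measurable
 have Lf: "L2 lborel (ft (slice d x h))" and Nf: "nsq lborel (ft (slice d x h)) = 4*pi^2*nsq lborel (slice d x h)"
  using Plancherel[OF slice_nice(1,2)[OF d h]] by auto
 have [measurable]: "ft (slice d x h) \<in> bm" using Lf by (auto simp: L2_def)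
 have u_eq: "(norm (u q))^2 = (norm (ft (slice d x h) (- q)))^2/(16*pi^4)" for q
  unfolding ft_slice[OF d h] u_def[symmetric] by (simp add: norm_mult norm_power power_mult_distrib)
 have i: "L1 (%q. (norm (ft (slice d x h) (- q)))^2)"
  using lborel_reflect(2)[of "%q. (norm (ft (slice d x h) q))^2"] L2_integrable[OF Lf] by simp
 show "L2 lborel (%q. tilt x h q * spectrum d q)"
  unfolding u_def[symmetric] L2_def u_eq using i by simp
 have "nsq lborel u = (LI q. (norm (ft (slice d x h) (- q)))^2)/(16*pi^4)"
  unfolding nsq_def u_eq by simp
 also have "(LI q. (norm (ft (slice d x h) (- q)))^2) = nsq lborel (ft (slice d x h))"
  unfolding nsq_def by (rule lborel_reflect(1)) measurable
 finally show "4*pi^2*nsq lborel (%q. tilt x h q * spectrum d q) = nsq lborel (slice d x h)"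
  unfolding u_def[symmetric] Nf by (simp add: power2_eq_square eval_nat_numeral)
qed

text \<open>For each \<open>e\<close> the squared norm of the function on the shifted boundary is the weighted norm of the
 spectrum damped by \<open>exp (- 2 t e)\<close>; Fatou's lemma removes the damping, and the weight is infinite on
 \<open>t \<le> 0\<close>.\<close>

lemma spectrum_L2_spec:
 assumes d: "d > 0"
 shows "L2 spec (spectrum d)" "nsq spec (spectrum d) <= M/(4*pi^2)"
proof -
 have [measurable]: "spectrum d \<in> bm" using d by (rule spectrum_measurable)
 define k where "k e q = ennreal (exp (- 2 * snd q*e)*(norm (spectrum d q))^2)" for e :: real and q
 have [measurable]: "k e \<in> bm" for e unfolding k_def by measurable
 have bd: "(NI q. weight b q*k e q) <= ennreal (M/(4*pi^2))" if e: "e > 0" for e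
 proof -
  have "ennreal (4*pi^2)*(NI q. weight b q*k e q) = ennreal (4*pi^2)*(NI q. NI x. nrm2 (tilt x (poly b x + e) q * spectrum d q))"
  proof (intro arg_cong2[where f="(*)"] refl nn_integral_cong)
   fix q :: "real \<times> real"
   have "(NI x. nrm2 (tilt x (poly b x + e) q * spectrum d q))
    = (NI x. ennreal (exp (2*(fst q*x - snd q*poly b x)))*k e q)"
   proof (rule nn_integral_cong)
    fix x :: real
    have "(exp (fst q*x - snd q*(poly b x + e)))^2 = exp (2*(fst q*x - snd q*poly b x))*exp (- 2 * snd q*e)"
     by (simp add: power2_eq_square exp_add[symmetric] algebra_simps)
    then have "(norm (tilt x (poly b x + e) q * spectrum d q))^2
     = exp (2*(fst q*x - snd q*poly b x))*(exp (- 2 * snd q*e)*(norm (spectrum d q))^2)"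
     unfolding norm_mult power_mult_distrib norm_of_real abs_exp_cancel by simp
    then show "nrm2 (tilt x (poly b x + e) q * spectrum d q) = ennreal (exp (2*(fst q*x - snd q*poly b x)))*k e q"
     by (simp only: k_def ennreal_mult exp_ge_zero zero_le_power2 mult_nonneg_nonneg)
   qed
   then show "weight b q*k e q = (NI x. nrm2 (tilt x (poly b x + e) q * spectrum d q))"
    unfolding weight_def by (simp add: nn_integral_multc)
  qed
  also have "... = ennreal (4*pi^2)*(NI x. NI q. nrm2 (tilt x (poly b x + e) q * spectrum d q))"
   by (subst lborel_pair.Fubini') (simp_all add: split_beta')
  also have "... = (NI x. ennreal (4*pi^2)*(NI q. nrm2 (tilt x (poly b x + e) q * spectrum d q)))"
   by (rule nn_integral_cmult[symmetric]) measurable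
  also have "... = (NI x. NI p. nrm2 (slice d x (poly b x + e) p))"
  proof (intro nn_integral_cong)
   fix x
   have h: "poly b x < poly b x + e" using e by simp
   show "ennreal (4*pi^2)*(NI q. nrm2 (tilt x (poly b x + e) q * spectrum d q)) = (NI p. nrm2 (slice d x (poly b x + e) p))"
    unfolding nn_nsq[OF spectrum_slice(1)[OF d h]] nn_nsq[OF slice_nice(2)[OF d h]] spectrum_slice(2)[OF d h, symmetric]
    by (simp add: ennreal_mult)
  qed
  also have "... <= (NI x. NI p. nrm2 (F (bdpt b e (x, p))))"
  proof (intro nn_integral_mono ennreal_leI power_mono)
   fix x and p :: "real \<times> real"
   show "norm (slice d x (poly b x + e) p) <= norm (F (bdpt b e (x, p)))"
    using Fd_norm_le[of d "(Complex x (fst p), Complex (snd p) (poly b x + e))"] d e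
    by (cases p) (simp add: slice_def shift_eq Complex_in_domain)
  qed simp
  also have "... = (NI p. nrm2 (F (bdpt b e p)))"
   unfolding lborel_prod[symmetric, where 'a=real and 'b="real\<times>real"]
   by (rule lborel.nn_integral_fst) (simp add: shifted_boundary_point_def case_prod_beta)
  also have "... <= ennreal M" by (rule F_bound[OF e])
  finally have le: "ennreal (4*pi^2)*(NI q. weight b q*k e q) <= ennreal M" .
  have "ennreal (1/(4*pi^2))*(ennreal (4*pi^2)*(NI q. weight b q*k e q)) <= ennreal (1/(4*pi^2))*ennreal M"
   using le by (rule mult_left_mono) simp
  moreover have "ennreal (1/(4*pi^2))*(ennreal (4*pi^2)*z) = z" for z
  proof -
   have "ennreal (1/(4*pi^2))*ennreal (4*pi^2) = 1" by (subst ennreal_mult[symmetric]) auto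
   then show ?thesis by (simp add: mult.assoc[symmetric])
  qed
  moreover have "ennreal (1/(4*pi^2))*ennreal M = ennreal (M/(4*pi^2))"
   using M0 by (subst ennreal_mult[symmetric]) auto
  ultimately show ?thesis by simp
 qed
 have "(\<integral>\<^sup>+q. nrm2 (spectrum d q) \<partial>spec) = (NI q. weight b q*nrm2 (spectrum d q))"
  by (rule nn_integral_spec) measurable
 also have "... = (NI q. liminf (%n. weight b q*k (shrink n) q))"
 proof (rule nn_integral_cong_AE)
  have "AE q in lborel. weight b q*k 1 q \<noteq> \<infinity>"
   using bd[of 1] by (intro nn_integral_PInf_AE) (auto simp: top_unique)
  then show "AE q in lborel. weight b q*nrm2 (spectrum d q) = liminf (%n. weight b q*k (shrink n) q)"
  proof eventually_elim
   case (elim q)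
   show ?case
   proof (cases "spectrum d q = 0")
    case True
    then show ?thesis by (simp add: k_def Liminf_const)
   next
    case False
    have "snd q > 0"
    proof (rule ccontr)
     assume "\<not> snd q > 0"
     then have "weight b q = \<infinity>" using weight_infinite[of "snd q" "fst q"] by simp
     then show False using elim False by (simp add: k_def ennreal_top_mult)
    qed
    then have w: "weight b q < \<infinity>" using weight_finite[of "snd q" "fst q"] by simp
    have "(%n. exp (- 2 * snd q * shrink n)*(norm (spectrum d q))^2) ----> exp (- 2 * snd q*0)*(norm (spectrum d q))^2"
     by (intro tendsto_intros shrink_tendsto)
    then have "(%n. k (shrink n) q) ----> nrm2 (spectrum d q)" unfolding k_def by (intro tendsto_ennrealI) simp
    then have "(%n. weight b q*k (shrink n) q) ----> weight b q*nrm2 (spectrum d q)"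
     using w by (intro ennreal_tendsto_cmult) auto
    then show ?thesis by (simp add: lim_imp_Liminf)
   qed
  qed
 qed
 also have "... <= liminf (%n. NI q. weight b q*k (shrink n) q)" by (rule nn_integral_liminf) measurable
 also have "... <= ennreal (M/(4*pi^2))" using bd by (intro Liminf_le) auto
 finally have le: "(\<integral>\<^sup>+q. nrm2 (spectrum d q) \<partial>spec) <= ennreal (M/(4*pi^2))" .
 have "spectrum d \<in> borel_measurable spec" by measurable
 from L2_I_nn[OF this le] M0 show "L2 spec (spectrum d)" "nsq spec (spectrum d) <= M/(4*pi^2)" by auto
qed

lemma slice_difference:
 assumes de: "de > 0" "de' > 0" and h: "poly b x < h"
 shows "4*pi^2*nsq lborel (%q. tilt x h q*(spectrum de q - spectrum de' q))
  = nsq lborel (%p. slice de x h p - slice de' x h p)"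
proof -
 have [measurable]: "spectrum de \<in> bm" "spectrum de' \<in> bm" using de by (auto intro: spectrum_measurable)
 define d where "d p = slice de x h p - slice de' x h p" for p
 have di: "L1 d" and dL: "L2 lborel d" unfolding d_def using slice_nice[OF de(1) h] slice_nice[OF de(2) h]
  by (auto intro!: Bochner_Integration.integrable_diff L2_diff)
 define u where "u q = tilt x h q*(spectrum de q - spectrum de' q)" for q
 have fd: "ft d (- q) = 4*pi^2*u q" for q
 proof -
  have i: "L1 (%p. slice de x h p*cis (p \<bullet> (- q)))" if "de > 0" for de
  proof (rule integrable_bound[OF slice_nice(1)[OF that h]])
   have [measurable]: "slice de x h \<in> bm" using slice_nice(1)[OF that h] by auto
   show "(%p. slice de x h p*cis (p \<bullet> (- q))) \<in> borel_measurable lborel" by measurable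
  qed (auto simp: norm_mult)
  have "ft d (- q) = ft (slice de x h) (- q) - ft (slice de' x h) (- q)"
   unfolding ft_def d_def left_diff_distrib by (rule Bochner_Integration.integral_diff[OF i[OF de(1)] i[OF de(2)]])
  then show ?thesis unfolding ft_slice[OF de(1) h] ft_slice[OF de(2) h] u_def by (simp add: algebra_simps)
 qed
 have [measurable]: "d \<in> bm" using di by auto
 have u_eq: "(norm (u q))^2 = (norm (ft d (- q)))^2/(16*pi^4)" for q
  unfolding fd by (simp add: norm_mult norm_power power_mult_distrib)
 have "nsq lborel u = (LI q. (norm (ft d (- q)))^2)/(16*pi^4)" unfolding nsq_def u_eq by simp
 also have "(LI q. (norm (ft d (- q)))^2) = nsq lborel (ft d)"
  unfolding nsq_def by (rule lborel_reflect(1)) measurable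
 finally show ?thesis unfolding u_def[symmetric] d_def[symmetric] Plancherel(2)[OF di dL] by (simp add: power2_eq_square eval_nat_numeral)
qed

lemma slice_0: "slice 0 x h p = F (Complex x (fst p), Complex (snd p) h)"
 by (simp add: slice_def Fd_def den_def)

lemma slice_tendsto: "(%n. slice (shrink n) x h p) ----> slice 0 x h p" if "poly b x < h"
proof -
 have "(%n. den (shrink n) P) ----> den 0 P" for P
  unfolding den_def by (intro tendsto_intros tendsto_of_real shrink_tendsto)
 moreover have "den 0 P \<noteq> 0" for P by (simp add: den_def)
 ultimately show ?thesis unfolding slice_def Fd_def by (intro tendsto_intros) auto
qed

text \<open>The spectra are bounded in the weighted space, hence so are the slices, and Fatou removes the damping.\<close>

lemma slice_0_L2:
 assumes h: "poly b x < h"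
 shows "L2 lborel (slice 0 x h)" "(%n. nsq lborel (%p. slice (shrink n) x h p - slice 0 x h p)) ----> 0"
proof -
 obtain K where K: "K > 0" "!!g. L2 spec g ==> nsq lborel (%q. tilt x h q*g q) <= K*nsq spec g"
  using L2_spec_slice(3)[OF spectrum_L2_spec(1)[of 1] h] by auto
 have m: "slice 0 x h \<in> borel_measurable lborel"
  using borel_measurable_continuous_onI[OF slice_continuous[of 0 x h]] h by simp
 have B: "nsq lborel (slice (shrink n) x h) <= 4*pi^2*(K*(M/(4*pi^2)))" for n
  unfolding spectrum_slice(2)[OF shrink_pos h, symmetric]
  using K(2)[OF spectrum_L2_spec(1)[OF shrink_pos[of n]]] mult_left_mono[OF spectrum_L2_spec(2)[OF shrink_pos[of n]], of K] K(1)
  by (intro mult_left_mono) auto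
 show L: "L2 lborel (slice 0 x h)"
 proof (rule L2_Fatou(1)[where f="%n. slice (shrink n) x h"])
  show "L2 lborel (slice (shrink n) x h)" for n by (rule slice_nice(2)[OF shrink_pos h])
  show "nsq lborel (slice (shrink n) x h) <= 4*pi^2*(K*(M/(4*pi^2)))" for n by (rule B)
  show "slice 0 x h \<in> borel_measurable lborel" by (rule m)
  show "AE p in lborel. (%n. slice (shrink n) x h p) ----> slice 0 x h p" using slice_tendsto[OF h] by simp
 qed
 have "(%n. nsq lborel (%p. slice (shrink n) x h p - slice 0 x h p)) ----> (\<integral>p. 0 \<partial>(lborel :: (real \<times> real) measure))"
  unfolding nsq_def
 proof (rule integral_dominated_convergence[where w="%p. 4*(norm (slice 0 x h p))^2"])
  show "L1 (%p. 4*(norm (slice 0 x h p))^2)" using L by (simp add: L2_def)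
  have [measurable]: "slice (shrink n) x h \<in> bm" for n using slice_nice(1)[OF shrink_pos h, of n] by auto
  show "(%p. (norm (slice (shrink n) x h p - slice 0 x h p))^2) \<in> borel_measurable lborel" for n
   using m by measurable
  show "AE p in lborel. (%n. (norm (slice (shrink n) x h p - slice 0 x h p))^2) ----> 0"
  proof (rule AE_I2)
   fix p
   have "(%n. (norm (slice (shrink n) x h p - slice 0 x h p))^2) ----> (norm (slice 0 x h p - slice 0 x h p))^2"
    by (intro tendsto_intros slice_tendsto h)
   then show "(%n. (norm (slice (shrink n) x h p - slice 0 x h p))^2) ----> 0" by simp
  qed
  show "AE p in lborel. norm ((norm (slice (shrink n) x h p - slice 0 x h p))^2) <= 4*(norm (slice 0 x h p))^2" for n
  proof (rule AE_I2)
   fix p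
   have "norm (slice (shrink n) x h p) <= norm (slice 0 x h p)"
    using Fd_norm_le[of "shrink n" "(Complex x (fst p), Complex (snd p) h)"] h unfolding slice_0 by (simp add: slice_def Complex_in_domain)
   then have "norm (slice (shrink n) x h p - slice 0 x h p) <= 2*norm (slice 0 x h p)"
    using norm_triangle_ineq4[of "slice (shrink n) x h p" "slice 0 x h p"] by linarith
   then have "(norm (slice (shrink n) x h p - slice 0 x h p))^2 <= (2*norm (slice 0 x h p))^2" by (intro power_mono) auto
   then show "norm ((norm (slice (shrink n) x h p - slice 0 x h p))^2) <= 4*(norm (slice 0 x h p))^2" by (simp add: power_mult_distrib)
  qed
 qed simp
 then show "(%n. nsq lborel (%p. slice (shrink n) x h p - slice 0 x h p)) ----> 0" by simp
qed

lemma spectrum_Cauchy: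
 assumes h: "poly b x < h" and e: "e > 0"
 shows "\<exists>N. \<forall>m\<ge>N. \<forall>n\<ge>N. nsq lborel (%q. tilt x h q * spectrum (shrink m) q - tilt x h q * spectrum (shrink n) q) <= e"
proof -
 have "\<forall>\<^sub>F n in sequentially. nsq lborel (%p. slice (shrink n) x h p - slice 0 x h p) < e*pi^2"
  using e by (intro order_tendstoD(2)[OF slice_0_L2(2)[OF h]]) simp
 then obtain N where N: "!!n. n >= N ==> nsq lborel (%p. slice (shrink n) x h p - slice 0 x h p) < e*pi^2"
  by (auto simp: eventually_sequentially)
 have "nsq lborel (%q. tilt x h q * spectrum (shrink m) q - tilt x h q * spectrum (shrink n) q) <= e"
  if mn: "m >= N" "n >= N" for m n
 proof -
  have Ld: "L2 lborel (%p. slice (shrink k) x h p - slice 0 x h p)" for k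
   by (rule L2_diff(1)[OF slice_nice(2)[OF shrink_pos h] slice_0_L2(1)[OF h]])
  have "4*pi^2*nsq lborel (%q. tilt x h q*(spectrum (shrink m) q - spectrum (shrink n) q))
    = nsq lborel (%p. (slice (shrink m) x h p - slice 0 x h p) - (slice (shrink n) x h p - slice 0 x h p))"
   unfolding slice_difference[OF shrink_pos shrink_pos h] by simp
  also have "... <= 2*(e*pi^2) + 2*(e*pi^2)"
   using L2_diff(2)[OF Ld[of m] Ld[of n]] N[OF mn(1)] N[OF mn(2)] by linarith
  finally have "pi^2*nsq lborel (%q. tilt x h q*(spectrum (shrink m) q - spectrum (shrink n) q)) <= pi^2*e" by (simp add: mult_ac)
  then have "nsq lborel (%q. tilt x h q*(spectrum (shrink m) q - spectrum (shrink n) q)) <= e"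
   by (rule mult_left_le_imp_le) simp
  then show ?thesis by (simp add: right_diff_distrib)
 qed
 then show ?thesis by blast
qed

text \<open>On one slice the damped spectra converge in the mean, and a subsequence converges almost everywhere. Its limit does not depend
 on the slice. On each slice the transform of the limit agrees almost everywhere with the function, and both are continuous.\<close>

theorem Paley_Wiener:
 obtains g where "L2 spec g" "!!P. P \<in> tube_domain b ==> F P = Lap g P"
proof -
 let ?e = "%x v q. tilt x v q"
 have sm: "spectrum (shrink n) \<in> bm" for n by (rule spectrum_measurable[OF shrink_pos])
 obtain k r where k: "L2 lborel k" and r: "strict_mono r"
  and AEk: "AE q in lborel. (%n. ?e 0 (poly b 0 + 1) q * spectrum (shrink (r n)) q) ----> k q"
 proof (rule Riesz_Fischer[of lborel "%n q. ?e 0 (poly b 0 + 1) q * spectrum (shrink n) q"])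
  show "L2 lborel (%q. ?e 0 (poly b 0 + 1) q * spectrum (shrink n) q)" for n
   by (rule spectrum_slice(1)[OF shrink_pos]) simp
  show "\<exists>N. \<forall>m\<ge>N. \<forall>n\<ge>N. nsq lborel (%q. ?e 0 (poly b 0 + 1) q * spectrum (shrink m) q - ?e 0 (poly b 0 + 1) q * spectrum (shrink n) q) <= e" if "e > 0" for e
   by (rule spectrum_Cauchy[OF _ that]) simp
 qed blast
 have [measurable]: "k \<in> bm" using k by (auto simp: L2_def)
 define g where "g q = of_real (exp (- (fst q*0 - snd q*(poly b 0 + 1))))*k q" for q
 have [measurable]: "g \<in> bm" unfolding g_def by measurable
 have AEg: "AE q in lborel. (%n. spectrum (shrink (r n)) q) ----> g q"
  using AEk
 proof eventually_elim
  case (elim q)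
  have "complex_of_real (exp (- (fst q*0 - snd q*(poly b 0 + 1))))*?e 0 (poly b 0 + 1) q = 1"
   unfolding of_real_mult[symmetric] exp_add[symmetric] by simp
  then have "complex_of_real (exp (- (fst q*0 - snd q*(poly b 0 + 1))))*(?e 0 (poly b 0 + 1) q * s) = s" for s
   by (simp only: mult.assoc[symmetric] mult_1)
  then show ?case using tendsto_mult[OF tendsto_const elim, of "complex_of_real (exp (- (fst q*0 - snd q*(poly b 0 + 1))))"]
   by (simp only: g_def)
 qed
 have gL: "L2 spec g"
 proof (rule L2_Fatou(1)[where f="%n. spectrum (shrink (r n))"])
  show "L2 spec (spectrum (shrink (r n)))" "nsq spec (spectrum (shrink (r n))) <= M/(4*pi^2)" for n
   by (rule spectrum_L2_spec[OF shrink_pos])+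
  show "g \<in> borel_measurable spec" by measurable
  show "AE q in spec. (%n. spectrum (shrink (r n)) q) ----> g q" unfolding AE_spec by (rule AEg)
 qed
 have "F P = Lap g P" if P: "P \<in> tube_domain b" for P
 proof -
  obtain x y t v where P': "P = (Complex x y, Complex t v)" by (metis complex.exhaust surj_pair)
  have v: "poly b x < v" using P by (simp add: P' Complex_in_domain)
  define G where "G p = Lap g (Complex x (fst p), Complex (snd p) v)" for p
  have G_ft: "G p = ft (%q. ?e x v q*g q) p" for p by (cases p) (simp add: G_def Lap_slice)
  have gi: "L1 (%q. ?e x v q*g q)" "L2 lborel (%q. ?e x v q*g q)"
   by (rule L2_spec_slice(1)[OF gL v], rule L2_spec_slice(2)[OF gL v])
  have si: "L1 (%q. ?e x v q * spectrum (shrink n) q)" for n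
   by (rule L2_spec_slice(1)[OF spectrum_L2_spec(1)[OF shrink_pos] v])
  have LG: "L2 lborel G" unfolding G_ft using Plancherel(1)[OF gi] by simp
  have inv: "slice (shrink n) x v p = ft (%q. ?e x v q * spectrum (shrink n) q) p" for n p
  proof -
   have ms[measurable]: "slice (shrink n) x v \<in> bm" using slice_nice(1)[OF shrink_pos v, of n] by auto
   have [measurable]: "(%q. ?e x v q * spectrum (shrink n) q) \<in> bm" using si[of n] by auto
   have fi: "L1 (ft (slice (shrink n) x v))"
   proof -
    have "L1 (%q. ft (slice (shrink n) x v) (- q))"
     unfolding ft_slice[OF shrink_pos v] using si[of n] by (intro integrable_mult_right)
    then show ?thesis by (subst (asm) lborel_reflect(2)) measurable
   qed
   obtain B where B: "!!p. norm (slice (shrink n) x v p) <= B" using slice_nice(3)[OF shrink_pos v] by blast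
   have "4*pi^2 * slice (shrink n) x v p = ft (ft (slice (shrink n) x v)) (- p)"
    by (rule Fourier_inversion[OF slice_nice(1)[OF shrink_pos v] slice_continuous[OF _ v] B fi, symmetric]) simp
   also have "... = (LI q. ft (slice (shrink n) x v) (- q)*cis ((- q) \<bullet> (- p)))"
    unfolding ft_def[of "ft (slice (shrink n) x v)"]
    by (rule lborel_reflect(1)[symmetric, where f="%q. ft (slice (shrink n) x v) q*cis (q \<bullet> (- p))"]) measurable
   also have "... = (LI q. 4*pi^2*(?e x v q * spectrum (shrink n) q*cis (q \<bullet> p)))"
    unfolding ft_slice[OF shrink_pos v] by (simp add: mult.assoc)
   also have "... = 4*pi^2*ft (%q. ?e x v q * spectrum (shrink n) q) p" by (simp add: ft_def)
   finally show ?thesis by simp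
  qed
  have diff: "nsq lborel (%p. slice (shrink n) x v p - G p) = 4*pi^2*nsq lborel (%q. ?e x v q * spectrum (shrink n) q - ?e x v q*g q)" for n
  proof -
   have i: "L1 (%q. h q*cis (q \<bullet> p))" if "L1 h" for h :: "real \<times> real => complex" and p
   proof (rule integrable_bound[OF that])
    have [measurable]: "h \<in> bm" using that by auto
    show "(%q. h q*cis (q \<bullet> p)) \<in> borel_measurable lborel" by measurable
   qed (auto simp: norm_mult)
   have "slice (shrink n) x v p - G p = ft (%q. ?e x v q * spectrum (shrink n) q - ?e x v q*g q) p" for p
    unfolding inv G_ft ft_def left_diff_distrib by (rule Bochner_Integration.integral_diff[symmetric, OF i[OF si] i[OF gi(1)]])
   then show ?thesis
    using Plancherel(2)[OF Bochner_Integration.integrable_diff[OF si[of n] gi(1)] L2_diff(1)[OF spectrum_slice(1)[OF shrink_pos v, of n] gi(2)]]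
    by simp
  qed
  have conv: "\<exists>N. \<forall>n\<ge>N. nsq lborel (%q. ?e x v q * spectrum (shrink (r n)) q - ?e x v q*g q) <= e" if e: "e > 0" for e
  proof -
   obtain N where N: "!!m n. m >= N ==> n >= N ==> nsq lborel (%q. ?e x v q * spectrum (shrink m) q - ?e x v q * spectrum (shrink n) q) <= e"
    using spectrum_Cauchy[OF v e] by blast
   have "nsq lborel (%q. ?e x v q * spectrum (shrink (r n)) q - ?e x v q*g q) <= e" if n: "n >= N" for n
   proof (rule L2_Fatou(2)[where f="%j q. ?e x v q * spectrum (shrink (r n)) q - ?e x v q * spectrum (shrink (r (j + N))) q"])
    show "L2 lborel (%q. ?e x v q * spectrum (shrink (r n)) q - ?e x v q * spectrum (shrink (r (j + N))) q)" for j
     by (intro L2_diff spectrum_slice(1) shrink_pos v)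
    show "nsq lborel (%q. ?e x v q * spectrum (shrink (r n)) q - ?e x v q * spectrum (shrink (r (j + N))) q) <= e" for j
     using seq_suble[OF r, of n] seq_suble[OF r, of "j + N"] n by (intro N) linarith+
    show "(%q. ?e x v q * spectrum (shrink (r n)) q - ?e x v q*g q) \<in> borel_measurable lborel"
     using sm[of "r n"] by measurable
    show "AE q in lborel. (%j. ?e x v q * spectrum (shrink (r n)) q - ?e x v q * spectrum (shrink (r (j + N))) q) ----> ?e x v q * spectrum (shrink (r n)) q - ?e x v q*g q"
     using AEg
    proof eventually_elim
     case (elim q)
     show ?case by (intro tendsto_diff tendsto_mult tendsto_const LIMSEQ_ignore_initial_segment[OF elim])
    qed
   qed
   then show ?thesis by blast
  qed
  have z: "nsq lborel (%p. slice 0 x v p - G p) = 0"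
  proof -
   have Ls: "L2 lborel (%p. slice (shrink n) x v p - slice 0 x v p)" "L2 lborel (%p. slice (shrink n) x v p - G p)" for n
    by (rule L2_diff(1)[OF slice_nice(2)[OF shrink_pos v] slice_0_L2(1)[OF v]], rule L2_diff(1)[OF slice_nice(2)[OF shrink_pos v] LG])
   have "nsq lborel (%p. slice 0 x v p - G p) <= e" if e: "e > 0" for e
   proof -
    have "\<forall>\<^sub>F n in sequentially. nsq lborel (%p. slice (shrink n) x v p - slice 0 x v p) < e/4"
     using e by (intro order_tendstoD(2)[OF slice_0_L2(2)[OF v]]) simp
    then obtain N1 where N1: "!!n. n >= N1 ==> nsq lborel (%p. slice (shrink n) x v p - slice 0 x v p) < e/4"
     by (auto simp: eventually_sequentially)
    obtain N2 where N2: "!!n. n >= N2 ==> nsq lborel (%q. ?e x v q * spectrum (shrink (r n)) q - ?e x v q*g q) <= e/(16*pi^2)"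
     using conv[of "e/(16*pi^2)"] e by auto
    define n where "n = max N1 N2"
    have "r n >= N1" using seq_suble[OF r, of n] by (simp add: n_def)
    have 1: "nsq lborel (%p. slice (shrink (r n)) x v p - slice 0 x v p) <= e/4" using N1[OF \<open>r n \<ge> N1\<close>] by simp
    have "4*pi^2*nsq lborel (%q. ?e x v q * spectrum (shrink (r n)) q - ?e x v q*g q) <= 4*pi^2*(e/(16*pi^2))"
     by (intro mult_left_mono N2) (auto simp: n_def)
    then have 2: "nsq lborel (%p. slice (shrink (r n)) x v p - G p) <= e/4" unfolding diff by simp
    have "nsq lborel (%p. (slice (shrink (r n)) x v p - G p) - (slice (shrink (r n)) x v p - slice 0 x v p)) <= 2*(e/4) + 2*(e/4)"
     using L2_diff(2)[OF Ls(2)[of "r n"] Ls(1)[of "r n"]] 1 2 by linarith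
    then show ?thesis by simp
   qed
   note le_eps = this
   have "nsq lborel (%p. slice 0 x v p - G p) <= 0"
   proof (rule field_le_epsilon)
    show "nsq lborel (%p. slice 0 x v p - G p) <= 0 + e" if "e > 0" for e using le_eps[OF that] by simp
   qed
   then show ?thesis using nsq_nonneg[of lborel "%p. slice 0 x v p - G p"] by linarith
  qed
  have "AE p in lborel. slice 0 x v p = G p"
   using z nsq_eq_0_iff[OF L2_diff(1)[OF slice_0_L2(1)[OF v] LG]] by simp
  moreover have "continuous_on UNIV G"
  proof -
   have "continuous_on (tube_domain b) (Lap g)"
    by (rule holomorphic2_on_continuous[OF Lap_holomorphic[OF L2_spec_lap_on[OF gL]]])
   then show ?thesis unfolding G_def
    by (rule continuous_on_compose2)
      (use v in \<open>auto simp: Complex_eq Complex_in_domain[unfolded Complex_eq] intro!: continuous_intros\<close>)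
  qed
  ultimately have "slice 0 x v (y, t) = G (y, t)" using slice_continuous[of 0 x v] v
   by (intro continuous_AE_eq[where f="slice 0 x v" and g=G and x="(y, t)"]) auto
  then show ?thesis by (simp add: slice_0 G_def P')
 qed
 with gL that show ?thesis by blast
qed

end

theorem (in szego_poly) hardy_space_Lap:
 assumes F: "F \<in> hardy_space b"
 obtains g where "L2 spec g" "!!P. P \<in> tube_domain b ==> F P = Lap g P"
proof -
 obtain c C where c: "c > 0" "!!x. poly b x >= c*x^2 - C" using poly_even_quadratic_bound[OF ev dp lc] by blast
 define F0 where "F0 P = (if P \<in> tube_domain b then F P else 0)" for P
 define S where "S = (SUP e\<in>{0<..}. NI p. nrm2 (F (bdpt b e p)))"
 have S: "S < \<infinity>" and Fh: "holomorphic2_on F (tube_domain b)" using F by (auto simp: hardy_space_def S_def)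
 note op = open_tube_domain
 have "hardy_function b F0 (enn2real S) c C"
 proof unfold_locales
  have "(%P. if P \<in> tube_domain b then F P else 0) \<in> bm"
   by (rule borel_measurable_continuous_on_if) (use op holomorphic2_on_continuous[OF Fh] in auto)
  then show "F0 \<in> bm" by (simp add: F0_def[abs_def])
  show "holomorphic2_on F0 (tube_domain b)"
   unfolding holomorphic2_on_def
  proof
   fix p assume p: "p \<in> tube_domain b"
   then obtain A B where "(F has_derivative (%(u, v). A*u + B * v)) (at p)" using Fh by (auto simp: holomorphic2_on_def)
   then have "(F0 has_derivative (%(u, v). A*u + B * v)) (at p)"
    by (rule has_derivative_transform_within_open[OF _ op p]) (simp add: F0_def)
   then show "\<exists>A B. (F0 has_derivative (%(u, v). A*u + B * v)) (at p)" by blast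
  qed
  show "(NI p. nrm2 (F0 (bdpt b e p))) <= ennreal (enn2real S)" if "e > 0" for e
  proof -
   have "(NI p. nrm2 (F0 (bdpt b e p))) = (NI p. nrm2 (F (bdpt b e p)))"
    using that by (simp add: F0_def shift_in_domain)
   also have "... <= S" unfolding S_def using that by (intro SUP_upper) simp
   finally show ?thesis using S by simp
  qed
 qed (use c in auto)
 then obtain g where "L2 spec g" "!!P. P \<in> tube_domain b ==> F0 P = Lap g P" using hardy_function.Paley_Wiener by blast
 then show ?thesis using that by (simp add: F0_def)
qed

section \<open>The Szego kernel as a Laplace transform\<close>

context szego_poly
begin

text \<open>The factor \<open>4 \<pi>\<^sup>2\<close> makes the Laplace transform an isometry for the inner product of the Hardy space.\<close>

definition sip :: "(real \<times> real => complex) => (real \<times> real => complex) => complex" where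
 "sip f g = 4*pi^2*(\<integral>q. f q*cnj (g q) \<partial>spec)"

lemma sip_add: "L2 spec f ==> L2 spec f' ==> L2 spec g ==> sip (%q. f q + f' q) g = sip f g + sip f' g"
 unfolding sip_def distrib_right
 by (subst Bochner_Integration.integral_add) (auto intro!: L2_mult_integrable L2_cnj simp: algebra_simps)

lemma sip_diff: "L2 spec f ==> L2 spec f' ==> L2 spec g ==> sip (%q. f q - f' q) g = sip f g - sip f' g"
 unfolding sip_def left_diff_distrib
 by (subst Bochner_Integration.integral_diff) (auto intro!: L2_mult_integrable L2_cnj simp: algebra_simps)

lemma sip_cmult: "sip (%q. c*f q) g = c * sip f g"
 unfolding sip_def by (simp add: mult.assoc)

lemma sip_zero [simp]: "sip (%q. 0) g = 0"
 by (simp add: sip_def)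

lemma sip_sum:
 "(!!i. i \<in> I ==> L2 spec (f i)) ==> L2 spec g ==> sip (%q. \<Sum>i\<in>I. f i q) g = (\<Sum>i\<in>I. sip (f i) g)"
 by (induction I rule: infinite_finite_induct) (auto simp: sip_add L2_sum)

lemma sip_commute:
 assumes "L2 spec f" "L2 spec g" shows "sip g f = cnj (sip f g)"
proof -
 have "(\<integral>q. cnj (f q*cnj (g q)) \<partial>spec) = cnj (\<integral>q. f q*cnj (g q) \<partial>spec)"
  by (rule integral_bounded_linear[OF bounded_linear_cnj L2_mult_integrable[OF assms(1) L2_cnj[OF assms(2)]]])
 then show ?thesis by (simp add: sip_def mult.commute)
qed

lemma sip_self: "sip f f = of_real (4*pi^2*nsq spec f)"
proof -
 have "(\<integral>q. f q*cnj (f q) \<partial>spec) = (\<integral>q. complex_of_real ((norm (f q))^2) \<partial>spec)"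
  by (intro LI_cong) (simp only: complex_norm_square)
 also have "... = of_real (nsq spec f)" unfolding nsq_def by (rule integral_complex_of_real)
 finally show ?thesis by (simp add: sip_def)
qed

lemma sip_tendsto:
 assumes "!!n. L2 spec (f n)" "L2 spec g" "L2 spec h" "(%n. nsq spec (%q. f n q - g q)) ----> 0"
 shows "(%n. sip (f n) h) ----> sip g h"
 unfolding sip_def by (intro tendsto_intros L2_tendsto_inner L2_cnj assms)

text \<open>The spectrum of the reproducing kernel at \<open>w\<close>: a conjugate exponential divided by the weight.\<close>

definition kern :: "complex \<times> complex => real \<times> real => complex" where
 "kern w q = of_real (inv_weight b q/(4*pi^2))*exp (of_real (fst q)*cnj (fst w) - \<i> * of_real (snd q)*cnj (snd w))"

lemma kern_measurable [measurable]: "kern w \<in> bm"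
proof -
 have [measurable]: "(%q::real\<times>real. exp (of_real (fst q)*cnj (fst w) - \<i> * of_real (snd q)*cnj (snd w))) \<in> bm"
  by (intro borel_measurable_continuous_onI continuous_intros)
 show ?thesis unfolding kern_def by measurable
qed

lemma norm_kern: "norm (kern w q) = inv_weight b q/(4*pi^2)*exp (fst q * Re (fst w) - snd q*Im (snd w))"
 by (simp add: kern_def norm_mult norm_exp_eq_Re norm_divide norm_power)

lemma kern_L2:
 assumes w: "w \<in> tube_domain b" shows "L2 spec (kern w)"
proof -
 define x where "x = Re (fst w)"
 define h where "h = Im (snd w)"
 have h: "poly b x < h" using w by (simp add: tube_domain_base x_def h_def)
 have i: "L1 (%q. (1/(16*pi^4))*(exp (2*fst q*x - 2 * snd q*h)*inv_weight b q))"
  by (intro integrable_mult_right inv_weight_integrable h)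
 have "(\<integral>\<^sup>+q. nrm2 (kern w q) \<partial>spec) = (NI q. weight b q*nrm2 (kern w q))"
  by (rule nn_integral_spec) measurable
 also have "... = (NI q. ennreal ((1/(16*pi^4))*(exp (2*fst q*x - 2 * snd q*h)*inv_weight b q)))"
 proof (rule nn_integral_cong)
  fix q :: "real \<times> real"
  obtain a t where q: "q = (a, t)" by force
  show "weight b q*nrm2 (kern w q) = ennreal ((1/(16*pi^4))*(exp (2*fst q*x - 2 * snd q*h)*inv_weight b q))"
  proof (cases "t > 0")
   case False
   then show ?thesis by (simp add: norm_kern inv_weight_def q)
  next
   case True
   have "(norm (kern w q))^2 = inv_weight b q*((1/(16*pi^4))*(exp (2*fst q*x - 2 * snd q*h)*inv_weight b q))"
   proof -
    have "(exp (fst q*x - snd q*h))^2 = exp (2*fst q*x - 2 * snd q*h)" by (simp add: power2_eq_square exp_add[symmetric])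
    then show ?thesis unfolding norm_kern x_def[symmetric] h_def[symmetric]
     by (simp add: power_mult_distrib power_divide power2_eq_square eval_nat_numeral mult_ac)
   qed
   then have "weight b q*nrm2 (kern w q) = (weight b q*ennreal (inv_weight b q))*ennreal ((1/(16*pi^4))*(exp (2*fst q*x - 2 * snd q*h)*inv_weight b q))"
    by (simp add: ennreal_mult mult.assoc del: times_divide_eq_left)
   then show ?thesis using weight_inv_weight[OF True, of a] by (simp add: q)
  qed
 qed
 also have "... < \<infinity>" using i by (subst nn_integral_eq_integral) auto
 finally show ?thesis by (auto simp: L2_iff_nn)
qed

lemma integral_spec_positive:
 fixes h :: "real \<times> real => complex"
 assumes [measurable]: "h \<in> bm" and z: "!!q. snd q <= 0 ==> h q = 0"
 shows "(\<integral>q. h q \<partial>spec) = (LI q. (if snd q > 0 then enn2real (weight b q) else 0) *\<^sub>R h q)"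
proof -
 define A where "A = {q :: real \<times> real. snd q > 0}"
 have [measurable]: "A \<in> sets borel" unfolding A_def by measurable
 define rw where "rw q = (if snd q > 0 then enn2real (weight b q) else 0)" for q
 have [measurable]: "rw \<in> bm" unfolding rw_def by measurable
 have rw: "weight b q*indicator A q = ennreal (rw q)" for q
  using weight_finite[of "snd q" "fst q"] by (auto simp: A_def rw_def indicator_def)
 have "(\<integral>q. h q \<partial>spec) = (\<integral>q. indicator A q *\<^sub>R h q \<partial>spec)"
  by (intro LI_cong) (use z in \<open>auto simp: A_def indicator_def not_less\<close>)
 also have "... = (\<integral>q. h q \<partial>density spec (%q. ennreal (indicator A q)))"
  by (rule integral_density[symmetric]) auto
 also have "density spec (%q. ennreal (indicator A q)) = density lborel (%q. ennreal (rw q))"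
  unfolding spec_def by (subst density_density_eq) (auto simp: rw ennreal_indicator)
 also have "(\<integral>q. h q \<partial>density lborel (%q. ennreal (rw q))) = (LI q. rw q *\<^sub>R h q)"
  by (rule integral_density) (auto simp: rw_def)
 finally show ?thesis by (simp add: rw_def)
qed

text \<open>Point evaluation is the inner product with the kernel.\<close>

lemma Lap_eq_sip:
 assumes g: "L2 spec g" and w: "w \<in> tube_domain b"
 shows "Lap g w = sip g (kern w)"
proof -
 have [measurable]: "g \<in> bm" by (rule L2_spec_measurable[OF g])
 let ?E = "%q. wave w q"
 have ck: "cnj (kern w q) = of_real (inv_weight b q/(4*pi^2))*?E q" for q
  by (simp add: kern_def exp_cnj)
 have "sip g (kern w) = 4*pi^2*(LI q. (if snd q > 0 then enn2real (weight b q) else 0) *\<^sub>R (g q*cnj (kern w q)))"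
  unfolding sip_def by (subst integral_spec_positive) (auto simp: kern_def inv_weight_def)
 also have "... = (LI q. 4*pi^2*((if snd q > 0 then enn2real (weight b q) else 0) *\<^sub>R (g q*cnj (kern w q))))"
  by (rule integral_mult_right_zero[symmetric])
 also have "... = (LI q. ?E q*g q)"
 proof (rule integral_cong_AE)
  show "AE q in lborel. 4*pi^2*((if snd q > 0 then enn2real (weight b q) else 0) *\<^sub>R (g q*cnj (kern w q))) = ?E q*g q"
   using L2_spec_support[OF g]
  proof eventually_elim
   case (elim q)
   show ?case
   proof (cases "snd q > 0")
    case False
    then show ?thesis using elim by simp
   next
    case True
    have p: "enn2real (weight b q) > 0" using weight_pos weight_finite[OF True, of "fst q"] by (simp add: enn2real_positive_iff)
    show ?thesis unfolding ck using True p by (simp add: inv_weight_def scaleR_conv_of_real)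
   qed
  qed
 qed measurable
 finally show ?thesis by (simp add: Lap_def)
qed

lemma hardy_inner_sip:
 assumes "L2 spec g" "L2 spec g'" "!!p. p \<in> tube_domain b ==> F p = Lap g p" "!!p. p \<in> tube_domain b ==> F' p = Lap g' p"
 shows "hardy_inner b F F' = sip g g'"
 unfolding sip_def by (rule hardy_inner_Lap[OF assms])

lemma hardy_inner_vanish:
 assumes g: "L2 spec g" and z: "sip g g = 0" and w: "w \<in> tube_domain b"
 shows "Lap g w = 0"
proof -
 have "nsq spec g = 0" using z by (simp add: sip_self del: of_real_mult)
 then have "norm (\<integral>q. g q*cnj (kern w q) \<partial>spec) <= 0"
  using L2_norm_integral_le[OF g L2_cnj[OF kern_L2[OF w]]] by simp
 then show ?thesis unfolding Lap_eq_sip[OF g w] sip_def by simp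
qed

text \<open>A maximal orthonormal set is a basis: a nonzero element of its orthogonal complement could be
 normalised and added.\<close>

lemma orthonormal_basis_exists: "\<exists>B. hardy_orthonormal_basis b B"
proof -
 define \<O> where "\<O> = {B. B \<subseteq> hardy_space b \<and> (\<forall>f\<in>B. \<forall>ps\<in>B. hardy_inner b f ps = (if f = ps then 1 else 0))}"
 have "\<exists>M\<in>\<O>. \<forall>X\<in>\<O>. M \<subseteq> X \<longrightarrow> X = M"
 proof (rule subset_Zorn')
  fix \<C> assume ch: "subset.chain \<O> \<C>"
  have "hardy_inner b f ps = (if f = ps then 1 else 0)" if mem: "f \<in> \<Union>\<C>" "ps \<in> \<Union>\<C>" for f ps
  proof -
   obtain X Y where XY: "X \<in> \<C>" "Y \<in> \<C>" "f \<in> X" "ps \<in> Y" using mem by auto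
   then have "X \<subseteq> Y \<or> Y \<subseteq> X" using ch by (auto simp: subset_chain_def)
   moreover have "X \<in> \<O>" "Y \<in> \<O>" using XY ch by (auto simp: subset_chain_def)
   ultimately show ?thesis using XY unfolding \<O>_def by blast
  qed
  moreover have "\<Union>\<C> \<subseteq> hardy_space b" using ch by (auto simp: subset_chain_def \<O>_def)
  ultimately show "\<Union>\<C> \<in> \<O>" by (simp add: \<O>_def)
 qed
 then obtain B where B: "B \<in> \<O>" and max: "!!X. X \<in> \<O> ==> B \<subseteq> X ==> X = B" by blast
 have compl: "F p = 0" if F: "F \<in> hardy_space b" and orth: "\<forall>f\<in>B. hardy_inner b F f = 0" and p: "p \<in> tube_domain b" for F p
 proof (rule ccontr)
  assume ne: "F p \<noteq> 0"
  obtain g where g: "L2 spec g" "!!P. P \<in> tube_domain b ==> F P = Lap g P" using hardy_space_Lap[OF F] by blast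
  define n where "n = 4*pi^2*nsq spec g"
  have gg: "sip g g = of_real n" by (simp add: sip_self n_def del: of_real_mult)
  have "n \<noteq> 0"
  proof
   assume "n = 0"
   then have "Lap g p = 0" using hardy_inner_vanish[OF g(1) _ p] gg by simp
   then show False using ne g(2)[OF p] by simp
  qed
  moreover have "n >= 0" by (simp add: n_def)
  ultimately have n: "n > 0" by simp
  define h where "h q = of_real (1/sqrt n)*g q" for q
  have h: "L2 spec h" unfolding h_def by (rule L2_cmult(1)[OF g(1)])
  have shl: "sip h u = of_real (1/sqrt n) * sip g u" for u unfolding h_def by (rule sip_cmult)
  have sgh: "sip g h = of_real (sqrt n)"
  proof -
   have "sip g h = cnj (sip h g)" by (rule sip_commute[OF h g(1)])
   also have "... = of_real (1/sqrt n*n)" unfolding shl gg by simp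
   also have "1/sqrt n*n = sqrt n" using n by (simp add: field_simps real_sqrt_mult_self)
   finally show ?thesis .
  qed
  have shh: "sip h h = 1" unfolding shl sgh using n by (simp flip: of_real_mult)
  define f0 where "f0 = Lap h"
  have f0: "f0 \<in> hardy_space b" unfolding f0_def by (rule Lap_in_hardy_space[OF h])
  have i0: "hardy_inner b f0 f0 = 1" using hardy_inner_sip[OF h h] shh by (simp add: f0_def)
  have iF: "hardy_inner b F f0 = of_real (sqrt n)" using hardy_inner_sip[OF g(1) h g(2)] sgh by (simp add: f0_def)
  have io: "hardy_inner b f0 f = 0 \<and> hardy_inner b f f0 = 0" if f: "f \<in> B" for f
  proof -
   have "f \<in> hardy_space b" using B f by (auto simp: \<O>_def)
   then obtain u where u: "L2 spec u" "!!P. P \<in> tube_domain b ==> f P = Lap u P" using hardy_space_Lap by blast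
   have "sip g u = 0" using hardy_inner_sip[OF g(1) u(1) g(2) u(2)] orth f by simp
   then have 1: "sip h u = 0" by (simp add: shl)
   then have 2: "sip u h = 0" using sip_commute[OF h u(1)] by simp
   show ?thesis using hardy_inner_sip[OF h u(1) _ u(2)] hardy_inner_sip[OF u(1) h u(2)] 1 2 by (simp add: f0_def)
  qed
  have "f0 \<notin> B" using orth iF n by auto
  moreover have "insert f0 B \<in> \<O>" using B f0 i0 io by (auto simp: \<O>_def)
  ultimately show False using max[of "insert f0 B"] by blast
 qed
 have BB: "B \<subseteq> hardy_space b" "\<forall>f\<in>B. \<forall>ps\<in>B. hardy_inner b f ps = (if f = ps then 1 else 0)"
  using B unfolding \<O>_def by simp_all
 have "\<forall>F\<in>hardy_space b. (\<forall>f\<in>B. hardy_inner b F f = 0) \<longrightarrow> (\<forall>p\<in>tube_domain b. F p = 0)"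
 proof (intro ballI impI)
  fix F p assume "F \<in> hardy_space b" "\<forall>f\<in>B. hardy_inner b F f = 0" "p \<in> tube_domain b"
  then show "F p = 0" by (rule compl)
 qed
 then show ?thesis unfolding hardy_orthonormal_basis_def using BB by (intro exI[of _ B] conjI)
qed

text \<open>Parseval's identity for the kernel. The partial sums of the orthogonal expansion converge by
 Riesz-Fischer, and completeness of the basis identifies the limit.\<close>

theorem szego_kernel_eq_Lap:
 assumes z: "z \<in> tube_domain b" and w: "w \<in> tube_domain b"
 shows "szego_kernel b z w = Lap (kern w) z"
proof -
 define B where "B = (SOME B. hardy_orthonormal_basis b B)"
 have B: "hardy_orthonormal_basis b B" unfolding B_def using orthonormal_basis_exists by (rule someI_ex)
 have BH: "ph \<in> hardy_space b" if "ph \<in> B" for ph using B that by (auto simp: hardy_orthonormal_basis_def)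
 have "\<forall>ph\<in>B. \<exists>g. L2 spec g \<and> (\<forall>P\<in>tube_domain b. ph P = Lap g P)"
 proof
  fix ph assume "ph \<in> B"
  obtain g where "L2 spec g" "!!P. P \<in> tube_domain b ==> ph P = Lap g P" using hardy_space_Lap[OF BH[OF \<open>ph \<in> B\<close>]] by blast
  then show "\<exists>g. L2 spec g \<and> (\<forall>P\<in>tube_domain b. ph P = Lap g P)" by blast
 qed
 then obtain u where u: "!!ph. ph \<in> B ==> L2 spec (u ph)" "!!ph P. ph \<in> B ==> P \<in> tube_domain b ==> ph P = Lap (u ph) P"
  by metis
 have on: "sip (u ph) (u ps) = (if ph = ps then 1 else 0)" if "ph \<in> B" "ps \<in> B" for ph ps
  using hardy_inner_sip[OF u(1)[OF that(1)] u(1)[OF that(2)] u(2)[OF that(1)] u(2)[OF that(2)]] B that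
  by (auto simp: hardy_orthonormal_basis_def)
 have ev_at: "sip (kern p) (u ph) = cnj (ph p)" if "ph \<in> B" "p \<in> tube_domain b" for ph p
  using Lap_eq_sip[OF u(1)[OF that(1)] that(2)] sip_commute[OF u(1)[OF that(1)] kern_L2[OF that(2)]] u(2)[OF that] by simp
 define s where "s p S q = (\<Sum>ph\<in>S. cnj (ph p)*u ph q)" for p S q
 have sL: "L2 spec (s p S)" if "S \<subseteq> B" for p S
  unfolding s_def using that by (intro L2_sum L2_cmult u(1)) auto
 have s_sip: "sip (s p S) h = (\<Sum>ph\<in>S. cnj (ph p) * sip (u ph) h)" if "S \<subseteq> B" "L2 spec h" for p S h
  unfolding s_def using that by (subst sip_sum) (auto intro!: L2_cmult u(1) simp: sip_cmult)
 have s_u: "sip (s p S) (u ps) = (if ps \<in> S then cnj (ps p) else 0)" if "finite S" "S \<subseteq> B" "ps \<in> B" for p S ps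
 proof -
  have "sip (s p S) (u ps) = (\<Sum>ph\<in>S. if ph = ps then cnj (ps p) else 0)"
   unfolding s_sip[OF that(2) u(1)[OF that(3)]] using that on by (intro sum.cong) auto
  then show ?thesis using that by simp
 qed
 have s_s: "sip (s p S) (s p S) = of_real (\<Sum>ph\<in>S. (norm (ph p))^2)" if S: "finite S" "S \<subseteq> B" for p S
 proof -
  have "sip (s p S) (s p S) = (\<Sum>ph\<in>S. cnj (ph p) * sip (u ph) (s p S))" by (rule s_sip[OF S(2) sL[OF S(2)]])
  also have "... = (\<Sum>ph\<in>S. of_real ((norm (ph p))^2))"
  proof (rule sum.cong[OF refl])
   fix ph assume ph: "ph \<in> S"
   have "sip (u ph) (s p S) = cnj (sip (s p S) (u ph))" using ph S by (intro sip_commute sL u(1)) auto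
   also have "... = ph p" using ph S by (subst s_u) auto
   finally show "cnj (ph p) * sip (u ph) (s p S) = of_real ((norm (ph p))^2)" by (simp only: complex_norm_square mult.commute)
  qed
  finally show ?thesis by (simp only: of_real_sum)
 qed
 have s_nsq: "4*pi^2*nsq spec (s p S) = (\<Sum>ph\<in>S. (norm (ph p))^2)" if "finite S" "S \<subseteq> B" for p S
  using s_s[OF that, of p] unfolding sip_self by (simp only: of_real_eq_iff)
 have bessel: "(\<Sum>ph\<in>S. (norm (ph p))^2) <= 4*pi^2*nsq spec (kern p)" if S: "finite S" "S \<subseteq> B" and p: "p \<in> tube_domain b" for S p
 proof -
  define t where "t = s p S"
  have tL: "L2 spec t" unfolding t_def by (rule sL[OF S(2)])
  have tt: "sip t t = of_real (\<Sum>ph\<in>S. (norm (ph p))^2)" unfolding t_def by (rule s_s[OF S])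
  have "sip t (kern p) = (\<Sum>ph\<in>S. cnj (ph p) * sip (u ph) (kern p))" unfolding t_def by (rule s_sip[OF S(2) kern_L2[OF p]])
  also have "... = (\<Sum>ph\<in>S. of_real ((norm (ph p))^2))"
  proof (rule sum.cong[OF refl])
   fix ph assume ph: "ph \<in> S"
   then have "sip (u ph) (kern p) = ph p" using Lap_eq_sip[OF u(1) p, of ph] u(2)[of ph p] S p by auto
   then show "cnj (ph p) * sip (u ph) (kern p) = of_real ((norm (ph p))^2)" by (simp only: complex_norm_square mult.commute)
  qed
  finally have tk: "sip t (kern p) = of_real (\<Sum>ph\<in>S. (norm (ph p))^2)" by (simp only: of_real_sum)
  have "of_real (4*pi^2*nsq spec (%q. kern p q - t q)) = sip (%q. kern p q - t q) (%q. kern p q - t q)" by (rule sip_self[symmetric])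
  also have "... = sip (kern p) (%q. kern p q - t q) - sip t (%q. kern p q - t q)"
   by (intro sip_diff kern_L2 p tL L2_diff)
  also have "sip (kern p) (%q. kern p q - t q) = cnj (sip (kern p) (kern p) - sip t (kern p))"
   by (subst sip_commute[OF L2_diff(1)[OF kern_L2[OF p] tL] kern_L2[OF p]]) (simp add: sip_diff kern_L2 p tL)
  also have "sip t (%q. kern p q - t q) = cnj (sip (kern p) t - sip t t)"
   by (subst sip_commute[OF L2_diff(1)[OF kern_L2[OF p] tL] tL]) (simp add: sip_diff kern_L2 p tL)
  also have "sip (kern p) t = cnj (sip t (kern p))" by (rule sip_commute[OF tL kern_L2[OF p]])
  finally have "complex_of_real (4*pi^2*nsq spec (%q. kern p q - t q)) = of_real (4*pi^2*nsq spec (kern p) - (\<Sum>ph\<in>S. (norm (ph p))^2))"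
   unfolding tk tt sip_self[of "kern p"] by (simp del: of_real_mult of_real_sum add: algebra_simps)
  then have "4*pi^2*nsq spec (%q. kern p q - t q) = 4*pi^2*nsq spec (kern p) - (\<Sum>ph\<in>S. (norm (ph p))^2)" by (simp only: of_real_eq_iff)
  moreover have "0 <= 4*pi^2*nsq spec (%q. kern p q - t q)" by simp
  ultimately show ?thesis by linarith
 qed
 have sq_sum: "(%ph. (norm (ph p))^2) summable_on B" if p: "p \<in> tube_domain b" for p
  by (rule nonneg_bdd_above_summable_on) (use bessel[OF _ _ p] in \<open>auto intro!: bdd_aboveI2\<close>)
 define sg where "sg = (\<Sum>\<^sub>\<infinity>ph\<in>B. (norm (ph w))^2)"
 have hs1: "((%ph. (norm (ph w))^2) has_sum sg) B" unfolding sg_def by (rule has_sum_infsum[OF sq_sum[OF w]])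
 have abs: "(%ph. ph z*cnj (ph w)) summable_on B"
 proof (rule abs_summable_summable)
  show "(%ph. norm (ph z*cnj (ph w))) summable_on B"
  proof (rule summable_on_comparison_test[OF summable_on_add[OF sq_sum[OF z] sq_sum[OF w]]])
   fix ph :: "complex \<times> complex => complex"
   have "2*(norm (ph z)*norm (ph w)) <= (norm (ph z))^2 + (norm (ph w))^2"
    using sum_squares_bound[of "norm (ph z)" "norm (ph w)"] by simp
   moreover have "0 <= norm (ph z)*norm (ph w)" by simp
   ultimately show "norm (ph z*cnj (ph w)) <= (norm (ph z))^2 + (norm (ph w))^2"
    unfolding norm_mult complex_mod_cnj by linarith
  qed auto
 qed
 have sz: "szego_kernel b z w = (\<Sum>\<^sub>\<infinity>ph\<in>B. ph z*cnj (ph w))" by (simp add: szego_kernel_def B_def)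
 have hs2: "((%ph. ph z*cnj (ph w)) has_sum szego_kernel b z w) B" unfolding sz by (rule has_sum_infsum[OF abs])
 define near where "near n T \<longleftrightarrow> dist (\<Sum>ph\<in>T. (norm (ph w))^2) sg < shrink n \<and> dist (\<Sum>ph\<in>T. ph z*cnj (ph w)) (szego_kernel b z w) < shrink n" for n T
 have "\<exists>S. finite S \<and> S \<subseteq> B \<and> (\<forall>T. finite T \<and> S \<subseteq> T \<and> T \<subseteq> B \<longrightarrow> near n T)" for n
 proof -
  have "\<forall>\<^sub>F T in finite_subsets_at_top B. near n T"
   using hs1 hs2 shrink_pos[of n] unfolding near_def has_sum_def by (intro eventually_conj tendstoD)
  then show ?thesis unfolding eventually_finite_subsets_at_top by blast
 qed
 then have "\<forall>n. \<exists>S. finite S \<and> S \<subseteq> B \<and> (\<forall>T. finite T \<and> S \<subseteq> T \<and> T \<subseteq> B \<longrightarrow> near n T)" by blast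
 from choice[OF this] obtain S0 where S0_all: "\<forall>n. finite (S0 n) \<and> S0 n \<subseteq> B \<and> (\<forall>T. finite T \<and> S0 n \<subseteq> T \<and> T \<subseteq> B \<longrightarrow> near n T)" by (rule exE)
 have S0: "finite (S0 n)" "S0 n \<subseteq> B" for n using S0_all by simp_all
 have S0d: "dist (\<Sum>ph\<in>T. (norm (ph w))^2) sg < shrink n \<and> dist (\<Sum>ph\<in>T. ph z*cnj (ph w)) (szego_kernel b z w) < shrink n"
  if "finite T" "S0 n \<subseteq> T" "T \<subseteq> B" for n T
  using S0_all that unfolding near_def by simp
 define S where "S n = (\<Union>k\<le>n. S0 k)" for n
 have S: "finite (S n)" "S n \<subseteq> B" "S0 n \<subseteq> S n" for n using S0 by (auto simp: S_def)
 have Smono: "S m \<subseteq> S n" if "m <= n" for m n using that by (auto simp: S_def intro: order_trans)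
 have tail: "(\<Sum>ph\<in>T - S n. (norm (ph w))^2) < 2 * shrink n" if T: "finite T" "S n \<subseteq> T" "T \<subseteq> B" for T n
 proof -
  have "(\<Sum>ph\<in>T. (norm (ph w))^2) = (\<Sum>ph\<in>T - S n. (norm (ph w))^2) + (\<Sum>ph\<in>S n. (norm (ph w))^2)"
   using T by (intro sum.subset_diff) auto
  moreover have "dist (\<Sum>ph\<in>T. (norm (ph w))^2) sg < shrink n" using S0d[of T n] S(3)[of n] T by auto
  moreover have "dist (\<Sum>ph\<in>S n. (norm (ph w))^2) sg < shrink n" using S0d[OF S(1) S(3) S(2)] by auto
  ultimately show ?thesis unfolding dist_real_def by linarith
 qed
 have cauchy: "nsq spec (%q. s w (S m) q - s w (S n) q) <= 2 * shrink k" if mn: "k <= n" "n <= m" for k m n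
 proof -
  have "(%q. s w (S m) q - s w (S n) q) = s w (S m - S n)"
  proof
   fix q
   show "s w (S m) q - s w (S n) q = s w (S m - S n) q"
    using sum.subset_diff[OF Smono[OF mn(2)] S(1), of "%ph. cnj (ph w)*u ph q"] by (simp add: s_def)
  qed
  then have "4*pi^2*nsq spec (%q. s w (S m) q - s w (S n) q) = (\<Sum>ph\<in>S m - S n. (norm (ph w))^2)"
   using s_nsq[where S="S m - S n" and p=w] S by auto
  also have "... < 2 * shrink n" by (rule tail[OF S(1) Smono[OF mn(2)] S(2)])
  also have "... <= 2 * shrink k" using shrink_antimono[OF mn(1)] by simp
  finally have "4*pi^2*nsq spec (%q. s w (S m) q - s w (S n) q) <= 2 * shrink k" by simp
  moreover have "1*nsq spec (%q. s w (S m) q - s w (S n) q) <= 4*pi^2*nsq spec (%q. s w (S m) q - s w (S n) q)"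
  proof (rule mult_right_mono)
   have "1*1 <= pi*pi" using pi_ge_two by (intro mult_mono) auto
   then show "1 <= 4*pi^2" by (simp add: power2_eq_square)
  qed simp
  ultimately show ?thesis by linarith
 qed
 obtain f where f: "L2 spec f" and flim: "(%n. nsq spec (%q. s w (S n) q - f q)) ----> 0"
 proof (rule Riesz_Fischer[of spec "%n. s w (S n)"])
  show "L2 spec (s w (S n))" for n by (rule sL[OF S(2)])
  fix e :: real assume e: "e > 0"
  obtain k where k: "2 * shrink k < e"
   using order_tendstoD(2)[OF tendsto_mult_right_zero[OF shrink_tendsto, of 2] e] by (auto simp: eventually_sequentially)
  have "nsq spec (%q. s w (S m) q - s w (S n) q) <= e" if "m >= k" "n >= k" for m n
  proof (cases "n <= m")
   case True then show ?thesis using cauchy[of k n m] that k by simp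
  next
   case False then show ?thesis using cauchy[of k m n] that k nsq_minus_commute[of spec "s w (S m)" "s w (S n)"] by simp
  qed
  then show "\<exists>N. \<forall>m\<ge>N. \<forall>n\<ge>N. nsq spec (%q. s w (S m) q - s w (S n) q) <= e" by blast
 qed blast
 have fu: "sip f (u ps) = cnj (ps w)" if ps: "ps \<in> B" for ps
 proof -
  have l: "(%n. sip (s w (S n)) (u ps)) ----> sip f (u ps)"
   by (rule sip_tendsto[OF sL[OF S(2)] f u(1)[OF ps] flim])
  show ?thesis
  proof (cases "\<exists>n. ps \<in> S n")
   case True
   then obtain n where n: "ps \<in> S n" by blast
   have "\<forall>\<^sub>F m in sequentially. sip (s w (S m)) (u ps) = cnj (ps w)"
    unfolding eventually_sequentially
   proof (intro exI allI impI)
    fix m assume "n <= m"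
    then have "ps \<in> S m" using Smono n by blast
    then show "sip (s w (S m)) (u ps) = cnj (ps w)" using s_u[OF S(1) S(2) ps] by simp
   qed
   then have "(%n. sip (s w (S n)) (u ps)) ----> cnj (ps w)" by (rule tendsto_eventually)
   then show ?thesis using l LIMSEQ_unique by blast
  next
   case False
   then have "sip (s w (S n)) (u ps) = 0" for n using s_u[OF S(1) S(2) ps] by simp
   then have f0: "sip f (u ps) = 0" using l by (simp add: LIMSEQ_const_iff)
   have "(norm (ps w))^2 <= 2 * shrink n" for n
   proof -
    have "(\<Sum>ph\<in>insert ps (S n) - S n. (norm (ph w))^2) < 2 * shrink n"
     by (rule tail) (use S ps in auto)
    moreover have "insert ps (S n) - S n = {ps}" using False by auto
    ultimately show ?thesis by simp
   qed
   then have "(norm (ps w))^2 <= 0"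
    using LIMSEQ_le_const[OF tendsto_mult_right_zero[OF shrink_tendsto, of 2], of "(norm (ps w))^2"] by blast
   then show ?thesis using f0 by simp
  qed
 qed
 have dL: "L2 spec (%q. kern w q - f q)" by (intro L2_diff kern_L2 w f)
 have "Lap (%q. kern w q - f q) z = 0"
 proof -
  have "hardy_inner b (Lap (%q. kern w q - f q)) ph = 0" if ph: "ph \<in> B" for ph
  proof -
   have "hardy_inner b (Lap (%q. kern w q - f q)) ph = sip (%q. kern w q - f q) (u ph)"
    by (rule hardy_inner_sip[OF dL u(1)[OF ph] refl u(2)[OF ph]])
   also have "... = sip (kern w) (u ph) - sip f (u ph)" by (intro sip_diff kern_L2 w f u(1) ph)
   also have "... = 0" using ev_at[OF ph w] fu[OF ph] by simp
   finally show ?thesis .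
  qed
  then show ?thesis using B Lap_in_hardy_space[OF dL] z by (auto simp: hardy_orthonormal_basis_def)
 qed
 then have "sip (kern w) (kern z) = sip f (kern z)"
  unfolding Lap_eq_sip[OF dL z] using sip_diff[OF kern_L2[OF w] f kern_L2[OF z]] by simp
 then have Lf: "Lap (kern w) z = sip f (kern z)" by (simp add: Lap_eq_sip[OF kern_L2[OF w] z])
 have "(%n. sip (s w (S n)) (kern z)) ----> sip f (kern z)"
  by (rule sip_tendsto[OF sL[OF S(2)] f kern_L2[OF z] flim])
 moreover have "sip (s w (S n)) (kern z) = (\<Sum>ph\<in>S n. ph z*cnj (ph w))" for n
  unfolding s_sip[OF S(2) kern_L2[OF z]]
 proof (rule sum.cong[OF refl])
  fix ph assume "ph \<in> S n"
  then have "ph \<in> B" using S(2) by blast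
  then show "cnj (ph w) * sip (u ph) (kern z) = ph z*cnj (ph w)"
   using Lap_eq_sip[OF u(1) z, of ph] u(2)[of ph z] z by (simp add: mult.commute)
 qed
 moreover have "(%n. \<Sum>ph\<in>S n. ph z*cnj (ph w)) ----> szego_kernel b z w"
 proof (rule metric_tendsto_imp_tendsto[OF shrink_tendsto])
  show "\<forall>\<^sub>F n in sequentially. dist (\<Sum>ph\<in>S n. ph z*cnj (ph w)) (szego_kernel b z w) <= dist (shrink n) 0"
   using S0d[OF S(1) S(3) S(2)] by (intro always_eventually allI) (auto simp: dist_real_def less_imp_le)
 qed
 ultimately have "szego_kernel b z w = sip f (kern z)" using LIMSEQ_unique by simp
 then show ?thesis by (simp add: Lf)
qed

definition kernel_density :: "real \<times> real => complex" where
 "kernel_density q = of_real (inv_weight b q/(4*pi^2))"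

theorem szego_kernel_formula:
 assumes "z \<in> tube_domain b" "w \<in> tube_domain b"
 shows "szego_kernel b z w = Lap kernel_density (fst z + cnj (fst w), snd z - cnj (snd w))"
 unfolding szego_kernel_eq_Lap[OF assms] Lap_def kern_def kernel_density_def
 by (intro LI_cong) (simp add: exp_add[symmetric] algebra_simps)

end

section \<open>Nonconvex polynomials: the kernel is unbounded near an off-diagonal boundary point\<close>

context szego_poly
begin

text \<open>The line of slope \<open>h\<close> through the point of the graph over \<open>x\<close> supports the graph from below.\<close>

definition slope_minimum :: "real => real => bool" where
 "slope_minimum h x \<longleftrightarrow> (\<forall>y. poly b x - h*x <= poly b y - h*y)"

lemma slope_coercive:
 fixes H :: real
 obtains R where "!!et y. \<bar>et\<bar> <= H ==> poly b y - et*y <= poly b 0 ==> \<bar>y\<bar> <= R"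
proof -
 obtain c C where c: "c > 0" "!!x. poly b x >= c*x^2 - C" using poly_even_quadratic_bound[OF ev dp lc] by blast
 define K where "K = \<bar>H\<bar> + \<bar>poly b 0\<bar> + \<bar>C\<bar> + 1"
 define R where "R = K/c + 1"
 have "\<bar>y\<bar> <= R" if h: "\<bar>et\<bar> <= H" "poly b y - et*y <= poly b 0" for et y :: real
 proof (rule ccontr)
  assume "\<not> \<bar>y\<bar> <= R"
  moreover have "K/c > 0" using c(1) by (simp add: K_def add_nonneg_pos)
  ultimately have y: "\<bar>y\<bar> > K/c" "\<bar>y\<bar> > 1" unfolding R_def by linarith+
  have "c*\<bar>y\<bar> > K" using y(1) c(1) by (simp add: divide_less_eq mult.commute)
  then have "c*\<bar>y\<bar> - \<bar>et\<bar> > \<bar>poly b 0\<bar> + \<bar>C\<bar>" using h(1) by (simp add: K_def)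
  then have "1*(\<bar>poly b 0\<bar> + \<bar>C\<bar>) < \<bar>y\<bar>*(c*\<bar>y\<bar> - \<bar>et\<bar>)" using y(2) by (intro mult_strict_mono) auto
  also have "... = c*y^2 - \<bar>et\<bar>*\<bar>y\<bar>" by (simp add: power2_eq_square algebra_simps)
  also have "... <= c*y^2 - et*y" using abs_ge_self[of "et*y"] by (simp add: abs_mult)
  finally have "\<bar>poly b 0\<bar> + \<bar>C\<bar> < c*y^2 - et*y" by simp
  moreover have "c*y^2 <= poly b y + C" using c(2)[of y] by simp
  moreover have "poly b y <= \<bar>poly b 0\<bar> + et*y" using h(2) abs_ge_self[of "poly b 0"] by linarith
  ultimately show False using abs_ge_self[of C] by (smt (verit))
 qed
 then show ?thesis using that by blast
qed

lemma slope_minimum_exists: "\<exists>x. slope_minimum h x"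
proof -
 obtain R where R: "!!h' y. \<bar>h'\<bar> <= \<bar>h\<bar> ==> poly b y - h'*y <= poly b 0 ==> \<bar>y\<bar> <= R" using slope_coercive by blast
 have R0: "R >= 0" using R[of h 0] by simp
 have "continuous_on {-R..R} (%y. poly b y - h*y)" by (intro continuous_intros)
 then obtain x where x: "x \<in> {-R..R}" "!!y. y \<in> {-R..R} ==> poly b x - h*x <= poly b y - h*y"
  using continuous_attains_inf[of "{-R..R}" "%y. poly b y - h*y"] R0 by auto
 have "poly b x - h*x <= poly b y - h*y" for y
 proof (cases "\<bar>y\<bar> <= R")
  case True then show ?thesis by (intro x(2)) auto
 next
  case False
  then have "poly b 0 < poly b y - h*y" using R[of h y] by fastforce
  moreover have "poly b x - h*x <= poly b 0 - h*0" using R0 by (intro x(2)) auto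
  ultimately show ?thesis by simp
 qed
 then show ?thesis by (auto simp: slope_minimum_def)
qed

lemma convex_if_supported:
 assumes "!!x. \<exists>h. slope_minimum h x" shows "convex_on UNIV (poly b)"
proof (rule convex_onI)
 fix t x y :: real assume t: "0 < t" "t < 1"
 define z where "z = (1 - t)*x + t*y"
 obtain h where h: "slope_minimum h z" using assms by blast
 have "(1 - t)*(poly b z - h*z) <= (1 - t)*(poly b x - h*x)" "t*(poly b z - h*z) <= t*(poly b y - h*y)"
  using h t by (auto simp: slope_minimum_def intro!: mult_left_mono)
 then have "(1 - t)*(poly b z - h*z) + t*(poly b z - h*z) <= (1 - t)*(poly b x - h*x) + t*(poly b y - h*y)" by linarith
 then have "poly b z - h*z <= (1 - t)*poly b x + t*poly b y - h*z"
  unfolding z_def by (simp add: algebra_simps)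
 then show "poly b ((1 - t) *\<^sub>R x + t *\<^sub>R y) <= (1 - t)*poly b x + t*poly b y" by (simp add: z_def)
qed simp

text \<open>Minimisers for bounded slopes stay in a compact set by coercivity, so a subsequence converges.\<close>

lemma closed_slopes:
 assumes S: "closed S" shows "closed {et. \<exists>x\<in>S. slope_minimum et x}"
 unfolding closed_sequential_limits
proof (intro allI impI, elim conjE)
 fix h l assume h: "\<forall>n. h n \<in> {et. \<exists>x\<in>S. slope_minimum et x}" and lim: "h ----> l"
 obtain X where X: "!!n. X n \<in> S" "!!n. slope_minimum (h n) (X n)" using h by (auto simp: bchoice) metis
 obtain H where H: "!!n. \<bar>h n\<bar> <= H" using convergent_imp_Bseq[OF convergentI[OF lim]] by (auto simp: Bseq_def)
 obtain R where R: "!!et y. \<bar>et\<bar> <= H ==> poly b y - et*y <= poly b 0 ==> \<bar>y\<bar> <= R" using slope_coercive by blast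
 have XR: "X n \<in> {-R..R}" for n
 proof -
  have "poly b (X n) - h n*X n <= poly b 0 - h n*0" using X(2)[of n] by (simp only: slope_minimum_def)
  then show ?thesis using R[OF H[of n], of "X n"] by auto
 qed
 obtain x r where x: "strict_mono (r :: nat => nat)" "(X \<circ> r) ----> x"
  using compact_Icc[of "-R" R] XR unfolding compact_def by blast
 have hl: "(h \<circ> r) ----> l" by (rule LIMSEQ_subseq_LIMSEQ[OF lim x(1)])
 have "x \<in> S" using closed_sequentially[OF S, of "X \<circ> r" x] X x by auto
 moreover have "slope_minimum l x" unfolding slope_minimum_def
 proof
  fix y
  have "(%n. poly b ((X \<circ> r) n) - (h \<circ> r) n*(X \<circ> r) n) ----> poly b x - l*x"
   by (intro tendsto_intros x hl)
  moreover have "(%n. poly b y - (h \<circ> r) n*y) ----> poly b y - l*y" by (intro tendsto_intros hl)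
  ultimately show "poly b x - l*x <= poly b y - l*y"
   by (rule LIMSEQ_le) (use X in \<open>auto simp: slope_minimum_def\<close>)
 qed
 ultimately show "l \<in> {et. \<exists>x\<in>S. slope_minimum et x}" by blast
qed

text \<open>If no line supports the graph at \<open>x\<^sub>0\<close>, then the slopes with a minimiser to the left of \<open>x\<^sub>0\<close> and those
 with one to the right form a closed cover of the line, so some slope has both.\<close>

lemma bitangent:
 assumes nc: "\<not> convex_on UNIV (poly b)"
 obtains et m x1 x2 where "x1 < x2" "poly b x1 = et*x1 + m" "poly b x2 = et*x2 + m" "!!x. et*x + m <= poly b x"
proof -
 obtain x0 where x0: "!!et. \<not> slope_minimum et x0" using convex_if_supported nc by blast
 define L where "L = {et. \<exists>x\<in>{..x0}. slope_minimum et x}"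
 define U where "U = {et. \<exists>x\<in>{x0..}. slope_minimum et x}"
 have cl: "closed L" "closed U" unfolding L_def U_def by (intro closed_slopes; simp)+
 have cover: "UNIV \<subseteq> L \<union> U"
 proof
  fix et
  obtain x where "slope_minimum et x" using slope_minimum_exists by blast
  then show "et \<in> L \<union> U" by (cases "x <= x0") (auto simp: L_def U_def)
 qed
 obtain c C where c: "c > 0" "!!x. poly b x >= c*x^2 - C" using poly_even_quadratic_bound[OF ev dp lc] by blast
 have lower: "poly b x >= - C" for x
 proof -
  have "0 <= c*x^2" using c(1) by simp
  then show ?thesis using c(2)[of x] by linarith
 qed
 have Lne: "L \<noteq> {}"
 proof -
  define et where "et = - (\<bar>poly b (x0 - 1)\<bar> + \<bar>C\<bar> + 1)"
  obtain x where x: "slope_minimum et x" using slope_minimum_exists by blast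
  have "x <= x0"
  proof (rule ccontr)
   assume "\<not> x <= x0"
   then have d: "x - (x0 - 1) >= 1" by simp
   have "poly b x - et*x <= poly b (x0 - 1) - et*(x0 - 1)" using x by (simp add: slope_minimum_def)
   then have "(- et)*(x - (x0 - 1)) <= poly b (x0 - 1) - poly b x" by (simp add: algebra_simps)
   moreover have "(- et)*1 <= (- et)*(x - (x0 - 1))" using d by (intro mult_left_mono) (auto simp: et_def)
   ultimately show False using lower[of x] by (simp add: et_def)
  qed
  then show ?thesis using x by (auto simp: L_def)
 qed
 have Une: "U \<noteq> {}"
 proof -
  define et where "et = \<bar>poly b (x0 + 1)\<bar> + \<bar>C\<bar> + 1"
  obtain x where x: "slope_minimum et x" using slope_minimum_exists by blast
  have "x >= x0"
  proof (rule ccontr)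
   assume "\<not> x >= x0"
   then have d: "(x0 + 1) - x >= 1" by simp
   have "poly b x - et*x <= poly b (x0 + 1) - et*(x0 + 1)" using x by (simp add: slope_minimum_def)
   then have "et*((x0 + 1) - x) <= poly b (x0 + 1) - poly b x" by (simp add: algebra_simps)
   moreover have "et*1 <= et*((x0 + 1) - x)" using d by (intro mult_left_mono) (auto simp: et_def)
   ultimately show False using lower[of x] by (simp add: et_def)
  qed
  then show ?thesis using x by (auto simp: U_def)
 qed
 have "L \<inter> U \<noteq> {}" using connected_closedD[OF connected_UNIV _ cover cl] Lne Une by auto
 then obtain et x1 x2 where h: "x1 <= x0" "slope_minimum et x1" "x0 <= x2" "slope_minimum et x2" by (auto simp: L_def U_def)
 have "x1 \<noteq> x0" "x2 \<noteq> x0" using h x0 by auto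
 then have "x1 < x2" using h by simp
 moreover have "poly b x1 - et*x1 = poly b x2 - et*x2" using h by (auto simp: slope_minimum_def intro: antisym)
 moreover have "et*x + (poly b x1 - et*x1) <= poly b x" for x
  using h(2)[unfolded slope_minimum_def, rule_format, of x] by linarith
 ultimately show ?thesis by (intro that[of x1 x2 et "poly b x1 - et*x1"]) linarith+
qed

text \<open>Over the strip \<open>et t \<le> a \<le> et t + 1\<close> along a bitangent slope the weight is at most a constant times the
 exponential of the supporting line, so the kernel between the two tangency points diverges at height zero.\<close>

lemma bitangent_kernel_lower_bound:
 assumes h: "poly b x1 = et*x1 + m" "poly b x2 = et*x2 + m" "!!x. et*x + m <= poly b x"
 obtains k where "k > 0" "!!T. T >= 1 ==> norm (szego_kernel b (Complex x1 0, Complex 0 (poly b x1 + 1/T)) (Complex x2 0, Complex 0 (poly b x2 + 1/T))) >= k*(T - 1)"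
proof -
 define Q where "Q = enn2real (weight b (et + 1, 1)) + enn2real (weight b (et - 1, 1))"
 have Qe: "weight b (et + 1, 1) + weight b (et - 1, 1) = ennreal Q"
  using weight_finite[of 1 "et + 1"] weight_finite[of 1 "et - 1"] by (simp add: Q_def ennreal_plus)
 have Q0: "Q > 0"
 proof -
  have "0 < weight b (et + 1, 1)" by (rule weight_pos)
  then have "0 < enn2real (weight b (et + 1, 1))" using weight_finite[of 1 "et + 1"] by (simp add: enn2real_positive_iff)
  then show ?thesis by (simp add: Q_def add_pos_nonneg)
 qed
 have wb: "weight b (et*t + s, t) <= ennreal (exp (2*m - 2*t*m)*Q)" if t: "t >= 1" and s: "0 <= s" "s <= 1" for t s
 proof -
  have "weight b (et*t + s, t) <= (NI l. ennreal (exp (2*m - 2*t*m)) *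
    (ennreal (exp (2*((et + 1)*l - 1*poly b l))) + ennreal (exp (2*((et - 1)*l - 1*poly b l)))))"
   unfolding weight_def fst_conv snd_conv
  proof (rule nn_integral_mono)
   fix l
   have "(t - 1)*(et*l + m) <= (t - 1)*poly b l" using t h(3)[of l] by (intro mult_left_mono) auto
   moreover have "s*l <= \<bar>l\<bar>"
   proof -
    have "s*l <= s*\<bar>l\<bar>" using s by (intro mult_left_mono) auto
    also have "... <= 1*\<bar>l\<bar>" using s by (intro mult_right_mono) auto
    finally show ?thesis by simp
   qed
   ultimately have le: "2*((et*t + s)*l - t*poly b l) <= (2*m - 2*t*m) + 2*(et*l + \<bar>l\<bar> - poly b l)"
    by (simp add: algebra_simps)
   have "exp (2*((et*t + s)*l - t*poly b l)) <= exp (2*m - 2*t*m)*exp (2*(et*l + \<bar>l\<bar> - poly b l))"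
    unfolding exp_add[symmetric] using le by simp
   also have "... <= exp (2*m - 2*t*m)*(exp (2*((et + 1)*l - 1*poly b l)) + exp (2*((et - 1)*l - 1*poly b l)))"
   proof (rule mult_left_mono)
    show "exp (2*(et*l + \<bar>l\<bar> - poly b l)) <= exp (2*((et + 1)*l - 1*poly b l)) + exp (2*((et - 1)*l - 1*poly b l))"
     by (cases "l >= 0") (auto simp: algebra_simps)
   qed simp
   finally have "ennreal (exp (2*((et*t + s)*l - t*poly b l))) <= ennreal (exp (2*m - 2*t*m)*(exp (2*((et + 1)*l - 1*poly b l)) + exp (2*((et - 1)*l - 1*poly b l))))"
    by (rule ennreal_leI)
   then show "ennreal (exp (2*((et*t + s)*l - t*poly b l))) <= ennreal (exp (2*m - 2*t*m))*(ennreal (exp (2*((et + 1)*l - 1*poly b l))) + ennreal (exp (2*((et - 1)*l - 1*poly b l))))"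
    by (simp only: ennreal_mult ennreal_plus exp_ge_zero add_nonneg_nonneg)
  qed
  also have "... = ennreal (exp (2*m - 2*t*m))*(weight b (et + 1, 1) + weight b (et - 1, 1))"
   unfolding weight_def fst_conv snd_conv by (simp add: nn_integral_cmult nn_integral_add)
  finally show ?thesis unfolding Qe using Q0 by (simp add: ennreal_mult)
 qed
 define k where "k = exp (- \<bar>x1 + x2\<bar>)*exp (- 2)/(4*pi^2*(exp (2*m)*Q))"
 have k: "k > 0" using Q0 by (simp add: k_def)
 have "norm (szego_kernel b (Complex x1 0, Complex 0 (poly b x1 + 1/T)) (Complex x2 0, Complex 0 (poly b x2 + 1/T))) >= k*(T - 1)"
  if T: "T >= 1" for T
 proof -
  define z where "z = (Complex x1 0, Complex 0 (poly b x1 + 1/T))"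
  define w where "w = (Complex x2 0, Complex 0 (poly b x2 + 1/T))"
  have zw: "z \<in> tube_domain b" "w \<in> tube_domain b" using T by (auto simp: z_def w_def tube_domain_def)
  define j where "j q = exp (fst q*(x1 + x2) - snd q*(poly b x1 + poly b x2 + 2/T))*(inv_weight b q/(4*pi^2))" for q
  have j0: "j q >= 0" for q by (simp add: j_def)
  have jeq: "wave z q*kern w q = of_real (j q)" for q
  proof -
   have "wave z q*exp (of_real (fst q)*cnj (fst w) - \<i> * of_real (snd q)*cnj (snd w))
    = exp (complex_of_real (fst q*(x1 + x2) - snd q*(poly b x1 + poly b x2 + 2/T)))"
    unfolding exp_add[symmetric]
    by (intro arg_cong[where f=exp]) (simp add: z_def w_def complex_eq_iff algebra_simps)
   note E = this
   have "wave z q*kern w q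
    = of_real (inv_weight b q/(4*pi^2))*exp (complex_of_real (fst q*(x1 + x2) - snd q*(poly b x1 + poly b x2 + 2/T)))"
    unfolding kern_def E[symmetric] by (rule mult.left_commute)
   then show ?thesis by (simp only: j_def exp_of_real of_real_mult mult.commute)
  qed
  have ij: "L1 j"
  proof -
   have "L1 (%q. wave z q*kern w q)"
    by (rule Lap_integrable[OF L2_spec_lap_on[OF kern_L2[OF zw(2)]]]) (use zw(1) in \<open>simp add: tube_domain_base\<close>)
   then have "L1 (%q. Re (complex_of_real (j q)))" unfolding jeq by (rule integrable_Re)
   then show ?thesis by simp
  qed
  have sk: "szego_kernel b z w = of_real (LI q. j q)"
   unfolding szego_kernel_eq_Lap[OF zw] Lap_def jeq by (rule integral_complex_of_real)
  have jl: "j (a, t) >= k" if t: "1 <= t" "t <= T" and a: "et*t <= a" "a <= et*t + 1" for a t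
  proof -
   define s where "s = a - et*t"
   have s: "0 <= s" "s <= 1" "a = et*t + s" using a by (auto simp: s_def)
   define W where "W = exp (2*m - 2*t*m)*Q"
   have W0: "W > 0" using Q0 by (simp add: W_def)
   have p: "enn2real (weight b (a, t)) > 0" using weight_pos weight_finite[of t a] t by (simp add: enn2real_positive_iff)
   have "enn2real (weight b (a, t)) <= W"
    using enn2real_mono[OF wb[OF t(1) s(1,2)]] W0 by (simp add: s(3) W_def)
   then have "1/W <= inv_weight b (a, t)" using p t by (simp add: inv_weight_def frac_le)
   then have iw: "1/W/(4*pi^2) <= inv_weight b (a, t)/(4*pi^2)" by (intro divide_right_mono) auto
   have e: "exp (- \<bar>x1 + x2\<bar>)*exp (- 2)*exp (- 2*t*m) <= exp (a*(x1 + x2) - t*(poly b x1 + poly b x2 + 2/T))"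
   proof -
    have "a*(x1 + x2) - t*(poly b x1 + poly b x2 + 2/T) = s*(x1 + x2) - 2*t*m - 2*(t/T)"
     by (simp add: h s(3) algebra_simps)
    moreover have "t/T <= 1" using t T by simp
    moreover have "s*(x1 + x2) >= - \<bar>x1 + x2\<bar>"
    proof -
     have "\<bar>s*(x1 + x2)\<bar> <= 1*\<bar>x1 + x2\<bar>" unfolding abs_mult using s by (intro mult_right_mono) auto
     then show ?thesis by (simp add: abs_le_iff)
    qed
    ultimately show ?thesis unfolding exp_add[symmetric] by simp
   qed
   have "k = (exp (- \<bar>x1 + x2\<bar>)*exp (- 2)*exp (- 2*t*m))*(1/W/(4*pi^2))"
   proof -
    have "W = exp (2*m)*Q*exp (- 2*t*m)" by (simp add: W_def exp_diff exp_minus divide_inverse)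
    then show ?thesis using Q0 by (simp add: k_def)
   qed
   also have "... <= j (a, t)" unfolding j_def fst_conv snd_conv using e iw W0 by (intro mult_mono) auto
   finally show ?thesis .
  qed
  have "ennreal (k*(T - 1)) = (NI t. ennreal k*indicator {1..T} t)"
   using T k by (subst nn_integral_cmult_indicator) (auto simp: ennreal_mult)
  also have "... = (NI t. NI a. ennreal k*indicator {1..T} t*indicator {et*t..et*t + 1} a)"
   by (intro nn_integral_cong) (subst nn_integral_cmult_indicator, auto)
  also have "... <= (NI t. NI a. ennreal (j (a, t)))"
   by (intro nn_integral_mono) (auto simp: indicator_def jl ennreal_leI)
  also have "... = (NI q. ennreal (j q))"
   unfolding lborel_prod[symmetric, where 'a=real and 'b=real]
   by (rule lborel_pair.nn_integral_snd) (use ij in \<open>auto simp: measurable_lborel_pair\<close>)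
  also have "... = ennreal (LI q. j q)" using ij j0 by (intro nn_integral_eq_integral) auto
  finally have "k*(T - 1) <= (LI q. j q)" using j0 by (subst (asm) ennreal_le_iff) (auto intro: integral_nonneg)
  also have "... <= norm (szego_kernel b z w)" unfolding sk using j0 by simp
  finally show ?thesis by (simp add: z_def w_def)
 qed
 then show ?thesis using that k by blast
qed

text \<open>Along heights \<open>1 / T\<close> the kernel grows at least linearly in \<open>T\<close>, while a continuous extension would
 be bounded along a convergent sequence.\<close>

theorem convex_if_extends:
 assumes E: "extends_smoothly (tube_domain b \<times> tube_domain b)
      (closure (tube_domain b) \<times> closure (tube_domain b) - boundary_diagonal b)
      (%(z, w). szego_kernel b z w)"
 shows "convex_on UNIV (poly b)"
proof (rule ccontr)
 assume "\<not> convex_on UNIV (poly b)"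
 note nc = this
 obtain et m x1 x2 where h: "x1 < x2" "poly b x1 = et*x1 + m" "poly b x2 = et*x2 + m" "!!x. et*x + m <= poly b x"
  by (rule bitangent[OF nc]) (rule that; assumption)
 obtain k where k: "k > 0" "!!T. T >= 1 ==> norm (szego_kernel b (Complex x1 0, Complex 0 (poly b x1 + 1/T)) (Complex x2 0, Complex 0 (poly b x2 + 1/T))) >= k*(T - 1)"
  using bitangent_kernel_lower_bound[OF h(2-4)] by blast
 let ?A = "closure (tube_domain b) \<times> closure (tube_domain b) - boundary_diagonal b"
 define P where "P e = ((Complex x1 0, Complex 0 (poly b x1 + e)), (Complex x2 0, Complex 0 (poly b x2 + e)))" for e
 obtain g where g: "continuous_on ?A g" "!!x. x \<in> tube_domain b \<times> tube_domain b ==> g x = (%(z, w). szego_kernel b z w) x"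
  using E unfolding extends_smoothly_def by (metis empty_subsetI iterated_derivative.simps(1) list.set(1))
 have Pc: "(%n. P (shrink n)) ----> P 0"
  unfolding P_def Complex_eq by (intro tendsto_intros tendsto_of_real shrink_tendsto)
 have PU: "P (shrink n) \<in> tube_domain b \<times> tube_domain b" for n by (simp add: P_def tube_domain_def)
 have PA: "P (shrink n) \<in> ?A" for n
  using h(1) PU[of n] closure_subset[of "tube_domain b"] by (auto simp: boundary_diagonal_def P_def)
 have P0: "P 0 \<in> ?A"
 proof -
  have "(%n. fst (P (shrink n))) ----> fst (P 0)" "(%n. snd (P (shrink n))) ----> snd (P 0)" using Pc by (auto intro: tendsto_fst tendsto_snd)
  moreover have "fst (P (shrink n)) \<in> tube_domain b" "snd (P (shrink n)) \<in> tube_domain b" for n using PU[of n] by auto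
  ultimately have "fst (P 0) \<in> closure (tube_domain b)" "snd (P 0) \<in> closure (tube_domain b)"
   unfolding closure_sequential by (metis (no_types))+
  then show ?thesis using h(1) by (auto simp: boundary_diagonal_def P_def)
 qed
 have "(%n. g (P (shrink n))) ----> g (P 0)"
  using g(1) Pc PA P0 unfolding continuous_on_sequentially by (auto simp: o_def)
 then have "Bseq (%n. g (P (shrink n)))" by (rule convergent_imp_Bseq[OF convergentI])
 then obtain K where K: "!!n. norm (g (P (shrink n))) <= K" by (auto simp: Bseq_def)
 have "k*real n <= K" for n
 proof -
  have "k*(real (Suc n) - 1) <= norm (g (P (shrink n)))"
   using k(2)[of "real (Suc n)"] g(2)[OF PU[of n]] by (simp add: P_def shrink_def divide_inverse)
  then show ?thesis using K[of n] by simp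
 qed
 moreover obtain n :: nat where "real n > K/k" using reals_Archimedean2 by blast
 moreover from this have "K < k*real n" using k(1) by (simp add: pos_divide_less_eq mult.commute)
 ultimately show False by (simp add: not_le[symmetric])
qed

end

section \<open>Convex polynomials: lower bounds for the perturbed weight\<close>

text \<open>An \<open>n\<close>-th difference with step \<open>h\<close> of a polynomial whose \<open>n\<close>-th derivative is the constant \<open>A\<close> equals \<open>A h\<^sup>n\<close>, and it is
 at most \<open>2\<^sup>n\<close> times the maximum on the interval.\<close>

lemma poly_constant_derivative_bound:
 fixes p :: "real poly"
 assumes "(pderiv ^^ n) p = [:A:]" "h >= 0" "!!u. y <= u ==> u <= y + real n*h ==> \<bar>poly p u\<bar> <= M"
 shows "\<bar>A\<bar>*h^n <= 2^n*M"
 using assms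
proof (induction n arbitrary: p A M)
 case 0
 then show ?case using "0.prems"(3)[of y] by simp
next
 case (Suc n)
 define q where "q = (pderiv ^^ n) p"
 define D where "D = pcompose p [:h, 1:] - p"
 have shift: "(pderiv ^^ k) (pcompose r [:h, 1:]) = pcompose ((pderiv ^^ k) r) [:h, 1:]" for k and r :: "real poly"
  by (induction k) (simp_all add: pderiv_pcompose pderiv_pCons)
 have pq: "pderiv q = [:A:]" using Suc.prems(1) by (simp add: q_def)
 have "(pderiv ^^ n) D = (pderiv ^^ n) (pcompose p [:h, 1:]) + (pderiv ^^ n) (smult (-1) p)"
  unfolding D_def higher_pderiv_add[symmetric] by simp
 also have "... = pcompose q [:h, 1:] - q" unfolding shift higher_pderiv_smult q_def by simp
 also have "... = [:A*h:]"
 proof (rule poly_eqI)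
  have "degree q <= 1"
  proof (rule ccontr)
   assume "\<not> degree q <= 1"
   then have "degree (pderiv q) >= 1" by (simp add: degree_pderiv)
   then show False using pq by simp
  qed
  then have q0: "q = [:coeff q 0, coeff q 1:]"
   by (intro poly_eqI) (auto simp: coeff_pCons coeff_eq_0 split: nat.split)
  obtain c d where q: "q = [:c, d:]" using q0 by blast
  then have "d = A" using pq by (simp add: pderiv_pCons)
  then show "coeff (pcompose q [:h, 1:] - q) k = coeff [:A*h:] k" for k
   by (simp add: q pcompose_pCons coeff_pCons split: nat.split)
 qed
 finally have D: "(pderiv ^^ n) D = [:A*h:]" .
 have "\<bar>poly D u\<bar> <= 2*M" if "y <= u" "u <= y + real n*h" for u
 proof -
  have "\<bar>poly p (h + u)\<bar> <= M" "\<bar>poly p u\<bar> <= M" using that Suc.prems(2) by (auto intro!: Suc.prems(3) simp: algebra_simps)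
  then show ?thesis unfolding D_def by (simp add: poly_pcompose)
 qed
 from Suc.IH[OF D Suc.prems(2) this] Suc.prems(2) show ?case by (simp add: abs_mult algebra_simps)
qed

definition excess :: "real poly => real => real => real" where
 "excess p x u = poly p (x + u) - poly p x - poly (pderiv p) x*u"

text \<open>Induction over the coefficients; multiplication of the polynomial by the variable adds one factor \<open>1 +
 \<bar>u\<bar>\<close>.\<close>

lemma excess_upper_bound:
 obtains C N where "C >= 1" "!!x u. \<bar>x\<bar> <= B ==> \<bar>excess p x u\<bar> <= C*u^2*(1 + \<bar>u\<bar>)^N"
proof -
 have "\<exists>C N. C >= 1 \<and> (\<forall>x u. \<bar>x\<bar> <= B \<longrightarrow> \<bar>excess p x u\<bar> <= C*u^2*(1 + \<bar>u\<bar>)^N)"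
 proof (induction p rule: pCons_induct)
  case 0
  show ?case by (rule exI[of _ 1], rule exI[of _ 0]) (simp add: excess_def)
 next
  case (pCons a p)
  then obtain C N where C: "C >= 1" "!!x u. \<bar>x\<bar> <= B ==> \<bar>excess p x u\<bar> <= C*u^2*(1 + \<bar>u\<bar>)^N" by blast
  have "bounded (poly (pderiv p) ` {-B..B})"
   by (intro compact_imp_bounded compact_continuous_image continuous_intros) auto
  then obtain D where "\<forall>x\<in>{-B..B}. \<bar>poly (pderiv p) x\<bar> <= D" by (auto simp: bounded_iff)
  then have D: "!!x. x \<in> {-B..B} ==> \<bar>poly (pderiv p) x\<bar> <= D" by blast
  have "\<bar>excess (pCons a p) x u\<bar> <= ((\<bar>B\<bar> + 1)*C + \<bar>D\<bar>)*u^2*(1 + \<bar>u\<bar>)^Suc N" if x: "\<bar>x\<bar> <= B" for x u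
  proof -
   have e: "excess (pCons a p) x u = (x + u)*excess p x u + u^2*poly (pderiv p) x"
    by (simp add: excess_def pderiv_pCons algebra_simps power2_eq_square)
   have 1: "1 <= (1 + \<bar>u\<bar>)^Suc N" by (intro one_le_power) auto
   have "\<bar>x + u\<bar> <= (\<bar>B\<bar> + 1)*(1 + \<bar>u\<bar>)" using x by (simp add: algebra_simps) (smt (verit) mult_nonneg_nonneg abs_ge_zero)
   then have "\<bar>(x + u)*excess p x u\<bar> <= ((\<bar>B\<bar> + 1)*(1 + \<bar>u\<bar>))*(C*u^2*(1 + \<bar>u\<bar>)^N)"
    unfolding abs_mult by (intro mult_mono C(2) x) auto
   moreover have "\<bar>poly (pderiv p) x\<bar> <= \<bar>D\<bar>" using D[of x] x by force
   then have "\<bar>u^2*poly (pderiv p) x\<bar> <= u^2*(\<bar>D\<bar>*(1 + \<bar>u\<bar>)^Suc N)"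
    unfolding abs_mult using mult_mono[of "\<bar>poly (pderiv p) x\<bar>" "\<bar>D\<bar>" 1 "(1 + \<bar>u\<bar>)^Suc N"] 1 by (intro mult_mono) auto
   ultimately have "\<bar>excess (pCons a p) x u\<bar> <= ((\<bar>B\<bar> + 1)*(1 + \<bar>u\<bar>))*(C*u^2*(1 + \<bar>u\<bar>)^N) + u^2*(\<bar>D\<bar>*(1 + \<bar>u\<bar>)^Suc N)"
    unfolding e by linarith
   also have "... = ((\<bar>B\<bar> + 1)*C + \<bar>D\<bar>)*u^2*(1 + \<bar>u\<bar>)^Suc N" by (simp add: algebra_simps)
   finally show ?thesis .
  qed
  moreover have "(\<bar>B\<bar> + 1)*C + \<bar>D\<bar> >= 1" using mult_mono[of 1 "\<bar>B\<bar> + 1" 1 C] C(1) by simp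
  ultimately show ?case by blast
 qed
 then show ?thesis using that by blast
qed

lemma continuous_on_excess [continuous_intros]:
 "continuous_on S f ==> continuous_on S g ==> continuous_on S (%x. excess p (f x) (g x))"
 unfolding excess_def by (intro continuous_intros)

lemma measurable_excess [measurable]: "excess p x \<in> bm"
 by (intro borel_measurable_continuous_onI continuous_intros)

locale convex_szego_poly = szego_poly +
 assumes convex: "convex_on UNIV (poly b)"
begin

lemma excess_nonneg: "0 <= excess b x u"
proof -
 have "poly (pderiv b) x*((x + u) - x) <= poly b (x + u) - poly b x"
  by (rule convex_on_imp_above_tangent[OF convex]) (auto intro: DERIV_subset[OF poly_DERIV])
 then show ?thesis by (simp add: excess_def)
qed

lemma excess_mono:
 assumes "0 <= s" "s <= 1" shows "excess b x (s*u) <= excess b x u"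
proof -
 have "poly b ((1 - s) *\<^sub>R x + s *\<^sub>R (x + u)) <= (1 - s)*poly b x + s*poly b (x + u)"
  using assms by (intro convex_onD[OF convex]) auto
 also have "(1 - s) *\<^sub>R x + s *\<^sub>R (x + u) = x + s*u" by (simp add: algebra_simps)
 finally have "excess b x (s*u) <= s*excess b x u" by (simp add: excess_def algebra_simps)
 also have "... <= excess b x u" using assms excess_nonneg[of x u] by (simp add: mult_left_le_one_le)
 finally show ?thesis .
qed

lemma degree_ge_2: "degree b >= 2"
 using ev dp by (metis One_nat_def Suc_1 Suc_leI le_neq_implies_less odd_one)

text \<open>Convexity of one fixed polynomial improves to a lower bound which is uniform in the point of tangency: the excess over a
 tangent is a polynomial with the same leading term, and it is monotone on both half lines.\<close>

lemma excess_lower_bound: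
 obtains c where "c > 0" "!!x u. excess b x u >= c*\<bar>u\<bar>^degree b"
proof -
 define m where "m = degree b"
 define A where "A = fact m*lead_coeff b"
 have m: "m >= 2" using degree_ge_2 by (simp add: m_def)
 have A: "A > 0" using lc by (simp add: A_def)
 have "A*(\<bar>u\<bar>/m)^m <= 2^m*excess b x u" for x u
 proof -
  define Q where "Q = pcompose b [:x, 1:] + smult (-1) [:poly b x, poly (pderiv b) x:]"
  have pQ: "poly Q v = excess b x v" for v by (simp add: Q_def excess_def poly_pcompose algebra_simps)
  have shift: "(pderiv ^^ k) (pcompose r [:x, 1:]) = pcompose ((pderiv ^^ k) r) [:x, 1:]" for k and r :: "real poly"
   by (induction k) (simp_all add: pderiv_pcompose pderiv_pCons)
  have 1: "(pderiv ^^ m) b = [:A:]"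
  proof (rule poly_eqI)
   fix k show "coeff ((pderiv ^^ m) b) k = coeff [:A:] k"
    unfolding coeff_higher_pderiv A_def
    by (cases k) (auto simp: m_def pochhammer_fact coeff_eq_0)
  qed
  have 2: "(pderiv ^^ m) [:c, d:] = 0" for c d :: real
  proof -
   have "pderiv (pderiv [:c, d:]) = 0" by (simp add: pderiv_pCons)
   moreover obtain k where "m = Suc (Suc k)" using m by (metis Suc_1 Suc_le_D le_Suc_ex add_2_eq_Suc)
   ultimately show ?thesis by (simp only: funpow_Suc_right comp_def higher_pderiv_0)
  qed
  have "(pderiv ^^ m) Q = [:A:]" unfolding Q_def higher_pderiv_add higher_pderiv_smult shift 1 2 by (simp add: pcompose_pCons)
  moreover have "\<bar>poly Q v\<bar> <= excess b x u" if "min 0 u <= v" "v <= min 0 u + real m*(\<bar>u\<bar>/m)" for v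
  proof (cases "u = 0")
   case False
   have "real m*(\<bar>u\<bar>/m) = \<bar>u\<bar>" using m by simp
   then have v: "min 0 u <= v" "v <= max 0 u" using that by (auto split: if_splits simp: min_def max_def)
   have "0 <= v/u" "v/u <= 1" using v False by (cases "u > 0"; auto simp: divide_simps split: if_splits)+
   from excess_mono[OF this, of x u] False show ?thesis by (simp add: pQ excess_nonneg)
  qed (use that in \<open>auto simp: pQ excess_def\<close>)
  ultimately have "\<bar>A\<bar>*(\<bar>u\<bar>/m)^m <= 2^m*excess b x u"
   by (intro poly_constant_derivative_bound[where y="min 0 u"]) auto
  then show ?thesis using A by simp
 qed
 then have "excess b x u >= A/(2*m)^m*\<bar>u\<bar>^m" for x u
  using m by (simp add: power_divide power_mult_distrib field_simps)
 then show ?thesis using A m by (intro that[of "A/(2*m)^m"]) (auto simp: m_def)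
qed

text \<open>Every exponential in \<open>u\<close> is absorbed by an arbitrarily small multiple of the excess.\<close>

lemma excess_absorbs:
 fixes T A :: real
 assumes T: "T > 0"
 obtains C where "!!x u. A*\<bar>u\<bar> - T*excess b x u <= C - \<bar>u\<bar>"
proof -
 obtain c where c: "c > 0" "!!x u. excess b x u >= c*\<bar>u\<bar>^degree b" using excess_lower_bound by blast
 have "A*\<bar>u\<bar> - T*excess b x u <= (T*c + (A + 1)^2/(4*(T*c))) - \<bar>u\<bar>" for x u
 proof -
  have "u^2 - 1 <= \<bar>u\<bar>^degree b"
  proof (cases "\<bar>u\<bar> <= 1")
   case True
   then have "u^2 <= 1" by (simp add: abs_square_le_1)
   then show ?thesis by (smt (verit) zero_le_power abs_ge_zero)
  next
   case False
   then have "\<bar>u\<bar>^2 <= \<bar>u\<bar>^degree b" using degree_ge_2 by (intro power_increasing) auto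
   then show ?thesis by simp
  qed
  then have "c*(u^2 - 1) <= excess b x u" using mult_left_mono[of "u^2 - 1" "\<bar>u\<bar>^degree b" c] c(1) c(2)[of u x] by linarith
  then have 1: "T*(c*(u^2 - 1)) <= T*excess b x u" using T by (intro mult_left_mono) auto
  define k where "k = T*c"
  have k: "k > 0" using T c by (simp add: k_def)
  have "0 <= (2*k*\<bar>u\<bar> - (A + 1))^2/(4*k)" using k by simp
  also have "(2*k*\<bar>u\<bar> - (A + 1))^2 = 4*k*(k*u^2 - (A + 1)*\<bar>u\<bar>) + (A + 1)^2"
   by (simp add: power2_diff power_mult_distrib) (simp add: power2_eq_square algebra_simps)
  also have ".../(4*k) = k*u^2 - (A + 1)*\<bar>u\<bar> + (A + 1)^2/(4*k)"
   using k by (simp add: add_divide_distrib)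
  finally show ?thesis using 1 unfolding k_def by (simp add: algebra_simps)
 qed
 then show ?thesis using that by blast
qed

lemma
 fixes k :: real
 assumes k: "k > 0"
 shows integrable_exp_minus_abs: "L1 (%u. exp (C - k*\<bar>u\<bar>))"
  and integral_exp_minus_abs: "(LI u. exp (- (k*\<bar>u\<bar>))) <= 2/k"
proof -
 define g where "g u = (erlang_density 0 k u + erlang_density 0 k (- u))/k" for u
 have "has_bochner_integral lborel (erlang_density 0 k) 1"
  using nn_integral_erlang_ith_moment[OF k, of 0 0] k by (intro has_bochner_integral_nn_integral) auto
 then have d: "L1 (erlang_density 0 k)" "(LI u. erlang_density 0 k u) = 1"
  by (auto simp: has_bochner_integral_iff)
 have d': "L1 (%u. erlang_density 0 k (- u))" "(LI u. erlang_density 0 k (- u)) = 1"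
  using lborel_integrable_real_affine[OF d(1), of "-1" 0] lborel_integral_real_affine[of "-1" "erlang_density 0 k" 0] d(2) by auto
 have g: "L1 g" "(LI u. g u) = 2/k"
  unfolding g_def using d d' by simp_all
 have le: "exp (- (k*\<bar>u\<bar>)) <= g u" for u
  using k by (auto simp: g_def erlang_density_def abs_if field_simps)
 have i: "L1 (%u. exp (- (k*\<bar>u\<bar>)))"
  by (rule integrable_bound[OF g(1)])
   (use le in \<open>auto intro!: borel_measurable_continuous_onI continuous_intros AE_I2 order_trans[OF _ abs_ge_self]\<close>)
 show "L1 (%u. exp (C - k*\<bar>u\<bar>))"
  using integrable_mult_right[OF i, of "exp C"] by (simp add: exp_add[symmetric] del: integrable_mult_right_iff)
 show "(LI u. exp (- (k*\<bar>u\<bar>))) <= 2/k"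
  using integral_mono[OF i g(1)] le g(2) by simp
qed

text \<open>The weight, normalised at \<open>x\<close> and as a function of complex \<open>al\<close> and \<open>t\<close>.\<close>

definition cweight :: "real => complex => complex => complex" where
 "cweight x al t = (LI u. exp (2*(al * of_real u - t * of_real (excess b x u))))"

definition rweight :: "real => real => real => real" where
 "rweight x al t = (LI u. exp (2*(al*u - t*excess b x u)))"

lemma integrable_weight_perturbed:
 assumes t: "Re t > 0" and r: "r < Re t"
 shows "L1 (%u. norm (exp (2*(al * of_real u - t * of_real (excess b x u))))*exp (2*r*(\<bar>u\<bar> + excess b x u)))"
proof -
 obtain C where C: "!!x u. (2*\<bar>Re al\<bar> + 2*\<bar>r\<bar>)*\<bar>u\<bar> - (2*(Re t - r))*excess b x u <= C - \<bar>u\<bar>"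
  using excess_absorbs[of "2*(Re t - r)" "2*\<bar>Re al\<bar> + 2*\<bar>r\<bar>"] r by auto
 show ?thesis
 proof (rule integrable_bound[OF integrable_exp_minus_abs[of 1 C]])
  show "AE u in lborel. norm (norm (exp (2*(al * of_real u - t * of_real (excess b x u))))*exp (2*r*(\<bar>u\<bar> + excess b x u))) <= norm (exp (C - 1*\<bar>u\<bar>))"
  proof (rule AE_I2)
   fix u
   have "Re al*u <= \<bar>Re al\<bar>*\<bar>u\<bar>" using abs_ge_self[of "Re al*u"] by (simp add: abs_mult)
   moreover have "r*\<bar>u\<bar> <= \<bar>r\<bar>*\<bar>u\<bar>" by (intro mult_right_mono) auto
   ultimately have "2*(Re al*u - Re t*excess b x u) + 2*r*(\<bar>u\<bar> + excess b x u) <= C - 1*\<bar>u\<bar>"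
    using C[of u x] by (simp add: algebra_simps)
   then show "norm (norm (exp (2*(al * of_real u - t * of_real (excess b x u))))*exp (2*r*(\<bar>u\<bar> + excess b x u))) <= norm (exp (C - 1*\<bar>u\<bar>))"
    by (simp add: norm_exp_eq_Re exp_add[symmetric])
  qed
 qed (auto intro!: borel_measurable_continuous_onI continuous_intros)
qed

lemma integrable_cweight:
 assumes "Re t > 0" shows "L1 (%u. exp (2*(al * of_real u - t * of_real (excess b x u))))"
proof -
 have "L1 (%u. norm (exp (2*(al * of_real u - t * of_real (excess b x u))))*exp (2*0*(\<bar>u\<bar> + excess b x u)))"
  by (rule integrable_weight_perturbed) (use assms in auto)
 then show ?thesis
  by (rule integrable_bound) (auto intro!: borel_measurable_continuous_onI continuous_intros)
qed

lemma integrable_rweight: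
 assumes "t > 0" shows "L1 (%u. exp (2*(al*u - t*excess b x u)))"
proof -
 have "L1 (%u. norm (exp (2*(complex_of_real al * of_real u - of_real t * of_real (excess b x u)))))"
  using integrable_cweight[of "of_real t" "of_real al" x] assms by (intro integrable_norm) auto
 then show ?thesis by (simp add: norm_exp_eq_Re)
qed

lemma cweight_of_real: "cweight x (of_real al) (of_real t) = of_real (rweight x al t)"
 unfolding cweight_def rweight_def integral_complex_of_real[symmetric]
 by (intro LI_cong) (simp add: exp_of_real[symmetric])

text \<open>Translation of the integration variable to the point of tangency.\<close>

lemma rweight_weight:
 assumes t: "t > 0"
 shows "exp (2*(a*x - t*poly b x))*inv_weight b (a, t) = 1/rweight x (a - t*poly (pderiv b) x) t"
proof -
 define e where "e = exp (2*(a*x - t*poly b x))"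
 have "(LI l. exp (2*(a*l - t*poly b l))) = (LI u. exp (2*(a*(u + x) - t*poly b (u + x))))"
  by (rule lborel_shift(1)[symmetric]) (auto intro!: borel_measurable_continuous_onI continuous_intros)
 also have "... = (LI u. e*exp (2*((a - t*poly (pderiv b) x)*u - t*excess b x u)))"
  by (intro LI_cong) (simp add: e_def exp_add[symmetric] excess_def algebra_simps)
 finally have 1: "(LI l. exp (2*(a*l - t*poly b l))) = e*rweight x (a - t*poly (pderiv b) x) t"
  by (simp add: rweight_def)
 have "enn2real (weight b (a, t)) = (LI l. exp (2*(a*l - t*poly b l)))"
  unfolding weight_def by (subst integral_eq_nn_integral) (auto intro!: borel_measurable_continuous_onI continuous_intros)
 then show ?thesis unfolding inv_weight_def 1 using t by (simp add: e_def)
qed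

text \<open>Differentiation under the integral sign, by the quadratic remainder of the exponential.\<close>

lemma integral_exp_has_field_derivative:
 fixes f g :: "real => complex"
 assumes [measurable]: "f \<in> bm" "g \<in> bm"
  and r: "r > 0" and i: "L1 (%u. norm (f u)*exp (r*norm (g u)))"
 shows "((%z. LI u. f u*exp (z*g u)) has_field_derivative (LI u. f u*g u)) (at 0)"
proof -
 define J where "J = (LI u. norm (f u)*exp (r*norm (g u)))"
 define K where "K = 8/r^2*J"
 have pw: "(norm (g u))^2*exp (r/2*norm (g u)) <= 8/r^2*exp (r*norm (g u))" for u
 proof -
  have "(r/2*norm (g u))^2/fact 2 <= exp (r/2*norm (g u))" using r by (intro power_fact_le_exp) auto
  then have "(norm (g u))^2 <= 8/r^2*exp (r/2*norm (g u))" using r by (simp add: power_mult_distrib power_divide field_simps)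
  then have "(norm (g u))^2*exp (r/2*norm (g u)) <= 8/r^2*exp (r/2*norm (g u))*exp (r/2*norm (g u))"
   by (intro mult_right_mono) auto
  also have "... = 8/r^2*exp (r*norm (g u))" by (simp add: exp_add[symmetric])
  finally show ?thesis .
 qed
 have ii: "L1 (%u. f u*exp (z*g u))" if "norm z <= r" for z
 proof (rule integrable_bound[OF i])
  show "AE u in lborel. norm (f u*exp (z*g u)) <= norm (norm (f u)*exp (r*norm (g u)))"
  proof (rule AE_I2)
   fix u
   have "Re (z*g u) <= norm z*norm (g u)" using complex_Re_le_cmod[of "z*g u"] by (simp add: norm_mult)
   also have "... <= r*norm (g u)" using that by (intro mult_right_mono) auto
   finally show "norm (f u*exp (z*g u)) <= norm (norm (f u)*exp (r*norm (g u)))"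
    by (simp add: norm_mult norm_exp_eq_Re mult_left_mono)
  qed
 qed measurable
 have i1: "L1 (%u. f u*g u)"
 proof (rule integrable_bound[OF integrable_mult_right[OF i, of "1/r"]])
  show "AE u in lborel. norm (f u*g u) <= norm (1/r*(norm (f u)*exp (r*norm (g u))))"
  proof (rule AE_I2)
   fix u
   have "r*norm (g u) <= exp (r*norm (g u))" using exp_ge_add_one_self[of "r*norm (g u)"] by linarith
   then have "norm (g u) <= exp (r*norm (g u))/r" using r by (simp add: field_simps)
   then show "norm (f u*g u) <= norm (1/r*(norm (f u)*exp (r*norm (g u))))"
    using r mult_left_mono[of "norm (g u)" "exp (r*norm (g u))/r" "norm (f u)"] by (simp add: norm_mult abs_mult)
  qed
 qed measurable
 have est: "norm ((LI u. f u*exp (z*g u)) - (LI u. f u*exp (0*g u)) - (LI u. f u*g u)*z) <= K*(norm z)^2"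
  if z: "norm z <= r/2" for z
 proof -
  have i3: "L1 (%u. f u*exp (z*g u) - f u - z*(f u*g u))"
   using ii[of z] ii[of 0] i1 z r by (intro Bochner_Integration.integrable_diff integrable_mult_right) auto
  have "(LI u. f u*exp (z*g u)) - (LI u. f u*exp (0*g u)) - (LI u. f u*g u)*z
    = (LI u. f u*exp (z*g u) - f u - z*(f u*g u))"
   using ii[of z] ii[of 0] i1 z r by (simp add: mult.commute)
  also have "norm ... <= (LI u. (norm z)^2*(8/r^2)*(norm (f u)*exp (r*norm (g u))))"
  proof (rule order_trans[OF integral_norm_bound], rule integral_mono)
   fix u
   have "f u*exp (z*g u) - f u - z*(f u*g u) = f u*(exp (z*g u) - 1 - z*g u)" by (simp add: algebra_simps)
   then have "norm (f u*exp (z*g u) - f u - z*(f u*g u)) <= norm (f u)*((norm (z*g u))^2*exp (norm (z*g u)))"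
    by (simp only: norm_mult[of "f u" "exp (z*g u) - 1 - z*g u"]) (intro mult_left_mono exp_quadratic_bound norm_ge_zero)
   also have "... <= norm (f u)*((norm z)^2*(8/r^2*exp (r*norm (g u))))"
   proof (intro mult_left_mono)
    have "(norm (z*g u))^2*exp (norm (z*g u)) <= (norm z)^2*((norm (g u))^2*exp (r/2*norm (g u)))"
     using mult_right_mono[OF z, of "norm (g u)"] by (simp add: norm_mult power_mult_distrib mult.assoc mult_left_mono)
    also have "... <= (norm z)^2*(8/r^2*exp (r*norm (g u)))" by (intro mult_left_mono pw) auto
    finally show "(norm (z*g u))^2*exp (norm (z*g u)) <= (norm z)^2*(8/r^2*exp (r*norm (g u)))" .
   qed auto
   finally show "norm (f u*exp (z*g u) - f u - z*(f u*g u)) <= (norm z)^2*(8/r^2)*(norm (f u)*exp (r*norm (g u)))"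
    by (simp add: mult_ac)
  qed (use i3 i in auto)
  also have "... = K*(norm z)^2" by (simp add: K_def J_def)
  finally show ?thesis .
 qed
 show ?thesis unfolding has_field_derivative_def has_derivative_iff_norm
 proof (intro conjI bounded_linear_mult_right)
  have "((%y::complex. K*norm y) \<longlongrightarrow> K*norm (0::complex)) (at 0)" by (intro tendsto_intros)
  then have l: "((%y::complex. K*norm y) \<longlongrightarrow> 0) (at 0)" by simp
  show "((%y. norm ((LI u. f u*exp (y*g u)) - (LI u. f u*exp (0*g u)) - (LI u. f u*g u)*(y - 0))/norm (y - 0)) \<longlongrightarrow> 0) (at 0)"
  proof (rule Lim_null_comparison[OF _ l])
   have "\<forall>\<^sub>F y in at 0. norm (y::complex) < r/2 \<and> y \<noteq> 0"
    using r unfolding eventually_at by (intro exI[of _ "r/2"]) auto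
   then show "\<forall>\<^sub>F y in at 0. norm (norm ((LI u. f u*exp (y*g u)) - (LI u. f u*exp (0*g u)) - (LI u. f u*g u)*(y - 0))/norm (y - 0)) <= K*norm y"
   proof eventually_elim
    case (elim y)
    then show ?case using est[of y] by (simp add: divide_le_eq power2_eq_square mult.assoc)
   qed
  qed
 qed
qed

lemma cweight_holomorphic:
 assumes S: "!!z. z \<in> S ==> Re (\<tau> + z*t) > 0"
 shows "(%z. cweight x (al + z * s) (\<tau> + z*t)) holomorphic_on S"
 unfolding holomorphic_on_def
proof (rule ballI, rule field_differentiable_at_within)
 fix z0 assume z0: "z0 \<in> S"
 define f where "f u = exp (2*((al + z0 * s) * of_real u - (\<tau> + z0*t) * of_real (excess b x u)))" for u
 define g where "g u = 2*(s * of_real u - t * of_real (excess b x u))" for u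
 define k where "k = norm s + norm t + 1"
 define r where "r = Re (\<tau> + z0*t)/(2*k)"
 have k: "k > 0" by (simp add: k_def add_nonneg_pos)
 have r: "r > 0" using S[OF z0] k by (simp add: r_def)
 have "L1 (%u. norm (f u)*exp (2*(r*k)*(\<bar>u\<bar> + excess b x u)))"
  unfolding f_def using S[OF z0] k by (intro integrable_weight_perturbed) (simp_all add: r_def del: plus_complex.sel times_complex.sel)
 then have i: "L1 (%u. norm (f u)*exp (r*norm (g u)))"
 proof (rule integrable_bound)
  show "AE u in lborel. norm (norm (f u)*exp (r*norm (g u))) <= norm (norm (f u)*exp (2*(r*k)*(\<bar>u\<bar> + excess b x u)))"
  proof (rule AE_I2)
   fix u
   have "norm (s * of_real u - t * of_real (excess b x u)) <= norm s*\<bar>u\<bar> + norm t*excess b x u"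
    using norm_triangle_ineq4[of "s * of_real u" "t * of_real (excess b x u)"] excess_nonneg[of x u] by (simp add: norm_mult)
   also have "... <= k*\<bar>u\<bar> + k*excess b x u" using excess_nonneg[of x u] by (intro add_mono mult_right_mono) (auto simp: k_def)
   finally have "r*norm (g u) <= r*(2*(k*\<bar>u\<bar> + k*excess b x u))" unfolding g_def norm_mult using r by (intro mult_left_mono) auto
   also have "... = 2*(r*k)*(\<bar>u\<bar> + excess b x u)" by (simp add: algebra_simps)
   finally show "norm (norm (f u)*exp (r*norm (g u))) <= norm (norm (f u)*exp (2*(r*k)*(\<bar>u\<bar> + excess b x u)))"
    by (simp add: mult_left_mono)
  qed
 qed (auto simp: f_def g_def intro!: borel_measurable_continuous_onI continuous_intros)
 have "((%z. LI u. f u*exp (z*g u)) has_field_derivative (LI u. f u*g u)) (at 0)"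
  by (rule integral_exp_has_field_derivative[OF _ _ r i]) (auto simp: f_def g_def intro!: borel_measurable_continuous_onI continuous_intros)
 then have "((%z. LI u. f u*exp ((z - z0)*g u)) has_field_derivative (LI u. f u*g u)) (at z0)"
  using DERIV_at_within_shift[of "%z. LI u. f u*exp ((z - z0)*g u)" _ z0 0 UNIV] by simp
 moreover have "(LI u. f u*exp ((z - z0)*g u)) = cweight x (al + z * s) (\<tau> + z*t)" for z
  unfolding cweight_def f_def g_def by (intro LI_cong) (simp add: exp_add[symmetric] algebra_simps)
 ultimately show "(%z. cweight x (al + z * s) (\<tau> + z*t)) field_differentiable at z0"
  unfolding field_differentiable_def by auto
qed

end

section \<open>Iterated differences\<close>

definition backward_difference :: "'a::ab_group_add => ('a => complex) => 'a => complex" where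
 "backward_difference h f x = f x - f (x - h)"

lemma backward_difference_eq:
 fixes e :: "'a::real_vector" and h :: complex
 assumes "!!k. k <= n ==> f (q - real k *\<^sub>R e) = g (z - of_nat k*h)"
 shows "(backward_difference e ^^ n) f q = (backward_difference h ^^ n) g z"
 using assms
proof (induction n arbitrary: f g)
 case (Suc n)
 have "backward_difference e f (q - real k *\<^sub>R e) = backward_difference h g (z - of_nat k*h)" if "k <= n" for k
  using Suc.prems[of k] Suc.prems[of "Suc k"] that by (simp add: backward_difference_def algebra_simps)
 from Suc.IH[of "backward_difference e f" "backward_difference h g", OF this]
 show ?case by (simp del: funpow.simps add: funpow_Suc_right)
qed (use assms[of 0] in simp)

lemma backward_difference_bound:
 fixes e :: "'a::real_vector"
 assumes "!!k. k <= n ==> norm (f (q - real k *\<^sub>R e)) <= M"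
 shows "norm ((backward_difference e ^^ n) f q) <= 2^n*M"
 using assms
proof (induction n arbitrary: f M)
 case (Suc n)
 have "norm (backward_difference e f (q - real k *\<^sub>R e)) <= 2*M" if "k <= n" for k
  using Suc.prems[of k] Suc.prems[of "Suc k"] that norm_triangle_ineq4[of "f (q - real k *\<^sub>R e)" "f (q - real (Suc k) *\<^sub>R e)"]
  by (simp add: backward_difference_def algebra_simps)
 from Suc.IH[of "backward_difference e f", OF this]
 show ?case by (simp del: funpow.simps add: funpow_Suc_right)
qed (use assms[of 0] in simp)

text \<open>Each difference costs a part \<open>h + rh\<close> of the radius of the disc and gains a factor \<open>h / rh\<close>, by Cauchy's estimate for
 the derivative.\<close>

lemma backward_difference_holomorphic_bound:
 assumes "g holomorphic_on ball 0 (r + real n*(h + rh))" "!!z. norm z < r + real n*(h + rh) ==> norm (g z) <= M"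
  and "0 < h" "0 < rh" "0 < r"
 shows "norm ((backward_difference (of_real h) ^^ n) g 0) <= M*(h/rh)^n"
 using assms(1,2)
proof (induction n arbitrary: g M)
 case 0 then show ?case using "0.prems"(2)[of 0] assms(5) by simp
next
 case (Suc n)
 define s where "s = r + real n*(h + rh)"
 have s: "s > 0" "r + real (Suc n)*(h + rh) = s + h + rh" using assms(3-5) by (auto simp: s_def algebra_simps add_pos_nonneg)
 have hol: "g holomorphic_on ball 0 (s + h + rh)" using Suc.prems(1) s(2) by simp
 have bnd: "norm z < s + h + rh ==> norm (g z) <= M" for z using Suc.prems(2) s(2) by simp
 have der: "norm (deriv g z) <= M/rh'" if z: "norm z < s + h" and rh': "0 < rh'" "rh' < rh" for z rh'
 proof -
  have sub: "cball z rh' \<subseteq> ball 0 (s + h + rh)"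
  proof
   fix w assume "w \<in> cball z rh'"
   then have "norm (w - z) <= rh'" by (simp add: dist_norm norm_minus_commute)
   then show "w \<in> ball 0 (s + h + rh)" using z rh' norm_triangle_ineq[of z "w - z"] by simp
  qed
  have "norm ((deriv ^^ 1) g z) <= fact 1*M/rh'^1"
  proof (rule Cauchy_inequality)
   show "g holomorphic_on ball z rh'" using hol sub by (meson holomorphic_on_subset ball_subset_cball order_trans)
   show "continuous_on (cball z rh') g" using hol sub by (meson holomorphic_on_imp_continuous_on continuous_on_subset)
   show "norm (g w) <= M" if "norm (z - w) = rh'" for w
   proof -
    have "w \<in> cball z rh'" using that by (simp add: dist_norm)
    then show ?thesis using sub bnd[of w] by auto
   qed
  qed (use rh' in auto)
  then show ?thesis by simp
 qed
 have der': "norm (deriv g z) <= M/rh" if z: "norm z < s + h" for z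
 proof -
  have "((%rh'. M/rh') \<longlongrightarrow> M/rh) (at_left rh)" using assms(4) by (intro tendsto_intros) auto
  moreover have "\<forall>\<^sub>F rh' in at_left rh. norm (deriv g z) <= M/rh'"
   using eventually_at_left_real[OF assms(4)] by eventually_elim (use der[OF z] in auto)
  ultimately show ?thesis by (rule tendsto_lowerbound) simp
 qed
 have "norm (backward_difference (of_real h) g z) <= M*(h/rh)" if z: "norm z < s" for z
 proof -
  have "norm (g z - g (z - of_real h)) <= M/rh*norm (z - (z - of_real h))"
  proof (rule field_differentiable_bound[where S="ball 0 (s + h)" and f'="deriv g"])
   fix w :: complex assume w: "w \<in> ball 0 (s + h)"
   have "g field_differentiable at w" using w assms(4) by (intro holomorphic_on_imp_differentiable_at[OF hol]) auto
   then show "(g has_field_derivative deriv g w) (at w within ball 0 (s + h))"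
    by (rule DERIV_subset[OF DERIV_deriv_iff_field_differentiable[THEN iffD2]]) simp
   show "norm (deriv g w) <= M/rh" using w by (intro der') auto
  next
   show "z \<in> ball 0 (s + h)" using z assms(3) by simp
   show "z - of_real h \<in> ball 0 (s + h)" using z assms(3) norm_triangle_ineq4[of z "of_real h"] by simp
  qed simp
  then show ?thesis using assms(3) by (simp add: backward_difference_def)
 qed
 moreover have "backward_difference (of_real h) g holomorphic_on ball 0 s"
  unfolding backward_difference_def[of "of_real h" g, abs_def]
 proof (rule holomorphic_on_diff)
  show "g holomorphic_on ball 0 s" using assms by (intro holomorphic_on_subset[OF hol]) auto
  have "(g \<circ> (%z. z - of_real h)) holomorphic_on ball 0 s"
  proof (rule holomorphic_on_compose)
   have "(%z::complex. z - of_real h) ` ball 0 s \<subseteq> ball 0 (s + h + rh)"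
   proof (rule image_subsetI)
    fix z :: complex assume "z \<in> ball 0 s"
    then show "z - of_real h \<in> ball 0 (s + h + rh)" using assms(3,4) norm_triangle_ineq4[of z "of_real h"] by simp
   qed
   then show "g holomorphic_on (%z. z - of_real h) ` ball 0 s" by (rule holomorphic_on_subset[OF hol])
  qed (intro holomorphic_intros)
  then show "(%z. g (z - of_real h)) holomorphic_on ball 0 s" by (simp add: comp_def)
 qed
 ultimately have "norm ((backward_difference (of_real h) ^^ n) (backward_difference (of_real h) g) 0) <= M*(h/rh)*(h/rh)^n"
  by (intro Suc.IH) (auto simp: s_def)
 then show ?case by (simp del: funpow.simps add: funpow_Suc_right mult.assoc)
qed

text \<open>If the disc is too small for the translates, that is if \<open>R < 2 n\<close>, then the trivial bound \<open>2\<^sup>n M\<close> is smaller than the bound in question.\<close>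

lemma backward_difference_decay:
 fixes e :: "'a::real_vector"
 assumes n: "n > 0" and h: "0 < h" "h <= 1" and R: "R > 0"
  and hol: "g holomorphic_on ball 0 R" and bnd: "!!z. norm z < R ==> norm (g z) <= M"
  and real: "!!k. k <= n ==> norm (f (q - real k *\<^sub>R e)) <= M"
  and eq: "!!k. k <= n ==> f (q - real k *\<^sub>R e) = g (of_real (- (real k*h)))"
 shows "norm ((backward_difference e ^^ n) f q) <= M*(4*real n/R)^n"
proof (cases "R >= 2*n")
 case True
 define rh where "rh = R/(4*n)"
 define r where "r = R - n*(h + rh)"
 have nrh: "n*rh = R/4" using n by (simp add: rh_def)
 have nh: "n*h <= n" using h n by simp
 have r: "r > 0" "r + n*(h + rh) = R" using nrh nh True R by (auto simp: r_def algebra_simps)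
 have M: "M >= 0" using order_trans[OF norm_ge_zero bnd[of 0]] R by simp
 have "norm ((backward_difference (of_real h) ^^ n) g 0) <= M*(h/rh)^n"
  using R n r h hol bnd by (intro backward_difference_holomorphic_bound[where r=r]) (auto simp: rh_def)
 also have "... <= M*(4*real n/R)^n"
  using M h R n by (intro mult_left_mono power_mono) (auto simp: rh_def field_simps)
 also have "(backward_difference (of_real h) ^^ n) g 0 = (backward_difference e ^^ n) f q"
  by (rule backward_difference_eq[symmetric]) (simp add: eq)
 finally show ?thesis .
next
 case False
 have M: "M >= 0" using order_trans[OF norm_ge_zero bnd[of 0]] R by simp
 have "norm ((backward_difference e ^^ n) f q) <= 2^n*M" by (rule backward_difference_bound) (rule real)
 also have "... <= (4*real n/R)^n*M" using M False R by (intro mult_right_mono power_mono) (auto simp: field_simps)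
 finally show ?thesis by (simp add: mult.commute)
qed

text \<open>Taking a difference of the amplitude multiplies an oscillatory integral by a factor that depends only on the phase.\<close>

lemma integral_backward_difference:
 fixes f w :: "'a::euclidean_space => complex"
 assumes [measurable]: "f \<in> bm" "w \<in> bm"
  and i: "L1 (%q. f q*w q)" and w: "!!q. w (q + e) = l*w q"
 shows "(backward_difference e ^^ n) f \<in> bm \<and>
  L1 (%q. (backward_difference e ^^ n) f q*w q) \<and>
  (LI q. (backward_difference e ^^ n) f q*w q) = (1 - l)^n*(LI q. f q*w q)"
proof (induction n)
 case (Suc n)
 define g where "g = (backward_difference e ^^ n) f"
 have [measurable]: "g \<in> bm" and ig: "L1 (%q. g q*w q)"
  and e: "(LI q. g q*w q) = (1 - l)^n*(LI q. f q*w q)" using Suc by (auto simp: g_def)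
 have [measurable]: "(%q. g (q - e)) \<in> bm" by measurable
 have eq: "g (q + e - e)*w (q + e) = l*(g q*w q)" for q by (simp add: w)
 have "L1 (%q. g (q + e - e)*w (q + e))" unfolding eq using ig by (rule integrable_mult_right)
 then have ig': "L1 (%q. g (q - e)*w q)"
  using lborel_shift(2)[of "%q. g (q - e)*w q" e] by simp
 have "(LI q. g (q - e)*w q) = (LI q. g (q + e - e)*w (q + e))"
  using lborel_shift(1)[of "%q. g (q - e)*w q" e] by simp
 also have "... = l*(LI q. g q*w q)" unfolding eq by simp
 finally have e': "(LI q. g (q - e)*w q) = l*(LI q. g q*w q)" .
 have "(%q. backward_difference e g q*w q) = (%q. g q*w q - g (q - e)*w q)"
  by (simp add: backward_difference_def algebra_simps)
 then have "L1 (%q. backward_difference e g q*w q)"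
  "(LI q. backward_difference e g q*w q) = (1 - l)^Suc n*(LI q. f q*w q)"
  using ig ig' e e' by (auto simp: algebra_simps)
 moreover have "backward_difference e g \<in> bm" unfolding backward_difference_def by measurable
 ultimately show ?case by (simp add: g_def)
qed (use i in simp)

lemma continuous_on_backward_difference:
 fixes f :: "'p::topological_space => 'a::real_normed_vector => complex"
 assumes f: "continuous_on (S \<times> UNIV) (%(p, q). f p q)" and e: "continuous_on S e"
 shows "continuous_on (S \<times> UNIV) (%(p, q). (backward_difference (e p) ^^ n) (f p) q)"
proof (induction n)
 case (Suc n)
 define g where "g p q = (backward_difference (e p) ^^ n) (f p) q" for p q
 have g: "continuous_on (S \<times> UNIV) (%(p, q). g p q)" using Suc by (simp add: g_def)
 have "continuous_on (S \<times> UNIV) (%x. (%(p, q). g p q) (fst x, snd x - e (fst x)))"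
  by (rule continuous_on_compose2[OF g]) (intro continuous_intros continuous_on_compose2[OF e], auto)
 then have "continuous_on (S \<times> UNIV) (%x. (%(p, q). g p q) x - (%(p, q). g p q) (fst x, snd x - e (fst x)))"
  by (intro continuous_on_diff g)
 then show ?case unfolding funpow.simps comp_def backward_difference_def[of _ "(backward_difference _ ^^ n) _"]
  by (simp add: g_def case_prod_unfold)
qed (use f in simp)

section \<open>Convex polynomials: decay of the differences of the kernel density\<close>

lemma exp_minus_le_power:
 fixes v :: real
 assumes "v >= 0" shows "exp (- v) <= exp 1*fact p/(1 + v)^p"
proof -
 have "(1 + v)^p/fact p <= exp (1 + v)" using assms by (intro power_fact_le_exp) simp
 then show ?thesis using assms by (simp add: exp_add exp_minus field_simps)
qed

lemma norm_exp_minus_1_le: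
 fixes w :: complex
 shows "norm (exp w - 1) <= norm w*exp (norm w)"
proof -
 have "norm (exp w - exp 0) <= exp (norm w)*norm (w - 0)"
 proof (rule field_differentiable_bound[where S="cball 0 (norm w)" and f'=exp])
  show "norm (exp z) <= exp (norm w)" if "z \<in> cball 0 (norm w)" for z :: complex
   using that complex_Re_le_cmod[of z] by (simp add: norm_exp_eq_Re)
 qed (auto intro: DERIV_subset[OF DERIV_exp])
 then show ?thesis by (simp add: mult.commute)
qed

text \<open>The symbol of the product of the derivatives in the directions \<open>(u, v)\<close> of a list.\<close>

fun symbol :: "(complex \<times> complex) list => complex => complex => complex" where
 "symbol [] a t = 1"
| "symbol ((u, v) # l) a t = (a*u + \<i>*t * v) * symbol l a t"

lemma symbol_bound:
 obtains C where "C >= 0" "!!a t. norm (symbol l a t) <= C*(1 + norm a + norm t)^length l"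
proof -
 have "\<exists>C\<ge>0. \<forall>a t. norm (symbol l a t) <= C*(1 + norm a + norm t)^length l"
 proof (induction l)
  case (Cons p l)
  obtain u v where p: "p = (u, v)" by force
  obtain C where C: "C >= 0" "!!a t. norm (symbol l a t) <= C*(1 + norm a + norm t)^length l" using Cons by blast
  have "norm (symbol (p # l) a t) <= ((norm u + norm v)*C)*(1 + norm a + norm t)^length (p # l)" for a t
  proof -
   have "norm (a*u + \<i>*t * v) <= norm a*norm u + norm t*norm v"
    using norm_triangle_ineq[of "a*u" "\<i>*t * v"] by (simp add: norm_mult)
   also have "... <= (norm u + norm v)*(1 + norm a + norm t)" by (simp add: algebra_simps)
   finally have "norm (symbol (p # l) a t) <= ((norm u + norm v)*(1 + norm a + norm t))*(C*(1 + norm a + norm t)^length l)"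
    unfolding p symbol.simps norm_mult using C by (intro mult_mono) auto
   then show ?thesis by (simp add: mult_ac)
  qed
  then show ?case using C(1) by (intro exI[of _ "(norm u + norm v)*C"]) simp
 qed (auto intro: exI[of _ 1])
 then show ?thesis using that by blast
qed

lemma symbol_holomorphic: "f holomorphic_on S ==> g holomorphic_on S ==> (%z. symbol l (f z) (g z)) holomorphic_on S"
 by (induction l) (auto intro!: holomorphic_intros)

lemma continuous_on_symbol [continuous_intros]:
 "continuous_on S f ==> continuous_on S g ==> continuous_on S (%z. symbol l (f z) (g z))"
 by (induction l) (auto intro!: continuous_intros)

context convex_szego_poly
begin

text \<open>The excess is at most quadratic near \<open>0\<close>, so on an interval of length comparable with \<open>1 / \<surd>(1 +
 t)\<close> the factor with the excess is bounded below.\<close>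

lemma rweight_lower_bound:
 obtains K where "K > 0" "!!x al t. \<bar>x\<bar> <= B ==> t > 0 ==> exp (\<bar>al\<bar>/sqrt (1 + t)) <= K * sqrt (1 + t)*rweight x al t"
proof -
 obtain C N where C: "C >= 1" "!!x u. \<bar>x\<bar> <= B ==> \<bar>excess b x u\<bar> <= C*u^2*(1 + \<bar>u\<bar>)^N" using excess_upper_bound by blast
 define E where "E = exp (2*C*2^N)"
 have "exp (\<bar>al\<bar>/sqrt (1 + t)) <= 2*E * sqrt (1 + t)*rweight x al t" if x: "\<bar>x\<bar> <= B" and t: "t > 0" for x al t
 proof -
  define d where "d = 1/sqrt (1 + t)"
  have d: "0 < d" "d <= 1" "t*d^2 <= 1" using t by (auto simp: d_def power_divide)
  define I where "I = (if al >= 0 then {d/2..d} else {-d..-d/2})"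
  have I: "measure lborel I = d/2" "I \<in> sets borel" "emeasure lborel I < \<infinity>" using d by (auto simp: I_def)
  have "exp (\<bar>al\<bar>*d)/E*(d/2) = (LI u. exp (\<bar>al\<bar>*d)/E*indicator I u)"
   using I(2,3) by (simp only: integral_mult_right_zero Bochner_Integration.integral_indicator Int_UNIV_right space_lborel space_borel I(1))
  also have "... <= rweight x al t"
   unfolding rweight_def
  proof (rule integral_mono[OF _ integrable_rweight[OF t]])
   fix u
   show "exp (\<bar>al\<bar>*d)/E*indicator I u <= exp (2*(al*u - t*excess b x u))"
   proof (cases "u \<in> I")
    case True
    have u: "\<bar>u\<bar> <= d" using True d by (auto simp: I_def split: if_splits)
    have "\<bar>al\<bar>*d <= 2*(al*u)"
    proof (cases "al >= 0")
     case True
     then show ?thesis using \<open>u \<in> I\<close> mult_left_mono[of "d" "2*u" al] by (simp add: I_def)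
    next
     case False
     then show ?thesis using \<open>u \<in> I\<close> mult_left_mono[of "d" "- 2*u" "- al"] by (simp add: I_def)
    qed
    moreover have "t*excess b x u <= C*2^N"
    proof -
     have u2: "u^2 <= d^2" using u d by (simp add: abs_le_square_iff[symmetric])
     have "excess b x u <= C*u^2*(1 + \<bar>u\<bar>)^N" using C(2)[OF x, of u] by simp
     also have "... <= C*d^2*2^N" using u d C(1) u2 by (intro mult_mono[OF mult_left_mono power_mono]) auto
     finally have "t*excess b x u <= t*(C*d^2*2^N)" using t by (intro mult_left_mono) auto
     also have "... = (t*d^2)*(C*2^N)" by (simp add: mult_ac)
     also have "... <= 1*(C*2^N)" using d(3) C(1) by (intro mult_right_mono) auto
     finally show ?thesis by simp
    qed
    ultimately have "\<bar>al\<bar>*d - 2*C*2^N <= 2*(al*u - t*excess b x u)" by (simp add: algebra_simps)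
    then show ?thesis using True by (simp add: E_def exp_diff[symmetric])
   qed simp
  qed (use I in simp)
  finally have "exp (\<bar>al\<bar>*d) <= 2*E*(1/d)*rweight x al t" using d by (simp add: E_def field_simps)
  then show ?thesis by (simp add: d_def)
 qed
 then show ?thesis by (intro that[of "2*E"]) (auto simp: E_def)
qed

lemma rweight_pos: "t > 0 ==> rweight x al t > 0"
proof -
 assume t: "t > 0"
 obtain K where "K > 0" "!!y al t. \<bar>y\<bar> <= \<bar>x\<bar> ==> t > 0 ==> exp (\<bar>al\<bar>/sqrt (1 + t)) <= K * sqrt (1 + t)*rweight y al t"
  using rweight_lower_bound[of "\<bar>x\<bar>"] by blast
 then have "0 < K * sqrt (1 + t)*rweight x al t" using t by (intro less_le_trans[OF exp_gt_zero]) auto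
 moreover have "0 < K * sqrt (1 + t)" using \<open>K > 0\<close> t by simp
 ultimately show ?thesis by (rule zero_less_mult_pos)
qed

text \<open>With \<open>\<tau> = t\<^sup>4\<^sup>m\<close>, the mass of the weight concentrates on \<open>\<bar>u\<bar> \<le> (1 + v) / t\<close>, where \<open>v = \<bar>al\<bar> / \<surd>(1 + \<tau>)\<close>. There a complex perturbation of
 \<open>al\<close> and \<open>\<tau>\<close> by a small multiple of \<open>t\<close> hardly changes the integrand. So the reciprocal of the weight is holomorphic on discs whose radius grows
 with \<open>\<tau>\<close>.\<close>

lemma cweight_perturbation:
 obtains t0 c0 L where "t0 >= 1" "0 < c0" "c0 <= 1/16"
  "!!x al \<tau> t z sg. \<bar>x\<bar> <= B ==> t >= t0 ==> \<tau> = t^(4*degree b) ==> norm z <= c0*t/(bracket al \<tau>)^L ==>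
   norm sg <= c0*t/(bracket al \<tau>)^L ==>
   norm (cweight x (of_real al + z) (of_real \<tau> + sg) - of_real (rweight x al \<tau>)) <= rweight x al \<tau>/2"
proof -
 define m where "m = degree b"
 have m: "m >= 2" using degree_ge_2 by (simp add: m_def)
 obtain c where c: "c > 0" "!!x u. excess b x u >= c*\<bar>u\<bar>^m" unfolding m_def using excess_lower_bound by blast
 obtain C N where C: "C >= 1" "!!x u. \<bar>x\<bar> <= B ==> \<bar>excess b x u\<bar> <= C*u^2*(1 + \<bar>u\<bar>)^N" using excess_upper_bound by blast
 obtain K where K: "K > 0" "!!x al \<tau>. \<bar>x\<bar> <= B ==> \<tau> > 0 ==> exp (\<bar>al\<bar>/sqrt (1 + \<tau>)) <= K * sqrt (1 + \<tau>)*rweight x al \<tau>"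
  using rweight_lower_bound by blast
  (* With this c0 the exponent changes by at most 1/8 where the mass concentrates. The two
   conditions on t0 make the leading term of the excess dominate the other exponents on the rest, and make
   the contribution of the rest small compared with the lower bound of the weight. *)
 define C1 where "C1 = 1 + C*2^N"
 have C1: "C1 >= 1" using C(1) by (simp add: C1_def)
 define c0 where "c0 = 1/(16*C1)"
 define t0 where "t0 = Max {1, 5/c, 16*K}"
 have t0: "t0 >= 1" "t0 >= 5/c" "t0 >= 16*K" by (auto simp: t0_def)
 define L where "L = N + 2"
 have c0: "0 < c0" "c0 <= 1/16" using C1 by (auto simp: c0_def divide_simps)
 have "norm (cweight x (of_real al + z) (of_real \<tau> + sg) - of_real (rweight x al \<tau>)) <= rweight x al \<tau>/2"
  if x: "\<bar>x\<bar> <= B" and t: "t >= t0" and \<tau>: "\<tau> = t^(4*m)" and z: "norm z <= c0*t/(bracket al \<tau>)^L"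
   and sg: "norm sg <= c0*t/(bracket al \<tau>)^L" for x al \<tau> t z sg
 proof -
  define s where "s = sqrt (1 + \<tau>)"
  define v where "v = \<bar>al\<bar>/s"
  define R where "R = c0*t/(1 + v)^L"
  have t1: "t >= 1" using t t0 by simp
  have \<tau>t: "\<tau> >= t" using t1 power_increasing[of 1 "4*m" t] m by (simp add: \<tau>)
  have s: "s >= 1" "s <= 2*t^(2*m)"
  proof -
   show "s >= 1" using \<tau>t t1 by (simp add: s_def)
   have "1 + \<tau> <= (2*t^(2*m))^2" using \<tau>t t1 by (simp add: \<tau> power_mult_distrib flip: power_mult)
   then show "s <= 2*t^(2*m)" unfolding s_def using t1 by (intro real_le_lsqrt) auto
  qed
  have v: "v >= 0" "\<bar>al\<bar> = v * s" using s by (auto simp: v_def)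
  have v1: "(1 + v)^L >= 1" using v by (intro one_le_power) simp
  have R: "0 < R" "R <= c0*t" "R <= t/16"
  proof -
   show "0 < R" unfolding R_def using c0 t1 v1 by (intro divide_pos_pos mult_pos_pos) auto
   show 1: "R <= c0*t" unfolding R_def using c0 t1 divide_left_mono[OF v1, of "c0*t"] v1 by simp
   have "c0*t <= 1/16*t" using c0(2) t1 by (intro mult_right_mono) auto
   then show "R <= t/16" using 1 by simp
  qed
  have z': "norm z <= R" and sg': "norm sg <= R" using z sg by (auto simp: R_def v_def s_def)
  define r where "r = (1 + v)/t"
  define w where "w u = 2*(z * of_real u - sg * of_real (excess b x u))" for u
  define g where "g u = exp (2*(al*u - \<tau>*excess b x u))" for u
  have wb: "norm (w u) <= 2 * R*(\<bar>u\<bar> + excess b x u)" for u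
  proof -
   have "norm (w u) <= 2*(norm z*\<bar>u\<bar> + norm sg*excess b x u)"
    unfolding w_def norm_mult using norm_triangle_ineq4[of "z * of_real u" "sg * of_real (excess b x u)"] excess_nonneg[of x u]
    by (simp add: norm_mult)
   also have "... <= 2*(R*\<bar>u\<bar> + R*excess b x u)"
    using z' sg' excess_nonneg[of x u] by (intro mult_left_mono add_mono mult_right_mono) auto
   finally show ?thesis by (simp add: algebra_simps)
  qed
  note pw = norm_exp_minus_1_le[of "w u" for u]
  have main: "g u*norm (exp (w u) - 1) <= g u/4 + exp (- (t^(3*m)*\<bar>u\<bar>))" for u
  proof (cases "\<bar>u\<bar> <= r")
   case True
   have "\<bar>u\<bar> + excess b x u <= C1*(1 + v)^L/t"
   proof -
    have r1: "r <= 1 + v" "0 <= r" using t1 v by (auto simp: r_def divide_le_eq mult_le_cancel_left1)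
    have "u^2 <= r^2" using True by (simp add: abs_le_square_iff[symmetric])
    also have "r^2 <= r*(1 + v)" unfolding power2_eq_square using r1 by (intro mult_left_mono) auto
    finally have u2: "u^2 <= (1 + v)^2/t" by (simp add: r_def power2_eq_square)
    have "excess b x u <= C*u^2*(1 + \<bar>u\<bar>)^N" using C(2)[OF x, of u] by simp
    also have "... <= C*((1 + v)^2/t)*(2*(1 + v))^N"
     using True r1 u2 C(1) v t1 by (intro mult_mono mult_left_mono power_mono) auto
    also have "... = C*2^N*(1 + v)^L/t" by (simp only: L_def power_mult_distrib power_add) (simp add: mult_ac)
    finally have "excess b x u <= C*2^N*(1 + v)^L/t" .
    moreover have "\<bar>u\<bar> <= (1 + v)^L/t"
    proof -
     have "(1 + v)^1 <= (1 + v)^L" using v by (intro power_increasing) (auto simp: L_def)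
     then show ?thesis using True t1 by (simp add: r_def field_simps)
    qed
    ultimately show ?thesis using t1 by (simp add: C1_def add_divide_distrib algebra_simps)
   qed
   then have "2 * R*(\<bar>u\<bar> + excess b x u) <= 2 * R*(C1*(1 + v)^L/t)" using R by (intro mult_left_mono) auto
   also have "... = 1/8"
   proof -
    have "1 + v \<noteq> 0" "C1 \<noteq> 0" "t \<noteq> 0" using v(1) C1 t1 by auto
    then show ?thesis unfolding R_def c0_def by (simp add: field_simps)
   qed
   finally have w8: "norm (w u) <= 1/8" using wb[of u] by linarith
   have "exp (norm (w u)) <= 2" using exp_bound_half[of "norm (w u)"] w8 by simp
   then have "norm (w u)*exp (norm (w u)) <= 1/8*2" using w8 by (intro mult_mono) auto
   then have "norm (exp (w u) - 1) <= 1/4" using pw[of u] by simp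
   then have "g u*norm (exp (w u) - 1) <= g u*(1/4)" by (intro mult_left_mono) (auto simp: g_def)
   then show ?thesis using exp_ge_zero[of "- (t^(3*m)*\<bar>u\<bar>)"] by linarith
  next
   case False
   have "norm (w u)*exp (norm (w u)) <= exp (norm (w u))*exp (norm (w u))"
    using exp_ge_add_one_self[of "norm (w u)"] by (intro mult_right_mono) (linarith, simp)
   also have "... <= exp (4 * R*(\<bar>u\<bar> + excess b x u))" using wb[of u] by (simp add: exp_add[symmetric] mult.assoc)
   finally have "norm (exp (w u) - 1) <= exp (4 * R*(\<bar>u\<bar> + excess b x u))" using pw[of u] by linarith
   then have "g u*norm (exp (w u) - 1) <= g u*exp (4 * R*(\<bar>u\<bar> + excess b x u))" by (intro mult_left_mono) (auto simp: g_def)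
   also have "... = exp (2*(al*u - \<tau>*excess b x u) + 4 * R*(\<bar>u\<bar> + excess b x u))" by (simp add: g_def exp_add[symmetric])
   also have "... <= exp (- (t^(3*m)*\<bar>u\<bar>))"
   proof -
    have 1: "4 * R*excess b x u <= \<tau>*excess b x u" using R \<tau>t t1 excess_nonneg[of x u] by (intro mult_right_mono) auto
    have 2: "2*(al*u) <= 4 * v * t^(2*m)*\<bar>u\<bar>"
    proof -
     have "2*(al*u) <= 2*(\<bar>al\<bar>*\<bar>u\<bar>)" using abs_ge_self[of "al*u"] by (simp add: abs_mult)
     also have "... <= 2*((v * (2*t^(2*m)))*\<bar>u\<bar>)" unfolding v(2) using s v(1) by (intro mult_left_mono mult_right_mono) auto
     finally show ?thesis by simp
    qed
    have 3: "4 * R*\<bar>u\<bar> <= 4*t*\<bar>u\<bar>" using R t1 by (intro mult_right_mono) auto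
    have 4: "5*t^(3*m)*(1 + v)*\<bar>u\<bar> <= \<tau>*excess b x u"
    proof -
     have r0: "0 < r" using v t1 by (simp add: r_def)
     have "(1 + v)/t^(m - 1) <= r^(m - 1)"
     proof -
      have "(1 + v)^1 <= (1 + v)^(m - 1)" using v m by (intro power_increasing) auto
      then show ?thesis using t1 by (simp add: r_def power_divide divide_right_mono)
     qed
     also have "... <= \<bar>u\<bar>^(m - 1)" using False r0 by (intro power_mono) auto
     finally have "t^(4*m)*(c*((1 + v)/t^(m - 1)*\<bar>u\<bar>)) <= t^(4*m)*(c*(\<bar>u\<bar>^(m - 1)*\<bar>u\<bar>))"
      using c(1) t1 by (intro mult_left_mono mult_right_mono) auto
     also have "\<bar>u\<bar>^(m - 1)*\<bar>u\<bar> = \<bar>u\<bar>^m" using m by (cases m) auto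
     also have "t^(4*m)*(c*\<bar>u\<bar>^m) <= \<tau>*excess b x u" unfolding \<tau> using t1 c(2)[of u x] by (intro mult_left_mono) auto
     also have "t^(4*m)*(c*((1 + v)/t^(m - 1)*\<bar>u\<bar>)) = (c*t)*(t^(3*m)*(1 + v)*\<bar>u\<bar>)"
     proof -
      have "t^(4*m) = t^(m - 1)*(t*t^(3*m))" using m by (simp flip: power_Suc power_add)
      then show ?thesis using t1 by simp
     qed
     finally have "(c*t)*(t^(3*m)*(1 + v)*\<bar>u\<bar>) <= \<tau>*excess b x u" .
     moreover have "5*(t^(3*m)*(1 + v)*\<bar>u\<bar>) <= (c*t)*(t^(3*m)*(1 + v)*\<bar>u\<bar>)"
     proof (rule mult_right_mono)
      show "5 <= c*t" using order_trans[OF t0(2) t] c(1) by (simp add: divide_le_eq mult.commute)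
     qed (use t1 v in auto)
     ultimately show ?thesis by (simp add: mult.assoc)
    qed
    have 5: "4 * v * t^(2*m)*\<bar>u\<bar> + 4*t*\<bar>u\<bar> + t^(3*m)*\<bar>u\<bar> <= 5*t^(3*m)*(1 + v)*\<bar>u\<bar>"
    proof -
     have a: "t^(2*m) <= t^(3*m)" "t^1 <= t^(3*m)" using t1 m by (intro power_increasing; simp)+
     have "4 * v * t^(2*m) <= 4 * v * t^(3*m)" using a v by (intro mult_left_mono) auto
     then have "4 * v * t^(2*m) + 4*t + t^(3*m) <= 4 * v * t^(3*m) + 4*t^(3*m) + t^(3*m)" using a by simp
     also have "... <= 5*t^(3*m)*(1 + v)" using v t1 by (simp add: algebra_simps)
     finally have "(4 * v * t^(2*m) + 4*t + t^(3*m))*\<bar>u\<bar> <= 5*t^(3*m)*(1 + v)*\<bar>u\<bar>" by (rule mult_right_mono) simp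
     then show ?thesis by (simp add: algebra_simps)
    qed
    have "2*(al*u - \<tau>*excess b x u) + 4 * R*(\<bar>u\<bar> + excess b x u) <= - (t^(3*m)*\<bar>u\<bar>)"
     using 1 2 3 4 5 by (simp add: algebra_simps)
    then show ?thesis by simp
   qed
   finally show ?thesis by (smt (verit) divide_nonneg_pos exp_gt_zero g_def)
  qed
  have \<tau>0: "\<tau> > 0" using \<tau>t t1 by simp
  have t3: "t^(3*m) > 0" using t1 by simp
  have Resg: "Re (of_real \<tau> + sg) > 0" using abs_Re_le_cmod[of sg] sg' R \<tau>t t1 by simp
  have ig: "L1 g" unfolding g_def by (rule integrable_rweight[OF \<tau>0])
  have ic: "L1 (%u. exp (2*((of_real al + z) * of_real u - (of_real \<tau> + sg) * of_real (excess b x u))))"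
   by (rule integrable_cweight[OF Resg])
  have igc: "L1 (%u. complex_of_real (g u))" using ig by simp
  have eqn: "exp (2*((of_real al + z) * of_real u - (of_real \<tau> + sg) * of_real (excess b x u))) - complex_of_real (g u) = of_real (g u)*(exp (w u) - 1)" for u
   unfolding g_def exp_of_real[symmetric] w_def by (simp add: exp_add[symmetric] algebra_simps)
  have "cweight x (of_real al + z) (of_real \<tau> + sg) - of_real (rweight x al \<tau>) = (LI u. of_real (g u)*(exp (w u) - 1))"
   unfolding eqn[symmetric] cweight_def rweight_def g_def[symmetric] using ic igc by (simp add: integral_complex_of_real)
  also have "norm ... <= (LI u. g u/4 + exp (- (t^(3*m)*\<bar>u\<bar>)))"
  proof (rule order_trans[OF integral_norm_bound], rule integral_mono)
   show "L1 (%u. norm (of_real (g u)*(exp (w u) - 1)))" unfolding eqn[symmetric] using ic igc by auto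
   show "L1 (%u. g u/4 + exp (- (t^(3*m)*\<bar>u\<bar>)))" using ig integrable_exp_minus_abs[OF t3, of 0] by simp
   show "norm (of_real (g u)*(exp (w u) - 1)) <= g u/4 + exp (- (t^(3*m)*\<bar>u\<bar>))" for u
    using main[of u] by (simp add: norm_mult g_def)
  qed
  also have "... = rweight x al \<tau>/4 + (LI u. exp (- (t^(3*m)*\<bar>u\<bar>)))"
   using ig integrable_exp_minus_abs[OF t3, of 0] unfolding rweight_def g_def[symmetric] by simp
  also have "... <= rweight x al \<tau>/4 + 2/t^(3*m)" using integral_exp_minus_abs[OF t3] by simp
  also have "2/t^(3*m) <= rweight x al \<tau>/4"
  proof -
   have "1 <= exp (\<bar>al\<bar>/sqrt (1 + \<tau>))" using s v by (simp add: s_def)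
   also have "... <= K * s*rweight x al \<tau>" using K(2)[OF x \<tau>0] by (simp add: s_def)
   also have "... <= K*(2*t^(2*m))*rweight x al \<tau>"
    using s K(1) rweight_pos[OF \<tau>0, of x al] by (intro mult_right_mono mult_left_mono) auto
   finally have "1 <= K*(2*t^(2*m))*rweight x al \<tau>" .
   then have "8*1 <= 8*(K*(2*t^(2*m))*rweight x al \<tau>)" by (intro mult_left_mono) auto
   also have "... = (16*K)*(t^(2*m)*rweight x al \<tau>)" by simp
   also have "... <= t^m*(t^(2*m)*rweight x al \<tau>)"
   proof (rule mult_right_mono)
    show "16*K <= t^m" using t0(3) t power_increasing[of 1 m t] t1 m by simp
   qed (use rweight_pos[OF \<tau>0, of x al] t1 in auto)
   also have "... = t^(3*m)*rweight x al \<tau>" by (simp add: power_add[symmetric] mult.assoc[symmetric])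
   finally show ?thesis using t3 by (simp add: field_simps)
  qed
  finally show ?thesis by simp
 qed
 then show ?thesis using that[of t0 c0 L] t0(1) c0 unfolding m_def by blast
qed

end

text \<open>Two local extensions agree on their overlap because the set on which they are prescribed is dense there.\<close>

lemma continuous_extension_local:
 fixes f :: "'a::metric_space => 'b::t2_space"
 assumes A: "A \<subseteq> closure U" "U \<subseteq> A"
  and loc: "!!p. p \<in> A ==> \<exists>V g. open V \<and> p \<in> V \<and> continuous_on (A \<inter> V) g \<and> (\<forall>x\<in>U \<inter> V. g x = f x)"
 shows "\<exists>g. continuous_on A g \<and> (\<forall>x\<in>U. g x = f x)"
proof -
 obtain V g where V: "!!p. p \<in> A ==> open (V p)" "!!p. p \<in> A ==> p \<in> V p"
  and g: "!!p. p \<in> A ==> continuous_on (A \<inter> V p) (g p)" "!!p x. p \<in> A ==> x \<in> U ==> x \<in> V p ==> g p x = f x"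
  using loc by (simp only: Ball_def Int_iff) metis
 have eq: "g q q = g p q" if p: "p \<in> A" and q: "q \<in> A" "q \<in> V p" for p q
 proof -
  obtain X where X: "!!n. X n \<in> U" "X ----> q" using A q closure_sequential by (metis subsetD)
  have "\<forall>\<^sub>F n in sequentially. X n \<in> V p \<inter> V q" using X(2) V(1)[OF p] V(1)[OF q(1)] V(2)[OF q(1)] q(2)
   by (intro topological_tendstoD) auto
  then obtain N where N: "!!n. n >= N ==> X n \<in> V p \<inter> V q" unfolding eventually_sequentially by blast
  define Y where "Y n = X (n + N)" for n
  have Y: "Y ----> q" "!!n. Y n \<in> A \<inter> V p" "!!n. Y n \<in> A \<inter> V q" "!!n. Y n \<in> U"
   using A N X(1) LIMSEQ_ignore_initial_segment[OF X(2), of N] by (auto simp: Y_def[abs_def])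
  have "(%n. g p (Y n)) ----> g p q"
   by (rule continuous_on_tendsto_compose[OF g(1)[OF p] Y(1)]) (use q Y(2) in auto)
  moreover have "(%n. g q (Y n)) ----> g q q"
   by (rule continuous_on_tendsto_compose[OF g(1)[OF q(1)] Y(1)]) (use q V(2) Y(3) in auto)
  moreover have "g p (Y n) = g q (Y n)" for n using g(2) p q Y by auto
  ultimately show ?thesis using LIMSEQ_unique by force
 qed
 have "continuous (at p within A) (%q. g q q)" if p: "p \<in> A" for p
 proof -
  have "continuous (at p within A \<inter> V p) (g p)"
   using g(1)[OF p] p V(2)[OF p] by (simp add: continuous_on_eq_continuous_within)
  then have "(g p \<longlongrightarrow> g p p) (at p within A)"
   using at_within_nhd[of p "V p" A "A \<inter> V p"] V[OF p] by (simp add: continuous_within Int_commute Int_left_commute)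
  moreover have "\<forall>\<^sub>F q in at p within A. g p q = g q q"
   using V[OF p] eq[OF p] unfolding eventually_at_topological by metis
  ultimately have "((%q. g q q) \<longlongrightarrow> g p p) (at p within A)" by (rule Lim_transform_eventually)
  then show ?thesis by (simp add: continuous_within)
 qed
 then have "continuous_on A (%q. g q q)" by (simp add: continuous_on_eq_continuous_within)
 moreover have "g x x = f x" if "x \<in> U" for x using g(2)[of x x] V(2)[of x] that A by auto
 ultimately show ?thesis by (intro exI[of _ "%q. g q q"]) auto
qed

context convex_szego_poly
begin

text \<open>The reciprocal of the weight decays exponentially in \<open>\<bar>al\<bar> / \<surd>(1 + t)\<close>. This absorbs the
 polynomial growth of the symbol and any further power \<open>A\<close>.\<close>

lemma amplitude_bound:
 assumes D: "D >= 0"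
 obtains C where "C >= 0" "!!x al t a' t'. \<bar>x\<bar> <= B ==> t > 0 ==> norm a' + norm t' <= D*(bracket al t)*(1 + t) ==>
  norm (symbol l a' t')/rweight x al t <= C * sqrt (1 + t)^(2*length l + 1)/(bracket al t)^A"
proof -
 obtain K where K: "K > 0" "!!x al t. \<bar>x\<bar> <= B ==> t > 0 ==> exp (\<bar>al\<bar>/sqrt (1 + t)) <= K * sqrt (1 + t)*rweight x al t"
  using rweight_lower_bound by blast
 obtain S where S: "S >= 0" "!!a t. norm (symbol l a t) <= S*(1 + norm a + norm t)^length l" using symbol_bound by blast
 define n where "n = length l"
 define E where "E = exp 1*(fact (A + n) :: real)"
 define C where "C = S*(1 + D)^n*(K*E)"
 have "norm (symbol l a' t')/rweight x al t <= C * sqrt (1 + t)^(2*n + 1)/(bracket al t)^A"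
  if x: "\<bar>x\<bar> <= B" and t: "t > 0" and b: "norm a' + norm t' <= D*(bracket al t)*(1 + t)" for x al t a' t'
 proof -
  define s where "s = sqrt (1 + t)"
  define v where "v = \<bar>al\<bar>/s"
  have s: "s >= 1" "1 + t = s^2" using t by (auto simp: s_def)
  have v: "v >= 0" using s by (simp add: v_def)
  have one: "1 <= (1 + v) * s^2" using mult_mono[of 1 "1 + v" 1 "s^2"] s v one_le_power[of s 2] by simp
  have "norm (symbol l a' t') <= S*(1 + norm a' + norm t')^n" using S(2) by (simp add: n_def)
  also have "... <= S*((1 + D)*((1 + v) * s^2))^n"
  proof (intro mult_left_mono power_mono)
   have "norm a' + norm t' <= D*((1 + v) * s^2)" using b by (simp only: s_def[symmetric] v_def[symmetric] s(2)[symmetric] mult.assoc)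
   then show "1 + norm a' + norm t' <= (1 + D)*((1 + v) * s^2)" using one unfolding distrib_right[of 1 D] by linarith
  qed (use S(1) in auto)
  also have "... = S*(1 + D)^n*(1 + v)^n * s^(2*n)" by (simp add: power_mult_distrib power_mult[symmetric] mult_ac)
  finally have 1: "norm (symbol l a' t') <= S*(1 + D)^n*(1 + v)^n * s^(2*n)" .
  have rp: "rweight x al t > 0" by (rule rweight_pos[OF t])
  have "exp v <= K * s*rweight x al t" using K(2)[OF x t] by (simp add: v_def s_def)
  then have "1/rweight x al t <= K * s*exp (- v)" using rp by (simp add: exp_minus field_simps)
  also have "... <= K * s*(E/(1 + v)^(A + n))" unfolding E_def using K(1) s v by (intro mult_left_mono exp_minus_le_power) auto
  finally have 2: "1/rweight x al t <= K * s*(E/(1 + v)^(A + n))" .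
  have "norm (symbol l a' t')/rweight x al t <= (S*(1 + D)^n*(1 + v)^n * s^(2*n))*(K * s*(E/(1 + v)^(A + n)))"
   using mult_mono[OF 1 2] rp S(1) D v s by simp
  also have "... = C * s^(2*n + 1)/(1 + v)^A"
  proof -
   have "1 + v \<noteq> 0" using v by simp
   then show ?thesis by (simp add: C_def power_add)
  qed
  finally show ?thesis by (simp add: s_def v_def)
 qed
 then show ?thesis unfolding n_def by (intro that[of C]) (use S(1) D K(1) in \<open>auto simp: C_def E_def\<close>)
qed

text \<open>The first direction moves \<open>al\<close> and the second one moves \<open>t\<close>, where \<open>al = a - t b'(x)\<close>.\<close>

definition direction :: "real => bool => real \<times> real" where
 "direction x k = (if k then (poly (pderiv b) x, 1) else (1, 0))"

definition cutoff :: "real => real => real" where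
 "cutoff T t = min 1 (max 0 (t - T))"

text \<open>The cutoff vanishes for \<open>t \<le> T\<close>. The maximum in the denominator only keeps the expression continuous
 there.\<close>

definition amplitude :: "(complex \<times> complex) list => real => real => real \<times> real => complex" where
 "amplitude l T x q = of_real (cutoff T (snd q)) * symbol l (of_real (fst q)) (of_real (snd q)) /
   of_real (rweight x (fst q - max T (snd q)*poly (pderiv b) x) (max T (snd q)))"

lemma amplitude_zero: "snd q <= T ==> amplitude l T x q = 0"
 by (simp add: amplitude_def cutoff_def)

lemma cauchy_weight_bound:
 fixes a al t :: real
 assumes D: "1 + \<bar>a\<bar> <= D*(bracket al t)*(1 + t)" and t: "t > 0"
 shows "1/(bracket al t)^2 <= D^2 * sqrt (1 + t)^8*(1/(1 + a^2)*(1/(1 + t^2)))"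
proof -
 define s where "s = sqrt (1 + t)"
 define w where "w = 1 + \<bar>al\<bar>/s"
 have s: "s >= 1" "1 + t = s^2" using t by (auto simp: s_def)
 have w: "w > 0" using s by (simp add: w_def add_pos_nonneg)
 have "1 + a^2 <= (1 + \<bar>a\<bar>)^2" by (simp add: power2_sum)
 also have "... <= (D*w * s^2)^2" using D unfolding w_def by (intro power_mono) (simp_all add: s_def[symmetric] s(2)[symmetric])
 finally have 1: "1 + a^2 <= (D*w * s^2)^2" .
 have 2: "1 + t^2 <= s^4"
 proof -
  have "1 + t^2 <= (1 + t)^2" using t by (simp add: power2_sum)
  also have "... = s^4" unfolding s(2) by (simp flip: power_mult)
  finally show ?thesis .
 qed
 have "(1 + a^2)*(1 + t^2) <= (D*w * s^2)^2 * s^4" using 1 2 by (intro mult_mono) (auto simp: add_nonneg_nonneg)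
 also have "... = D^2 * s^8*w^2" by (simp add: power_mult_distrib mult_ac flip: power_mult power_add)
 finally have "(1 + a^2)*(1 + t^2) <= D^2 * s^8*w^2" .
 moreover have "(1 + a^2)*(1 + t^2) > 0" by (intro mult_pos_pos) (auto intro: add_pos_nonneg)
 ultimately show ?thesis unfolding s_def[symmetric] w_def[symmetric] using w by (simp add: field_simps)
qed

lemma frequency_bound:
 obtains D where "D >= 0"
  "!!x al t. \<bar>x\<bar> <= B ==> t > 0 ==> 1 + \<bar>al + t*poly (pderiv b) x\<bar> + t <= D*(bracket al t)*(1 + t)"
  "!!x al t. \<bar>x\<bar> <= B ==> t > 0 ==> \<bar>al + t*poly (pderiv b) x\<bar> + t + (\<bar>poly (pderiv b) x\<bar> + 1)*(1 + t) <= D*(bracket al t)*(1 + t)"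
proof -
 have "bounded (poly (pderiv b) ` {-B..B})"
  by (intro compact_imp_bounded compact_continuous_image continuous_intros) auto
 then obtain B' where B': "\<forall>x\<in>{-B..B}. \<bar>poly (pderiv b) x\<bar> <= B'" by (auto simp: bounded_iff)
 define D where "D = 2*\<bar>B'\<bar> + 4"
 have main: "1 + \<bar>al + t*poly (pderiv b) x\<bar> + t + (\<bar>poly (pderiv b) x\<bar> + 1)*(1 + t) <= D*(bracket al t)*(1 + t)"
  if h: "\<bar>x\<bar> <= B" "t > 0" for x al t
 proof -
  define s where "s = sqrt (1 + t)"
  define v where "v = \<bar>al\<bar>/s"
  have s: "s >= 1" "1 + t = s^2" using h by (auto simp: s_def)
  have v: "v >= 0" "\<bar>al\<bar> = v * s" using s by (auto simp: v_def)
  have "s <= s^2" using s by (simp add: power2_eq_square mult_le_cancel_left1)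
  then have 1: "\<bar>al\<bar> <= v * (1 + t)" unfolding v(2) s(2) using v(1) by (intro mult_left_mono) auto
  have "x \<in> {-B..B}" using h by auto
  then have b': "\<bar>poly (pderiv b) x\<bar> <= \<bar>B'\<bar>" using B' by fastforce
  then have "\<bar>t*poly (pderiv b) x\<bar> <= t*\<bar>B'\<bar>" "(\<bar>poly (pderiv b) x\<bar> + 1)*(1 + t) <= (\<bar>B'\<bar> + 1)*(1 + t)"
   unfolding abs_mult using h by (auto intro!: mult_mono)
  then have "1 + \<bar>al + t*poly (pderiv b) x\<bar> + t + (\<bar>poly (pderiv b) x\<bar> + 1)*(1 + t) <= v * (1 + t) + t*\<bar>B'\<bar> + (1 + t) + (\<bar>B'\<bar> + 1)*(1 + t)"
   using 1 by linarith
  also have "... <= D*(1 + v)*(1 + t)"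
  proof -
   have "0 <= v * t" "0 <= v * \<bar>B'\<bar>" "0 <= v * \<bar>B'\<bar>*t" using v(1) h(2) by auto
   then show ?thesis using v(1) h(2) by (simp add: D_def algebra_simps)
  qed
  finally show ?thesis by (simp add: v_def s_def)
 qed
 have nn: "0 <= (\<bar>poly (pderiv b) x\<bar> + 1)*(1 + t)" if "t > 0" for x t :: real using that by (intro mult_nonneg_nonneg) auto
 show ?thesis
 proof (rule that[of D])
  fix x al t :: real assume h: "\<bar>x\<bar> <= B" "t > 0"
  show "1 + \<bar>al + t*poly (pderiv b) x\<bar> + t <= D*(bracket al t)*(1 + t)"
   "\<bar>al + t*poly (pderiv b) x\<bar> + t + (\<bar>poly (pderiv b) x\<bar> + 1)*(1 + t) <= D*(bracket al t)*(1 + t)"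
   using main[OF h, of al] nn[OF h(2), of x] by linarith+
 qed (simp add: D_def)
qed

text \<open>For large \<open>\<tau>\<close> the discs of holomorphy have radius \<open>R\<close> proportional to \<open>t / (1 +
 v)\<^sup>L\<close>, where \<open>t\<close> is a root of \<open>\<tau>\<close>, so \<open>K\<close> differences gain
 \<open>R\<close> to the power \<open>- K\<close>. The loss in \<open>v\<close> is absorbed by the decay in \<open>v\<close>,
 and \<open>K\<close> is chosen so large that the gain in \<open>t\<close> beats the growth of the amplitude. For
 \<open>\<tau>\<close> in a bounded interval there is nothing to gain.\<close>

lemma amplitude_difference_bound:
 obtains T K C where "T > 0" "K > 0" "C >= 0"
  "!!ka x h q. \<bar>x\<bar> <= B ==> 0 < h ==> h <= 1 ==>
   norm ((backward_difference (h *\<^sub>R direction x ka) ^^ K) (amplitude l T x) q) <= C*(cauchy q)"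
  "!!ka x h q. 0 < h ==> snd q <= T ==> (backward_difference (h *\<^sub>R direction x ka) ^^ K) (amplitude l T x) q = 0"
proof -
 define m where "m = degree b"
 define n where "n = length l"
  (* The amplitude and the two Cauchy densities cost 2 n + 9 powers of sqrt (1 + tau), and
   sqrt (1 + tau) is at most 2 t^(2 m) for tau = t^(4 m). *)
 define K where "K = 2*m*(2*n + 9)"
 have m: "m >= 2" using degree_ge_2 by (simp add: m_def)
 have K0: "K > 0" using m by (simp add: K_def)
 obtain t0 c0 L where t0: "t0 >= 1" and c0: "0 < c0" "c0 <= 1/16" and pert:
  "!!x al \<tau> t ze sg. \<bar>x\<bar> <= B ==> t >= t0 ==> \<tau> = t^(4*m) ==> norm ze <= c0*t/(bracket al \<tau>)^L ==>
   norm sg <= c0*t/(bracket al \<tau>)^L ==>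
   norm (cweight x (of_real al + ze) (of_real \<tau> + sg) - of_real (rweight x al \<tau>)) <= rweight x al \<tau>/2"
  unfolding m_def using cweight_perturbation by blast
 define A where "A = L*K + 2"
 define T where "T = t0^(4*m)"
 have T: "T >= 1" unfolding T_def using t0 by (intro one_le_power)
 obtain D where D: "D >= 0" and
  freq: "!!x al \<tau>. \<bar>x\<bar> <= B ==> \<tau> > 0 ==> 1 + \<bar>al + \<tau>*poly (pderiv b) x\<bar> + \<tau> <= D*(bracket al \<tau>)*(1 + \<tau>)"
   "!!x al \<tau>. \<bar>x\<bar> <= B ==> \<tau> > 0 ==> \<bar>al + \<tau>*poly (pderiv b) x\<bar> + \<tau> + (\<bar>poly (pderiv b) x\<bar> + 1)*(1 + \<tau>) <= D*(bracket al \<tau>)*(1 + \<tau>)"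
  using frequency_bound[of B] by blast
 obtain C where C: "C >= 0" "!!x al \<tau> a' \<tau>'. \<bar>x\<bar> <= B ==> \<tau> > 0 ==> norm a' + norm \<tau>' <= D*(bracket al \<tau>)*(1 + \<tau>) ==>
  norm (symbol l a' \<tau>')/rweight x al \<tau> <= C * sqrt (1 + \<tau>)^(2*n + 1)/(bracket al \<tau>)^A"
  unfolding n_def using amplitude_bound[OF D] by blast
 define Z where "Z = max (2*C*(real K + 1)^A) (2*C)"
 define s1 where "s1 = sqrt (T + real K + 2)"
 define C' where "C' = max (2^K*(Z*(D^2 * s1^(2*n + 9)))) (Z*D^2*2^(2*n + 9)*(4*real K/c0)^K)"
 have s1: "s1 >= 0" using T by (simp add: s1_def)
 have Z: "Z >= 0" using C(1) by (simp add: Z_def)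
 have zero: "(backward_difference (h *\<^sub>R direction x ka) ^^ K) (amplitude l T x) q = 0" if "0 < h" "snd q <= T" for ka x h q
 proof -
  have "norm ((backward_difference (h *\<^sub>R direction x ka) ^^ K) (amplitude l T x) q) <= 2^K*0"
  proof (rule backward_difference_bound)
   fix k
   have "snd (q - real k *\<^sub>R h *\<^sub>R direction x ka) <= T" using that by (auto simp: direction_def intro: order_trans[of _ "snd q"])
   then show "norm (amplitude l T x (q - real k *\<^sub>R h *\<^sub>R direction x ka)) <= 0" by (simp add: amplitude_zero)
  qed
  then show ?thesis by simp
 qed
 have main: "norm ((backward_difference (h *\<^sub>R direction x ka) ^^ K) (amplitude l T x) q) <= C'*(cauchy q)"
  if x: "\<bar>x\<bar> <= B" and h: "0 < h" "h <= 1" for ka x h q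
 proof (cases "snd q <= T")
  case True
  have "C' >= 0" using Z using T c0 s1 by (auto simp: C'_def le_max_iff_disj intro!: mult_nonneg_nonneg)
  then show ?thesis using zero[OF h(1) True] by simp
 next
  case False
  obtain a \<tau> where q: "q = (a, \<tau>)" by force
  have \<tau>T: "\<tau> > T" and \<tau>: "\<tau> > 0" using False q T by auto
  define b' where "b' = poly (pderiv b) x"
  define al where "al = a - \<tau>*b'"
  define s where "s = sqrt (1 + \<tau>)"
  define v where "v = \<bar>al\<bar>/s"
  define M where "M = Z * s^(2*n + 1)/(1 + v)^A"
  have s: "s >= 1" "1 + \<tau> = s^2" using \<tau> by (auto simp: s_def)
  have v: "v >= 0" using s by (simp add: v_def)
  define e where "e = (if ka then (0 :: real, 1 :: real) else (1, 0))"
  have dir: "direction x ka = (fst e + snd e*b', snd e)" by (simp add: direction_def e_def b'_def)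
  have e: "0 <= fst e" "fst e <= 1" "0 <= snd e" "snd e <= 1" by (auto simp: e_def)
  have qk: "q - real k *\<^sub>R h *\<^sub>R direction x ka = (a - k*h*(fst e + snd e*b'), \<tau> - k*h * snd e)" for k
   by (simp add: q dir)
  have kh: "0 <= k*h * snd e" "k*h * snd e <= K" "k*h*fst e <= K" "0 <= k*h*fst e" if "k <= K" for k :: nat
   using mult_mono[of "k*h" "real K" "snd e" 1] mult_mono[of "k*h" "real K" "fst e" 1] mult_mono[of "real k" "real K" h 1] that h e by auto
  have M: "norm (amplitude l T x (q - real k *\<^sub>R h *\<^sub>R direction x ka)) <= M" if k: "k <= K" for k
  proof -
   define a' where "a' = a - k*h*(fst e + snd e*b')"
   define \<tau>' where "\<tau>' = \<tau> - k*h * snd e"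
   define al' where "al' = al - k*h*fst e"
   have M0: "M >= 0" using Z s v by (simp add: M_def)
   show ?thesis
   proof (cases "\<tau>' <= T")
    case True
    then have "amplitude l T x (a', \<tau>') = 0" by (simp add: amplitude_zero)
    then show ?thesis unfolding qk a'_def[symmetric] \<tau>'_def[symmetric] using M0 by simp
   next
    case False
    have \<tau>': "\<tau>' > 0" "\<tau>' <= \<tau>" "max T \<tau>' = \<tau>'" using False T kh[OF k] by (auto simp: \<tau>'_def)
    have a': "a' = al' + \<tau>'*b'" by (simp add: a'_def al'_def al_def \<tau>'_def algebra_simps)
    define s' where "s' = sqrt (1 + \<tau>')"
    define v' where "v' = \<bar>al'\<bar>/s'"
    have s': "1 <= s'" "s' <= s" using \<tau>' by (auto simp: s'_def s_def)
    have v': "v' >= 0" using s' by (simp add: v'_def)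
    have "\<bar>a'\<bar> + \<bar>\<tau>'\<bar> <= D*(1 + v')*(1 + \<tau>')"
     using freq(1)[OF x \<tau>'(1), of al'] \<tau>'(1) unfolding a' b'_def v'_def s'_def by linarith
    then have "norm (symbol l (of_real a') (of_real \<tau>'))/rweight x al' \<tau>' <= C * s'^(2*n + 1)/(1 + v')^A"
     unfolding s'_def v'_def by (intro C(2)[OF x \<tau>'(1)]) simp
    also have "... <= C * s^(2*n + 1)*((real K + 1)^A/(1 + v)^A)"
    proof -
     have "v <= v' + K"
     proof -
      have "\<bar>al\<bar> <= \<bar>al'\<bar> + K" using kh[OF k] by (simp add: al'_def)
      then have "v <= (\<bar>al'\<bar> + K)/s" unfolding v_def using s by (intro divide_right_mono) auto
      also have "... <= (\<bar>al'\<bar> + K)/s'" using s s' by (intro divide_left_mono) auto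
      also have "... = v' + K/s'" by (simp add: v'_def add_divide_distrib)
      also have "K/s' <= K" using s' by (simp add: divide_le_eq mult_le_cancel_left1)
      finally show ?thesis by simp
     qed
     also have "... <= (real K + 1)*(1 + v') - 1" using v' by (simp add: algebra_simps)
     finally have "1 + v <= (real K + 1)*(1 + v')" by simp
     then have "(1 + v)^A <= ((real K + 1)*(1 + v'))^A" using v by (intro power_mono) auto
     then have "1/(1 + v')^A <= (real K + 1)^A/(1 + v)^A" using v v' unfolding power_mult_distrib by (simp add: divide_simps mult.commute)
     moreover have "C * s'^(2*n + 1) <= C * s^(2*n + 1)" using C(1) s s' by (intro mult_left_mono power_mono) auto
     ultimately show ?thesis using C(1) s s' v v' mult_mono[of "C * s'^(2*n + 1)" "C * s^(2*n + 1)" "1/(1 + v')^A" "(real K + 1)^A/(1 + v)^A"]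
      by simp
    qed
    also have "... = (C*(real K + 1)^A)*(s^(2*n + 1)/(1 + v)^A)" by simp
    also have "... <= Z*(s^(2*n + 1)/(1 + v)^A)" using C(1) s v by (intro mult_right_mono) (auto simp: Z_def le_max_iff_disj)
    finally have 1: "norm (symbol l (of_real a') (of_real \<tau>'))/rweight x al' \<tau>' <= M" by (simp add: M_def)
    have "norm (amplitude l T x (a', \<tau>')) <= norm (symbol l (of_real a') (of_real \<tau>'))/rweight x al' \<tau>'"
     using rweight_pos[OF \<tau>'(1), of x al'] mult_right_mono[of "cutoff T \<tau>'" 1 "norm (symbol l (of_real a') (of_real \<tau>'))/rweight x al' \<tau>'"]
     by (simp add: amplitude_def \<tau>'(3) a' b'_def[symmetric] norm_mult norm_divide cutoff_def)
    then show ?thesis unfolding qk a'_def[symmetric] \<tau>'_def[symmetric] using 1 by linarith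
   qed
  qed
  have v2: "1/(1 + v)^2 <= D^2 * s^8*(1/(1 + a^2)*(1/(1 + \<tau>^2)))"
  proof -
   have "1 + \<bar>a\<bar> <= D*(1 + v)*(1 + \<tau>)"
    using freq(1)[OF x \<tau>, of al] \<tau> unfolding v_def s_def by (simp add: al_def b'_def)
   then show ?thesis unfolding v_def s_def by (intro cauchy_weight_bound \<tau>)
  qed
  have p9: "s^(2*n + 9) = s^(2*n + 1) * s^8" proof -
   have "2*n + 9 = (2*n + 1) + 8" by simp
   then show ?thesis by (simp only: power_add)
  qed
  define W where "W = 1/(1 + a^2)*(1/(1 + \<tau>^2))"
  have W: "W >= 0" by (simp add: W_def)
  have bnd: "norm ((backward_difference (h *\<^sub>R direction x ka) ^^ K) (amplitude l T x) q) <= C'*W"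
  proof (cases "\<tau> < T + K + 1")
   case True
   have ss: "s <= s1" using True by (simp add: s_def s1_def)
   have "norm ((backward_difference (h *\<^sub>R direction x ka) ^^ K) (amplitude l T x) q) <= 2^K*M"
    by (rule backward_difference_bound) (rule M)
   also have "M <= Z * s^(2*n + 1)*(1/(1 + v)^2)"
   proof -
    have "(1 + v)^2 <= (1 + v)^A" using v by (intro power_increasing) (auto simp: A_def)
    then show ?thesis unfolding M_def using Z s v by (simp add: divide_left_mono)
   qed
   also have "... <= Z * s^(2*n + 1)*(D^2 * s^8*W)" unfolding W_def using v2 Z s by (intro mult_left_mono) auto
   also have "... = Z*(D^2 * s^(2*n + 9))*W" by (simp only: p9) (simp add: mult_ac)
   also have "... <= Z*(D^2 * s1^(2*n + 9))*W" using ss s Z W by (intro mult_right_mono mult_left_mono power_mono) auto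
   finally have "norm ((backward_difference (h *\<^sub>R direction x ka) ^^ K) (amplitude l T x) q) <= (2^K*(Z*(D^2 * s1^(2*n + 9))))*W"
    by (simp add: mult_ac)
   also have "... <= C'*W" using W by (intro mult_right_mono) (auto simp: C'_def)
   finally show ?thesis .
  next
   case False
   define t where "t = root (4*m) \<tau>"
   have t4: "\<tau> = t^(4*m)" unfolding t_def using \<tau> m by (intro real_root_pow_pos2[symmetric]) auto
   have "t >= root (4*m) T" unfolding t_def using \<tau>T m by (intro real_root_le_mono) auto
   then have t: "t >= t0" unfolding T_def using t0 m by (simp add: real_root_power_cancel)
   have t1: "t >= 1" using t t0 by simp
   define R where "R = c0*t/(1 + v)^L"
   have v1: "(1 + v)^L >= 1" using v by (intro one_le_power) simp
   have Rt: "0 < R" "R <= t"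
   proof -
    show "0 < R" unfolding R_def using c0 t1 v1 by (intro divide_pos_pos mult_pos_pos) auto
    have "R <= c0*t" unfolding R_def using c0 t1 divide_left_mono[OF v1, of "c0*t"] v1 by simp
    also have "... <= 1*t" using c0 t1 by (intro mult_right_mono) auto
    finally show "R <= t" by simp
   qed
   have t\<tau>: "t <= \<tau>" using t1 power_increasing[of 1 "4*m" t] m by (simp add: t4)
   define g where "g z = symbol l (of_real a + z * of_real (fst e + snd e*b')) (of_real \<tau> + z * of_real (snd e)) /
    cweight x (of_real al + z * of_real (fst e)) (of_real \<tau> + z * of_real (snd e))" for z
   have near: "norm (cweight x (of_real al + z * of_real (fst e)) (of_real \<tau> + z * of_real (snd e)) - of_real (rweight x al \<tau>)) <= rweight x al \<tau>/2"
    if z: "norm z < R" for z :: complex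
   proof (rule pert[OF x t t4])
    have "norm z*fst e <= R*1" "norm z * snd e <= R*1"
     using z e Rt(1) mult_mono[of "norm z" R "fst e" 1] mult_mono[of "norm z" R "snd e" 1] by simp_all
    then show "norm (z * of_real (fst e)) <= c0*t/(bracket al \<tau>)^L" "norm (z * of_real (snd e)) <= c0*t/(bracket al \<tau>)^L"
     using e by (auto simp: norm_mult R_def v_def s_def)
   qed
   have rp: "rweight x al \<tau> > 0" by (rule rweight_pos[OF \<tau>])
   have low: "norm (cweight x (of_real al + z * of_real (fst e)) (of_real \<tau> + z * of_real (snd e))) >= rweight x al \<tau>/2" if z: "norm z < R" for z :: complex
    using near[OF z] rp norm_triangle_ineq3[of "cweight x (of_real al + z * of_real (fst e)) (of_real \<tau> + z * of_real (snd e))" "of_real (rweight x al \<tau>)"]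
    by (simp add: abs_le_iff)
   have "norm ((backward_difference (h *\<^sub>R direction x ka) ^^ K) (amplitude l T x) q) <= M*(4*real K/R)^K"
   proof (rule backward_difference_decay[OF K0 h Rt(1)])
    show "g holomorphic_on ball 0 R"
     unfolding g_def
    proof (intro holomorphic_on_divide symbol_holomorphic cweight_holomorphic holomorphic_intros)
     fix z :: complex assume z: "z \<in> ball 0 R"
     have "\<bar>Re z * snd e\<bar> <= norm z*1" unfolding abs_mult using e by (intro mult_mono abs_Re_le_cmod) auto
     then have "\<bar>Re z * snd e\<bar> < \<tau>" using z Rt t\<tau> by simp
     then show "0 < Re (of_real \<tau> + z * of_real (snd e))" by simp
     show "cweight x (of_real al + z * of_real (fst e)) (of_real \<tau> + z * of_real (snd e)) \<noteq> 0" using low[of z] rp z by auto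
    qed
    show "norm (g z) <= M" if z: "norm z < R" for z :: complex
    proof -
     have "norm (of_real a + z * of_real (fst e + snd e*b')) + norm (of_real \<tau> + z * of_real (snd e)) <= D*(1 + v)*(1 + \<tau>)"
     proof -
      have "\<bar>fst e + snd e*b'\<bar> + \<bar>snd e\<bar> <= \<bar>b'\<bar> + 1" by (auto simp: e_def)
      then have "norm z*(\<bar>fst e + snd e*b'\<bar> + \<bar>snd e\<bar>) <= (1 + \<tau>)*(\<bar>b'\<bar> + 1)"
       using z Rt t\<tau> by (intro mult_mono) auto
      moreover have "norm (of_real a + z * of_real (fst e + snd e*b')) <= \<bar>a\<bar> + norm z*\<bar>fst e + snd e*b'\<bar>"
       using norm_triangle_ineq[of "of_real a :: complex" "z * of_real (fst e + snd e*b')"] by (simp only: norm_mult norm_of_real)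
      moreover have "norm (of_real \<tau> + z * of_real (snd e)) <= \<tau> + norm z*\<bar>snd e\<bar>"
       using norm_triangle_ineq[of "of_real \<tau> :: complex" "z * of_real (snd e)"] \<tau> by (simp only: norm_mult norm_of_real abs_of_pos)
      moreover have "\<bar>a\<bar> + \<tau> + (\<bar>b'\<bar> + 1)*(1 + \<tau>) <= D*(1 + v)*(1 + \<tau>)"
       using freq(2)[OF x \<tau>, of al] unfolding v_def s_def al_def b'_def by simp
      ultimately show ?thesis by (simp add: algebra_simps)
     qed
     then have "norm (symbol l (of_real a + z * of_real (fst e + snd e*b')) (of_real \<tau> + z * of_real (snd e)))/rweight x al \<tau>
       <= C * s^(2*n + 1)/(1 + v)^A"
      unfolding v_def s_def by (intro C(2)[OF x \<tau>])
     then have "2*(norm (symbol l (of_real a + z * of_real (fst e + snd e*b')) (of_real \<tau> + z * of_real (snd e)))/rweight x al \<tau>)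
       <= (2*C)*(s^(2*n + 1)/(1 + v)^A)" by simp
     also have "... <= Z*(s^(2*n + 1)/(1 + v)^A)" using s v by (intro mult_right_mono) (auto simp: Z_def)
     finally have 1: "norm (symbol l (of_real a + z * of_real (fst e + snd e*b')) (of_real \<tau> + z * of_real (snd e)))/(rweight x al \<tau>/2) <= M"
      by (simp add: M_def mult.commute)
     have "norm (g z) <= norm (symbol l (of_real a + z * of_real (fst e + snd e*b')) (of_real \<tau> + z * of_real (snd e)))/(rweight x al \<tau>/2)"
      unfolding g_def norm_divide using low[OF z] rp by (intro divide_left_mono mult_pos_pos) auto
     then show ?thesis using 1 by linarith
    qed
    show "norm (amplitude l T x (q - real k *\<^sub>R h *\<^sub>R direction x ka)) <= M" if "k <= K" for k by (rule M[OF that])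
    show "amplitude l T x (q - real k *\<^sub>R h *\<^sub>R direction x ka) = g (of_real (- (real k*h)))" if k: "k <= K" for k
    proof -
     have "T + 1 <= \<tau> - k*h * snd e" using kh[OF k] False by simp
     then have c: "cutoff T (\<tau> - k*h * snd e) = 1" "max T (\<tau> - k*h * snd e) = \<tau> - k*h * snd e" by (auto simp: cutoff_def)
     have r: "cweight x (of_real al + of_real (- (real k*h)) * of_real (fst e)) (of_real \<tau> + of_real (- (real k*h)) * of_real (snd e))
      = of_real (rweight x (al - k*h*fst e) (\<tau> - k*h * snd e))"
      unfolding cweight_of_real[symmetric] by simp
     have "a - k*h*(fst e + snd e*b') - (\<tau> - k*h * snd e)*poly (pderiv b) x = al - k*h*fst e"
      by (simp add: al_def b'_def algebra_simps)
     then show ?thesis unfolding qk g_def r amplitude_def fst_conv snd_conv c by simp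
    qed
   qed
   also have "M*(4*real K/R)^K = Z * s^(2*n + 1)*(1/(1 + v)^2)*((4*real K/c0)^K/t^K)"
   proof -
    have nz: "1 + v \<noteq> 0" "c0 \<noteq> 0" "t \<noteq> 0" using v c0 t1 by auto
    have "(4*real K/R)^K = (4*real K/c0)^K/t^K*(1 + v)^(L*K)"
     unfolding R_def using nz by (simp add: power_divide power_mult_distrib power_mult)
    then show ?thesis using nz by (simp add: M_def A_def power_add power2_eq_square)
   qed
   also have "... <= Z * s^(2*n + 1)*(D^2 * s^8*W)*((4*real K/c0)^K/t^K)"
    unfolding W_def using v2 Z s c0 t1 by (intro mult_right_mono mult_left_mono) auto
   also have "... = Z*D^2*(s^(2*n + 9)/t^K)*(4*real K/c0)^K*W"
    by (simp only: p9) (simp add: mult_ac)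
   also have "... <= Z*D^2*2^(2*n + 9)*(4*real K/c0)^K*W"
   proof (intro mult_right_mono mult_left_mono)
    have "1 + \<tau> <= (2*t^(2*m))^2" using t\<tau> t1 by (simp add: t4 power_mult_distrib flip: power_mult)
    then have "s <= 2*t^(2*m)" unfolding s_def using t1 by (intro real_le_lsqrt) auto
    then have "s^(2*n + 9) <= (2*t^(2*m))^(2*n + 9)" using s by (intro power_mono) auto
    also have "... = 2^(2*n + 9)*t^K" by (simp only: power_mult_distrib K_def power_mult)
    finally show "s^(2*n + 9)/t^K <= 2^(2*n + 9)" using t1 by (simp add: divide_le_eq)
   qed (use Z W c0 in auto)
   also have "... <= C'*W" using W by (intro mult_right_mono) (auto simp: C'_def)
   finally show ?thesis .
  qed
  then show ?thesis by (simp add: W_def q)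
 qed
 have "C' >= 0" using Z using T c0 s1 by (auto simp: C'_def le_max_iff_disj intro!: mult_nonneg_nonneg)
 show ?thesis
 proof (rule that[of T K C'])
  show "0 < T" using T by simp
 qed (use K0 \<open>C' \<ge> 0\<close> main zero in blast)+
qed

end

section \<open>Convex polynomials: continuous extension of the kernel and its derivatives\<close>

context convex_szego_poly
begin

text \<open>The absorption estimate is uniform in the point of tangency, which gives a dominating function near each parameter.\<close>

lemma continuous_on_rweight:
 "continuous_on {p::real \<times> real \<times> real. snd (snd p) > 0} (%p. rweight (fst p) (fst (snd p)) (snd (snd p)))"
 unfolding rweight_def
proof (rule continuous_on_integral_dominated)
 fix p0 :: "real \<times> real \<times> real" assume p0: "p0 \<in> {p. snd (snd p) > 0}"
 define al where "al = fst (snd p0)"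
 define t where "t = snd (snd p0)"
 have t: "t > 0" using p0 by (simp add: t_def)
 obtain C where C: "!!x u. 2*(\<bar>al\<bar> + 1)*\<bar>u\<bar> - t*excess b x u <= C - \<bar>u\<bar>" using excess_absorbs[OF t] by blast
 define U where "U = {p::real \<times> real \<times> real. \<bar>fst (snd p)\<bar> < \<bar>al\<bar> + 1 \<and> t/2 < snd (snd p)}"
 have "exp (2*(fst (snd p)*u - snd (snd p)*excess b (fst p) u)) <= exp (C - 1*\<bar>u\<bar>)" if p: "p \<in> U" for p u
 proof -
  have "fst (snd p)*u <= (\<bar>al\<bar> + 1)*\<bar>u\<bar>"
  proof -
   have "fst (snd p)*u <= \<bar>fst (snd p)\<bar>*\<bar>u\<bar>" using abs_ge_self[of "fst (snd p)*u"] by (simp add: abs_mult)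
   also have "... <= (\<bar>al\<bar> + 1)*\<bar>u\<bar>" using p by (intro mult_right_mono) (auto simp: U_def)
   finally show ?thesis .
  qed
  moreover have "t/2*excess b (fst p) u <= snd (snd p)*excess b (fst p) u"
   using p excess_nonneg by (intro mult_right_mono) (auto simp: U_def)
  ultimately show ?thesis using C[of u "fst p"] by (simp add: algebra_simps)
 qed
 moreover have "open U" unfolding U_def by (intro open_Collect_conj open_Collect_less continuous_intros)
 moreover have "p0 \<in> U" using t by (simp add: U_def al_def t_def)
 ultimately show "\<exists>U g. open U \<and> p0 \<in> U \<and> L1 g \<and>
  (\<forall>p\<in>U \<inter> {p. snd (snd p) > 0}. AE u in lborel. norm (exp (2*(fst (snd p)*u - snd (snd p)*excess b (fst p) u))) <= g u)"
  by (intro exI[of _ U] exI[of _ "%u. exp (C - 1*\<bar>u\<bar>)"]) (auto intro: integrable_exp_minus_abs[of 1 C, simplified])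
qed (auto intro!: continuous_intros borel_measurable_continuous_onI)

lemma continuous_on_amplitude:
 assumes T: "T > 0" and f: "continuous_on S f" and g: "continuous_on S g"
 shows "continuous_on S (%p. amplitude l T (f p) (g p))"
proof -
 have "continuous_on S (%p. (%p. rweight (fst p) (fst (snd p)) (snd (snd p)))
  (f p, fst (g p) - max T (snd (g p))*poly (pderiv b) (f p), max T (snd (g p))))"
  using T by (intro continuous_on_compose2[OF continuous_on_rweight] continuous_intros f g) auto
 then have "continuous_on S (%p. rweight (f p) (fst (g p) - max T (snd (g p))*poly (pderiv b) (f p)) (max T (snd (g p))))"
  by simp
 moreover have "rweight x al (max T t) \<noteq> 0" for x al t
 proof -
  have "max T t > 0" using T by (simp add: less_max_iff_disj)
  then show ?thesis using rweight_pos[of "max T t" x al] by simp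
 qed
 ultimately show ?thesis unfolding amplitude_def cutoff_def
  by (intro continuous_intros f g) auto
qed

abbreviation symbol_density :: "(complex \<times> complex) list => real \<times> real => complex" where
 "symbol_density l \<equiv> %q. symbol l (of_real (fst q)) (of_real (snd q))*kernel_density q"

abbreviation domain2 :: "((complex \<times> complex) \<times> (complex \<times> complex)) set" where
 "domain2 \<equiv> tube_domain b \<times> tube_domain b"

abbreviation closure2 :: "((complex \<times> complex) \<times> (complex \<times> complex)) set" where
 "closure2 \<equiv> closure (tube_domain b) \<times> closure (tube_domain b) - boundary_diagonal b"

abbreviation kernel_derivative :: "((complex \<times> complex) \<times> (complex \<times> complex)) list => (complex \<times> complex) \<times> (complex \<times> complex) => complex" where
 "kernel_derivative vs \<equiv> iterated_derivative vs (%(z, w). szego_kernel b z w)"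

lemma lap_on_symbol:
 "lap_on {(X, Y). 2*poly b (X/2) < Y} (symbol_density l)"
proof (induction l)
 case Nil
 have "open {p::real \<times> real. 2*poly b (fst p/2) < snd p}" by (auto intro!: open_Collect_less continuous_intros)
 moreover have "L1 (%q. exp (fst q*X - snd q*Y)*norm (kernel_density q))" if "2*poly b (X/2) < Y" for X Y
 proof -
  have "L1 (%q. exp (2*fst q*(X/2) - 2 * snd q*(Y/2))*inv_weight b q)"
   using that by (intro inv_weight_integrable) simp
  from integrable_mult_right[OF this, of "1/(4*pi^2)"] show ?thesis
   by (simp add: kernel_density_def norm_divide norm_mult power2_eq_square mult_ac)
 qed
 moreover have "kernel_density \<in> bm" unfolding kernel_density_def[abs_def] by measurable
 ultimately show ?case by (auto simp: lap_on_def case_prod_unfold)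
next
 case (Cons p l)
 obtain u v where p: "p = (u, v)" by force
 define r where "r = 1/(1 + norm u + norm v)"
 have r: "r > 0" "r*norm u <= 1" "r*norm v <= 1" by (auto simp: r_def add_pos_nonneg divide_simps)
 have "lap_on {(X, Y). 2*poly b (X/2) < Y} (%q. (of_real r*(of_real (fst q)*u + \<i> * of_real (snd q) * v))*(symbol l (of_real (fst q)) (of_real (snd q))*kernel_density q))"
 proof (rule lap_on_weight[OF Cons])
  fix q :: "real \<times> real"
  have "norm (of_real r*(of_real (fst q)*u + \<i> * of_real (snd q) * v)) <= r*(\<bar>fst q\<bar>*norm u + \<bar>snd q\<bar>*norm v)"
   using norm_triangle_ineq[of "of_real (fst q)*u" "\<i> * of_real (snd q) * v"] r(1) by (simp add: norm_mult)
  also have "... = \<bar>fst q\<bar>*(r*norm u) + \<bar>snd q\<bar>*(r*norm v)" by (simp add: algebra_simps)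
  also have "... <= \<bar>fst q\<bar>*1 + \<bar>snd q\<bar>*1" using r by (intro add_mono mult_left_mono) auto
  finally show "norm (of_real r*(of_real (fst q)*u + \<i> * of_real (snd q) * v)) <= \<bar>fst q\<bar> + \<bar>snd q\<bar>" by simp
 qed (auto intro!: borel_measurable_continuous_onI continuous_intros)
 then have L: "lap_on {(X, Y). 2*poly b (X/2) < Y} (%q. of_real r*(symbol (p # l) (of_real (fst q)) (of_real (snd q))*kernel_density q))"
  by (simp add: p mult_ac)
 have "(%q. of_real (1/r)*(of_real r*(symbol (p # l) (of_real (fst q)) (of_real (snd q))*kernel_density q))) \<in> bm"
  using lap_on_measurable[OF L] by measurable
 then have m: "(%q. symbol (p # l) (of_real (fst q)) (of_real (snd q))*kernel_density q) \<in> bm"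
  using r(1) by simp
 have "L1 (%q. exp (fst q*X - snd q*Y)*norm (symbol (p # l) (of_real (fst q)) (of_real (snd q))*kernel_density q))"
  if "(X, Y) \<in> {(X, Y). 2*poly b (X/2) < Y}" for X Y
  using integrable_mult_right[OF lap_on_integrable[OF L that], of "1/r"] r(1) by (simp add: norm_mult mult_ac del: symbol.simps)
 then show ?case using L m by (simp add: lap_on_def case_prod_unfold)
qed

text \<open>The centre, the phases along the two directions, and the oscillating factor, at a point \<open>(Z, W)\<close> with \<open>Im W \<ge> 2 b (Re Z / 2)\<close>.\<close>

definition centre :: "complex \<times> complex => real" where
 "centre P = Re (fst P)/2"

definition height :: "complex \<times> complex => real" where
 "height P = Im (snd P) - 2*poly b (centre P)"

definition phase :: "bool => complex \<times> complex => complex" where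
 "phase k P = of_real (fst (direction (centre P) k)*Im (fst P)) + of_real (snd (direction (centre P) k))*Complex (Re (snd P)) (height P)"

definition oscillation :: "complex \<times> complex => real \<times> real => complex" where
 "oscillation P q = exp (\<i>*(of_real (fst q*Im (fst P)) + of_real (snd q)*Complex (Re (snd P)) (height P)))"

lemma continuous_on_Complex [continuous_intros]:
 "continuous_on S f ==> continuous_on S g ==> continuous_on S (%x. Complex (f x) (g x))"
 by (simp add: Complex_eq) (intro continuous_intros)

lemma continuous_on_centre [continuous_intros]: "continuous_on S f ==> continuous_on S (%x. centre (f x))"
 unfolding centre_def by (auto intro!: continuous_intros)

lemma continuous_on_height [continuous_intros]: "continuous_on S f ==> continuous_on S (%x. height (f x))"
 unfolding height_def by (intro continuous_intros)

lemma continuous_on_phase [continuous_intros]: "continuous_on S f ==> continuous_on S (%x. phase k (f x))"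
 unfolding phase_def direction_def by (cases k) (auto intro!: continuous_intros)

lemma continuous_on_oscillation [continuous_intros]:
 "continuous_on S f ==> continuous_on S g ==> continuous_on S (%x. oscillation (f x) (g x))"
 unfolding oscillation_def by (intro continuous_intros)

lemma norm_oscillation: "norm (oscillation P q) = exp (- snd q*height P)"
 by (simp add: oscillation_def norm_exp_eq_Re)

lemma oscillation_shift: "oscillation P (q + h *\<^sub>R direction (centre P) k) = exp (\<i> * of_real h*phase k P) * oscillation P q"
 by (simp add: oscillation_def phase_def exp_add[symmetric] algebra_simps)

text \<open>The exponential splits at the centre into the normalisation of the weight and the oscillating factor.\<close>

lemma kernel_integrand:
 assumes "snd q > 0"
 shows "wave P q*kernel_density q =
  oscillation P q/of_real (4*pi^2*rweight (centre P) (fst q - snd q*poly (pderiv b) (centre P)) (snd q))"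
proof -
 obtain a t where q: "q = (a, t)" by force
 define x where "x = centre P"
 have "exp (of_real a*fst P + \<i> * of_real t * snd P) = of_real (exp (2*(a*x - t*poly b x))) * oscillation P q"
  unfolding exp_of_real[symmetric] oscillation_def exp_add[symmetric]
  by (rule arg_cong[where f=exp]) (simp add: complex_eq_iff q x_def centre_def height_def algebra_simps)
 then have "exp (of_real a*fst P + \<i> * of_real t * snd P)*kernel_density q
   = of_real (exp (2*(a*x - t*poly b x))*inv_weight b (a, t)) * oscillation P q/of_real (4*pi^2)"
  by (simp add: kernel_density_def q)
 also have "exp (2*(a*x - t*poly b x))*inv_weight b (a, t) = 1/rweight x (a - t*poly (pderiv b) x) t"
  using assms by (intro rweight_weight) (simp add: q)
 finally show ?thesis by (simp add: q x_def mult_ac)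
qed

text \<open>The step is so short that the exponent stays inside of the unit disc, which contains no nonzero period.\<close>

lemma exp_step_eq_1:
 fixes f :: complex
 assumes "exp (\<i> * of_real (1/(1 + norm f))*f) = 1" shows "f = 0"
proof -
 define w where "w = \<i> * of_real (1/(1 + norm f))*f"
 have "norm w = 1/(1 + norm f)*norm f" unfolding w_def norm_mult norm_of_real by (simp add: add_nonneg_nonneg)
 then have n: "norm w < 1" by (simp add: divide_less_eq add_pos_nonneg)
 obtain k where k: "Re w = 0" "Im w = of_int (2*k)*pi" using assms unfolding w_def[symmetric] exp_eq_1 by auto
 have "\<bar>of_int (2*k)*pi\<bar> < 1" using n abs_Im_le_cmod[of w] k by simp
 then have "k = 0"
 proof (rule_tac ccontr)
  assume a: "\<bar>of_int (2*k)*pi\<bar> < 1" and "k \<noteq> 0"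
  then have "1 <= \<bar>of_int k :: real\<bar>" by (simp flip: of_int_abs)
  then have "2*1*pi <= \<bar>of_int (2*k)*pi\<bar>" by (simp add: abs_mult)
  then show False using a pi_gt3 by linarith
 qed
 then have "w = 0" using k by (simp add: complex_eq_iff)
 moreover have "1 + complex_of_real (norm f) \<noteq> 0"
  by (metis add_pos_nonneg norm_ge_zero of_real_1 of_real_add of_real_eq_0_iff order_less_irrefl zero_less_one)
 ultimately show ?thesis by (simp add: w_def)
qed

text \<open>The kernel is split at \<open>\<tau> \<approx> T\<close>. The part with small \<open>\<tau>\<close> converges absolutely up to the boundary. For the other part, iterated differences of
 the amplitude in either direction give absolutely convergent integrals, which equal the part itself times a power
 of \<open>1 - exp (i h ph)\<close>, where \<open>h\<close> is the step and \<open>ph\<close> the phase. For a step that depends suitably and continuously on the phase, this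
 factor vanishes only where the phase does, and the two phases vanish simultaneously only at the excluded points.\<close>

lemma Lap_symbol_extends:
 "\<exists>g. continuous_on {P. \<bar>centre P\<bar> < B \<and> 0 <= height P \<and> \<not> (Im (fst P) = 0 \<and> Re (snd P) = 0 \<and> height P = 0)} g \<and>
  (\<forall>P. \<bar>centre P\<bar> < B \<longrightarrow> 0 < height P \<longrightarrow> g P = Lap (symbol_density l) P)"
proof -
 define S where "S = {P. \<bar>centre P\<bar> < B \<and> 0 <= height P \<and> \<not> (Im (fst P) = 0 \<and> Re (snd P) = 0 \<and> height P = 0)}"
 define Ps where "Ps q = symbol l (of_real (fst q)) (of_real (snd q))*kernel_density q" for q
 have LPs: "lap_on {(X, Y). 2*poly b (X/2) < Y} Ps" unfolding Ps_def by (rule lap_on_symbol)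
 have [measurable]: "Ps \<in> bm" by (rule lap_on_measurable[OF LPs])
 obtain T K C where T: "T > 0" and K: "K > 0" and C: "C >= 0" and
  bnd: "!!ka x h q. \<bar>x\<bar> <= B ==> 0 < h ==> h <= 1 ==>
   norm ((backward_difference (h *\<^sub>R direction x ka) ^^ K) (amplitude l T x) q) <= C*(cauchy q)" and
  zero: "!!ka x h q. 0 < h ==> snd q <= T ==> (backward_difference (h *\<^sub>R direction x ka) ^^ K) (amplitude l T x) q = 0"
  using amplitude_difference_bound[of B l] by blast
 have iW: "L1 (%q::real\<times>real. k*(cauchy q))" for k
  by (intro integrable_mult_right integrable_cauchy_product)
 have mc: "(%q::real\<times>real. of_real (1 - cutoff T (snd q)) :: complex) \<in> bm" "(%q::real\<times>real. of_real (cutoff T (snd q)) :: complex) \<in> bm"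
  unfolding cutoff_def by (intro borel_measurable_continuous_onI continuous_intros)+
 have cut: "norm (of_real (1 - cutoff T t)*w) <= norm w" "norm (of_real (cutoff T t)*w) <= norm w" for t and w :: complex
  unfolding norm_mult norm_of_real by (intro mult_left_le_one_le; simp add: cutoff_def)+
 have amp: "wave P q*Ps q =
   symbol l (of_real (fst q)) (of_real (snd q))/of_real (rweight (centre P) (fst q - snd q*poly (pderiv b) (centre P)) (snd q)) * oscillation P q/of_real (4*pi^2)"
  if "snd q > 0" for P q
  using arg_cong[OF kernel_integrand[OF that, of P], of "%w. symbol l (of_real (fst q)) (of_real (snd q))*w"] by (simp add: Ps_def mult_ac)
 define F0 where "F0 P q = of_real (1 - cutoff T (snd q))*(wave P q*Ps q)" for P q
 define G0 where "G0 P = (LI q. F0 P q)" for P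
 define h where "h ka P = 1/(1 + norm (phase ka P))" for ka P
 define F where "F ka P q = (backward_difference (h ka P *\<^sub>R direction (centre P) ka) ^^ K) (amplitude l T (centre P)) q * oscillation P q" for ka P q
 define G where "G ka P = (LI q. F ka P q)" for ka P
 define f where "f ka P = (1 - exp (\<i> * of_real (h ka P)*phase ka P))^K" for ka P
 have h: "0 < h ka P" "h ka P <= 1" for ka P by (auto simp: h_def add_pos_nonneg)
 have ch: "continuous_on UNIV (h ka)" for ka
  unfolding h_def by (intro continuous_intros continuous_on_phase) (metis add_pos_nonneg norm_ge_zero order_less_irrefl zero_less_one)
 have cG0: "continuous_on S G0"
  unfolding G0_def
 proof (rule continuous_on_integral_dominated)
  show "F0 P \<in> borel_measurable lborel" for P
   unfolding F0_def using mc(1) Lap_kernel_measurable[of "fst P" "snd P"] by simp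
  show "continuous_on S (%P. F0 P q)" for q unfolding F0_def by (intro continuous_intros)
  obtain D where D: "D >= 0" and
   freq: "!!x al \<tau>. \<bar>x\<bar> <= B ==> \<tau> > 0 ==> 1 + \<bar>al + \<tau>*poly (pderiv b) x\<bar> + \<tau> <= D*(bracket al \<tau>)*(1 + \<tau>)"
    "!!x al \<tau>. \<bar>x\<bar> <= B ==> \<tau> > 0 ==> \<bar>al + \<tau>*poly (pderiv b) x\<bar> + \<tau> + (\<bar>poly (pderiv b) x\<bar> + 1)*(1 + \<tau>) <= D*(bracket al \<tau>)*(1 + \<tau>)"
   using frequency_bound[of B] by blast
  obtain C0 where C0: "C0 >= 0" "!!x al \<tau> a' \<tau>'. \<bar>x\<bar> <= B ==> \<tau> > 0 ==> norm a' + norm \<tau>' <= D*(bracket al \<tau>)*(1 + \<tau>) ==>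
   norm (symbol l a' \<tau>')/rweight x al \<tau> <= C0 * sqrt (1 + \<tau>)^(2*length l + 1)/(bracket al \<tau>)^2"
   using amplitude_bound[OF D, of B l 2] by blast
  define s1 where "s1 = sqrt (T + 2)"
  define k where "k = C0 * s1^(2*length l + 1)*(D^2 * s1^8)/(4*pi^2)"
  have k: "k >= 0" using C0(1) T by (auto simp: k_def s1_def)
  have "norm (F0 P q) <= k*(cauchy q)" if P: "P \<in> S" for P q
  proof (cases "0 < snd q \<and> snd q < T + 1")
   case False
   then have "F0 P q = 0" by (auto simp: F0_def Ps_def kernel_density_def cutoff_def inv_weight_def)
   then show ?thesis using k by simp
  next
   case True
   obtain a \<tau> where q: "q = (a, \<tau>)" by force
   define x where "x = centre P"
   define al where "al = a - \<tau>*poly (pderiv b) x"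
   have \<tau>: "\<tau> > 0" "\<tau> < T + 1" using True q by auto
   have x: "\<bar>x\<bar> <= B" using P by (simp add: S_def x_def)
   have Db: "1 + \<bar>a\<bar> + \<tau> <= D*(bracket al \<tau>)*(1 + \<tau>)" using freq(1)[OF x \<tau>(1), of al] by (simp add: al_def)
   have rp: "rweight x al \<tau> > 0" by (rule rweight_pos[OF \<tau>(1)])
   have "norm (F0 P q) <= norm (exp (of_real a*fst P + \<i> * of_real \<tau> * snd P)*Ps q)"
    unfolding F0_def using cut(1)[of "snd q"] by (simp add: q)
   also have "... = norm (symbol l (of_real a) (of_real \<tau>))/rweight x al \<tau>*norm (oscillation P q)/(4*pi^2)"
    using amp[of q P] rp \<tau>(1) by (simp add: q al_def x_def norm_mult norm_divide norm_power)
   also have "... <= norm (symbol l (of_real a) (of_real \<tau>))/rweight x al \<tau>*1/(4*pi^2)"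
    using P \<tau>(1) rp by (intro divide_right_mono mult_left_mono) (auto simp: norm_oscillation q S_def)
   also have "... <= (C0 * s1^(2*length l + 1)*(1/(bracket al \<tau>)^2))/(4*pi^2)"
   proof (intro divide_right_mono)
    have "norm (symbol l (of_real a) (of_real \<tau>))/rweight x al \<tau> <= C0 * sqrt (1 + \<tau>)^(2*length l + 1)/(bracket al \<tau>)^2"
     using Db \<tau>(1) by (intro C0(2)[OF x \<tau>(1)]) simp
    also have "... <= C0 * s1^(2*length l + 1)/(bracket al \<tau>)^2"
     unfolding s1_def using C0(1) \<tau> by (intro divide_right_mono mult_left_mono power_mono real_sqrt_le_mono) auto
    finally show "norm (symbol l (of_real a) (of_real \<tau>))/rweight x al \<tau>*1 <= C0 * s1^(2*length l + 1)*(1/(bracket al \<tau>)^2)" by simp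
   qed simp
   also have "... <= (C0 * s1^(2*length l + 1)*(D^2 * s1^8*(1/(1 + a^2)*(1/(1 + \<tau>^2)))))/(4*pi^2)"
   proof (intro divide_right_mono mult_left_mono)
    have "1/(bracket al \<tau>)^2 <= D^2 * sqrt (1 + \<tau>)^8*(1/(1 + a^2)*(1/(1 + \<tau>^2)))"
     using Db \<tau>(1) by (intro cauchy_weight_bound) auto
    also have "... <= D^2 * s1^8*(1/(1 + a^2)*(1/(1 + \<tau>^2)))"
     unfolding s1_def using \<tau> by (intro mult_right_mono mult_left_mono power_mono real_sqrt_le_mono) auto
    finally show "1/(bracket al \<tau>)^2 <= D^2 * s1^8*(1/(1 + a^2)*(1/(1 + \<tau>^2)))" .
   qed (use C0(1) T in \<open>auto simp: s1_def\<close>)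
   also have "... = k*(cauchy q)" by (simp add: k_def q)
   finally show ?thesis .
  qed
  then show "\<exists>U g. open U \<and> P0 \<in> U \<and> L1 g \<and> (\<forall>P\<in>U \<inter> S. AE q in lborel. norm (F0 P q) <= g q)" if "P0 \<in> S" for P0
   by (intro exI[of _ UNIV] exI[of _ "%q::real\<times>real. k*(cauchy q)"] conjI iW) auto
 qed
 have cG: "continuous_on S (G ka)" for ka
  unfolding G_def
 proof (rule continuous_on_integral_dominated)
  have "continuous_on (UNIV \<times> UNIV) (%(P, q). (backward_difference (h ka P *\<^sub>R direction (centre P) ka) ^^ K) (amplitude l T (centre P)) q)"
  proof (rule continuous_on_backward_difference)
   have "continuous_on UNIV (%x::(complex\<times>complex)\<times>(real\<times>real). amplitude l T (centre (fst x)) (snd x))"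
    by (intro continuous_on_amplitude T continuous_intros)
   then show "continuous_on (UNIV \<times> UNIV) (%(P, q). amplitude l T (centre P) q)" by (simp add: case_prod_unfold)
   show "continuous_on UNIV (%P. h ka P *\<^sub>R direction (centre P) ka)"
    unfolding direction_def by (cases ka) (auto intro!: continuous_intros ch)
  qed
  then have "continuous_on UNIV (%x. (backward_difference (h ka (fst x) *\<^sub>R direction (centre (fst x)) ka) ^^ K) (amplitude l T (centre (fst x))) (snd x))"
   by (simp add: case_prod_unfold)
  then have cF: "continuous_on UNIV (%x. F ka (fst x) (snd x))"
   unfolding F_def by (intro continuous_on_mult continuous_intros)
  show "F ka P \<in> borel_measurable lborel" for P
  proof -
   have "continuous_on UNIV (%q. F ka (fst (P, q)) (snd (P, q)))"
    by (rule continuous_on_compose2[OF cF]) (intro continuous_intros, simp)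
   then show ?thesis by (simp add: borel_measurable_continuous_onI)
  qed
  show "continuous_on S (%P. F ka P q)" for q
  proof -
   have "continuous_on S (%P. F ka (fst (P, q)) (snd (P, q)))"
    by (rule continuous_on_compose2[OF cF]) (intro continuous_intros, simp)
   then show ?thesis by simp
  qed
  have "norm (F ka P q) <= C*(cauchy q)" if P: "P \<in> S" for P q
  proof (cases "snd q <= T")
   case True
   then show ?thesis using C by (simp add: F_def zero[OF h(1)])
  next
   case False
   have "norm (oscillation P q) <= 1" using False T P by (simp add: norm_oscillation S_def)
   moreover have "norm ((backward_difference (h ka P *\<^sub>R direction (centre P) ka) ^^ K) (amplitude l T (centre P)) q) <= C*(cauchy q)"
    using P by (intro bnd h) (auto simp: S_def)
   ultimately show ?thesis unfolding F_def norm_mult by (rule_tac order_trans[OF mult_left_mono]) auto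
  qed
  then show "\<exists>U g. open U \<and> P0 \<in> U \<and> L1 g \<and> (\<forall>P\<in>U \<inter> S. AE q in lborel. norm (F ka P q) <= g q)" if "P0 \<in> S" for P0
   by (intro exI[of _ UNIV] exI[of _ "%q::real\<times>real. C*(cauchy q)"] conjI iW) auto
 qed
 have cf: "continuous_on S (f ka)" for ka
  unfolding f_def by (intro continuous_intros continuous_on_subset[OF ch]) auto
 have nz: "(norm (f False P))^2 + (norm (f True P))^2 \<noteq> 0" if P: "P \<in> S" for P
 proof
  assume "(norm (f False P))^2 + (norm (f True P))^2 = 0"
  then have "f False P = 0" "f True P = 0" by (auto simp: add_nonneg_eq_0_iff)
  then have "phase False P = 0" "phase True P = 0" unfolding f_def h_def using K exp_step_eq_1 by auto
  then show False using P by (auto simp: phase_def direction_def S_def complex_eq_iff)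
 qed
 define g where "g P = G0 P + (cnj (f False P)*G False P + cnj (f True P)*G True P)/of_real (4*pi^2*((norm (f False P))^2 + (norm (f True P))^2))" for P
 have nz': "complex_of_real (4*pi^2*((norm (f False P))^2 + (norm (f True P))^2)) \<noteq> 0" if "P \<in> S" for P
  unfolding of_real_eq_0_iff using nz[OF that] by simp
 have "continuous_on S g"
  unfolding g_def by (intro continuous_intros ballI nz' cG0 cG cf)
 moreover have "g P = Lap Ps P" if P: "\<bar>centre P\<bar> < B" "0 < height P" for P
 proof -
  have PS: "P \<in> S" using P by (auto simp: S_def)
  have i: "L1 (%q. wave P q*Ps q)"
   using P by (intro Lap_integrable[OF LPs]) (simp add: height_def centre_def)
  have i0: "L1 (F0 P)"
   unfolding F0_def using mc Lap_kernel_measurable[of "fst P" "snd P"] by (intro integrable_bound[OF i] AE_I2 cut) auto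
  define H where "H q = of_real (cutoff T (snd q))*(wave P q*Ps q)" for q
  have iH: "L1 H"
   unfolding H_def using mc Lap_kernel_measurable[of "fst P" "snd P"] by (intro integrable_bound[OF i] AE_I2 cut) auto
  have HA: "amplitude l T (centre P) q * oscillation P q = of_real (4*pi^2)*H q" for q
  proof (cases "snd q <= T")
   case True
   then show ?thesis by (simp add: amplitude_zero H_def cutoff_def)
  next
   case False
   then show ?thesis using amp[of q P] T by (simp add: amplitude_def H_def max_def)
  qed
  have LH: "Lap Ps P = G0 P + (LI q. H q)"
  proof -
   have "Lap Ps P = (LI q. F0 P q + H q)"
    unfolding Lap_def by (intro LI_cong) (simp add: F0_def H_def algebra_simps)
   then show ?thesis using i0 iH by (simp add: G0_def)
  qed
  have mA: "amplitude l T (centre P) \<in> bm"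
   by (intro borel_measurable_continuous_onI continuous_on_amplitude[OF T] continuous_intros)
  have mo: "oscillation P \<in> bm"
   by (intro borel_measurable_continuous_onI continuous_intros)
  have iA: "L1 (%q. amplitude l T (centre P) q * oscillation P q)" unfolding HA using iH by simp
  have GJ: "G ka P = f ka P*(of_real (4*pi^2)*(LI q. H q))" for ka
   using integral_backward_difference[OF mA mo iA oscillation_shift[of P], of K "h ka P" ka]
   unfolding HA by (simp add: G_def F_def f_def)
  define N where "N = (norm (f False P))^2 + (norm (f True P))^2"
  have "cnj (f False P)*G False P + cnj (f True P)*G True P = of_real N*(of_real (4*pi^2)*(LI q. H q))"
   unfolding GJ N_def of_real_add complex_norm_square by (simp add: algebra_simps)
  moreover have "of_real (4*pi^2*N) \<noteq> (0::complex)" using nz[OF PS] by (simp only: N_def of_real_eq_0_iff) simp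
  ultimately show ?thesis unfolding g_def LH N_def[symmetric] by (simp add: field_simps)
 qed
 ultimately show ?thesis unfolding S_def Ps_def by blast
qed

definition kernel_arg :: "(complex \<times> complex) \<times> (complex \<times> complex) => complex \<times> complex" where
 "kernel_arg p = (fst (fst p) + cnj (fst (snd p)), snd (fst p) - cnj (snd (snd p)))"

lemma closure_tube_domain: "closure (tube_domain b) = {p. poly b (Re (fst p)) <= Im (snd p)}"
proof (intro equalityI subsetI)
 have "closed {p::complex\<times>complex. poly b (Re (fst p)) <= Im (snd p)}" by (intro closed_Collect_le continuous_intros)
 then have "closure (tube_domain b) \<subseteq> {p. poly b (Re (fst p)) <= Im (snd p)}" by (rule closure_minimal[rotated]) (auto simp: tube_domain_def)
 then show "p \<in> {p. poly b (Re (fst p)) <= Im (snd p)}" if "p \<in> closure (tube_domain b)" for p using that by blast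
next
 fix p :: "complex \<times> complex" assume p: "p \<in> {p. poly b (Re (fst p)) <= Im (snd p)}"
 define X where "X n = (fst p, snd p + \<i> * of_real (inverse (real (Suc n))))" for n
 have "X n \<in> tube_domain b" for n using p by (auto simp: tube_domain_def X_def intro: le_less_trans[OF _ less_add_same_cancel1[THEN iffD2]])
 moreover have "X ----> p"
 proof -
  have "X ----> (fst p, snd p + \<i> * of_real 0)" unfolding X_def by (intro tendsto_intros LIMSEQ_inverse_real_of_nat)
  then show ?thesis by simp
 qed
 ultimately show "p \<in> closure (tube_domain b)" unfolding closure_sequential by blast
qed

text \<open>Strict convexity puts a sum of two points of the closed base outside of the doubled boundary, unless they are the same boundary point.\<close>

lemma height_kernel_arg:
 assumes z: "poly b (Re (fst z)) <= Im (snd z)" and w: "poly b (Re (fst w)) <= Im (snd w)"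
 shows "0 <= height (kernel_arg (z, w))"
  and "height (kernel_arg (z, w)) = 0 ==> Re (fst z) = Re (fst w) \<and> Im (snd z) = Im (snd w) \<and> Im (snd z) = poly b (Re (fst z))"
  and "poly b (Re (fst z)) < Im (snd z) ==> 0 < height (kernel_arg (z, w))"
proof -
 define x where "x = (Re (fst z) + Re (fst w))/2"
 define u where "u = (Re (fst z) - Re (fst w))/2"
 have xu: "Re (fst z) = x + u" "Re (fst w) = x + (- u)" by (auto simp: x_def u_def field_simps)
 have c: "height (kernel_arg (z, w)) = (Im (snd z) - poly b (x + u)) + (Im (snd w) - poly b (x + (- u))) + excess b x u + excess b x (- u)"
  by (simp add: height_def kernel_arg_def centre_def x_def excess_def algebra_simps)
 show "0 <= height (kernel_arg (z, w))" unfolding c using z w excess_nonneg[of x u] excess_nonneg[of x "- u"] by (simp add: xu)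
 show "poly b (Re (fst z)) < Im (snd z) ==> 0 < height (kernel_arg (z, w))"
  unfolding c using w excess_nonneg[of x u] excess_nonneg[of x "- u"] by (simp add: xu)
 assume "height (kernel_arg (z, w)) = 0"
 then have e: "excess b x u = 0" "Im (snd z) = poly b (x + u)" "Im (snd w) = poly b (x + (- u))"
  using z w excess_nonneg[of x u] excess_nonneg[of x "- u"] unfolding c xu by linarith+
 obtain k where "k > 0" "!!x u. excess b x u >= k*\<bar>u\<bar>^degree b" using excess_lower_bound by blast
 then have "k*\<bar>u\<bar>^degree b <= 0" "0 < k" using e(1) by metis+
 then have "u = 0" by (smt (verit) mult_pos_pos zero_less_power abs_ge_zero)
 then show "Re (fst z) = Re (fst w) \<and> Im (snd z) = Im (snd w) \<and> Im (snd z) = poly b (Re (fst z))" using e by (simp add: xu)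
qed

text \<open>On the domain, a derivative of the kernel in the direction \<open>(z, w)\<close> inserts a linear factor into the Laplace transform.\<close>

lemma Lap_kernel_arg_has_derivative:
 assumes p: "p \<in> domain2"
  and f: "!!p. p \<in> domain2 ==> f p = Lap (symbol_density l) (kernel_arg p)"
 shows "(f has_derivative (%v. Lap (symbol_density (kernel_arg v # l)) (kernel_arg p))) (at p)"
proof -
 define P where "P q = symbol l (of_real (fst q)) (of_real (snd q))*kernel_density q" for q
 have L: "lap_on {(X, Y). 2*poly b (X/2) < Y} P" unfolding P_def by (rule lap_on_symbol)
 obtain z w where zw: "p = (z, w)" by (cases p)
 have "0 < height (kernel_arg (z, w))"
  using p zw by (intro height_kernel_arg(3)) (auto simp: tube_domain_def)
 then have pt: "tube_pt (kernel_arg p) \<in> {(X, Y). 2*poly b (X/2) < Y}" by (simp add: zw height_def centre_def)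
 have "bounded_linear kernel_arg"
  unfolding kernel_arg_def[abs_def]
  by (intro bounded_linear_Pair bounded_linear_add bounded_linear_sub bounded_linear_compose[OF bounded_linear_cnj]
   bounded_linear_fst_comp bounded_linear_snd_comp bounded_linear_fst bounded_linear_snd bounded_linear_ident)
 then have "(kernel_arg has_derivative kernel_arg) (at p)" by (rule bounded_linear_imp_has_derivative)
 from diff_chain_at[OF this Lap_has_derivative[OF L pt]]
 have "((%p. Lap P (kernel_arg p)) has_derivative (%v. Lap (%q. of_real (fst q)*P q) (kernel_arg p)*fst (kernel_arg v) +
   Lap (%q. \<i> * of_real (snd q)*P q) (kernel_arg p) * snd (kernel_arg v))) (at p)"
  by (simp add: comp_def case_prod_unfold)
 moreover have "Lap (%q. of_real (fst q)*P q) (kernel_arg p)*u + Lap (%q. \<i> * of_real (snd q)*P q) (kernel_arg p) * v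
  = Lap (symbol_density ((u, v) # l)) (kernel_arg p)" for u v
 proof -
  define A where "A q = wave (kernel_arg p) q*(of_real (fst q)*P q)" for q
  define B where "B q = wave (kernel_arg p) q*(\<i> * of_real (snd q)*P q)" for q
  have i: "L1 A" "L1 B"
   unfolding A_def B_def by (rule Lap_integrable[OF lap_on_fst[OF L] pt], rule Lap_integrable[OF lap_on_snd[OF L] pt])
  have "(LI q. A q)*u + (LI q. B q) * v = (LI q. A q*u + B q * v)" using i by simp
  also have "... = Lap (symbol_density ((u, v) # l)) (kernel_arg p)"
   unfolding Lap_def by (intro LI_cong) (simp add: A_def B_def P_def algebra_simps)
  finally show ?thesis by (simp add: Lap_def A_def B_def)
 qed
 ultimately have d: "((%p. Lap P (kernel_arg p)) has_derivative
   (%v. Lap (symbol_density (kernel_arg v # l)) (kernel_arg p))) (at p)"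
  by (simp only: prod.collapse)
 show ?thesis
  by (rule has_derivative_transform_within_open[OF d open_Times[OF open_tube_domain open_tube_domain] p]) (simp add: f P_def[abs_def])
qed

lemma iterated_derivative_kernel:
 "\<exists>l. \<forall>p\<in>domain2.
   kernel_derivative vs p = Lap (symbol_density l) (kernel_arg p)"
proof (induction vs)
 case Nil
 show ?case by (intro exI[of _ "[]"]) (auto simp: szego_kernel_formula kernel_arg_def)
next
 case (Cons v vs)
 then obtain l where l: "!!p. p \<in> domain2 ==>
  kernel_derivative vs p = Lap (symbol_density l) (kernel_arg p)"
  by blast
 show ?case
 proof (intro exI[of _ "kernel_arg v # l"] ballI)
  fix p assume p: "p \<in> domain2"
  have "frechet_derivative (kernel_derivative vs) (at p)
   = (%v. Lap (symbol_density (kernel_arg v # l)) (kernel_arg p))"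
   by (rule frechet_derivative_at[OF Lap_kernel_arg_has_derivative[OF p l], symmetric])
  then show "kernel_derivative (v # vs) p
   = Lap (symbol_density (kernel_arg v # l)) (kernel_arg p)"
   by (simp only: iterated_derivative.simps)
 qed
qed

text \<open>All derivatives of the kernel are Laplace transforms of the same type, composed with a linear map. Off the diagonal this map
 avoids the exceptional set of the extension.\<close>

theorem extends_if_convex:
 "extends_smoothly domain2
   closure2 (%(z, w). szego_kernel b z w)"
 unfolding extends_smoothly_def smooth_on_def
proof (intro conjI allI impI ballI)
 fix vs p assume "p \<in> domain2"
 moreover obtain l where "!!p. p \<in> domain2 ==>
   kernel_derivative vs p = Lap (symbol_density l) (kernel_arg p)"
  using iterated_derivative_kernel[of vs] by blast
 ultimately show "kernel_derivative vs differentiable at p"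
  by (intro differentiableI[OF Lap_kernel_arg_has_derivative])
next
 fix vs
 obtain l where l: "!!p. p \<in> domain2 ==>
   kernel_derivative vs p = Lap (symbol_density l) (kernel_arg p)"
  using iterated_derivative_kernel[of vs] by blast
 show "\<exists>g. continuous_on closure2 g \<and>
   (\<forall>x\<in>domain2. g x = kernel_derivative vs x)"
 proof (rule continuous_extension_local)
  show "closure2 \<subseteq> closure domain2"
   by (auto simp: closure_Times)
  have "frontier (tube_domain b) \<inter> tube_domain b = {}" using open_tube_domain by (auto simp: frontier_def interior_open)
  then show "domain2 \<subseteq> closure2"
   using closure_subset[of "tube_domain b"] by (auto simp: boundary_diagonal_def)
  fix p assume p: "p \<in> closure2"
  define B where "B = \<bar>centre (kernel_arg p)\<bar> + 1"
  have ca: "continuous_on S kernel_arg" for S unfolding kernel_arg_def by (intro continuous_intros)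
  define V where "V = {p. \<bar>centre (kernel_arg p)\<bar> < B}"
  have "open V" unfolding V_def
   by (intro open_Collect_less continuous_intros ca)
  obtain g where g: "continuous_on {P. \<bar>centre P\<bar> < B \<and> 0 <= height P \<and> \<not> (Im (fst P) = 0 \<and> Re (snd P) = 0 \<and> height P = 0)} g"
   "!!P. \<bar>centre P\<bar> < B ==> 0 < height P ==> g P = Lap (symbol_density l) P"
   using Lap_symbol_extends[of B l] by blast
  show "\<exists>V g. open V \<and> p \<in> V \<and> continuous_on (closure2 \<inter> V) g \<and>
   (\<forall>x\<in>domain2 \<inter> V. g x = kernel_derivative vs x)"
  proof (intro exI[of _ V] exI[of _ "%p. g (kernel_arg p)"] conjI ballI)
   show "open V" by fact
   show "p \<in> V" by (simp add: V_def B_def)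
   show "continuous_on (closure2 \<inter> V) (%p. g (kernel_arg p))"
   proof (rule continuous_on_compose2[OF g(1) ca], rule image_subsetI)
    fix q assume q: "q \<in> closure2 \<inter> V"
    obtain z w where zw: "q = (z, w)" by (cases q)
    have c: "poly b (Re (fst z)) <= Im (snd z)" "poly b (Re (fst w)) <= Im (snd w)"
     using q by (auto simp: zw closure_tube_domain)
    have "\<not> (Im (fst (kernel_arg q)) = 0 \<and> Re (snd (kernel_arg q)) = 0 \<and> height (kernel_arg q) = 0)"
    proof
     assume a: "Im (fst (kernel_arg q)) = 0 \<and> Re (snd (kernel_arg q)) = 0 \<and> height (kernel_arg q) = 0"
     then have h: "Re (fst z) = Re (fst w)" "Im (snd z) = Im (snd w)" "Im (snd z) = poly b (Re (fst z))"
      using height_kernel_arg(2)[OF c] by (auto simp: zw)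
     then have "z = w" using a by (auto simp: zw kernel_arg_def complex_eq_iff prod_eq_iff)
     moreover have "z \<in> frontier (tube_domain b)"
      using c h open_tube_domain by (simp add: frontier_def interior_open closure_tube_domain) (auto simp: tube_domain_def)
     ultimately have "q \<in> boundary_diagonal b" by (simp add: boundary_diagonal_def zw)
     then show False using q by blast
    qed
    then show "kernel_arg q \<in> {P. \<bar>centre P\<bar> < B \<and> 0 <= height P \<and> \<not> (Im (fst P) = 0 \<and> Re (snd P) = 0 \<and> height P = 0)}"
     using q height_kernel_arg(1)[OF c] by (auto simp: zw V_def)
   qed
   fix q assume q: "q \<in> domain2 \<inter> V"
   obtain z w where zw: "q = (z, w)" by (cases q)
   have "0 < height (kernel_arg (z, w))"
    using q zw by (intro height_kernel_arg(3)) (auto simp: tube_domain_def)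
   then show "g (kernel_arg q) = kernel_derivative vs q"
    using q l[of q] g(2)[of "kernel_arg q"] by (simp add: zw V_def)
  qed
 qed
qed

end

theorem corollary2p6:
  fixes b :: "real poly"
  assumes "even (degree b)" and "0 < degree b" and "0 < lead_coeff b"
  shows "extends_smoothly
           (tube_domain b \<times> tube_domain b)
           (closure (tube_domain b) \<times> closure (tube_domain b) - boundary_diagonal b)
           (\<lambda>(z, w). szego_kernel b z w)
         \<longleftrightarrow> convex_on UNIV (poly b)"
proof -
  interpret szego_poly b using assms by unfold_locales
  show ?thesis
  proof
    assume "convex_on UNIV (poly b)"
    then interpret convex_szego_poly b by unfold_locales
    show "extends_smoothly (tube_domain b \<times> tube_domain b)
        (closure (tube_domain b) \<times> closure (tube_domain b) - boundary_diagonal b) (\<lambda>(z, w). szego_kernel b z w)"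
      by (rule extends_if_convex)
  qed (rule convex_if_extends)
qed

end
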